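(* Let $\sigma>0$, $\lambda>0$, $r\in[1,\infty)$ and $\alpha:=(r-1)/r\in[0,1)$, and assume the density is bounded below by a positive constant $\rho_0$. Then the following three formulations are equivalent (all functions being $\lambda$-periodic in the horizontal variable): (i) the velocity formulation (V) for $u-c,\,v,\,P\in W^1_r(\Omega_\eta)\cap C^\alpha(\overline{\Omega}_\eta)$, $\eta\in W^2_r(\mathbb{R})$ and $\rho\in W^1_r(\Omega_\eta)\cap C^\alpha(\overline{\Omega}_\eta)$; (ii) the stream function formulation (S) for $\psi\in W^2_r(\Omega_\eta)\cap C^{1+\alpha}(\overline{\Omega}_\eta)$, $\eta\in W^2_r(\mathbb{R})$, $\overline\rho\in W^1_r((p_0,0))$ and $\beta\in L_r((p_0,0))$; (iii) the height function formulation (D) for $h\in W^2_r(\Omega)\cap C^{1+\alpha}(\overline\Omega)$ with $\mathrm{tr}_0 h\in W^2_r(\mathbb{R})$, $\overline\rho\in W^1_r((p_0,0))$ and $\beta\in L_r((p_0,0))$. That is, each solution of (V) in the class (i) determines, through the correspondence (V)$\to$(S), a constant $p_0<0$ and a solution of (S) in the class (ii); each solution of (S) in the class (ii) determines, through the correspondence (S)$\to$(D), a solution of (D) in the class (iii); and each solution of (D) in the class (iii) arises through these correspondences from a solution of (V) in the class (i).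
   Context: Constants: $g>0$, $d>0$ are fixed; $\rho_0>0$; $p_0<0$. For $\eta:\mathbb{R}\to(-d,\infty)$ set $\Omega_\eta:=\{(x,y): x\in\mathbb{R},\ -d<y<\eta(x)\}$, and $\Omega:=\mathbb{R}\times(p_0,0)$. All function spaces consist of functions that are $\lambda$-periodic in $x$ (respectively $q$), with integrability understood over one period; equations hold in $L_r$, i.e. almost everywhere. $C^0$ and $C^1$ are meant when $\alpha=0$. $\mathrm{tr}_0h(q):=h(q,0)$. (V) Velocity formulation, unknowns $(u-c,v,P,\rho,\eta)$: $$\rho(u-c)u_x+\rho v u_y=-P_x,\quad \rho(u-c)v_x+\rho v v_y=-P_y-g\rho,\quad (u-c)\rho_x+v\rho_y=0,\quad u_x+v_y=0\quad\text{in }\Omega_\eta,$$ $$P=-\frac{\sigma\eta''}{(1+\eta'^2)^{3/2}},\quad v=(u-c)\eta'\quad\text{on } y=\eta(x);\qquad v=0\ \text{on } y=-d;\qquad \int_0^\lambda\eta\,dx=0,$$ together with $\sup_{\Omega_\eta}(u-c)<0$; density bound: $\rho\ge\rho_0$. (S) Stream function formulation, unknowns $(\psi,\eta)$, with data $p_0,\overline\rho,\beta$: $$\Delta\psi=gy\,\overline\rho'(-\psi)+\beta(-\psi)\ \text{in }\Omega_\eta,\quad \psi=0\ \text{on }y=\eta(x),\quad \psi=-p_0\ \text{on }y=-d,$$ $$|\nabla\psi|^2-\frac{2\sigma\eta''}{(1+\eta'^2)^{3/2}}+2g\overline\rho(0)y=Q\ \text{on }y=\eta(x),\qquad Q=\frac1\lambda\int_0^\lambda|\nabla\psi|^2(x,\eta(x))\,dx,$$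 together with $\sup_{\Omega_\eta}\psi_y<0$; density bound: $\overline\rho\ge\rho_0$. (D) Height function formulation, unknown $h$, with data $p_0,\overline\rho,\beta$: $$(1+h_q^2)h_{pp}-2h_qh_ph_{pq}+h_p^2h_{qq}-[g\overline\rho'(h-d)+\beta]h_p^3=0\ \text{in }\Omega,\qquad h=0\ \text{on }p=p_0,$$ $$1+h_q^2+h_p^2\Big[2g\overline\rho(0)(h-d)-\frac{2\sigma h_{qq}}{(1+h_q^2)^{3/2}}-\frac1\lambda\int_0^\lambda\frac{1+h_q^2}{h_p^2}(q,0)\,dq\Big]=0\ \text{on }p=0,$$ together with $\inf_\Omega h_p>0$; density bound: $\overline\rho\ge\rho_0$. Correspondences. (V)$\to$(S): $\psi$ is determined by $\nabla\psi=(-\sqrt\rho\,v,\sqrt\rho\,(u-c))$ in $\Omega_\eta$ and $\psi=0$ on $y=\eta(x)$; $p_0:=-\psi|_{y=-d}$ (a negative constant); $\mathcal H(x,y):=(q,p):=(x,-\psi(x,y))$ is a bijection $\overline\Omega_\eta\to\overline\Omega$; with $E:=P+\rho\frac{(u-c)^2+v^2}{2}+g\rho y$, the functions $\overline\rho,\beta$ of $p$ alone are determined by $\rho\circ\mathcal H^{-1}=\overline\rho$ and $-\partial_p(E\circ\mathcal H^{-1})=\beta$. (S)$\to$(D): $h(q,p):=y+d$, where $(x,y)=\mathcal H^{-1}(q,p)$ and $\mathcal H(x,y)=(x,-\psi(x,y))$. *)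

theory Defs
  imports "HOL-Analysis.Analysis"
begin


definition pd :: "'a::euclidean_space \<Rightarrow> ('a \<Rightarrow> real) \<Rightarrow> 'a \<Rightarrow> real" where
  "pd b f z = frechet_derivative f (at z) b"

primrec iter_pd :: "'a::euclidean_space list \<Rightarrow> ('a \<Rightarrow> real) \<Rightarrow> 'a \<Rightarrow> real" where
  "iter_pd [] f = f"
| "iter_pd (b # bs) f = pd b (iter_pd bs f)"

definition smooth :: "('a::euclidean_space \<Rightarrow> real) \<Rightarrow> bool" where
  "smooth f \<longleftrightarrow> (\<forall>bs. set bs \<subseteq> Basis \<longrightarrow> (\<forall>z. iter_pd bs f differentiable (at z)))"

definition test_functions :: "'a::euclidean_space set \<Rightarrow> ('a \<Rightarrow> real) set" where
  "test_functions S =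
     {\<phi>. smooth \<phi> \<and> compact (closure {z. \<phi> z \<noteq> 0}) \<and> closure {z. \<phi> z \<noteq> 0} \<subseteq> S}"

definition locally_integrable :: "'a::euclidean_space set \<Rightarrow> ('a \<Rightarrow> real) \<Rightarrow> bool" where
  "locally_integrable S f \<longleftrightarrow> (\<forall>K. compact K \<and> K \<subseteq> S \<longrightarrow> set_integrable lebesgue K f)"

definition has_weak_deriv ::
  "'a::euclidean_space set \<Rightarrow> 'a \<Rightarrow> ('a \<Rightarrow> real) \<Rightarrow> ('a \<Rightarrow> real) \<Rightarrow> bool" where
  "has_weak_deriv S b f f' \<longleftrightarrow>
     locally_integrable S f \<and> locally_integrable S f' \<and>
     (\<forall>\<phi>\<in>test_functions S.
        (LINT z:S|lebesgue. f z * pd b \<phi> z) = - (LINT z:S|lebesgue. f' z * \<phi> z))"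

text \<open>
  On open sets the weak derivative is unique up to null sets. \<open>wd\<close> picks one representative,
  so it is only meaningful in statements that hold almost everywhere.
\<close>

definition wd :: "'a::euclidean_space set \<Rightarrow> 'a \<Rightarrow> ('a \<Rightarrow> real) \<Rightarrow> 'a \<Rightarrow> real" where
  "wd S b f = (SOME f'. has_weak_deriv S b f f')"

definition Lr :: "real \<Rightarrow> 'a::euclidean_space set \<Rightarrow> ('a \<Rightarrow> real) \<Rightarrow> bool" where
  "Lr r C f \<longleftrightarrow> f \<in> borel_measurable (lebesgue_on C) \<and>
                 integrable (lebesgue_on C) (\<lambda>z. \<bar>f z\<bar> powr r)"

text \<open>
  \<open>sobolev k r S C f\<close>: the weak derivatives of \<open>f\<close> up to order \<open>k\<close> exist on the open set \<open>S\<close>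
  and are \<open>r\<close>-integrable over \<open>C \<subseteq> S\<close>. For the usual space \<open>W\<^sup>k\<^sub>r(S)\<close> take \<open>C = S\<close>; for functions
  that are periodic in the first variable, \<open>C\<close> is one period cell of \<open>S\<close>.
\<close>

primrec sobolev ::
  "nat \<Rightarrow> real \<Rightarrow> 'a::euclidean_space set \<Rightarrow> 'a set \<Rightarrow> ('a \<Rightarrow> real) \<Rightarrow> bool" where
  "sobolev 0 r S C f \<longleftrightarrow> locally_integrable S f \<and> Lr r C f"
| "sobolev (Suc k) r S C f \<longleftrightarrow> locally_integrable S f \<and> Lr r C f \<and>
     (\<forall>b\<in>Basis. \<exists>f'. has_weak_deriv S b f f' \<and> sobolev k r S C f')"

text \<open>
  The spaces \<open>C\<^sup>\<alpha>\<close> and \<open>C\<^sup>1\<^sup>+\<^sup>\<alpha>\<close> on the closure of the open set \<open>S\<close>. For \<open>\<alpha> = 0\<close> the Hoelder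
  condition only says that \<open>f\<close> is bounded, so \<open>holder 0\<close> and \<open>holder1 0\<close> are the spaces of
  (bounded) \<open>C\<^sup>0\<close> and \<open>C\<^sup>1\<close> functions.
\<close>

definition holder :: "real \<Rightarrow> 'a::euclidean_space set \<Rightarrow> ('a \<Rightarrow> real) \<Rightarrow> bool" where
  "holder \<alpha> S f \<longleftrightarrow> continuous_on (closure S) f \<and> bounded (f ` closure S) \<and>
     (\<exists>K. \<forall>z\<in>closure S. \<forall>w\<in>closure S. \<bar>f z - f w\<bar> \<le> K * dist z w powr \<alpha>)"

definition holder1 :: "real \<Rightarrow> 'a::euclidean_space set \<Rightarrow> ('a \<Rightarrow> real) \<Rightarrow> bool" where
  "holder1 \<alpha> S f \<longleftrightarrow> continuous_on (closure S) f \<and> bounded (f ` closure S) \<and>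
     (\<forall>z\<in>S. f differentiable (at z)) \<and>
     (\<forall>b\<in>Basis. \<exists>f'. holder \<alpha> S f' \<and> (\<forall>z\<in>S. f' z = pd b f z))"

text \<open>The continuous extension to the closure of \<open>S\<close> of a partial derivative taken inside \<open>S\<close>.\<close>

definition pd_cl :: "'a::euclidean_space set \<Rightarrow> 'a \<Rightarrow> ('a \<Rightarrow> real) \<Rightarrow> 'a \<Rightarrow> real" where
  "pd_cl S b f z = Lim (at z within S) (pd b f)"

abbreviation ex :: "real \<times> real" where "ex \<equiv> (1, 0)"
abbreviation ey :: "real \<times> real" where "ey \<equiv> (0, 1)"

definition periodic_on :: "real \<Rightarrow> (real \<times> real) set \<Rightarrow> (real \<times> real \<Rightarrow> real) \<Rightarrow> bool" where
  "periodic_on l S f \<longleftrightarrow> (\<forall>(x, y)\<in>S. f (x + l, y) = f (x, y))"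

definition cell :: "real \<Rightarrow> (real \<times> real) set \<Rightarrow> (real \<times> real) set" where
  "cell l S = {z \<in> S. 0 < fst z \<and> fst z < l}"

definition per_W1_holder ::
  "real \<Rightarrow> real \<Rightarrow> real \<Rightarrow> (real \<times> real) set \<Rightarrow> (real \<times> real \<Rightarrow> real) \<Rightarrow> bool" where
  "per_W1_holder l r \<alpha> S f \<longleftrightarrow>
     periodic_on l (closure S) f \<and> sobolev 1 r S (cell l S) f \<and> holder \<alpha> S f"

definition per_W2_holder1 ::
  "real \<Rightarrow> real \<Rightarrow> real \<Rightarrow> (real \<times> real) set \<Rightarrow> (real \<times> real \<Rightarrow> real) \<Rightarrow> bool" where
  "per_W2_holder1 l r \<alpha> S f \<longleftrightarrow>
     periodic_on l (closure S) f \<and> sobolev 2 r S (cell l S) f \<and> holder1 \<alpha> S f"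

text \<open>
  Elements of \<open>W\<^sup>2\<^sub>r(\<real>)\<close> have a \<open>C\<^sup>1\<close> representative and those of \<open>W\<^sup>1\<^sub>r((p0, 0))\<close> one that is
  continuous on \<open>{p0..0}\<close>. Continuity is required below in order to work with these
  representatives, whose point values (\<open>\<eta>\<close>, \<open>\<eta>'\<close>, \<open>R 0\<close>) enter the equations.
\<close>

definition per_W2 :: "real \<Rightarrow> real \<Rightarrow> (real \<Rightarrow> real) \<Rightarrow> bool" where
  "per_W2 l r f \<longleftrightarrow> (\<forall>x. f (x + l) = f x) \<and> continuous_on UNIV f \<and> sobolev 2 r UNIV {0<..<l} f"

abbreviation deriv2 :: "(real \<Rightarrow> real) \<Rightarrow> real \<Rightarrow> real" where
  "deriv2 f \<equiv> wd UNIV 1 (deriv f)"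

definition data_class :: "real \<Rightarrow> real \<Rightarrow> (real \<Rightarrow> real) \<Rightarrow> (real \<Rightarrow> real) \<Rightarrow> bool" where
  "data_class r p0 R \<beta> \<longleftrightarrow>
     continuous_on {p0..0} R \<and> sobolev 1 r {p0<..<0} {p0<..<0} R \<and> Lr r {p0<..<0} \<beta>"



definition fluid :: "real \<Rightarrow> (real \<Rightarrow> real) \<Rightarrow> (real \<times> real) set" where
  "fluid d \<eta> = {(x, y). - d < y \<and> y < \<eta> x}"

definition strip :: "real \<Rightarrow> (real \<times> real) set" where
  "strip p0 = UNIV \<times> {p0<..<0}"

text \<open>\<open>U\<close> stands for \<open>u - c\<close>, \<open>\<rho>\<close> for the density, \<open>\<rho>0\<close> for its lower bound.\<close>

definition velocity_class ::
  "real \<Rightarrow> real \<Rightarrow> real \<Rightarrow> real \<Rightarrow> (real \<times> real \<Rightarrow> real) \<Rightarrow> (real \<times> real \<Rightarrow> real) \<Rightarrow>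
   (real \<times> real \<Rightarrow> real) \<Rightarrow> (real \<times> real \<Rightarrow> real) \<Rightarrow> (real \<Rightarrow> real) \<Rightarrow> bool" where
  "velocity_class d l r \<alpha> U v P \<rho> \<eta> \<longleftrightarrow>
     per_W2 l r \<eta> \<and> (\<forall>x. - d < \<eta> x) \<and>
     per_W1_holder l r \<alpha> (fluid d \<eta>) U \<and> per_W1_holder l r \<alpha> (fluid d \<eta>) v \<and>
     per_W1_holder l r \<alpha> (fluid d \<eta>) P \<and> per_W1_holder l r \<alpha> (fluid d \<eta>) \<rho>"

definition velocity_problem ::
  "real \<Rightarrow> real \<Rightarrow> real \<Rightarrow> real \<Rightarrow> real \<Rightarrow> (real \<times> real \<Rightarrow> real) \<Rightarrow> (real \<times> real \<Rightarrow> real) \<Rightarrow>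
   (real \<times> real \<Rightarrow> real) \<Rightarrow> (real \<times> real \<Rightarrow> real) \<Rightarrow> (real \<Rightarrow> real) \<Rightarrow> bool" where
  "velocity_problem g d \<sigma> \<rho>0 l U v P \<rho> \<eta> \<longleftrightarrow>
     (let S = fluid d \<eta> in
      (AE z in lebesgue_on S.
         \<rho> z * U z * wd S ex U z + \<rho> z * v z * wd S ey U z = - wd S ex P z \<and>
         \<rho> z * U z * wd S ex v z + \<rho> z * v z * wd S ey v z = - wd S ey P z - g * \<rho> z \<and>
         U z * wd S ex \<rho> z + v z * wd S ey \<rho> z = 0 \<and>
         wd S ex U z + wd S ey v z = 0) \<and>
      (AE x in lebesgue.
         P (x, \<eta> x) = - (\<sigma> * deriv2 \<eta> x / (1 + (deriv \<eta> x)\<^sup>2) powr (3/2))) \<and>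
      (\<forall>x. v (x, \<eta> x) = U (x, \<eta> x) * deriv \<eta> x) \<and>
      (\<forall>x. v (x, - d) = 0) \<and>
      integral {0..l} \<eta> = 0 \<and>
      (SUP z\<in>S. U z) < 0 \<and>
      (\<forall>z\<in>closure S. \<rho>0 \<le> \<rho> z))"

text \<open>In the following, \<open>R\<close> is the density as a function of \<open>p\<close> and \<open>\<beta>\<close> the Bernoulli function.\<close>

definition stream_class ::
  "real \<Rightarrow> real \<Rightarrow> real \<Rightarrow> real \<Rightarrow> real \<Rightarrow> (real \<Rightarrow> real) \<Rightarrow> (real \<Rightarrow> real) \<Rightarrow>
   (real \<times> real \<Rightarrow> real) \<Rightarrow> (real \<Rightarrow> real) \<Rightarrow> bool" where
  "stream_class d l r \<alpha> p0 R \<beta> \<psi> \<eta> \<longleftrightarrow>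
     per_W2 l r \<eta> \<and> (\<forall>x. - d < \<eta> x) \<and> per_W2_holder1 l r \<alpha> (fluid d \<eta>) \<psi> \<and> data_class r p0 R \<beta>"

definition surface_grad_sq ::
  "real \<Rightarrow> (real \<times> real \<Rightarrow> real) \<Rightarrow> (real \<Rightarrow> real) \<Rightarrow> real \<Rightarrow> real" where
  "surface_grad_sq d \<psi> \<eta> x =
     (pd_cl (fluid d \<eta>) ex \<psi> (x, \<eta> x))\<^sup>2 + (pd_cl (fluid d \<eta>) ey \<psi> (x, \<eta> x))\<^sup>2"

definition stream_problem ::
  "real \<Rightarrow> real \<Rightarrow> real \<Rightarrow> real \<Rightarrow> real \<Rightarrow> real \<Rightarrow> (real \<Rightarrow> real) \<Rightarrow> (real \<Rightarrow> real) \<Rightarrow>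
   (real \<times> real \<Rightarrow> real) \<Rightarrow> (real \<Rightarrow> real) \<Rightarrow> bool" where
  "stream_problem g d \<sigma> \<rho>0 l p0 R \<beta> \<psi> \<eta> \<longleftrightarrow>
     (let S = fluid d \<eta>; R' = wd {p0<..<0} 1 R;
          Q = (1 / l) * integral {0..l} (surface_grad_sq d \<psi> \<eta>) in
      (AE z in lebesgue_on S.
         wd S ex (pd ex \<psi>) z + wd S ey (pd ey \<psi>) z = g * snd z * R' (- \<psi> z) + \<beta> (- \<psi> z)) \<and>
      (\<forall>x. \<psi> (x, \<eta> x) = 0) \<and>
      (\<forall>x. \<psi> (x, - d) = - p0) \<and>
      (AE x in lebesgue.
         surface_grad_sq d \<psi> \<eta> x - 2 * \<sigma> * deriv2 \<eta> x / (1 + (deriv \<eta> x)\<^sup>2) powr (3/2)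
           + 2 * g * R 0 * \<eta> x = Q) \<and>
      (SUP z\<in>S. pd ey \<psi> z) < 0 \<and>
      (\<forall>p\<in>{p0..0}. \<rho>0 \<le> R p))"

definition height_class ::
  "real \<Rightarrow> real \<Rightarrow> real \<Rightarrow> real \<Rightarrow> (real \<Rightarrow> real) \<Rightarrow> (real \<Rightarrow> real) \<Rightarrow> (real \<times> real \<Rightarrow> real) \<Rightarrow> bool"
  where
  "height_class l r \<alpha> p0 R \<beta> h \<longleftrightarrow>
     per_W2_holder1 l r \<alpha> (strip p0) h \<and> per_W2 l r (\<lambda>q. h (q, 0)) \<and> data_class r p0 R \<beta>"

definition height_problem ::
  "real \<Rightarrow> real \<Rightarrow> real \<Rightarrow> real \<Rightarrow> real \<Rightarrow> real \<Rightarrow> (real \<Rightarrow> real) \<Rightarrow> (real \<Rightarrow> real) \<Rightarrow>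
   (real \<times> real \<Rightarrow> real) \<Rightarrow> bool" where
  "height_problem g d \<sigma> \<rho>0 l p0 R \<beta> h \<longleftrightarrow>
     (let S = strip p0; R' = wd {p0<..<0} 1 R; hq = pd ex h; hp = pd ey h;
          hq0 = (\<lambda>q. pd_cl S ex h (q, 0)); hp0 = (\<lambda>q. pd_cl S ey h (q, 0)) in
      (AE z in lebesgue_on S.
         (1 + (hq z)\<^sup>2) * wd S ey hp z - 2 * hq z * hp z * wd S ey hq z
           + (hp z)\<^sup>2 * wd S ex hq z - (g * R' (snd z) * (h z - d) + \<beta> (snd z)) * (hp z)^3 = 0) \<and>
      (\<forall>q. h (q, p0) = 0) \<and>
      (AE q in lebesgue.
         1 + (hq0 q)\<^sup>2 + (hp0 q)\<^sup>2 *
           (2 * g * R 0 * (h (q, 0) - d)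
            - 2 * \<sigma> * deriv2 (\<lambda>q. h (q, 0)) q / (1 + (hq0 q)\<^sup>2) powr (3/2)
            - (1 / l) * integral {0..l} (\<lambda>q. (1 + (hq0 q)\<^sup>2) / (hp0 q)\<^sup>2)) = 0) \<and>
      0 < (INF z\<in>S. hp z) \<and>
      (\<forall>p\<in>{p0..0}. \<rho>0 \<le> R p))"



definition hodograph :: "(real \<times> real \<Rightarrow> real) \<Rightarrow> real \<times> real \<Rightarrow> real \<times> real" where
  "hodograph \<psi> z = (fst z, - \<psi> z)"

abbreviation inv_hodograph ::
  "real \<Rightarrow> (real \<Rightarrow> real) \<Rightarrow> (real \<times> real \<Rightarrow> real) \<Rightarrow> real \<times> real \<Rightarrow> real \<times> real" where
  "inv_hodograph d \<eta> \<psi> \<equiv> inv_into (closure (fluid d \<eta>)) (hodograph \<psi>)"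

definition energy ::
  "real \<Rightarrow> (real \<times> real \<Rightarrow> real) \<Rightarrow> (real \<times> real \<Rightarrow> real) \<Rightarrow> (real \<times> real \<Rightarrow> real) \<Rightarrow>
   (real \<times> real \<Rightarrow> real) \<Rightarrow> real \<times> real \<Rightarrow> real" where
  "energy g U v P \<rho> z = P z + \<rho> z * (((U z)\<^sup>2 + (v z)\<^sup>2) / 2) + g * \<rho> z * snd z"

definition velocity_to_stream ::
  "real \<Rightarrow> real \<Rightarrow> (real \<times> real \<Rightarrow> real) \<Rightarrow> (real \<times> real \<Rightarrow> real) \<Rightarrow> (real \<times> real \<Rightarrow> real) \<Rightarrow>
   (real \<times> real \<Rightarrow> real) \<Rightarrow> (real \<Rightarrow> real) \<Rightarrow>
   real \<Rightarrow> (real \<Rightarrow> real) \<Rightarrow> (real \<Rightarrow> real) \<Rightarrow> (real \<times> real \<Rightarrow> real) \<Rightarrow> bool" where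
  "velocity_to_stream g d U v P \<rho> \<eta> p0 R \<beta> \<psi> \<longleftrightarrow>
     continuous_on (closure (fluid d \<eta>)) \<psi> \<and>
     (\<forall>z\<in>fluid d \<eta>.
        (\<psi> has_derivative (\<lambda>(a, b). - sqrt (\<rho> z) * v z * a + sqrt (\<rho> z) * U z * b)) (at z)) \<and>
     (\<forall>x. \<psi> (x, \<eta> x) = 0) \<and>
     (\<forall>x. p0 = - \<psi> (x, - d)) \<and>
     bij_betw (hodograph \<psi>) (closure (fluid d \<eta>)) (closure (strip p0)) \<and>
     (\<forall>(q, p)\<in>closure (strip p0). (\<rho> \<circ> inv_hodograph d \<eta> \<psi>) (q, p) = R p) \<and>
     has_weak_deriv (strip p0) ey (energy g U v P \<rho> \<circ> inv_hodograph d \<eta> \<psi>) (\<lambda>(q, p). - \<beta> p)"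

definition stream_to_height ::
  "real \<Rightarrow> real \<Rightarrow> (real \<times> real \<Rightarrow> real) \<Rightarrow> (real \<Rightarrow> real) \<Rightarrow> (real \<times> real \<Rightarrow> real) \<Rightarrow> bool" where
  "stream_to_height d p0 \<psi> \<eta> h \<longleftrightarrow>
     bij_betw (hodograph \<psi>) (closure (fluid d \<eta>)) (closure (strip p0)) \<and>
     (\<forall>w\<in>closure (strip p0). h w = snd (inv_hodograph d \<eta> \<psi> w) + d)"

end

theory Submission
  imports Defs "HOL-Analysis.Analysis" "HOL-Analysis.Lebesgue_Integral_Substitution"
begin

text \<open>
  The semi-hodograph map \<open>(x, y) \<mapsto> (x, - \<psi> (x, y))\<close> is a bi-Lipschitz shear between the
  closures of the fluid domain and of the strip; its inverse is \<open>(q, p) \<mapsto> (q, h (q, p) - d)\<close>.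
  Weak derivatives, \<open>L\<^sub>r\<close> integrability and Hoelder bounds are transported along such shears by a
  chain rule obtained from mollification, which turns the semilinear equation for \<open>\<psi>\<close> into the
  quasilinear one for \<open>h\<close>. From the velocity one gets \<open>\<psi>\<close> because the mass flux
  \<open>sqrt \<rho> * (U, v)\<close> is weakly divergence free, and density and Bernoulli energy are constant along
  streamlines, that is, functions of \<open>p\<close> alone; the Euler equations then reduce to the equation for
  \<open>\<Delta>\<psi>\<close>. Conversely the pressure is defined by Bernoulli's law. The mean of the curvature over
  a period vanishes, which matches \<open>Q\<close> with the condition that \<open>\<eta>\<close> has mean zero.
\<close>

text \<open>Since \<open>r = 1\<close> is allowed, second derivatives of \<open>\<psi>\<close> and
  \<open>h\<close> may be merely integrable, and a product of two of them may fail to be integrable.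
  Every calculus rule below therefore acts on continuous functions (velocity, pressure, density, the
  gradients of \<open>\<psi>\<close> and \<open>h\<close>), which the Hoelder classes provide: such
  functions are approximated locally uniformly while their weak derivatives are approximated in
  \<open>L\<^sub>1\<close>, and this survives composition. The equations hold almost everywhere, so
  a one-sided bound on image measures is enough to move them through the hodograph map. The obstacle
  at the boundary is that derivatives exist inside the domain, whereas the boundary conditions
  concern their continuous extensions; boundary facts are reached as limits from nearby interior
  lines. The exponent \<open>\<alpha> = (r - 1) / r\<close> is the Hoelder exponent of primitives of
  \<open>L\<^sub>r\<close> functions of one variable: \<open>R\<close> and the primitive of
  \<open>- \<beta>\<close> have it, hence so do the density and the pressure built from
  them.\<close>

abbreviation (input) wder :: "'a::euclidean_space set => 'a => ('a => real) => ('a => real) => bool" where "wder == has_weak_deriv"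
abbreviation (input) cts :: "'a::topological_space set => ('a => 'b::topological_space) => bool" where "cts == continuous_on"
abbreviation (input) Leb :: "'a::euclidean_space measure" where "Leb == lebesgue"
abbreviation (input) loc_int :: "'a::euclidean_space set => ('a => real) => bool" where "loc_int == locally_integrable"
abbreviation (input) set_int :: "'a measure => 'a set => ('a => 'b::{banach,second_countable_topology}) => bool" where "set_int == set_integrable"

section \<open>Mollifiers and convolution\<close>

lemma pd_eqI: "(f has_derivative D) (at z) ==> pd b f z = D b"
 unfolding pd_def by (simp add: frechet_derivative_at[symmetric])

lemma has_derivative_pd:
 assumes "f differentiable (at z)"
 shows "(f has_derivative (%h. \<Sum>b\<in>Basis. (h \<bullet> b) * pd b f z)) (at z)"
proof -
 obtain D where D: "(f has_derivative D) (at z)" using assms unfolding differentiable_def by blast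
 interpret bounded_linear D by (rule has_derivative_bounded_linear[OF D])
 have "D h = (\<Sum>b\<in>Basis. (h \<bullet> b) * pd b f z)" for h
 proof -
 have "D h = D (\<Sum>b\<in>Basis. (h \<bullet> b) *\<^sub>R b)" by (simp add: euclidean_representation)
 also have "... = (\<Sum>b\<in>Basis. (h \<bullet> b) * pd b f z)"
 by (simp add: sum scaleR pd_eqI[OF D])
 finally show ?thesis .
 qed
 then have "D = (%h. \<Sum>b\<in>Basis. (h \<bullet> b) * pd b f z)" by blast
 with D show ?thesis by simp
qed

text \<open>The classical flat function \<open>exp (- 1 / x)\<close>, extended by zero. The factor
  of order \<open>k\<close> makes the family closed, up to linear combinations, under
  differentiation, so that all derivatives are handled at once.\<close>

definition flat_exp :: "nat => real => real" where
 "flat_exp k x = (if 0 < x then (1 / x) ^ k * exp (- (1 / x)) else 0)"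

text \<open>In the variable \<open>inverse x\<close> this is the decay at infinity of a power
  divided by the exponential; from the left the function is identically zero.\<close>

lemma flat_exp_at_0: "((%x. flat_exp k x) \<longlongrightarrow> 0) (at 0)"
proof -
 have "((%x::real. x ^ k / exp x) \<longlongrightarrow> 0) at_top" by (rule tendsto_power_div_exp_0)
 then have "((%x::real. (inverse x) ^ k / exp (inverse x)) \<longlongrightarrow> 0) (at_right 0)"
 by (rule filterlim_compose[OF _ filterlim_inverse_at_top_right])
 then have "(flat_exp k \<longlongrightarrow> 0) (at_right 0)"
 by (rule Lim_transform_eventually)
 (auto simp: eventually_at_filter flat_exp_def exp_minus field_simps)
 moreover have "(flat_exp k \<longlongrightarrow> 0) (at_left 0)"
 by (rule Lim_transform_eventually[of "%_. 0"]) (auto simp: eventually_at_filter flat_exp_def)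
 ultimately show ?thesis by (simp add: filterlim_split_at)
qed

lemma flat_exp_deriv:
 "(flat_exp k has_real_derivative (flat_exp (k + 2) x - k * flat_exp (k + 1) x)) (at x)"
proof -
 consider "x > 0" | "x < 0" | "x = 0" by linarith
 then show ?thesis
 proof cases
 case 1
 have "((%x. inverse x ^ k * exp (- inverse x)) has_real_derivative
 (k * inverse x ^ (k - 1) * (- (inverse x)\<^sup>2) * exp (- inverse x)
 + inverse x ^ k * (exp (- inverse x) * (inverse x)\<^sup>2))) (at x)"
 using 1 by (auto intro!: derivative_eq_intros simp: power2_eq_square)
 moreover have "k * inverse x ^ (k - 1) * (- (inverse x)\<^sup>2) * exp (- inverse x)
 + inverse x ^ k * (exp (- inverse x) * (inverse x)\<^sup>2) = flat_exp (k + 2) x - k * flat_exp (k + 1) x"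
 using 1 by (cases k) (simp_all add: flat_exp_def divide_inverse algebra_simps power2_eq_square)
 ultimately have "((%x. inverse x ^ k * exp (- inverse x)) has_real_derivative
 (flat_exp (k + 2) x - k * flat_exp (k + 1) x)) (at x)" by simp
 then show ?thesis
 by (rule has_field_derivative_transform_within_open[of _ _ _ "{0<..}"])
 (use 1 in "auto simp: flat_exp_def divide_inverse")
 next
 case 2
 have "((%x::real. 0) has_real_derivative (flat_exp (k + 2) x - k * flat_exp (k + 1) x)) (at x)"
 using 2 by (simp add: flat_exp_def)
 then show ?thesis
 by (rule has_field_derivative_transform_within_open[of _ _ _ "{..<0}"])
 (use 2 in "auto simp: flat_exp_def")
 next
 case 3
 \<comment> \<open>At the origin the difference quotient of \<open>flat_exp k\<close> is
   \<open>flat_exp (Suc k)\<close>, whose limit is already known.\<close>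
 have "((%h. flat_exp (Suc k) h) \<longlongrightarrow> 0) (at 0)" by (rule flat_exp_at_0)
 then have "((%h. (flat_exp k (0 + h) - flat_exp k 0) / h) \<longlongrightarrow> 0) (at 0)"
 by (rule Lim_transform_eventually) (auto simp: eventually_at_filter flat_exp_def)
 then show ?thesis using 3 by (simp add: DERIV_def flat_exp_def)
 qed
qed

text \<open>A class of functions that is visibly closed under partial derivatives: membership is
  preserved by \<open>pd\<close>, hence by \<open>iter_pd\<close>, so smoothness reduces to one
  induction over the formation rules.\<close>

inductive_set smooth_ring :: "('a::euclidean_space => real) set" where
 const: "(%z. c) \<in> smooth_ring"
| flat: "(%z. flat_exp k (m * (z \<bullet> b) + t)) \<in> smooth_ring"
| add: "f \<in> smooth_ring ==> g \<in> smooth_ring ==> (%z. f z + g z) \<in> smooth_ring"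
| mult: "f \<in> smooth_ring ==> g \<in> smooth_ring ==> (%z. f z * g z) \<in> smooth_ring"

lemma smooth_ring_pd:
 "f \<in> smooth_ring ==> (\<forall>z. f differentiable (at z)) & pd b f \<in> smooth_ring"
proof (induction rule: smooth_ring.induct)
 case (const c)
 have "pd b (%z. c) = (%z. 0)" by (rule ext, rule pd_eqI) simp
 then show ?case by (auto intro: smooth_ring.const)
next
 case (flat k m e t)
 have D: "((%z. flat_exp k (m * (z \<bullet> e) + t)) has_derivative
 (%h. m * (h \<bullet> e) * (flat_exp (k + 2) (m * (z \<bullet> e) + t) + (- k) * flat_exp (k + 1) (m * (z \<bullet> e) + t)))) (at z)" for z
 proof -
 have "((%z. m * (z \<bullet> e) + t) has_derivative (%h. m * (h \<bullet> e))) (at z)"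
 by (auto intro!: derivative_eq_intros)
 from DERIV_compose_FDERIV[OF flat_exp_deriv this] show ?thesis by simp
 qed
 have eq: "pd b (%z. flat_exp k (m * (z \<bullet> e) + t)) = (%z. (m * (b \<bullet> e)) *
 (flat_exp (k + 2) (m * (z \<bullet> e) + t) + (- real k) * flat_exp (k + 1) (m * (z \<bullet> e) + t)))"
 by (rule ext, subst pd_eqI[OF D]) simp
 have "pd b (%z. flat_exp k (m * (z \<bullet> e) + t)) \<in> smooth_ring"
 unfolding eq
 by (rule smooth_ring.mult[OF smooth_ring.const smooth_ring.add[OF smooth_ring.flat
 smooth_ring.mult[OF smooth_ring.const smooth_ring.flat]]])
 then show ?case using D by (auto intro: differentiableI)
next
 case (add f g)
 have "pd b (%z. f z + g z) = (%z. pd b f z + pd b g z)"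
 using add by (auto simp: pd_def frechet_derivative_works intro!: ext pd_eqI[unfolded pd_def] derivative_eq_intros)
 with add show ?case by (auto intro: smooth_ring.add)
next
 case (mult f g)
 have "pd b (%z. f z * g z) = (%z. f z * pd b g z + pd b f z * g z)"
 using mult by (auto simp: pd_def frechet_derivative_works intro!: ext pd_eqI[unfolded pd_def] derivative_eq_intros)
 with mult show ?case by (auto intro: smooth_ring.add smooth_ring.mult)
qed

lemma smooth_ring_smooth: "f \<in> smooth_ring ==> smooth f"
proof -
 assume f: "f \<in> smooth_ring"
 have "iter_pd bs f \<in> smooth_ring" for bs by (induction bs) (auto simp: f smooth_ring_pd)
 then show ?thesis unfolding smooth_def using smooth_ring_pd by blast
qed

lemma smooth_differentiable: "smooth f ==> f differentiable (at z)"
 unfolding smooth_def by (metis empty_subsetI iter_pd.simps(1) list.set(1))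

lemma smooth_pd: assumes "smooth f" "b \<in> Basis" shows "smooth (pd b f)"
 unfolding smooth_def
proof (intro allI impI)
 fix bs :: "'a list" and z assume bs: "set bs \<subseteq> Basis"
 have "iter_pd bs (pd b f) = iter_pd (bs @ [b]) f" by (induction bs) auto
 moreover have "set (bs @ [b]) \<subseteq> Basis" using bs assms(2) by simp
 ultimately show "iter_pd bs (pd b f) differentiable (at z)"
 using assms(1) unfolding smooth_def by metis
qed

lemma smooth_continuous: "smooth f ==> cts A f"
 by (intro continuous_at_imp_continuous_on ballI differentiable_imp_continuous_within smooth_differentiable)

lemma has_derivative_translate:
 fixes f :: "'a::real_normed_vector => real"
 assumes "(f has_derivative D) (at (z - a))"
 shows "((%w. f (w - a)) has_derivative D) (at z)"
proof -
 have "((%w. w - a) has_derivative (%h. h)) (at z)" by (auto intro!: derivative_eq_intros)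
 from has_derivative_compose[OF this assms] show ?thesis by simp
qed

lemma pd_translate: "f differentiable (at (z - a)) ==> pd b (%w. f (w - a)) z = pd b f (z - a)"
proof -
 assume "f differentiable (at (z - a))"
 then obtain D where D: "(f has_derivative D) (at (z - a))" unfolding differentiable_def by blast
 show ?thesis using pd_eqI[OF D] pd_eqI[OF has_derivative_translate[OF D]] by simp
qed

lemma smooth_translate: assumes "smooth f" shows "smooth (%w. f (w - a))"
 unfolding smooth_def
proof (intro allI impI)
 fix bs :: "'a list" and z assume bs: "set bs \<subseteq> Basis"
 have "iter_pd bs (%w. f (w - a)) = (%w. iter_pd bs f (w - a))"
 using bs
 proof (induction bs)
 case (Cons b bs)
 then have IH: "iter_pd bs (%w. f (w - a)) = (%w. iter_pd bs f (w - a))" by simp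
 have "iter_pd bs f differentiable (at w)" for w
 using assms Cons.prems unfolding smooth_def by simp
 then show ?case by (simp only: iter_pd.simps IH) (rule ext, rule pd_translate, blast)
 qed simp
 moreover have "iter_pd bs f differentiable (at (z - a))"
 using assms bs unfolding smooth_def by simp
 ultimately show "iter_pd bs (%w. f (w - a)) differentiable (at z)"
 unfolding differentiable_def by (auto intro: has_derivative_translate)
qed

text \<open>Symmetry about the origin is not asked for, which leaves room for a bump supported in a
  cube with one corner at the origin.\<close>

definition mollifier :: "real => ('a::euclidean_space => real) => bool" where
 "mollifier e k \<longleftrightarrow> smooth k & (\<forall>w. 0 <= k w) & (\<forall>w. k w ~= 0 --> norm w <= e) &
 integrable lborel k & integral\<^sup>L lborel k = 1"

lemma integrable_compact_support:
 fixes f :: "'a::euclidean_space => real"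
 assumes "cts UNIV f" "!!w. f w ~= 0 ==> norm w <= e"
 shows "integrable lborel f"
proof -
 have "set_int lborel (cball 0 e) f"
 unfolding set_integrable_def
 by (rule borel_integrable_compact) (auto intro: continuous_on_subset[OF assms(1)])
 moreover have "(%x. indicator (cball 0 e) x *\<^sub>R f x) = f"
 using assms(2) by (force simp: indicator_def)
 ultimately show ?thesis unfolding set_integrable_def by simp
qed

lemma smooth_ring_prod:
 "finite A ==> (!!b. b \<in> A ==> v b \<in> smooth_ring) ==> (%w. \<Prod>b\<in>A. v b w) \<in> smooth_ring"
 by (induction A rule: finite_induct) (simp_all add: smooth_ring.const smooth_ring.mult)

lemma mollifier_exists:
 assumes "0 < e"
 shows "\<exists>k::'a::euclidean_space => real. mollifier e k"
proof -
 \<comment> \<open>The bump lives on a cube of side \<open>d\<close>. The Euclidean norm is at most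
   the sum of the absolute values of the coordinates, so this side puts the cube into the ball of
   radius \<open>e\<close>.\<close>
 define d where "d = e / DIM('a)"
 have d: "d > 0" using assms by (simp add: d_def)
 define u where "u = (%w::'a. \<Prod>b\<in>Basis. flat_exp 0 (1 * (w \<bullet> b) + 0) * flat_exp 0 ((-1) * (w \<bullet> b) + d))"
 have sm: "u \<in> smooth_ring" unfolding u_def
 by (rule smooth_ring_prod[OF finite_Basis smooth_ring.mult[OF smooth_ring.flat smooth_ring.flat]])
 have nn: "0 <= u w" for w unfolding u_def by (auto intro!: prod_nonneg simp: flat_exp_def)
 have supp: "norm w <= e" if "u w ~= 0" for w
 proof -
 have "abs (w \<bullet> b) <= d" if "b \<in> Basis" for b
 using \<open>u w ~= 0\<close> that unfolding u_def by (auto simp: flat_exp_def split: if_splits)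
 then have "(\<Sum>b\<in>Basis. abs (w \<bullet> b)) <= (\<Sum>b\<in>(Basis::'a set). d)" by (rule sum_mono)
 then have "norm w <= (\<Sum>b\<in>(Basis::'a set). d)" using norm_le_l1[of w] by linarith
 then show ?thesis by (simp add: d_def)
 qed
 have cont: "cts UNIV u" by (rule smooth_continuous[OF smooth_ring_smooth[OF sm]])
 have int: "integrable lborel u" by (rule integrable_compact_support[OF cont supp])
 have "integral\<^sup>L lborel u ~= 0"
 proof
 assume "integral\<^sup>L lborel u = 0"
 then have "AE w in lborel. u w = 0"
 using integral_nonneg_eq_0_iff_AE[OF int] nn by simp
 moreover have "u w ~= 0" if "w \<in> box 0 (d *\<^sub>R One)" for w
 using that d unfolding u_def by (auto simp: flat_exp_def mem_box)
 ultimately have "AE w in lborel. w \<notin> box 0 (d *\<^sub>R One :: 'a)" by (rule_tac AE_mp) auto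
 then have "emeasure lborel (box 0 (d *\<^sub>R One :: 'a)) = 0"
 by (subst (asm) AE_iff_measurable[OF _ refl]) auto
 then show False using d by (simp add: emeasure_lborel_box_eq inner_diff_left)
 qed
 then have pos: "integral\<^sup>L lborel u > 0" using integral_nonneg_AE[of u lborel] nn by (auto simp: less_le)
 let ?k = "%w. (1 / integral\<^sup>L lborel u) * u w"
 have "smooth ?k" by (rule smooth_ring_smooth[OF smooth_ring.mult[OF smooth_ring.const sm]])
 then have "mollifier e ?k" unfolding mollifier_def using pos nn supp int by auto
 then show ?thesis by blast
qed

text \<open>The kernel enters as \<open>k (w - z)\<close>, a correlation rather than a convolution:
  as a function of \<open>w\<close> it is a translate of \<open>k\<close> and hence itself a test
  function once its support fits into the domain. The price is a minus sign in each derivative with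
  respect to \<open>z\<close>.\<close>

definition mconv :: "('a::euclidean_space => real) => ('a => real) => 'a => real" where
 "mconv k f z = integral\<^sup>L lborel (%w. f w * k (w - z))"

lemma pd_support:
 assumes "!!w. k w ~= 0 ==> norm w <= e" "pd b k w ~= (0::real)"
 shows "norm w <= e"
proof (rule ccontr)
 assume n: "\<not> norm w <= e"
 have o: "open {x::'a. norm x > e}" by (intro open_Collect_less continuous_intros)
 have "((%w. 0::real) has_derivative (%h. 0)) (at w)" by simp
 then have "(k has_derivative (%h. 0)) (at w)"
 by (rule has_derivative_transform_within_open[OF _ o]) (use n assms(1) in force)+
 then show False using assms(2) by (simp add: pd_eqI)
qed

lemma mconv_as_integral:
 fixes F :: "'a::euclidean_space => real"
 assumes F: "cts UNIV F" and k: "cts UNIV k" "!!w. k w ~= 0 ==> norm w <= e"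
 and ab: "cball z e \<subseteq> cbox a b"
 shows "mconv k F z = integral (cbox a b) (%w. F w * k (w - z))"
proof -
 have c: "cts UNIV (%w. F w * k (w - z))"
 by (intro continuous_intros F continuous_on_compose2[OF k(1)]) auto
 have 0: "F w * k (w - z) = 0" if "w \<notin> cbox a b" for w
 using that ab k(2)[of "w - z"] by (force simp: dist_norm norm_minus_commute)
 have "set_int lborel (cbox a b) (%w. F w * k (w - z))"
 unfolding set_integrable_def
 by (rule borel_integrable_compact) (auto intro: continuous_on_subset[OF c])
 then have "set_lebesgue_integral lborel (cbox a b) (%w. F w * k (w - z)) = integral (cbox a b) (%w. F w * k (w - z))"
 by (rule set_borel_integral_eq_integral(2))
 moreover have "set_lebesgue_integral lborel (cbox a b) (%w. F w * k (w - z)) = mconv k F z"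
 unfolding set_lebesgue_integral_def mconv_def
 by (rule Bochner_Integration.integral_cong) (use 0 in "auto simp: indicator_def")
 ultimately show ?thesis by simp
qed

text \<open>Differentiation under the integral sign wants a fixed compact domain of integration. For
  \<open>x\<close> within distance one of \<open>z\<close> the supports of all kernels
  \<open>k (w - x)\<close> lie in one box, and the Leibniz rule is applied there.\<close>

lemma mconv_has_derivative:
 fixes F :: "'a::euclidean_space => real"
 assumes F: "cts UNIV F" and k: "smooth k" "!!w. k w ~= 0 ==> norm w <= e"
 shows "(mconv k F has_derivative (%h. \<Sum>b\<in>Basis. (h \<bullet> b) * (- mconv (pd b k) F z))) (at z)"
proof -
 obtain u where u: "cball z (1 + e) \<subseteq> cbox (- u) u"
 using bounded_subset_cbox_symmetric[OF bounded_cball] by metis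
 have ab: "cball x e \<subseteq> cbox (- u) u" if "x \<in> ball z 1" for x
 proof
 fix y assume "y \<in> cball x e"
 then have "dist z y <= 1 + e" using that dist_triangle[of z y x] by (simp add: dist_commute)
 then show "y \<in> cbox (- u) u" using u by auto
 qed
 define fx where "fx x t = (\<Sum>b\<in>Basis. (- (F t * pd b k (t - x))) *\<^sub>R blinfun_inner_left b)" for x t
 have fx: "blinfun_apply (fx x t) h = (\<Sum>b\<in>Basis. (h \<bullet> b) * (- (F t * pd b k (t - x))))" for x t h
 unfolding fx_def by (simp add: blinfun.sum_left blinfun.scaleR_left blinfun.minus_left mult.commute)
 have D: "((%x. F t * k (t - x)) has_derivative blinfun_apply (fx x t)) (at x within ball z 1)" for x t
 proof -
 have "((%x. t - x) has_derivative (%h. - h)) (at x within ball z 1)" by (auto intro!: derivative_eq_intros)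
 from has_derivative_compose[OF this has_derivative_pd[OF smooth_differentiable[OF k(1)]]]
 have "((%x. F t * k (t - x)) has_derivative (%h. F t * (\<Sum>b\<in>Basis. (- h \<bullet> b) * pd b k (t - x)))) (at x within ball z 1)"
 by (auto intro: has_derivative_mult_right)
 moreover have "(%h. F t * (\<Sum>b\<in>Basis. (- h \<bullet> b) * pd b k (t - x))) = blinfun_apply (fx x t)"
 by (rule ext) (simp add: fx sum_distrib_left algebra_simps sum_negf)
 ultimately show ?thesis by simp
 qed
 have int: "(%t. F t * k (t - x)) integrable_on cbox (- u) u" for x
 by (intro integrable_continuous continuous_intros continuous_on_compose2[OF smooth_continuous[OF k(1)]]
 continuous_on_subset[OF F]) auto
 have pc: "cts UNIV (pd b k)" if "b \<in> Basis" for b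
 by (rule smooth_continuous[OF smooth_pd[OF k(1) that]])
 have cont: "cts (ball z 1 \<times> cbox (- u) u) (%(x, t). fx x t)"
 unfolding fx_def case_prod_unfold
 by (intro continuous_intros continuous_on_compose2[OF pc] continuous_on_compose2[OF F]) auto
 have "((%x. integral (cbox (- u) u) (%t. F t * k (t - x))) has_derivative
 blinfun_apply (integral (cbox (- u) u) (fx z))) (at z within ball z 1)"
 by (rule leibniz_rule[OF D int cont]) auto
 then have D1: "((%x. integral (cbox (- u) u) (%t. F t * k (t - x))) has_derivative
 blinfun_apply (integral (cbox (- u) u) (fx z))) (at z)"
 by (simp add: at_within_open[of z "ball z 1"])
 have D2: "integral (cbox (- u) u) (%t. F t * k (t - x)) = mconv k F x" if "x \<in> ball z 1" for x
 by (rule mconv_as_integral[OF F smooth_continuous[OF k(1)] k(2) ab[OF that], symmetric])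
 have "(mconv k F has_derivative blinfun_apply (integral (cbox (- u) u) (fx z))) (at z)"
 by (rule has_derivative_transform_within_open[OF D1 open_ball]) (use D2 in auto)
 moreover have "blinfun_apply (integral (cbox (- u) u) (fx z)) = (%h. \<Sum>b\<in>Basis. (h \<bullet> b) * (- mconv (pd b k) F z))"
 proof
 fix h
 have "cts (cbox (- u) u) (fx z)"
 unfolding fx_def
 by (intro continuous_intros continuous_on_compose2[OF pc] continuous_on_subset[OF F]) auto
 then have "fx z integrable_on cbox (- u) u" by (rule integrable_continuous)
 then have "blinfun_apply (integral (cbox (- u) u) (fx z)) h = integral (cbox (- u) u) (%t. blinfun_apply (fx z t) h)"
 by (rule blinfun_apply_integral)
 also have "... = integral (cbox (- u) u) (%t. \<Sum>b\<in>Basis. (h \<bullet> b) * (- (F t * pd b k (t - z))))"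
 by (simp add: fx)
 also have "... = (\<Sum>b\<in>Basis. integral (cbox (- u) u) (%t. (h \<bullet> b) * (- (F t * pd b k (t - z)))))"
 by (rule integral_sum) (auto intro!: integrable_continuous continuous_intros continuous_on_compose2[OF pc]
 continuous_on_subset[OF F])
 also have "... = (\<Sum>b\<in>Basis. (h \<bullet> b) * (- mconv (pd b k) F z))"
 by (rule sum.cong)
 (auto simp: mconv_as_integral[OF F pc pd_support[OF k(2)] ab[of z], simplified])
 finally show "blinfun_apply (integral (cbox (- u) u) (fx z)) h = (\<Sum>b\<in>Basis. (h \<bullet> b) * (- mconv (pd b k) F z))" .
 qed
 ultimately show ?thesis by simp
qed

lemma mconv_pd:
 fixes F :: "'a::euclidean_space => real"
 assumes "cts UNIV F" "smooth k" "!!w. k w ~= 0 ==> norm w <= e" "b \<in> Basis"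
 shows "pd b (mconv k F) z = - mconv (pd b k) F z"
 using pd_eqI[OF mconv_has_derivative[OF assms(1-3)], of b z] assms(4)
 by (simp add: inner_Basis if_distrib if_distribR cong: if_cong)

lemma mconv_continuous:
 fixes F :: "'a::euclidean_space => real"
 assumes "cts UNIV F" "smooth k" "!!w. k w ~= 0 ==> norm w <= e"
 shows "cts A (mconv k F)"
 using has_derivative_continuous[OF mconv_has_derivative[OF assms]]
 by (simp add: continuous_at_imp_continuous_on)

lemma mconv_pd_continuous:
 fixes F :: "'a::euclidean_space => real"
 assumes "cts UNIV F" "smooth k" "!!w. k w ~= 0 ==> norm w <= e" "b \<in> Basis"
 shows "cts A (pd b (mconv k F))"
proof -
 have "pd b (mconv k F) = (%z. - mconv (pd b k) F z)" using mconv_pd[OF assms] by blast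
 then show ?thesis
 using mconv_continuous[OF assms(1) smooth_pd[OF assms(2,4)] pd_support[OF assms(3)]]
 by (simp add: continuous_on_minus)
qed

section \<open>Mollification in L1\<close>

lemma mconv_shift:
 fixes f :: "'a::euclidean_space => real"
 assumes [measurable]: "f \<in> borel_measurable borel" "k \<in> borel_measurable borel"
 shows "mconv k f z = integral\<^sup>L lborel (%s. f (z + s) * k s)"
proof -
 have "integral\<^sup>L lborel (%w. f w * k (w - z)) = integral\<^sup>L (distr lborel borel ((+) z)) (%w. f w * k (w - z))"
 by (simp add: lborel_distr_plus)
 also have "... = integral\<^sup>L lborel (%s. f (z + s) * k s)"
 by (subst integral_distr) auto
 finally show ?thesis by (simp add: mconv_def)
qed

text \<open>Mollification contracts the \<open>L\<^sub>1\<close> norm: exchanging the integrals and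
  translating reduces the claim to the total mass one of the kernel. In this local form the set
  \<open>K\<close> on the left is paid for by its enlargement \<open>K1\<close> on the
  right.\<close>

lemma nn_integral_mconv_le:
 fixes w :: "'a::euclidean_space => real"
 assumes w[measurable]: "w \<in> borel_measurable borel" and k: "mollifier e k"
 and K[measurable]: "K \<in> sets borel" "K1 \<in> sets borel"
 and sub: "!!z s. z \<in> K ==> norm s <= e ==> z + s \<in> K1"
 shows "(\<integral>\<^sup>+z. ennreal \<bar>mconv k w z\<bar> * indicator K z \<partial>lborel) <= (\<integral>\<^sup>+z. ennreal \<bar>w z\<bar> * indicator K1 z \<partial>lborel)"
proof -
 have km[measurable]: "k \<in> borel_measurable borel"
 using k smooth_continuous unfolding mollifier_def by (blast intro: borel_measurable_continuous_onI)
 have kn: "0 <= k s" "k s ~= 0 ==> norm s <= e" for s using k unfolding mollifier_def by auto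
 have k1: "(\<integral>\<^sup>+s. ennreal (k s) \<partial>lborel) = 1"
 using k unfolding mollifier_def by (subst nn_integral_eq_integral) auto
 have "(\<integral>\<^sup>+z. ennreal \<bar>mconv k w z\<bar> * indicator K z \<partial>lborel)
 <= (\<integral>\<^sup>+z. (\<integral>\<^sup>+s. (ennreal \<bar>w (z + s)\<bar> * indicator K1 (z + s)) * ennreal (k s) \<partial>lborel) \<partial>lborel)"
 proof (rule nn_integral_mono)
 fix z :: 'a
 show "ennreal \<bar>mconv k w z\<bar> * indicator K z
 <= (\<integral>\<^sup>+s. (ennreal \<bar>w (z + s)\<bar> * indicator K1 (z + s)) * ennreal (k s) \<partial>lborel)"
 proof (cases "z \<in> K")
 case True
 have "ennreal \<bar>mconv k w z\<bar> <= (\<integral>\<^sup>+s. ennreal (norm (w (z + s) * k s)) \<partial>lborel)"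
 unfolding mconv_shift[OF w km] real_norm_def[symmetric]
 by (cases "integrable lborel (%s. w (z + s) * k s)")
 (use integral_norm_bound_ennreal[of lborel "%s. w (z + s) * k s"] in
 \<open>simp_all add: not_integrable_integral_eq\<close>)
 also have "... <= (\<integral>\<^sup>+s. (ennreal \<bar>w (z + s)\<bar> * indicator K1 (z + s)) * ennreal (k s) \<partial>lborel)"
 using kn sub[OF True]
 by (intro nn_integral_mono) (auto simp: indicator_def abs_mult ennreal_mult)
 finally show ?thesis using True by simp
 qed simp
 qed
 also have "... = (\<integral>\<^sup>+s. (\<integral>\<^sup>+z. (ennreal \<bar>w (z + s)\<bar> * indicator K1 (z + s)) * ennreal (k s) \<partial>lborel) \<partial>lborel)"
 by (rule lborel_pair.Fubini') measurable
 also have "... = (\<integral>\<^sup>+s. (\<integral>\<^sup>+z. (ennreal \<bar>w z\<bar> * indicator K1 z) \<partial>lborel) * ennreal (k s) \<partial>lborel)"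
 proof (rule nn_integral_cong)
 fix s :: 'a
 have "(\<integral>\<^sup>+z. (ennreal \<bar>w (z + s)\<bar> * indicator K1 (z + s)) * ennreal (k s) \<partial>lborel)
 = (\<integral>\<^sup>+z. ennreal \<bar>w (z + s)\<bar> * indicator K1 (z + s) \<partial>lborel) * ennreal (k s)"
 by (rule nn_integral_multc) measurable
 also have "(\<integral>\<^sup>+z. ennreal \<bar>w (z + s)\<bar> * indicator K1 (z + s) \<partial>lborel)
 = (\<integral>\<^sup>+z. ennreal \<bar>w z\<bar> * indicator K1 z \<partial>(distr lborel borel ((+) s)))"
 by (subst nn_integral_distr) (auto simp: add.commute)
 finally show "(\<integral>\<^sup>+z. (ennreal \<bar>w (z + s)\<bar> * indicator K1 (z + s)) * ennreal (k s) \<partial>lborel)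
 = (\<integral>\<^sup>+z. (ennreal \<bar>w z\<bar> * indicator K1 z) \<partial>lborel) * ennreal (k s)"
 by (simp add: lborel_distr_plus)
 qed
 also have "... = (\<integral>\<^sup>+z. (ennreal \<bar>w z\<bar> * indicator K1 z) \<partial>lborel) * (\<integral>\<^sup>+s. ennreal (k s) \<partial>lborel)"
 by (rule nn_integral_cmult) measurable
 finally show ?thesis by (simp add: k1)
qed

text \<open>Truncation at a large height \<open>M\<close> changes \<open>u\<close> little in
  \<open>L\<^sub>1\<close>. The truncated function is almost everywhere a limit of truncated
  continuous functions, and on the bounded set \<open>K\<close> the bound \<open>2 * M\<close> gives
  dominated convergence.\<close>

lemma L1_approx_continuous:
 fixes u :: "'a::euclidean_space => real"
 assumes u: "integrable lborel u" and K: "K \<in> sets borel" "bounded K" and e: "0 < e"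
 shows "\<exists>c. cts UNIV c & (\<integral>\<^sup>+z. ennreal \<bar>u z - c z\<bar> * indicator K z \<partial>lborel) < ennreal e"
proof -
 have um[measurable]: "u \<in> borel_measurable borel" using u by auto
 have Km[measurable]: "K \<in> sets borel" by fact
 have "u measurable_on UNIV"
 by (rule lebesgue_measurable_imp_measurable_on) (auto intro: measurable_completion)
 then obtain N g where N: "negligible N" and g: "!!n. cts UNIV (g n)"
 "!!x. x \<notin> N ==> (%n. g n x) \<longlonglongrightarrow> u x"
 unfolding measurable_on_def by auto
 have AE_N: "AE x in lborel. x \<notin> N"
 using AE_not_in[of N Leb] N by (simp add: negligible_iff_null_sets AE_completion_iff)
 define cl where "cl M x = max (- real M) (min (real M) x)" for M and x :: real
 have cl_lim: "(%M. cl M x) \<longlonglongrightarrow> x" for x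
 proof (rule tendsto_eventually)
 obtain M0 :: nat where "abs x <= M0" using real_arch_simple by blast
 then show "\<forall>\<^sub>F M in sequentially. cl M x = x"
 unfolding eventually_sequentially cl_def by (intro exI[of _ M0]) force
 qed
 have clm[measurable]: "cl M \<in> borel_measurable borel" for M unfolding cl_def by measurable
 have "(%M. integral\<^sup>L lborel (%x. abs (u x - cl M (u x)))) \<longlonglongrightarrow> integral\<^sup>L lborel (%x::'a. 0::real)"
 proof (rule integral_dominated_convergence[where w = "%x. abs (u x)"])
 show "AE x in lborel. (%M. abs (u x - cl M (u x))) \<longlonglongrightarrow> 0"
 proof (rule AE_I2)
 fix x
 have "(%M. \<bar>u x - cl M (u x)\<bar>) \<longlonglongrightarrow> \<bar>u x - u x\<bar>" by (intro tendsto_intros cl_lim)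
 then show "(%M. abs (u x - cl M (u x))) \<longlonglongrightarrow> 0" by simp
 qed
 qed (use u in "auto simp: cl_def")
 then obtain M where M: "integral\<^sup>L lborel (%x. abs (u x - cl M (u x))) < e / 2"
 using e by (force dest!: LIMSEQ_D[of _ _ "e/2"])
 have intM: "integrable lborel (%x. abs (u x - cl M (u x)))"
 by (rule Bochner_Integration.integrable_bound[OF u]) (auto simp: cl_def)
 have fin: "emeasure lborel K < \<infinity>" using K emeasure_bounded_finite by blast
 have intK: "integrable lborel (%x. 2 * real M * indicator K x)"
 using integrable_real_indicator[OF _ fin] by (intro integrable_mult_right) simp
 have gm[measurable]: "g n \<in> borel_measurable borel" for n by (rule borel_measurable_continuous_onI[OF g(1)])
 have "(%n. integral\<^sup>L lborel (%x. abs (cl M (u x) - cl M (g n x)) * indicator K x)) \<longlonglongrightarrow> integral\<^sup>L lborel (%x::'a. 0::real)"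
 proof (rule integral_dominated_convergence[where w = "%x. 2 * real M * indicator K x"])
 show "AE x in lborel. (%n. abs (cl M (u x) - cl M (g n x)) * indicator K x) \<longlonglongrightarrow> 0"
 using AE_N
 proof (rule AE_mp, intro AE_I2 impI)
 fix x assume "x \<notin> N"
 then have "(%n. \<bar>cl M (u x) - cl M (g n x)\<bar> * indicator K x) \<longlonglongrightarrow> \<bar>cl M (u x) - cl M (u x)\<bar> * indicator K x"
 unfolding cl_def by (intro tendsto_intros g(2))
 then show "(%n. abs (cl M (u x) - cl M (g n x)) * indicator K x) \<longlonglongrightarrow> 0" by simp
 qed
 show "integrable lborel (%x. 2 * real M * indicator K x)" by (rule intK)
 qed (auto simp: cl_def indicator_def)
 then obtain n where n: "integral\<^sup>L lborel (%x. abs (cl M (u x) - cl M (g n x)) * indicator K x) < e / 2"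
 using e by (force dest!: LIMSEQ_D[of _ _ "e/2"])
 have intn: "integrable lborel (%x. abs (cl M (u x) - cl M (g n x)) * indicator K x)"
 by (rule Bochner_Integration.integrable_bound[OF intK]) (auto simp: cl_def indicator_def)
 have "(\<integral>\<^sup>+z. ennreal \<bar>u z - cl M (g n z)\<bar> * indicator K z \<partial>lborel)
 <= (\<integral>\<^sup>+z. ennreal (abs (u z - cl M (u z)) + abs (cl M (u z) - cl M (g n z)) * indicator K z) \<partial>lborel)"
 by (rule nn_integral_mono) (auto simp: indicator_def simp flip: ennreal_plus intro!: ennreal_leI)
 also have "... = ennreal (integral\<^sup>L lborel (%z. abs (u z - cl M (u z)) + abs (cl M (u z) - cl M (g n z)) * indicator K z))"
 by (rule nn_integral_eq_integral) (use intM intn in auto)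
 also have "... < ennreal e"
 proof (rule ennreal_lessI[OF e])
 show "integral\<^sup>L lborel (%z. abs (u z - cl M (u z)) + abs (cl M (u z) - cl M (g n z)) * indicator K z) < e"
 using M n Bochner_Integration.integral_add[OF intM intn] by linarith
 qed
 finally have "(\<integral>\<^sup>+z. ennreal \<bar>u z - cl M (g n z)\<bar> * indicator K z \<partial>lborel) < ennreal e" .
 moreover have "cts UNIV (%z. cl M (g n z))"
 unfolding cl_def by (intro continuous_intros g)
 ultimately show ?thesis by blast
qed

lemma compact_thicken:
 fixes K S :: "'a::euclidean_space set"
 assumes "compact K" "open S" "K \<subseteq> S"
 obtains e K1 where "0 < e" "compact K1" "K1 \<subseteq> S" "!!z. z \<in> K ==> cball z e \<subseteq> K1"
proof (cases "K = {}")
 case True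
 then show ?thesis using that[of 1 "{}"] by simp
next
 case False
 obtain e where e: "e > 0" "{x. infdist x K <= e} \<subseteq> S"
 using compact_in_open_separated[OF False assms] by blast
 show ?thesis
 proof (rule that[OF e(1) _ e(2)])
 show "compact {x. infdist x K <= e}" by (rule compact_infdist_le[OF False assms(1) e(1)])
 fix z assume "z \<in> K"
 then show "cball z e \<subseteq> {x. infdist x K <= e}"
 by (auto intro: infdist_le2 simp: dist_commute)
 qed
qed

lemma lebesgue_integral_cong_AE:
 fixes f g :: "'a::euclidean_space => real"
 assumes "f \<in> borel_measurable Leb" "AE x in Leb. f x = g x"
 shows "integral\<^sup>L Leb f = integral\<^sup>L Leb g"
 by (rule integral_cong_AE[OF assms(1) borel_measurable_AE[OF assms] assms(2)])

text \<open>A weak derivative is tested on \<open>S\<close> and up to null sets, while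
  \<open>mconv\<close> integrates a Borel function over the whole space. The two integrals agree
  because the translated kernel vanishes off the ball of radius \<open>e\<close> about
  \<open>z\<close>.\<close>

lemma set_lebesgue_integral_mconv:
 fixes f F k :: "'a::euclidean_space => real"
 assumes F[measurable]: "F \<in> borel_measurable borel" and km[measurable]: "k \<in> borel_measurable borel"
 and k: "!!w. k w ~= 0 ==> norm w <= e"
 and S: "cball z e \<subseteq> S" and AE: "AE w in Leb. w \<in> cball z e --> F w = f w"
 shows "set_lebesgue_integral Leb S (%w. f w * k (w - z)) = mconv k F z"
proof -
 have 0: "AE w in Leb. F w * k (w - z) = indicator S w *\<^sub>R (f w * k (w - z))"
 using AE
 proof (rule AE_mp, intro AE_I2 impI)
 fix w assume w: "w \<in> cball z e --> F w = f w"
 show "F w * k (w - z) = indicator S w *\<^sub>R (f w * k (w - z))"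
 proof (cases "w \<in> cball z e")
 case True
 then show ?thesis using w S by (simp add: indicator_def subset_iff)
 next
 case False
 then have "k (w - z) = 0" using k[of "w - z"] by (auto simp: dist_norm norm_minus_commute)
 then show ?thesis by simp
 qed
 qed
 have "mconv k F z = integral\<^sup>L Leb (%w. F w * k (w - z))"
 unfolding mconv_def by (rule integral_completion[symmetric]) measurable
 also have "... = integral\<^sup>L Leb (%w. indicator S w *\<^sub>R (f w * k (w - z)))"
 by (rule lebesgue_integral_cong_AE[OF _ 0]) (intro measurable_completion, measurable)
 finally show ?thesis by (simp add: set_lebesgue_integral_def)
qed

lemma test_function_translate:
 fixes k :: "'a::euclidean_space => real"
 assumes k: "smooth k" "!!w. k w ~= 0 ==> norm w <= e" and S: "cball z e \<subseteq> S"
 shows "(%w. k (w - z)) \<in> test_functions S"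
proof -
 have "{w. k (w - z) ~= 0} \<subseteq> cball z e" using k(2) by (force simp: dist_norm norm_minus_commute)
 then have c: "closure {w. k (w - z) ~= 0} \<subseteq> cball z e" by (rule closure_minimal) simp
 then have "compact (closure {w. k (w - z) ~= 0})"
 by (meson bounded_cball bounded_subset closed_closure compact_eq_bounded_closed)
 then show ?thesis unfolding test_functions_def using c S smooth_translate[OF k(1)] by auto
qed

lemma mconv_diff:
 fixes u c :: "'a::euclidean_space => real"
 assumes u: "integrable lborel u" and c: "cts UNIV c" and k: "mollifier e k"
 shows "mconv k (%w. u w - c w) z = mconv k u z - mconv k c z"
proof -
 have ks: "cts A k" for A using k smooth_continuous unfolding mollifier_def by blast
 have supp: "k w ~= 0 ==> norm w <= e" for w using k unfolding mollifier_def by blast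
 have [measurable]: "k \<in> borel_measurable borel" by (rule borel_measurable_continuous_onI[OF ks])
 obtain B where B: "!!w. abs (k w) <= B"
 proof -
 have "bounded (k ` cball 0 e)" by (intro compact_imp_bounded compact_continuous_image ks) simp
 then obtain B where "\<forall>x\<in>k ` cball 0 e. norm x <= B" unfolding bounded_iff by blast
 then have "!!w. norm w <= e ==> abs (k w) <= B" by simp
 then have "abs (k w) <= abs B" for w using supp[of w]
 by (metis abs_ge_self abs_ge_zero abs_zero order_trans)
 then show ?thesis using that by blast
 qed
 have i1: "integrable lborel (%w. u w * k (w - z))"
 proof (rule Bochner_Integration.integrable_bound[of _ "%w. B * u w"])
 show "AE x in lborel. norm (u x * k (x - z)) <= norm (B * u x)"
 proof (rule AE_I2)
 fix x
 have "abs (k (x - z)) <= abs B" using B[of "x - z"] by linarith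
 then show "norm (u x * k (x - z)) <= norm (B * u x)"
 using mult_left_mono[of "abs (k (x - z))" "abs B" "abs (u x)"] by (simp add: abs_mult mult.commute)
 qed
 qed (use u in auto)
 have i2: "integrable lborel (%w. c w * k (w - z))"
 proof (rule integrable_compact_support[of _ "norm z + e"])
 show "cts UNIV (%w. c w * k (w - z))"
 by (intro continuous_intros c continuous_on_compose2[OF ks]) auto
 fix w assume "c w * k (w - z) ~= 0"
 then show "norm w <= norm z + e" using supp[of "w - z"] norm_triangle_sub[of w z] by auto
 qed
 show ?thesis unfolding mconv_def
 using Bochner_Integration.integral_diff[OF i1 i2] by (simp add: algebra_simps)
qed

lemma mconv_near:
 fixes c :: "'a::euclidean_space => real"
 assumes c: "cts UNIV c" and k: "mollifier e k" and d: "!!s. norm s <= e ==> abs (c (z + s) - c z) <= d"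
 shows "abs (mconv k c z - c z) <= d"
proof -
 have ks: "cts A k" for A using k smooth_continuous unfolding mollifier_def by blast
 have supp: "k w ~= 0 ==> norm w <= e" "0 <= k w" for w using k unfolding mollifier_def by blast+
 have ki: "integrable lborel k" "integral\<^sup>L lborel k = 1" using k unfolding mollifier_def by auto
 have [measurable]: "k \<in> borel_measurable borel" by (rule borel_measurable_continuous_onI[OF ks])
 have [measurable]: "c \<in> borel_measurable borel" by (rule borel_measurable_continuous_onI[OF c])
 have i: "integrable lborel (%s. c (z + s) * k s)"
 by (rule integrable_compact_support[of _ e]) (auto intro!: continuous_intros ks continuous_on_compose2[OF c] supp)
 have "mconv k c z - c z = integral\<^sup>L lborel (%s. c (z + s) * k s) - integral\<^sup>L lborel (%s. c z * k s)"
 using ki by (simp add: mconv_shift)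
 also have "... = integral\<^sup>L lborel (%s. (c (z + s) - c z) * k s)"
 using i ki by (subst Bochner_Integration.integral_diff[symmetric]) (auto simp: algebra_simps)
 also have "abs (...) <= integral\<^sup>L lborel (%s. abs ((c (z + s) - c z) * k s))"
 by (rule integral_abs_bound)
 also have "... <= integral\<^sup>L lborel (%s. d * k s)"
 proof (rule integral_mono)
 have "integrable lborel (%s. c (z + s) * k s - c z * k s)" using i ki(1) by auto
 then show "integrable lborel (%s. abs ((c (z + s) - c z) * k s))" by (simp add: algebra_simps)
 fix s show "abs ((c (z + s) - c z) * k s) <= d * k s"
 using d[of s] supp[of s] by (cases "k s = 0") (auto simp: abs_mult mult_right_mono)
 qed (use ki in auto)
 also have "... = d" using ki by simp
 finally show ?thesis .
qed

lemma uniformly_near_compact: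
 fixes c :: "'a::euclidean_space => real"
 assumes "cts UNIV c" "compact K" "0 < d"
 shows "\<exists>e>0. \<forall>z\<in>K. \<forall>s. norm s <= e --> abs (c (z + s) - c z) <= d"
proof -
 obtain B where B: "!!z. z \<in> K ==> norm z <= B" using compact_imp_bounded[OF assms(2)] unfolding bounded_iff by blast
 have "uniformly_continuous_on (cball 0 (B + 1)) c"
 by (rule compact_uniformly_continuous) (auto intro: continuous_on_subset[OF assms(1)])
 then obtain r where r: "r > 0" "!!x y. x \<in> cball 0 (B + 1) ==> y \<in> cball 0 (B + 1) ==> dist y x < r ==> dist (c y) (c x) < d"
 unfolding uniformly_continuous_on_def using assms(3) by metis
 have "abs (c (z + s) - c z) <= d" if "z \<in> K" "norm s <= min 1 (r/2)" for z s
 proof -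
 have "norm (z + s) <= B + 1" using B[OF that(1)] that(2) norm_triangle_ineq[of z s] by linarith
 then have "dist (c (z + s)) (c z) < d"
 using B[OF that(1)] that(2) r(1) by (intro r(2)) (simp_all add: dist_norm[of z] dist_norm[of "z + s"])
 then show ?thesis by (simp add: dist_norm)
 qed
 then show ?thesis using r(1) by (intro exI[of _ "min 1 (r/2)"]) auto
qed

text \<open>The usual three-term estimate: \<open>u\<close> is replaced by a continuous
  \<open>c\<close>; the error enters twice, once mollified and controlled by the contraction
  property, and \<open>c\<close> is uniformly close to its own mollification on
  \<open>K\<close>.\<close>

lemma mconv_L1:
 fixes u :: "'a::euclidean_space => real"
 assumes u: "integrable lborel u" and K: "compact K" and d: "0 < d"
 shows "\<exists>e>0. \<forall>e' k. e' <= e & mollifier e' k -->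
 (\<integral>\<^sup>+z. ennreal \<bar>mconv k u z - u z\<bar> * indicator K z \<partial>lborel) <= ennreal d"
proof -
 have [measurable]: "u \<in> borel_measurable borel" using u by auto
 obtain e1 K1 where e1: "0 < e1" "compact K1" "!!z. z \<in> K ==> cball z e1 \<subseteq> K1"
 by (rule compact_thicken[OF K open_UNIV subset_UNIV]) (rule that)
 have Km[measurable]: "K \<in> sets borel" "K1 \<in> sets borel" using borel_compact K e1(2) by blast+
 obtain c where c: "cts UNIV c" "(\<integral>\<^sup>+z. ennreal \<bar>u z - c z\<bar> * indicator K1 z \<partial>lborel) < ennreal (d / 3)"
 using L1_approx_continuous[OF u Km(2) compact_imp_bounded[OF e1(2)], of "d / 3"] d by auto
 have [measurable]: "c \<in> borel_measurable borel" by (rule borel_measurable_continuous_onI[OF c(1)])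
 define m where "m = measure lborel K"
 have m: "emeasure lborel K = ennreal m" "0 <= m" unfolding m_def
 using emeasure_compact_finite[OF K] by (simp_all add: emeasure_eq_ennreal_measure)
 \<comment> \<open>The bound is chosen so that its integral over \<open>K\<close> is at most
   \<open>d / 3\<close>; the added one covers sets \<open>K\<close> of measure zero.\<close>
 obtain e2 where e2: "e2 > 0" "!!z s. z \<in> K ==> norm s <= e2 ==> abs (c (z + s) - c z) <= d / (3 * (m + 1))"
 proof -
 have "0 < d / (3 * (m + 1))" using d m(2) by simp
 from uniformly_near_compact[OF c(1) K this] show ?thesis using that by blast
 qed
 have "(\<integral>\<^sup>+z. ennreal \<bar>mconv k u z - u z\<bar> * indicator K z \<partial>lborel) <= ennreal d"
 if e': "e' <= min e1 e2" and k: "mollifier e' k" for e' k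
 proof -
 have kF: "cts UNIV (mconv k c)"
 by (rule mconv_continuous[OF c(1), of _ e']) (use k in "auto simp: mollifier_def")
 have km[measurable]: "k \<in> borel_measurable borel"
 using k smooth_continuous unfolding mollifier_def by (blast intro: borel_measurable_continuous_onI)
 have [measurable]: "mconv k c \<in> borel_measurable borel" by (rule borel_measurable_continuous_onI[OF kF])
 have "(%z. mconv k (%w. u w - c w) z) \<in> borel_measurable borel"
 unfolding mconv_def by measurable
 then have [measurable]: "mconv k (%w. u w - c w) \<in> borel_measurable borel" by simp
 have a: "(\<integral>\<^sup>+z. ennreal \<bar>mconv k (%w. u w - c w) z\<bar> * indicator K z \<partial>lborel) <= ennreal (d / 3)"
 proof -
 have "z + s \<in> K1" if "z \<in> K" "norm s <= e'" for z s
 using e1(3)[OF that(1)] that(2) e' by (auto simp: dist_norm subset_iff)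
 then have "(\<integral>\<^sup>+z. ennreal \<bar>mconv k (%w. u w - c w) z\<bar> * indicator K z \<partial>lborel)
 <= (\<integral>\<^sup>+z. ennreal \<bar>u z - c z\<bar> * indicator K1 z \<partial>lborel)"
 by (intro nn_integral_mconv_le[OF _ k Km]) auto
 then show ?thesis using c(2) by auto
 qed
 have near: "abs (mconv k c z - c z) <= d / (3 * (m + 1))" if "z \<in> K" for z
 by (rule mconv_near[OF c(1) k]) (use e2(2)[OF that] e' in auto)
 have b: "(\<integral>\<^sup>+z. ennreal \<bar>mconv k c z - c z\<bar> * indicator K z \<partial>lborel) <= ennreal (d / 3)"
 proof -
 have "(\<integral>\<^sup>+z. ennreal \<bar>mconv k c z - c z\<bar> * indicator K z \<partial>lborel) <= (\<integral>\<^sup>+z. ennreal (d / (3 * (m + 1))) * indicator K z \<partial>lborel)"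
 proof (rule nn_integral_mono)
 fix z show "ennreal \<bar>mconv k c z - c z\<bar> * indicator K z <= ennreal (d / (3 * (m + 1))) * indicator K z"
 using near[of z] by (cases "z \<in> K") (simp_all add: ennreal_leI)
 qed
 also have "... = ennreal (d / (3 * (m + 1))) * ennreal m"
 using m by (simp add: nn_integral_cmult_indicator)
 also have "... = ennreal (d / (3 * (m + 1)) * m)"
 by (rule ennreal_mult[symmetric]) (use m d in auto)
 also have "... <= ennreal (d / 3)" using d m(2) by (intro ennreal_leI) (simp add: field_simps)
 finally show ?thesis .
 qed
 have c': "(\<integral>\<^sup>+z. ennreal \<bar>u z - c z\<bar> * indicator K z \<partial>lborel) <= ennreal (d / 3)"
 proof -
 have "K \<subseteq> K1" using e1(1,3) by force
 then have "(\<integral>\<^sup>+z. ennreal \<bar>u z - c z\<bar> * indicator K z \<partial>lborel) <= (\<integral>\<^sup>+z. ennreal \<bar>u z - c z\<bar> * indicator K1 z \<partial>lborel)"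
 by (intro nn_integral_mono) (auto simp: indicator_def)
 then show ?thesis using c(2) by auto
 qed
 have "(\<integral>\<^sup>+z. ennreal \<bar>mconv k u z - u z\<bar> * indicator K z \<partial>lborel)
 <= (\<integral>\<^sup>+z. (ennreal \<bar>mconv k (%w. u w - c w) z\<bar> * indicator K z + ennreal \<bar>mconv k c z - c z\<bar> * indicator K z)
 + ennreal \<bar>u z - c z\<bar> * indicator K z \<partial>lborel)"
 by (rule nn_integral_mono)
 (auto simp: indicator_def mconv_diff[OF u c(1) k] simp flip: ennreal_plus intro!: ennreal_leI)
 also have "... = (\<integral>\<^sup>+z. ennreal \<bar>mconv k (%w. u w - c w) z\<bar> * indicator K z \<partial>lborel)
 + (\<integral>\<^sup>+z. ennreal \<bar>mconv k c z - c z\<bar> * indicator K z \<partial>lborel)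
 + (\<integral>\<^sup>+z. ennreal \<bar>u z - c z\<bar> * indicator K z \<partial>lborel)"
 proof -
 have "(%z. ennreal \<bar>mconv k (%w. u w - c w) z\<bar> * indicator K z) \<in> borel_measurable lborel"
 "(%z. ennreal \<bar>mconv k c z - c z\<bar> * indicator K z) \<in> borel_measurable lborel"
 "(%z. ennreal \<bar>u z - c z\<bar> * indicator K z) \<in> borel_measurable lborel"
 by measurable
 then show ?thesis by (simp add: nn_integral_add)
 qed
 also have "... <= ennreal (d / 3) + ennreal (d / 3) + ennreal (d / 3)"
 by (intro add_mono a b c')
 also have "... = ennreal d" using d by (simp flip: ennreal_plus)
 finally show ?thesis .
 qed
 then show ?thesis using e1(1) e2(1) by (intro exI[of _ "min e1 e2"]) auto
qed

section \<open>Weak derivatives\<close>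

definition C1_on :: "'a::euclidean_space set => ('a => real) => bool" where
 "C1_on V f \<longleftrightarrow> (\<forall>z\<in>V. f differentiable (at z)) & (\<forall>b\<in>Basis. cts V (pd b f))"

lemma C1_on_continuous: "C1_on V f ==> cts V f"
 unfolding C1_on_def by (simp add: continuous_at_imp_continuous_on differentiable_imp_continuous_within)

text \<open>Convergence in the \<open>L\<^sub>1\<close> norm over \<open>K\<close>, written with the
  nonnegative integral so that it can be stated before the differences are known to be
  integrable.\<close>

definition L1lim :: "'a::euclidean_space set => (nat => 'a => real) => ('a => real) => bool" where
 "L1lim K u v \<longleftrightarrow> (\<forall>e>0. \<forall>\<^sub>F n in sequentially.
 (\<integral>\<^sup>+z. ennreal \<bar>u n z - v z\<bar> * indicator K z \<partial>Leb) <= ennreal e)"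

lemma set_integrable_measurable:
 fixes u :: "'a::euclidean_space => real"
 assumes "set_int Leb K u"
 shows "(%z. ennreal \<bar>u z\<bar> * indicator K z) \<in> borel_measurable Leb"
proof -
 have "(%z. ennreal \<bar>indicator K z *\<^sub>R u z\<bar>) \<in> borel_measurable Leb"
 using assms unfolding set_integrable_def by measurable
 moreover have "(%z. ennreal \<bar>indicator K z *\<^sub>R u z\<bar>) = (%z. ennreal \<bar>u z\<bar> * indicator K z)"
 by (auto simp: indicator_def)
 ultimately show ?thesis by (simp only:)
qed

lemma set_integrable_continuous_compact:
 fixes f :: "'a::euclidean_space => real"
 assumes "compact K" "cts K f"
 shows "set_int Leb K f"
proof -
 have "integrable lborel (%x. indicator K x *\<^sub>R f x)" by (rule borel_integrable_compact[OF assms])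
 then show ?thesis unfolding set_integrable_def
 by (subst integrable_completion) auto
qed

lemma set_integrable_nn_finite:
 fixes u :: "'a::euclidean_space => real"
 assumes "set_int Leb K u"
 shows "(\<integral>\<^sup>+z. ennreal \<bar>u z\<bar> * indicator K z \<partial>Leb) < \<infinity>"
proof -
 have "(\<integral>\<^sup>+z. ennreal (norm (indicator K z *\<^sub>R u z)) \<partial>Leb) < \<infinity>"
 using assms unfolding set_integrable_def integrable_iff_bounded by blast
 moreover have "(%z. ennreal (norm (indicator K z *\<^sub>R u z))) = (%z. ennreal \<bar>u z\<bar> * indicator K z)"
 by (auto simp: indicator_def)
 ultimately show ?thesis by simp
qed

lemma set_integrableI_nn:
 fixes u :: "'a::euclidean_space => real"
 assumes "(%z. indicator K z * u z) \<in> borel_measurable Leb"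
 and "(\<integral>\<^sup>+z. ennreal \<bar>u z\<bar> * indicator K z \<partial>Leb) < \<infinity>"
 shows "set_int Leb K u"
proof -
 have "(%z. ennreal (norm (indicator K z *\<^sub>R u z))) = (%z. ennreal \<bar>u z\<bar> * indicator K z)"
 by (auto simp: indicator_def)
 then show ?thesis using assms unfolding set_integrable_def integrable_iff_bounded by simp
qed

lemma L1lim_uniform:
 assumes "compact K" "uniform_limit K u v sequentially"
 shows "L1lim K u v"
 unfolding L1lim_def
proof (intro allI impI)
 fix e :: real assume e: "e > 0"
 define m where "m = measure lborel K"
 have m: "emeasure Leb K = ennreal m" "0 <= m" unfolding m_def
 using emeasure_compact_finite[OF assms(1)] borel_compact[OF assms(1)]
 by (simp_all add: emeasure_eq_ennreal_measure emeasure_completion)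
 have "e / (m + 1) > 0" using e m(2) by simp
 then have "\<forall>\<^sub>F n in sequentially. \<forall>z\<in>K. dist (u n z) (v z) < e / (m + 1)"
 using assms(2) unfolding uniform_limit_iff by blast
 then show "\<forall>\<^sub>F n in sequentially. (\<integral>\<^sup>+z. ennreal \<bar>u n z - v z\<bar> * indicator K z \<partial>Leb) <= ennreal e"
 proof (rule eventually_mono)
 fix n assume n: "\<forall>z\<in>K. dist (u n z) (v z) < e / (m + 1)"
 have "(\<integral>\<^sup>+z. ennreal \<bar>u n z - v z\<bar> * indicator K z \<partial>Leb) <= (\<integral>\<^sup>+z. ennreal (e / (m + 1)) * indicator K z \<partial>Leb)"
 proof (rule nn_integral_mono)
 fix z show "ennreal \<bar>u n z - v z\<bar> * indicator K z <= ennreal (e / (m + 1)) * indicator K z"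
 using n by (cases "z \<in> K") (auto simp: dist_real_def less_imp_le intro!: ennreal_leI)
 qed
 also have "... = ennreal (e / (m + 1)) * ennreal m"
 using m borel_compact[OF assms(1)] by (simp add: nn_integral_cmult_indicator)
 also have "... = ennreal (e / (m + 1) * m)"
 by (rule ennreal_mult[symmetric]) (use m e in auto)
 also have "... <= ennreal e" using e m(2) by (intro ennreal_leI) (simp add: field_simps)
 finally show "(\<integral>\<^sup>+z. ennreal \<bar>u n z - v z\<bar> * indicator K z \<partial>Leb) <= ennreal e" .
 qed
qed

text \<open>The error splits into \<open>p n\<close> times \<open>u n - v\<close> plus
  \<open>p n - q\<close> times \<open>v\<close>. A uniform limit times an \<open>L\<^sub>1\<close>
  limit converges in \<open>L\<^sub>1\<close>, which explains why one factor in every product below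
  is continuous.\<close>

lemma L1lim_mult:
 assumes K: "compact K" and lim: "uniform_limit K p q sequentially" and q: "cts K q"
 and u: "!!n. set_int Leb K (u n)" and v: "set_int Leb K v" and L: "L1lim K u v"
 shows "L1lim K (%n z. p n z * u n z) (%z. q z * v z)"
 unfolding L1lim_def
proof (intro allI impI)
 fix e :: real assume e: "e > 0"
 have "bounded (q ` K)" by (rule compact_imp_bounded[OF compact_continuous_image[OF q K]])
 then obtain M0 where "\<forall>x\<in>q ` K. norm x <= M0" unfolding bounded_iff by blast
 then have M0: "!!z. z \<in> K ==> abs (q z) <= M0" by simp
 define M where "M = abs M0 + 1"
 have M: "M > 0" unfolding M_def by simp
 obtain V where V: "(\<integral>\<^sup>+z. ennreal \<bar>v z\<bar> * indicator K z \<partial>Leb) = ennreal V" "0 <= V"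
 using set_integrable_nn_finite[OF v] by (cases "(\<integral>\<^sup>+z. ennreal \<bar>v z\<bar> * indicator K z \<partial>Leb)") auto
 \<comment> \<open>The bound one keeps \<open>p n\<close> below \<open>M\<close>; the other bound
   makes the second part of the error at most \<open>e / 2\<close>.\<close>
 define d where "d = min 1 (e / (2 * (V + 1)))"
 have d: "d > 0" "d * V <= e / 2" "d <= 1"
 proof -
 show "d > 0" "d <= 1" unfolding d_def using e V(2) by auto
 have "d * V <= e / (2 * (V + 1)) * V" unfolding d_def using V(2) by (intro mult_right_mono) auto
 also have "... <= e / 2" using e V(2) by (simp add: field_simps)
 finally show "d * V <= e / 2" .
 qed
 have "\<forall>\<^sub>F n in sequentially. \<forall>z\<in>K. dist (p n z) (q z) < d"
 using lim d(1) unfolding uniform_limit_iff by blast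
 moreover have "\<forall>\<^sub>F n in sequentially. (\<integral>\<^sup>+z. ennreal \<bar>u n z - v z\<bar> * indicator K z \<partial>Leb) <= ennreal (e / (2 * M))"
 using L e M unfolding L1lim_def by simp
 ultimately show "\<forall>\<^sub>F n in sequentially. (\<integral>\<^sup>+z. ennreal \<bar>p n z * u n z - q z * v z\<bar> * indicator K z \<partial>Leb) <= ennreal e"
 proof eventually_elim
 case (elim n)
 have "(\<integral>\<^sup>+z. ennreal \<bar>p n z * u n z - q z * v z\<bar> * indicator K z \<partial>Leb)
 <= (\<integral>\<^sup>+z. ennreal M * (ennreal \<bar>u n z - v z\<bar> * indicator K z) + ennreal d * (ennreal \<bar>v z\<bar> * indicator K z) \<partial>Leb)"
 proof (rule nn_integral_mono)
 fix z
 show "ennreal \<bar>p n z * u n z - q z * v z\<bar> * indicator K z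
 <= ennreal M * (ennreal \<bar>u n z - v z\<bar> * indicator K z) + ennreal d * (ennreal \<bar>v z\<bar> * indicator K z)"
 proof (cases "z \<in> K")
 case True
 have pq: "abs (p n z - q z) <= d" using elim(1) True by (auto simp: dist_real_def less_imp_le)
 then have pM: "abs (p n z) <= M" using M0[OF True] d(3) unfolding M_def by linarith
 have "p n z * u n z - q z * v z = p n z * (u n z - v z) + (p n z - q z) * v z" by (simp add: algebra_simps)
 then have "abs (p n z * u n z - q z * v z) <= abs (p n z) * abs (u n z - v z) + abs (p n z - q z) * abs (v z)"
 by (metis abs_mult abs_triangle_ineq)
 also have "... <= M * abs (u n z - v z) + d * abs (v z)"
 by (intro add_mono mult_right_mono pq pM) auto
 finally show ?thesis using True M d(1) by (simp add: ennreal_leI flip: ennreal_mult ennreal_plus)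
 qed simp
 qed
 also have "... = ennreal M * (\<integral>\<^sup>+z. ennreal \<bar>u n z - v z\<bar> * indicator K z \<partial>Leb)
 + ennreal d * (\<integral>\<^sup>+z. ennreal \<bar>v z\<bar> * indicator K z \<partial>Leb)"
 proof -
 have "set_int Leb K (%z. u n z - v z)" by (rule set_integral_diff(1)[OF u v])
 from set_integrable_measurable[OF this] set_integrable_measurable[OF v]
 show ?thesis by (simp add: nn_integral_add nn_integral_cmult)
 qed
 also have "... <= ennreal M * ennreal (e / (2 * M)) + ennreal d * ennreal V"
 unfolding V(1) by (intro add_mono mult_left_mono elim(2)) auto
 also have "... = ennreal (e / 2 + d * V)" using M d e V(2) by (simp flip: ennreal_mult ennreal_plus)
 also have "... <= ennreal e" using d(2) by (intro ennreal_leI) simp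
 finally show ?case .
 qed
qed

lemma L1lim_add:
 assumes u: "!!n. set_int Leb K (u n)" "set_int Leb K v" "L1lim K u v"
 and u': "!!n. set_int Leb K (u' n)" "set_int Leb K v'" "L1lim K u' v'"
 shows "L1lim K (%n z. u n z + u' n z) (%z. v z + v' z)"
 unfolding L1lim_def
proof (intro allI impI)
 fix e :: real assume e: "e > 0"
 have "\<forall>\<^sub>F n in sequentially. (\<integral>\<^sup>+z. ennreal \<bar>u n z - v z\<bar> * indicator K z \<partial>Leb) <= ennreal (e / 2)"
 "\<forall>\<^sub>F n in sequentially. (\<integral>\<^sup>+z. ennreal \<bar>u' n z - v' z\<bar> * indicator K z \<partial>Leb) <= ennreal (e / 2)"
 using u(3) u'(3) e unfolding L1lim_def by simp_all
 then show "\<forall>\<^sub>F n in sequentially. (\<integral>\<^sup>+z. ennreal \<bar>u n z + u' n z - (v z + v' z)\<bar> * indicator K z \<partial>Leb) <= ennreal e"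
 proof eventually_elim
 case (elim n)
 have "(\<integral>\<^sup>+z. ennreal \<bar>u n z + u' n z - (v z + v' z)\<bar> * indicator K z \<partial>Leb)
 <= (\<integral>\<^sup>+z. ennreal \<bar>u n z - v z\<bar> * indicator K z + ennreal \<bar>u' n z - v' z\<bar> * indicator K z \<partial>Leb)"
 by (rule nn_integral_mono) (auto simp: indicator_def simp flip: ennreal_plus intro!: ennreal_leI)
 also have "... = (\<integral>\<^sup>+z. ennreal \<bar>u n z - v z\<bar> * indicator K z \<partial>Leb)
 + (\<integral>\<^sup>+z. ennreal \<bar>u' n z - v' z\<bar> * indicator K z \<partial>Leb)"
 using set_integrable_measurable[OF set_integral_diff(1)[OF u(1,2)]]
 set_integrable_measurable[OF set_integral_diff(1)[OF u'(1,2)]]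
 by (simp add: nn_integral_add)
 also have "... <= ennreal (e / 2) + ennreal (e / 2)" by (intro add_mono elim)
 also have "... = ennreal e" using e by (simp flip: ennreal_plus)
 finally show ?case .
 qed
qed

lemma L1lim_unique:
 assumes u: "!!n. set_int Leb K (u n)" and v: "set_int Leb K v" "L1lim K u v"
 and w: "set_int Leb K w" "L1lim K u w"
 shows "AE z in Leb. z \<in> K --> v z = w z"
proof -
 have m: "(%z. ennreal \<bar>v z - w z\<bar> * indicator K z) \<in> borel_measurable Leb"
 by (rule set_integrable_measurable[OF set_integral_diff(1)[OF v(1) w(1)]])
 have le: "(\<integral>\<^sup>+z. ennreal \<bar>v z - w z\<bar> * indicator K z \<partial>Leb) <= ennreal e" if e: "e > 0" for e
 proof -
 have "\<forall>\<^sub>F n in sequentially. (\<integral>\<^sup>+z. ennreal \<bar>u n z - v z\<bar> * indicator K z \<partial>Leb) <= ennreal (e / 2)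
 & (\<integral>\<^sup>+z. ennreal \<bar>u n z - w z\<bar> * indicator K z \<partial>Leb) <= ennreal (e / 2)"
 using v(2) w(2) e unfolding L1lim_def by (intro eventually_conj) simp_all
 then obtain n where n: "(\<integral>\<^sup>+z. ennreal \<bar>u n z - v z\<bar> * indicator K z \<partial>Leb) <= ennreal (e / 2)"
 "(\<integral>\<^sup>+z. ennreal \<bar>u n z - w z\<bar> * indicator K z \<partial>Leb) <= ennreal (e / 2)"
 using eventually_happens'[OF sequentially_bot] by blast
 have "(\<integral>\<^sup>+z. ennreal \<bar>v z - w z\<bar> * indicator K z \<partial>Leb)
 <= (\<integral>\<^sup>+z. ennreal \<bar>u n z - v z\<bar> * indicator K z + ennreal \<bar>u n z - w z\<bar> * indicator K z \<partial>Leb)"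
 by (rule nn_integral_mono) (auto simp: indicator_def simp flip: ennreal_plus intro!: ennreal_leI)
 also have "... = (\<integral>\<^sup>+z. ennreal \<bar>u n z - v z\<bar> * indicator K z \<partial>Leb)
 + (\<integral>\<^sup>+z. ennreal \<bar>u n z - w z\<bar> * indicator K z \<partial>Leb)"
 using set_integrable_measurable[OF set_integral_diff(1)[OF u v(1)]]
 set_integrable_measurable[OF set_integral_diff(1)[OF u w(1)]]
 by (simp add: nn_integral_add)
 also have "... <= ennreal (e / 2) + ennreal (e / 2)" by (intro add_mono n)
 also have "... = ennreal e" using e by (simp flip: ennreal_plus)
 finally show ?thesis .
 qed
 have "(\<integral>\<^sup>+z. ennreal \<bar>v z - w z\<bar> * indicator K z \<partial>Leb) <= 0"
 by (rule ennreal_le_epsilon) (simp add: le)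
 then have "(\<integral>\<^sup>+z. ennreal \<bar>v z - w z\<bar> * indicator K z \<partial>Leb) = 0" by simp
 then have "AE z in Leb. ennreal \<bar>v z - w z\<bar> * indicator K z = 0"
 using nn_integral_0_iff_AE[OF m] by simp
 then show ?thesis by (rule AE_mp) (auto simp: indicator_def)
qed

text \<open>This is how closeness in \<open>L\<^sub>1\<close> passes through the pairing with a test
  function or with its derivative, which play the role of \<open>\<theta>\<close>.\<close>

lemma set_integral_L1lim:
 fixes \<theta> :: "'a::euclidean_space => real"
 assumes u: "set_int Leb K u" and v: "set_int Leb K v"
 and th: "cts K \<theta>" "!!z. z \<in> K ==> abs (\<theta> z) <= B" and K: "compact K"
 and le: "(\<integral>\<^sup>+z. ennreal \<bar>u z - v z\<bar> * indicator K z \<partial>Leb) <= ennreal d" "0 <= d" "0 <= B"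
 shows "abs ((LINT z:K|Leb. u z * \<theta> z) - (LINT z:K|Leb. v z * \<theta> z)) <= B * d"
proof -
 have mult: "set_int Leb K (%z. u z * \<theta> z)" if "set_int Leb K u" for u
 proof -
 have "set_int Leb K \<theta>" by (rule set_integrable_continuous_compact[OF K th(1)])
 then have m: "(%z. (indicator K z *\<^sub>R u z) * (indicator K z *\<^sub>R \<theta> z)) \<in> borel_measurable Leb"
 using that unfolding set_integrable_def by measurable
 have "integrable Leb (%z. (indicator K z *\<^sub>R u z) * (indicator K z *\<^sub>R \<theta> z))"
 proof (rule Bochner_Integration.integrable_bound[OF _ m])
 show "integrable Leb (%z. B * (indicator K z *\<^sub>R u z))"
 using that unfolding set_integrable_def by (intro integrable_mult_right)
 show "AE z in Leb. norm ((indicator K z *\<^sub>R u z) * (indicator K z *\<^sub>R \<theta> z)) <= norm (B * (indicator K z *\<^sub>R u z))"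
 proof (rule AE_I2)
 fix z
 show "norm ((indicator K z *\<^sub>R u z) * (indicator K z *\<^sub>R \<theta> z)) <= norm (B * (indicator K z *\<^sub>R u z))"
 using th(2)[of z] le(3) mult_left_mono[of "abs (\<theta> z)" B "abs (u z)"]
 by (cases "z \<in> K") (auto simp: abs_mult mult.commute)
 qed
 qed
 moreover have "(%z. (indicator K z *\<^sub>R u z) * (indicator K z *\<^sub>R \<theta> z)) = (%z. indicator K z *\<^sub>R (u z * \<theta> z))"
 by (auto simp: indicator_def)
 ultimately show ?thesis unfolding set_integrable_def by simp
 qed
 have duv: "set_int Leb K (%z. u z - v z)" by (rule set_integral_diff(1)[OF u v])
 have "(LINT z:K|Leb. u z * \<theta> z) - (LINT z:K|Leb. v z * \<theta> z) = (LINT z:K|Leb. (u z - v z) * \<theta> z)"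
 using set_integral_diff(2)[OF mult[OF u] mult[OF v]] by (simp add: left_diff_distrib)
 moreover have "ennreal \<bar>LINT z:K|Leb. (u z - v z) * \<theta> z\<bar> <= ennreal (B * d)"
 proof -
 have "ennreal \<bar>LINT z:K|Leb. (u z - v z) * \<theta> z\<bar> <= (\<integral>\<^sup>+z. ennreal (norm (indicator K z *\<^sub>R ((u z - v z) * \<theta> z))) \<partial>Leb)"
 unfolding set_lebesgue_integral_def real_norm_def[symmetric]
 by (rule integral_norm_bound_ennreal) (use mult[OF duv] in "simp add: set_integrable_def")
 also have "... <= (\<integral>\<^sup>+z. ennreal B * (ennreal \<bar>u z - v z\<bar> * indicator K z) \<partial>Leb)"
 proof (rule nn_integral_mono)
 fix z
 show "ennreal (norm (indicator K z *\<^sub>R ((u z - v z) * \<theta> z))) <= ennreal B * (ennreal \<bar>u z - v z\<bar> * indicator K z)"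
 proof (cases "z \<in> K")
 case True
 then have "abs (u z - v z) * abs (\<theta> z) <= B * abs (u z - v z)"
 using mult_left_mono[OF th(2)[OF True], of "abs (u z - v z)"] by (simp add: mult.commute)
 then have "ennreal (\<bar>u z - v z\<bar> * \<bar>\<theta> z\<bar>) <= ennreal B * ennreal \<bar>u z - v z\<bar>"
 by (subst ennreal_mult[symmetric]) (auto simp: le(3) ennreal_leI)
 then show ?thesis using True by (simp add: abs_mult)
 qed simp
 qed
 also have "... = ennreal B * (\<integral>\<^sup>+z. ennreal \<bar>u z - v z\<bar> * indicator K z \<partial>Leb)"
 by (rule nn_integral_cmult[OF set_integrable_measurable[OF duv]])
 also have "... <= ennreal B * ennreal d" by (intro mult_left_mono le) auto
 also have "... = ennreal (B * d)" by (rule ennreal_mult[symmetric]) (use le in auto)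
 finally show ?thesis .
 qed
 moreover have "0 <= B * d" using le by simp
 ultimately show ?thesis using ennreal_le_iff by metis
qed

lemma integrable_on_compact: "loc_int S f ==> compact K ==> K \<subseteq> S ==> set_int Leb K f"
 unfolding locally_integrable_def by blast

lemma C1_integrable:
 assumes "C1_on V g" "compact K" "K \<subseteq> V"
 shows "set_int Leb K g" "b \<in> Basis ==> set_int Leb K (pd b g)"
 using C1_on_continuous[OF assms(1)] assms unfolding C1_on_def
 by (auto intro!: set_integrable_continuous_compact intro: continuous_on_subset)

text \<open>The function is extended from a neighbourhood of \<open>K\<close> by the Tietze theorem
  and mollified. For \<open>z\<close> in \<open>K\<close> the translated kernel is a test function
  on \<open>S\<close>, so the derivative moves from the kernel to \<open>f\<close> and produces the
  mollified weak derivative, which converges in \<open>L\<^sub>1\<close>. One sequence serves all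
  directions and all representatives of the weak derivatives; uniqueness and the chain rules rest on
  this.\<close>

lemma weak_deriv_approx:
 fixes S :: "'a::euclidean_space set"
 assumes S: "open S" and K: "compact K" "K \<subseteq> S" and f: "cts S f"
 shows "\<exists>g. (\<forall>n. C1_on UNIV (g n)) & uniform_limit K g f sequentially &
 (\<forall>b\<in>Basis. \<forall>f'. wder S b f f' --> L1lim K (%n. pd b (g n)) f')"
proof -
 obtain e K1 where e: "0 < e" "compact K1" "K1 \<subseteq> S" "!!z. z \<in> K ==> cball z e \<subseteq> K1"
 by (rule compact_thicken[OF K(1) S K(2)]) (rule that)
 have "closedin (top_of_set UNIV) K1" using compact_imp_closed[OF e(2)] by simp
 then obtain F where F: "cts UNIV F" "!!x. x \<in> K1 ==> F x = f x"
 by (rule Tietze_unbounded[OF continuous_on_subset[OF f e(3)]]) (rule that)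
 \<comment> \<open>The radii start at \<open>e\<close> and shrink, so that already from the first
   member on the kernels centred in \<open>K\<close> stay inside \<open>K1\<close>.\<close>
 have "\<forall>n. \<exists>k::'a => real. mollifier (e / real (Suc n)) k"
 using mollifier_exists e(1) by (metis divide_pos_pos of_nat_0_less_iff zero_less_Suc)
 then obtain k :: "nat => 'a => real" where k: "!!n. mollifier (e / real (Suc n)) (k n)" by metis
 have ks: "smooth (k n)" "!!w. k n w ~= 0 ==> norm w <= e / real (Suc n)" for n
 using k[of n] unfolding mollifier_def by blast+
 have en: "e / real (Suc n) <= e" for n
 using divide_left_mono[of 1 "real (Suc n)" e] e(1) by simp
 have ks': "k n w ~= 0 ==> norm w <= e" for n w using ks(2)[of n w] en[of n] by linarith
 have lim0: "\<forall>\<^sub>F n in sequentially. e / real (Suc n) <= d" if "0 < d" for d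
 proof -
 have "(%n. e * inverse (real (Suc n))) \<longlonglongrightarrow> e * 0" by (intro tendsto_intros LIMSEQ_inverse_real_of_nat)
 then have "(%n. e / real (Suc n)) \<longlonglongrightarrow> 0" by (simp add: divide_inverse)
 from order_tendstoD(2)[OF this that] show ?thesis by (rule eventually_mono) simp
 qed
 define g where "g n = mconv (k n) F" for n
 have C1: "C1_on UNIV (g n)" for n
 unfolding C1_on_def g_def
 using differentiableI[OF mconv_has_derivative[OF F(1) ks(1) ks'[of n]], of n]
 mconv_pd_continuous[OF F(1) ks(1) ks'[of n], of n] by blast
 moreover have "uniform_limit K g f sequentially"
 unfolding uniform_limit_iff
 proof (intro allI impI)
 fix d :: real assume d: "0 < d"
 have "0 < d / 2" using d by simp
 from uniformly_near_compact[OF F(1) K(1) this]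
 obtain r where r: "r > 0" "!!z s. z \<in> K ==> norm s <= r ==> abs (F (z + s) - F z) <= d / 2" by blast
 from lim0[OF r(1)] show "\<forall>\<^sub>F n in sequentially. \<forall>z\<in>K. dist (g n z) (f z) < d"
 proof (rule eventually_mono, intro ballI)
 fix n z assume n: "e / real (Suc n) <= r" and z: "z \<in> K"
 have "abs (g n z - F z) <= d / 2"
 unfolding g_def by (rule mconv_near[OF F(1) k]) (use r(2)[OF z] n in auto)
 moreover have "z \<in> cball z e" using e(1) by simp
 then have "F z = f z" using e(4)[OF z] F(2) by blast
 ultimately show "dist (g n z) (f z) < d" using d by (simp add: dist_real_def)
 qed
 qed
 moreover have "L1lim K (%n. pd b (g n)) f'" if b: "b \<in> Basis" and w: "wder S b f f'" for b f'
 proof -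
 have "set_int Leb K1 f'"
 using w e(2,3) integrable_on_compact unfolding has_weak_deriv_def by blast
 then have i: "integrable Leb (%z. indicator K1 z *\<^sub>R f' z)" unfolding set_integrable_def .
 \<comment> \<open>A Borel representative of the weak derivative, cut off to \<open>K1\<close>: a
   function on the whole space that can be mollified.\<close>
 obtain u where u: "u \<in> borel_measurable lborel" "AE z in lborel. indicator K1 z *\<^sub>R f' z = u z"
 using completion_ex_borel_measurable_real[OF borel_measurable_integrable[OF i]] by blast
 have u_AE: "AE z in Leb. indicator K1 z *\<^sub>R f' z = u z" by (rule AE_completion[OF u(2)])
 have um: "u \<in> borel_measurable Leb" by (rule measurable_completion[OF u(1)])
 have "integrable Leb u" by (rule integrable_cong_AE_imp[OF i um u_AE])
 then have ui: "integrable lborel u" using integrable_completion[OF u(1)] by simp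
 have uK: "AE z in Leb. z \<in> K1 --> u z = f' z"
 using u_AE by (rule AE_mp) (auto intro!: AE_I2)
 have eq: "pd b (g n) z = mconv (k n) u z" if z: "z \<in> K" for n z
 proof -
 have sub: "cball z e \<subseteq> S" using e(3,4) z by blast
 have km: "k n \<in> borel_measurable borel" "pd b (k n) \<in> borel_measurable borel"
 using smooth_continuous[OF ks(1)] smooth_continuous[OF smooth_pd[OF ks(1) b]]
 by (auto intro: borel_measurable_continuous_onI)
 have "pd b (g n) z = - mconv (pd b (k n)) F z"
 unfolding g_def by (rule mconv_pd[OF F(1) ks(1) ks' b])
 also have "mconv (pd b (k n)) F z = (LINT w:S|Leb. f w * pd b (k n) (w - z))"
 proof (rule set_lebesgue_integral_mconv[symmetric, OF _ km(2) _ sub])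
 show "F \<in> borel_measurable borel" by (rule borel_measurable_continuous_onI[OF F(1)])
 show "norm w <= e" if "pd b (k n) w ~= 0" for w by (rule pd_support[OF ks' that])
 show "AE w in Leb. w \<in> cball z e --> F w = f w" using F(2) e(4)[OF z] by (intro AE_I2) blast
 qed
 also have "... = (LINT w:S|Leb. f w * pd b (%w. k n (w - z)) w)"
 by (simp add: pd_translate[OF smooth_differentiable[OF ks(1)]])
 also have "... = - (LINT w:S|Leb. f' w * k n (w - z))"
 using w test_function_translate[OF ks(1)[of n] ks'[of n] sub] unfolding has_weak_deriv_def by blast
 also have "(LINT w:S|Leb. f' w * k n (w - z)) = mconv (k n) u z"
 proof (rule set_lebesgue_integral_mconv[OF _ km(1) ks' sub])
 show "u \<in> borel_measurable borel" using u(1) by simp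
 show "AE w in Leb. w \<in> cball z e --> u w = f' w"
 using uK by (rule AE_mp) (use e(4)[OF z] in "intro AE_I2, blast")
 qed
 finally show ?thesis by simp
 qed
 show ?thesis unfolding L1lim_def
 proof (intro allI impI)
 fix d :: real assume "0 < d"
 from mconv_L1[OF ui K(1) this] obtain r where r: "r > 0"
 "!!e' k. e' <= r ==> mollifier e' k ==> (\<integral>\<^sup>+z. ennreal \<bar>mconv k u z - u z\<bar> * indicator K z \<partial>lborel) <= ennreal d"
 by blast
 from lim0[OF r(1)] show "\<forall>\<^sub>F n in sequentially. (\<integral>\<^sup>+z. ennreal \<bar>pd b (g n) z - f' z\<bar> * indicator K z \<partial>Leb) <= ennreal d"
 proof (rule eventually_mono)
 fix n assume n: "e / real (Suc n) <= r"
 have KK: "K \<subseteq> K1" using e(1,4) by force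
 have "(\<integral>\<^sup>+z. ennreal \<bar>pd b (g n) z - f' z\<bar> * indicator K z \<partial>Leb) = (\<integral>\<^sup>+z. ennreal \<bar>mconv (k n) u z - u z\<bar> * indicator K z \<partial>Leb)"
 proof (rule nn_integral_cong_AE)
 show "AE z in Leb. ennreal \<bar>pd b (g n) z - f' z\<bar> * indicator K z = ennreal \<bar>mconv (k n) u z - u z\<bar> * indicator K z"
 using uK by (rule AE_mp) (use KK eq in "auto intro!: AE_I2 simp: indicator_def")
 qed
 also have "... <= ennreal d" unfolding nn_integral_completion by (rule r(2)[OF n k])
 finally show "(\<integral>\<^sup>+z. ennreal \<bar>pd b (g n) z - f' z\<bar> * indicator K z \<partial>Leb) <= ennreal d" .
 qed
 qed
 qed
 ultimately show ?thesis by blast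
qed

text \<open>On each set of a compact exhaustion both candidates are \<open>L\<^sub>1\<close> limits
  of the derivatives of one and the same approximating sequence.\<close>

lemma has_weak_deriv_unique:
 fixes S :: "'a::euclidean_space set"
 assumes S: "open S" and f: "cts S f" and b: "b \<in> Basis"
 and d: "wder S b f f1" "wder S b f f2"
 shows "AE z in Leb. z \<in> S --> f1 z = f2 z"
proof -
 obtain D :: "nat => 'a set" where D: "!!n. compact (D n)" "!!n. D n \<subseteq> S" "S = (\<Union>n. D n)"
 proof (rule open_Union_compact_subsets[OF S])
 fix C :: "nat => 'a set"
 assume "!!n. compact (C n)" "!!n. C n \<subseteq> S" "\<Union> (range C) = S"
 then show thesis by (intro that[of C]) auto
 qed
 have "AE z in Leb. z \<in> D n --> f1 z = f2 z" for n
 proof -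
 obtain g where g: "!!n. C1_on UNIV (g n)" "uniform_limit (D n) g f sequentially"
 "!!b f'. b \<in> Basis ==> wder S b f f' ==> L1lim (D n) (%n. pd b (g n)) f'"
 using weak_deriv_approx[OF S D(1)[of n] D(2)[of n] f] by blast
 have i: "set_int Leb (D n) f1" "set_int Leb (D n) f2"
 using d unfolding has_weak_deriv_def by (simp_all add: integrable_on_compact[OF _ D(1) D(2)])
 show ?thesis
 by (rule L1lim_unique[OF C1_integrable(2)[OF g(1) D(1) subset_UNIV b] i(1) g(3)[OF b d(1)] i(2) g(3)[OF b d(2)]])
 qed
 then have "AE z in Leb. \<forall>n. z \<in> D n --> f1 z = f2 z" unfolding AE_all_countable by blast
 then show ?thesis
 proof (rule AE_mp, intro AE_I2 impI)
 fix z assume "\<forall>n. z \<in> D n --> f1 z = f2 z" "z \<in> S"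
 then show "f1 z = f2 z" using D(3) by blast
 qed
qed

text \<open>Difference quotients integrate to zero by translation invariance. The mean value theorem
  bounds them uniformly on a common bounded set, and dominated convergence passes to the
  derivative.\<close>

lemma integral_pd_compact_support:
 fixes W :: "'a::euclidean_space => real"
 assumes W: "C1_on UNIV W" and supp: "!!z. W z ~= 0 ==> norm z <= R" and b: "b \<in> Basis"
 shows "integral\<^sup>L lborel (pd b W) = 0"
proof -
 have cW: "cts A W" for A using C1_on_continuous[OF W] by (rule continuous_on_subset) simp
 have cp: "cts A (pd b W)" for A using W b unfolding C1_on_def by (auto intro: continuous_on_subset)
 have [measurable]: "W \<in> borel_measurable borel" "pd b W \<in> borel_measurable borel"
 using cW cp by (auto intro: borel_measurable_continuous_onI)
 have iW: "integrable lborel W" by (rule integrable_compact_support[OF cW supp])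
 have "bounded (pd b W ` cball 0 R)" by (intro compact_imp_bounded compact_continuous_image cp compact_cball)
 then obtain B0 where "\<forall>x\<in>pd b W ` cball 0 R. norm x <= B0" unfolding bounded_iff by blast
 then have B0: "abs (pd b W z) <= abs B0" for z
 using pd_support[OF supp, where b = b and w = z] by (cases "pd b W z = 0") force+
 \<comment> \<open>Step sizes of at most one keep all difference quotients supported in the ball of
   radius \<open>R + 1\<close>.\<close>
 define t where "t n = inverse (real (Suc n))" for n
 have t: "0 < t n" "t n <= 1" for n unfolding t_def by (auto simp: field_simps)
 have t0: "t \<longlonglongrightarrow> 0" unfolding t_def by (rule LIMSEQ_inverse_real_of_nat)
 have line: "((%s. W (z + s *\<^sub>R b)) has_real_derivative pd b W (z + s *\<^sub>R b)) (at s)" for z s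
 proof -
 have 1: "((%s. z + s *\<^sub>R b) has_derivative (%h. h *\<^sub>R b)) (at s)" by (auto intro!: derivative_eq_intros)
 have "W differentiable (at (z + s *\<^sub>R b))" using W unfolding C1_on_def by blast
 then obtain D where D: "(W has_derivative D) (at (z + s *\<^sub>R b))" unfolding differentiable_def by blast
 have "D (h *\<^sub>R b) = pd b W (z + s *\<^sub>R b) * h" for h
 using linear_scale[OF has_derivative_linear[OF D], of h b] pd_eqI[OF D, of b] by simp
 then show ?thesis using has_derivative_compose[OF 1 D] unfolding has_field_derivative_def by simp
 qed
 define Dq where "Dq n z = (W (z + t n *\<^sub>R b) - W z) / t n" for n z
 have Dqm[measurable]: "Dq n \<in> borel_measurable borel" for n unfolding Dq_def by measurable
 have Dq0: "integral\<^sup>L lborel (Dq n) = 0" for n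
 proof -
 have "integral\<^sup>L lborel W = integral\<^sup>L (distr lborel borel ((+) (t n *\<^sub>R b))) W" by (simp add: lborel_distr_plus)
 also have "... = integral\<^sup>L lborel (%z. W (t n *\<^sub>R b + z))" by (rule integral_distr) auto
 finally have 1: "integral\<^sup>L lborel (%z. W (z + t n *\<^sub>R b)) = integral\<^sup>L lborel W" by (simp add: add.commute)
 have 2: "integrable lborel (%z. W (z + t n *\<^sub>R b))"
 proof (rule integrable_compact_support[of _ "R + 1"])
 show "cts UNIV (%z. W (z + t n *\<^sub>R b))" by (intro continuous_on_compose2[OF cW] continuous_intros) auto
 fix w assume "W (w + t n *\<^sub>R b) ~= 0"
 from supp[OF this] show "norm w <= R + 1"
 using norm_triangle_ineq4[of "w + t n *\<^sub>R b" "t n *\<^sub>R b"] t[of n] b by simp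
 qed
 show ?thesis unfolding Dq_def using 1 iW 2 by simp
 qed
 have Dqlim: "(%n. Dq n z) \<longlonglongrightarrow> pd b W z" for z
 proof -
 have "((%h. (W (z + (0 + h) *\<^sub>R b) - W (z + 0 *\<^sub>R b)) / h) \<longlongrightarrow> pd b W (z + 0 *\<^sub>R b)) (at 0)"
 using line[of z 0] unfolding DERIV_def .
 then have l: "((%h. (W (z + h *\<^sub>R b) - W z) / h) \<longlongrightarrow> pd b W z) (at 0)" by simp
 have "filterlim t (at 0) sequentially"
 unfolding filterlim_at using t0 t(1) by (auto simp: less_imp_neq[THEN not_sym])
 from filterlim_compose[OF l this] show ?thesis unfolding Dq_def .
 qed
 have Dqb: "abs (Dq n z) <= abs B0 * indicator (cball 0 (R + 1)) z" for n z
 proof (cases "norm z <= R + 1")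
 case True
 obtain s where "W (z + t n *\<^sub>R b) - W (z + 0 *\<^sub>R b) = (t n - 0) * pd b W (z + s *\<^sub>R b)"
 using MVT2[OF t(1)[of n], of "%s. W (z + s *\<^sub>R b)" "%s. pd b W (z + s *\<^sub>R b)"] line by blast
 then have "Dq n z = pd b W (z + s *\<^sub>R b)" unfolding Dq_def using t(1)[of n] by simp
 then show ?thesis using B0 True by simp
 next
 case False
 have "norm (z + t n *\<^sub>R b) > R"
 using False norm_triangle_ineq4[of "z + t n *\<^sub>R b" "t n *\<^sub>R b"] t[of n] b by simp
 then have "W (z + t n *\<^sub>R b) = 0" using supp[of "z + t n *\<^sub>R b"] by linarith
 moreover have "W z = 0" using supp[of z] False by linarith
 ultimately show ?thesis by (simp add: Dq_def)
 qed
 have "(%n. integral\<^sup>L lborel (Dq n)) \<longlonglongrightarrow> integral\<^sup>L lborel (pd b W)"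
 proof (rule integral_dominated_convergence[where w = "%z. abs B0 * indicator (cball 0 (R + 1)) z"])
 have "emeasure lborel (cball (0::'a) (R + 1)) < \<infinity>" using emeasure_compact_finite[OF compact_cball] by simp
 then show "integrable lborel (%z::'a. abs B0 * indicator (cball 0 (R + 1)) z)"
 by (intro integrable_mult_right integrable_real_indicator) auto
 qed (use Dqlim Dqb in auto)
 then show ?thesis unfolding Dq0 using LIMSEQ_unique tendsto_const by blast
qed

lemma pd_mult:
 assumes "f differentiable (at z)" "g differentiable (at z)"
 shows "pd b (%z. f z * g z) z = f z * pd b g z + pd b f z * g z"
proof -
 obtain D E where "(f has_derivative D) (at z)" "(g has_derivative E) (at z)"
 using assms unfolding differentiable_def by blast
 then show ?thesis using pd_eqI[OF has_derivative_mult, of f D z g E b] by (simp add: pd_eqI)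
qed

lemma pd_transform:
 assumes "open V" "z \<in> V" "!!w. w \<in> V ==> f w = g w" "f differentiable (at z)"
 shows "g differentiable (at z)" "pd b g z = pd b f z"
proof -
 obtain D where D: "(f has_derivative D) (at z)" using assms(4) unfolding differentiable_def by blast
 have "(g has_derivative D) (at z)" by (rule has_derivative_transform_within_open[OF D assms(1-3)])
 then show "g differentiable (at z)" "pd b g z = pd b f z"
 using D by (auto simp: differentiable_def pd_eqI)
qed

lemma pd_zero:
 assumes "open V" "z \<in> V" "!!w. w \<in> V ==> f w = (0::real)"
 shows "f differentiable (at z) & pd b f z = 0"
proof -
 have c0: "((%_. 0::real) has_derivative (%_. 0)) (at z)" by simp
 have "(f has_derivative (%_. 0)) (at z)"
 by (rule has_derivative_transform_within_open[OF c0 assms(1,2)]) (simp add: assms(3))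
 then show ?thesis by (auto simp: differentiable_def pd_eqI)
qed

text \<open>The product of \<open>g\<close> and \<open>\<phi>\<close>, set to zero off
  \<open>V\<close>, is C1 on the whole space: it is C1 on \<open>V\<close> and zero on the
  complement of \<open>K\<close>, and these two open sets cover everything. Its derivative then has
  integral zero.\<close>

lemma integration_by_parts_compact:
 fixes g \<phi> :: "'a::euclidean_space => real"
 assumes V: "open V" "K \<subseteq> V" and K: "compact K" and g: "C1_on V g" and ph: "smooth \<phi>"
 and supp: "!!z. \<phi> z ~= 0 ==> z \<in> K" and b: "b \<in> Basis"
 shows "(LINT z:K|Leb. g z * pd b \<phi> z) = - (LINT z:K|Leb. pd b g z * \<phi> z)"
proof -
 have oK: "open (- K)" using compact_imp_closed[OF K] by (simp add: open_Compl)
 define W where "W z = (if z \<in> V then g z * \<phi> z else 0)" for z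
 have W_V: "W differentiable (at z) & pd c W z = g z * pd c \<phi> z + pd c g z * \<phi> z" if "z \<in> V" for z c
 proof -
 have d: "g differentiable (at z)" "\<phi> differentiable (at z)"
 using g that smooth_differentiable[OF ph] unfolding C1_on_def by auto
 have "(%z. g z * \<phi> z) differentiable (at z)" by (rule differentiable_mult[OF d])
 from pd_transform[OF V(1) that _ this, of W] pd_mult[OF d] show ?thesis by (simp add: W_def)
 qed
 have W_K: "W differentiable (at z) & pd c W z = 0" if "z \<notin> K" for z c
 proof (rule pd_zero[OF oK])
 show "z \<in> - K" using that by simp
 show "W w = 0" if "w \<in> - K" for w using that supp by (auto simp: W_def)
 qed
 have ph_K: "pd c \<phi> z = 0" if "z \<notin> K" for z c
 using pd_zero[OF oK, of z \<phi>] that supp by blast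
 have C1W: "C1_on UNIV W" unfolding C1_on_def
 proof (intro conjI ballI)
 show "W differentiable (at z)" for z using W_V W_K V(2) by blast
 fix c :: 'a assume c: "c \<in> Basis"
 have UV: "UNIV = V \<union> (- K)" using V(2) by blast
 have "cts V (pd c g)" using g c unfolding C1_on_def by blast
 then have "cts V (%z. g z * pd c \<phi> z + pd c g z * \<phi> z)"
 by (intro continuous_on_add continuous_on_mult C1_on_continuous[OF g]
 smooth_continuous[OF ph] smooth_continuous[OF smooth_pd[OF ph c]])
 then have 1: "cts V (pd c W)" by (rule continuous_on_cong[THEN iffD1, rotated 2]) (use W_V in auto)
 have 2: "cts (- K) (pd c W)"
 by (rule continuous_on_cong[THEN iffD1, OF refl _ continuous_on_const[of _ 0]]) (use W_K in auto)
 show "cts UNIV (pd c W)" unfolding UV by (rule continuous_on_open_Un[OF V(1) oK 1 2])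
 qed
 obtain R where R: "!!z. z \<in> K ==> norm z <= R" using compact_imp_bounded[OF K] unfolding bounded_iff by blast
 have "integral\<^sup>L lborel (pd b W) = 0"
 by (rule integral_pd_compact_support[OF C1W _ b]) (use supp R in "auto simp: W_def split: if_splits")
 moreover have "integral\<^sup>L Leb (pd b W) = integral\<^sup>L lborel (pd b W)"
 using C1W b unfolding C1_on_def by (intro integral_completion) (auto intro: borel_measurable_continuous_onI)
 ultimately have I0: "integral\<^sup>L Leb (pd b W) = 0" by simp
 have "pd b W = (%z. indicator K z *\<^sub>R (g z * pd b \<phi> z + pd b g z * \<phi> z))"
 proof
 fix z show "pd b W z = indicator K z *\<^sub>R (g z * pd b \<phi> z + pd b g z * \<phi> z)"
 using W_V[of z b] W_K[of z b] V(2) by (cases "z \<in> K") auto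
 qed
 with I0 have "(LINT z:K|Leb. g z * pd b \<phi> z + pd b g z * \<phi> z) = 0"
 unfolding set_lebesgue_integral_def by simp
 moreover have "(LINT z:K|Leb. g z * pd b \<phi> z + pd b g z * \<phi> z)
 = (LINT z:K|Leb. g z * pd b \<phi> z) + (LINT z:K|Leb. pd b g z * \<phi> z)"
 proof (rule set_integral_add(2))
 have c: "cts K g" "cts K (pd b g)"
 using C1_on_continuous[OF g] g b V(2) unfolding C1_on_def by (auto intro: continuous_on_subset)
 show "set_int Leb K (%z. g z * pd b \<phi> z)" "set_int Leb K (%z. pd b g z * \<phi> z)"
 by (intro set_integrable_continuous_compact K continuous_intros c smooth_continuous ph smooth_pd b)+
 qed
 ultimately show ?thesis by simp
qed

text \<open>Converse of the approximation result: integration by parts for the approximants passes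
  to the limit against bounded test functions. The open sets \<open>V n\<close> may vary with
  \<open>n\<close>, which admits compositions that are defined only near \<open>K\<close>.\<close>

lemma has_weak_derivI_approx:
 fixes S :: "'a::euclidean_space set"
 assumes b: "b \<in> Basis" and li: "loc_int S f" "loc_int S f'"
 and approx: "!!K. compact K ==> K \<subseteq> S ==>
 \<exists>g V. (\<forall>n. open (V n) & K \<subseteq> V n & C1_on (V n) (g n)) & L1lim K g f & L1lim K (%n. pd b (g n)) f'"
 shows "wder S b f f'"
 unfolding has_weak_deriv_def
proof (intro conjI li ballI)
 fix \<phi> assume "\<phi> \<in> test_functions S"
 then have ph: "smooth \<phi>" and K: "compact (closure {z. \<phi> z ~= 0})" "closure {z. \<phi> z ~= 0} \<subseteq> S"
 unfolding test_functions_def by auto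
 define K' where "K' = closure {z. \<phi> z ~= 0}"
 have supp: "\<phi> z ~= 0 ==> z \<in> K'" for z unfolding K'_def by (auto intro: closure_subset[THEN subsetD])
 have oK: "open (- K')" unfolding K'_def by (rule open_Compl) (rule closed_closure)
 have ph_K: "pd b \<phi> z = 0" if "z \<notin> K'" for z
 using pd_zero[OF oK, of z \<phi>] that supp by blast
 have K': "compact K'" "K' \<subseteq> S" using K unfolding K'_def by auto
 obtain g V where gV: "!!n. open (V n)" "!!n. K' \<subseteq> V n" "!!n. C1_on (V n) (g n)"
 "L1lim K' g f" "L1lim K' (%n. pd b (g n)) f'" using approx[OF K'] by metis
 have i: "set_int Leb K' f" "set_int Leb K' f'"
 using li K' integrable_on_compact by blast+
 have gi: "set_int Leb K' (g n)" "set_int Leb K' (pd b (g n))" for n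
 using C1_integrable[OF gV(3) K'(1) gV(2)] b by auto
 have c: "cts K' \<phi>" "cts K' (pd b \<phi>)" using ph smooth_pd[OF ph b] by (auto intro: smooth_continuous)
 have "bounded (\<phi> ` K')" "bounded (pd b \<phi> ` K')"
 using c K'(1) by (auto intro!: compact_imp_bounded compact_continuous_image)
 then obtain B1 B2 where "\<forall>x\<in>\<phi> ` K'. norm x <= B1" "\<forall>x\<in>pd b \<phi> ` K'. norm x <= B2" unfolding bounded_iff by blast
 then have B1: "!!z. z \<in> K' ==> abs (\<phi> z) <= abs B1" and B2: "!!z. z \<in> K' ==> abs (pd b \<phi> z) <= abs B2" by force+
 have "abs ((LINT z:K'|Leb. f z * pd b \<phi> z) + (LINT z:K'|Leb. f' z * \<phi> z)) <= (abs B1 + abs B2) * e"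
 if e: "e > 0" for e
 proof -
 have "\<forall>\<^sub>F n in sequentially. (\<integral>\<^sup>+z. ennreal \<bar>g n z - f z\<bar> * indicator K' z \<partial>Leb) <= ennreal e
 & (\<integral>\<^sup>+z. ennreal \<bar>pd b (g n) z - f' z\<bar> * indicator K' z \<partial>Leb) <= ennreal e"
 using gV(4,5) e unfolding L1lim_def by (intro eventually_conj) simp_all
 then obtain n where n: "(\<integral>\<^sup>+z. ennreal \<bar>g n z - f z\<bar> * indicator K' z \<partial>Leb) <= ennreal e"
 "(\<integral>\<^sup>+z. ennreal \<bar>pd b (g n) z - f' z\<bar> * indicator K' z \<partial>Leb) <= ennreal e"
 using eventually_happens'[OF sequentially_bot] by blast
 have 1: "abs ((LINT z:K'|Leb. g n z * pd b \<phi> z) - (LINT z:K'|Leb. f z * pd b \<phi> z)) <= abs B2 * e"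
 by (rule set_integral_L1lim[OF gi(1) i(1) c(2) B2 K'(1) n(1)]) (use e in auto)
 have 2: "abs ((LINT z:K'|Leb. pd b (g n) z * \<phi> z) - (LINT z:K'|Leb. f' z * \<phi> z)) <= abs B1 * e"
 by (rule set_integral_L1lim[OF gi(2) i(2) c(1) B1 K'(1) n(2)]) (use e in auto)
 have 3: "(LINT z:K'|Leb. g n z * pd b \<phi> z) = - (LINT z:K'|Leb. pd b (g n) z * \<phi> z)"
 by (rule integration_by_parts_compact[OF gV(1,2) K'(1) gV(3) ph supp b])
 show ?thesis using 1 2 3 by (simp add: distrib_right)
 qed
 then have "abs ((LINT z:K'|Leb. f z * pd b \<phi> z) + (LINT z:K'|Leb. f' z * \<phi> z)) <= 0"
 proof -
 assume a: "!!e. 0 < e ==> abs ((LINT z:K'|Leb. f z * pd b \<phi> z) + (LINT z:K'|Leb. f' z * \<phi> z)) <= (abs B1 + abs B2) * e"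
 show ?thesis
 proof (rule field_le_epsilon)
 fix e :: real assume e: "0 < e"
 have "(abs B1 + abs B2) * (e / (abs B1 + abs B2 + 1)) <= e"
 using e by (simp add: field_simps)
 then show "abs ((LINT z:K'|Leb. f z * pd b \<phi> z) + (LINT z:K'|Leb. f' z * \<phi> z)) <= 0 + e"
 using a[of "e / (abs B1 + abs B2 + 1)"] e by force
 qed
 qed
 moreover have "(LINT z:S|Leb. f z * pd b \<phi> z) = (LINT z:K'|Leb. f z * pd b \<phi> z)"
 "(LINT z:S|Leb. f' z * \<phi> z) = (LINT z:K'|Leb. f' z * \<phi> z)"
 unfolding set_lebesgue_integral_def
 by (rule Bochner_Integration.integral_cong; use ph_K supp K'(2) in "auto simp: indicator_def")+
 ultimately show "(LINT z:S|Leb. f z * pd b \<phi> z) = - (LINT z:S|Leb. f' z * \<phi> z)" by simp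
qed

lemma locally_integrable_continuous: "cts S f ==> loc_int S f"
 unfolding locally_integrable_def by (auto intro: set_integrable_continuous_compact continuous_on_subset)

lemma L1lim_const: "L1lim K (%n. f) f"
 unfolding L1lim_def by simp

lemma has_weak_deriv_C1:
 fixes S :: "'a::euclidean_space set"
 assumes "open S" "C1_on S f" "b \<in> Basis"
 shows "wder S b f (pd b f)"
proof (rule has_weak_derivI_approx[OF assms(3)])
 show "loc_int S f" "loc_int S (pd b f)"
 using assms C1_on_continuous[OF assms(2)] by (auto simp: C1_on_def intro: locally_integrable_continuous)
 fix K :: "'a set" assume "compact K" "K \<subseteq> S"
 then show "\<exists>g V. (\<forall>n. open (V n) & K \<subseteq> V n & C1_on (V n) (g n)) & L1lim K g f & L1lim K (%n. pd b (g n)) (pd b f)"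
 using assms by (intro exI[of _ "%_. f"] exI[of _ "%_. S"]) (simp add: L1lim_const)
qed

lemma set_integrable_mult_continuous:
 fixes u a :: "'a::euclidean_space => real"
 assumes K: "compact K" and a: "cts K a" and u: "set_int Leb K u"
 shows "set_int Leb K (%z. a z * u z)"
proof -
 have "bounded (a ` K)" by (rule compact_imp_bounded[OF compact_continuous_image[OF a K]])
 then obtain B0 where "\<forall>x\<in>a ` K. norm x <= B0" unfolding bounded_iff by blast
 then have B: "!!z. z \<in> K ==> abs (a z) <= abs B0" by force
 have "set_int Leb K a" by (rule set_integrable_continuous_compact[OF K a])
 then have m: "(%z. (indicator K z *\<^sub>R a z) * (indicator K z *\<^sub>R u z)) \<in> borel_measurable Leb"
 using u unfolding set_integrable_def by measurable
 have "integrable Leb (%z. (indicator K z *\<^sub>R a z) * (indicator K z *\<^sub>R u z))"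
 proof (rule Bochner_Integration.integrable_bound[OF _ m])
 show "integrable Leb (%z. B0 * (indicator K z *\<^sub>R u z))"
 using u unfolding set_integrable_def by (intro integrable_mult_right)
 show "AE z in Leb. norm ((indicator K z *\<^sub>R a z) * (indicator K z *\<^sub>R u z)) <= norm (B0 * (indicator K z *\<^sub>R u z))"
 proof (rule AE_I2)
 fix z
 show "norm ((indicator K z *\<^sub>R a z) * (indicator K z *\<^sub>R u z)) <= norm (B0 * (indicator K z *\<^sub>R u z))"
 using B[of z] mult_right_mono[of "abs (a z)" "abs B0" "abs (u z)"]
 by (cases "z \<in> K") (auto simp: abs_mult)
 qed
 qed
 moreover have "(%z. (indicator K z *\<^sub>R a z) * (indicator K z *\<^sub>R u z)) = (%z. indicator K z *\<^sub>R (a z * u z))"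
 by (auto simp: indicator_def)
 ultimately show ?thesis unfolding set_integrable_def by simp
qed

lemma locally_integrable_mult:
 "cts S a ==> loc_int S u ==> loc_int S (%z. a z * u z)"
 unfolding locally_integrable_def by (blast intro: set_integrable_mult_continuous continuous_on_subset)

lemma locally_integrable_add:
 "loc_int S u ==> loc_int S v ==> loc_int S (%z. u z + v z)"
 unfolding locally_integrable_def by (blast intro: set_integral_add(1))

lemma set_integrable_cong_AE_lebesgue:
 fixes u v :: "'a::euclidean_space => real"
 assumes "set_int Leb K u" "AE z in Leb. z \<in> K --> u z = v z"
 shows "set_int Leb K v"
proof -
 have AE: "AE z in Leb. indicator K z *\<^sub>R u z = indicator K z *\<^sub>R v z"
 using assms(2) by (rule AE_mp) (auto intro!: AE_I2 simp: indicator_def)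
 have i: "integrable Leb (%z. indicator K z *\<^sub>R u z)" using assms(1) unfolding set_integrable_def .
 show ?thesis unfolding set_integrable_def
 by (rule integrable_cong_AE_imp[OF i borel_measurable_AE[OF borel_measurable_integrable[OF i] AE] AE])
qed

lemma locally_integrable_cong_AE:
 assumes "loc_int S u" "AE z in Leb. z \<in> S --> u z = v z"
 shows "loc_int S v"
 unfolding locally_integrable_def
proof (intro allI impI)
 fix K assume K: "compact K & K \<subseteq> S"
 have "AE z in Leb. z \<in> K --> u z = v z" using assms(2) by (rule AE_mp) (use K in "auto intro!: AE_I2")
 then show "set_int Leb K v"
 using assms(1) K set_integrable_cong_AE_lebesgue unfolding locally_integrable_def by blast
qed

text \<open>Measurability is not assumed: if one integrand fails to be measurable, so does the
  other, and both integrals are zero by convention.\<close>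

lemma set_lebesgue_integral_cong_AE2:
 fixes u v :: "'a::euclidean_space => real"
 assumes "AE z in Leb. z \<in> S --> u z = v z"
 shows "(LINT z:S|Leb. u z) = (LINT z:S|Leb. v z)"
proof -
 have AE: "AE z in Leb. indicator S z *\<^sub>R u z = indicator S z *\<^sub>R v z"
 using assms by (rule AE_mp) (auto intro!: AE_I2 simp: indicator_def)
 have AE': "AE z in Leb. indicator S z *\<^sub>R v z = indicator S z *\<^sub>R u z"
 using AE by (rule AE_mp) (auto intro!: AE_I2)
 show ?thesis
 proof (cases "(%z. indicator S z *\<^sub>R u z) \<in> borel_measurable Leb")
 case True
 then show ?thesis unfolding set_lebesgue_integral_def using lebesgue_integral_cong_AE[OF True AE] by simp
 next
 case False
 then have "(%z. indicator S z *\<^sub>R v z) \<notin> borel_measurable Leb"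
 using borel_measurable_AE[OF _ AE'] by blast
 then show ?thesis unfolding set_lebesgue_integral_def using False
 by (metis borel_measurable_integrable not_integrable_integral_eq)
 qed
qed

lemma has_weak_deriv_cong_AE:
 assumes w: "wder S b f f'"
 and AE: "AE z in Leb. z \<in> S --> f z = k z" "AE z in Leb. z \<in> S --> f' z = k' z"
 shows "wder S b k k'"
proof -
 have "(LINT z:S|Leb. k z * pd b \<phi> z) = (LINT z:S|Leb. f z * pd b \<phi> z)"
 "(LINT z:S|Leb. k' z * \<phi> z) = (LINT z:S|Leb. f' z * \<phi> z)" for \<phi>
 by (rule set_lebesgue_integral_cong_AE2, use AE(1) in \<open>rule AE_mp\<close>, auto intro!: AE_I2)
 (rule set_lebesgue_integral_cong_AE2, use AE(2) in \<open>rule AE_mp\<close>, auto intro!: AE_I2)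
 then show ?thesis
 using w locally_integrable_cong_AE[OF _ AE(1)] locally_integrable_cong_AE[OF _ AE(2)]
 unfolding has_weak_deriv_def by auto
qed

lemma has_weak_deriv_wd: "wder S b f f' ==> wder S b f (wd S b f)"
 unfolding wd_def by (rule someI[of "wder S b f"])

section \<open>Chain rule and shear maps\<close>

lemma uniform_limit_compose_pair:
 fixes A :: "real \<times> real => real"
 assumes lim: "uniform_limit K f' f sequentially" "uniform_limit K g' g sequentially"
 and Q: "compact Q" "cts Q A"
 and im: "!!z. z \<in> K ==> (f z, g z) \<in> Q" "!!n z. z \<in> K ==> (f' n z, g' n z) \<in> Q"
 shows "uniform_limit K (%n z. A (f' n z, g' n z)) (%z. A (f z, g z)) sequentially"
 unfolding uniform_limit_iff
proof (intro allI impI)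
 fix e :: real assume "e > 0"
 with compact_uniformly_continuous[OF Q(2,1)] obtain d where d: "d > 0"
 "!!x y. x \<in> Q ==> y \<in> Q ==> dist y x < d ==> dist (A y) (A x) < e"
 unfolding uniformly_continuous_on_def by metis
 have "\<forall>\<^sub>F n in sequentially. \<forall>z\<in>K. dist (f' n z) (f z) < d / 2" "\<forall>\<^sub>F n in sequentially. \<forall>z\<in>K. dist (g' n z) (g z) < d / 2"
 using uniform_limitD[OF lim(1), of "d / 2"] uniform_limitD[OF lim(2), of "d / 2"] d(1) by auto
 then show "\<forall>\<^sub>F n in sequentially. \<forall>z\<in>K. dist (A (f' n z, g' n z)) (A (f z, g z)) < e"
 proof eventually_elim
 case (elim n)
 show ?case
 proof
 fix z assume z: "z \<in> K"
 have "dist (f' n z, g' n z) (f z, g z) <= dist (f' n z) (f z) + dist (g' n z) (g z)"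
 unfolding dist_Pair_Pair by (rule sqrt_sum_squares_le_sum) auto
 then have "dist (f' n z, g' n z) (f z, g z) < d" using elim z by force
 then show "dist (A (f' n z, g' n z)) (A (f z, g z)) < e" by (intro d(2) im z)
 qed
 qed
qed

lemma uniform_limit_shift:
 "uniform_limit K f' f sequentially ==> uniform_limit K (%n. f' (n + N)) f sequentially"
 unfolding uniform_limit_iff eventually_sequentially by (meson trans_le_add1)

lemma L1lim_shift: "L1lim K u v ==> L1lim K (%n. u (n + N)) v"
 unfolding L1lim_def eventually_sequentially by (meson trans_le_add1)

text \<open>The approximants are \<open>F\<close> applied to mollified \<open>f\<close> and
  \<open>g\<close>. Their derivatives are sums of products of a uniformly convergent factor and an
  \<open>L\<^sub>1\<close> convergent one, so continuity of the partial derivatives \<open>A\<close>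
  and \<open>C\<close> suffices for the limit.\<close>

lemma has_weak_deriv_chain:
 fixes S :: "'a::euclidean_space set" and F :: "real \<times> real => real"
 assumes S: "open S" and b: "b \<in> Basis"
 and f: "cts S f" "wder S b f f'"
 and g: "cts S g" "wder S b g g'"
 and V: "open V" "!!z. z \<in> S ==> (f z, g z) \<in> V"
 and F: "!!w. w \<in> V ==> (F has_derivative (%(s, t). A w * s + C w * t)) (at w)"
 and AC: "cts V A" "cts V C"
 shows "wder S b (%z. F (f z, g z)) (%z. A (f z, g z) * f' z + C (f z, g z) * g' z)"
proof -
 have cF: "cts V F"
 using has_derivative_continuous[OF F] by (simp add: continuous_at_imp_continuous_on)
 have cfg: "cts S (%z. (f z, g z))" using f g by (intro continuous_intros)
 have comp: "cts S (%z. B (f z, g z))" if "cts V B" for B :: "real \<times> real => real"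
 by (rule continuous_on_compose2[OF that cfg]) (use V(2) in auto)
 have li: "loc_int S f'" "loc_int S g'" using f g unfolding has_weak_deriv_def by auto
 show ?thesis
 proof (rule has_weak_derivI_approx[OF b])
 show "loc_int S (%z. F (f z, g z))" by (rule locally_integrable_continuous[OF comp[OF cF]])
 show "loc_int S (%z. A (f z, g z) * f' z + C (f z, g z) * g' z)"
 by (intro locally_integrable_add locally_integrable_mult comp AC li)
 fix K :: "'a set" assume K: "compact K" "K \<subseteq> S"
 obtain fn where fn: "!!n. C1_on UNIV (fn n)" "uniform_limit K fn f sequentially" "L1lim K (%n. pd b (fn n)) f'"
 using weak_deriv_approx[OF S K f(1)] f(2) b by blast
 obtain gn where gn: "!!n. C1_on UNIV (gn n)" "uniform_limit K gn g sequentially" "L1lim K (%n. pd b (gn n)) g'"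
 using weak_deriv_approx[OF S K g(1)] g(2) b by blast
 have "compact ((%z. (f z, g z)) ` K)" "(%z. (f z, g z)) ` K \<subseteq> V"
 using compact_continuous_image[OF continuous_on_subset[OF cfg K(2)] K(1)] V(2) K(2) by auto
 then obtain r Q where rQ: "0 < r" "compact Q" "Q \<subseteq> V" "!!w. w \<in> (%z. (f z, g z)) ` K ==> cball w r \<subseteq> Q"
 by (rule compact_thicken[OF _ V(1)]) (rule that)
 have "\<forall>\<^sub>F n in sequentially. (\<forall>z\<in>K. dist (fn n z) (f z) < r / 2) & (\<forall>z\<in>K. dist (gn n z) (g z) < r / 2)"
 using uniform_limitD[OF fn(2), of "r / 2"] uniform_limitD[OF gn(2), of "r / 2"] rQ(1)
 by (intro eventually_conj) auto
 then obtain N where N: "!!n z. n \<ge> N ==> z \<in> K ==> dist (fn n z) (f z) < r / 2"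
 "!!n z. n \<ge> N ==> z \<in> K ==> dist (gn n z) (g z) < r / 2"
 unfolding eventually_sequentially by blast
 \<comment> \<open>\<open>F\<close> is controlled only on \<open>V\<close>. Dropping the first
   \<open>N\<close> members keeps the approximating pairs in the compact neighbourhood
   \<open>Q\<close> of the image of \<open>K\<close>.\<close>
 define fm where "fm n = fn (n + N)" for n
 define gm where "gm n = gn (n + N)" for n
 have fm: "!!n. C1_on UNIV (fm n)" "uniform_limit K fm f sequentially" "L1lim K (%n. pd b (fm n)) f'"
 unfolding fm_def using fn uniform_limit_shift L1lim_shift[of K "%n. pd b (fn n)"] by auto
 have gm: "!!n. C1_on UNIV (gm n)" "uniform_limit K gm g sequentially" "L1lim K (%n. pd b (gm n)) g'"
 unfolding gm_def using gn uniform_limit_shift L1lim_shift[of K "%n. pd b (gn n)"] by auto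
 have inQ: "(f z, g z) \<in> Q" "(fm n z, gm n z) \<in> Q" if z: "z \<in> K" for n z
 proof -
 have sub: "cball (f z, g z) r \<subseteq> Q" using rQ(4) z by blast
 then show "(f z, g z) \<in> Q" using rQ(1) by auto
 have "dist (f z, g z) (fm n z, gm n z) <= dist (f z) (fm n z) + dist (g z) (gm n z)"
 unfolding dist_Pair_Pair by (rule sqrt_sum_squares_le_sum) auto
 moreover have "dist (f z) (fm n z) < r / 2" "dist (g z) (gm n z) < r / 2"
 unfolding fm_def gm_def using N[of "n + N" z] z by (simp_all add: dist_commute)
 ultimately have "(fm n z, gm n z) \<in> cball (f z, g z) r" by simp
 then show "(fm n z, gm n z) \<in> Q" using sub by blast
 qed
 define W where "W n = {z. (fm n z, gm n z) \<in> V}" for n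
 have cfgm: "cts X (%z. (fm n z, gm n z))" for n X
 using C1_on_continuous[OF fm(1)] C1_on_continuous[OF gm(1)]
 by (intro continuous_intros) (auto intro: continuous_on_subset)
 have W: "open (W n)" "K \<subseteq> W n" for n
 proof -
 have "open ((%z. (fm n z, gm n z)) -` V)" by (rule open_vimage[OF V(1) cfgm])
 then show "open (W n)" unfolding W_def vimage_def .
 show "K \<subseteq> W n" unfolding W_def using inQ(2) rQ(3) by blast
 qed
 define h where "h n z = F (fm n z, gm n z)" for n z
 have D: "h n differentiable (at z) & pd c (h n) z = A (fm n z, gm n z) * pd c (fm n) z + C (fm n z, gm n z) * pd c (gm n) z"
 if "z \<in> W n" for n z c
 proof -
 have "fm n differentiable (at z)" "gm n differentiable (at z)" using fm(1) gm(1) unfolding C1_on_def by auto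
 then obtain D1 D2 where D: "(fm n has_derivative D1) (at z)" "(gm n has_derivative D2) (at z)"
 unfolding differentiable_def by blast
 have "((%z. (fm n z, gm n z)) has_derivative (%h. (D1 h, D2 h))) (at z)"
 by (rule has_derivative_Pair[OF D])
 from has_derivative_compose[OF this F] that
 have "(h n has_derivative (%x. A (fm n z, gm n z) * D1 x + C (fm n z, gm n z) * D2 x)) (at z)"
 unfolding h_def W_def by auto
 then show ?thesis using pd_eqI D by (auto simp: differentiable_def pd_eqI[OF D(1)] pd_eqI[OF D(2)])
 qed
 have compW: "cts (W n) (%z. B (fm n z, gm n z))" if "cts V B" for B :: "real \<times> real => real" and n
 by (rule continuous_on_compose2[OF that cfgm]) (auto simp: W_def)
 have C1h: "C1_on (W n) (h n)" for n unfolding C1_on_def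
 proof (intro conjI ballI)
 show "h n differentiable (at z)" if "z \<in> W n" for z using D[OF that] by blast
 fix c :: 'a assume c: "c \<in> Basis"
 have "cts (W n) (pd c (fm n))" "cts (W n) (pd c (gm n))"
 using fm(1)[of n] gm(1)[of n] c continuous_on_subset[OF _ subset_UNIV] unfolding C1_on_def by blast+
 then have "cts (W n) (%z. A (fm n z, gm n z) * pd c (fm n) z + C (fm n z, gm n z) * pd c (gm n) z)"
 by (intro continuous_on_add continuous_on_mult compW AC)
 then show "cts (W n) (pd c (h n))"
 by (rule continuous_on_cong[THEN iffD1, rotated 2]) (use D in auto)
 qed
 have int: "set_int Leb K (%z. B (fm n z, gm n z) * pd b k z)"
 if "cts V B" "C1_on UNIV k" for B :: "real \<times> real => real" and n k
 by (rule set_integrable_mult_continuous[OF K(1) continuous_on_subset[OF compW[OF that(1)] W(2)]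
 C1_integrable(2)[OF that(2) K(1) subset_UNIV b]])
 have int': "set_int Leb K (%z. B (f z, g z) * u z)"
 if "cts V B" "loc_int S u" for B :: "real \<times> real => real" and u
 by (rule integrable_on_compact[OF locally_integrable_mult[OF comp[OF that(1)] that(2)] K])
 have L: "L1lim K (%n z. B (fm n z, gm n z) * pd b (k n) z) (%z. B (f z, g z) * u z)"
 if "cts V B" "loc_int S u" "!!n. C1_on UNIV (k n)" "L1lim K (%n. pd b (k n)) u"
 for B :: "real \<times> real => real" and u and k :: "nat => 'a => real"
 proof (rule L1lim_mult[OF K(1) _ _ _ _ that(4)])
 show "uniform_limit K (%n z. B (fm n z, gm n z)) (%z. B (f z, g z)) sequentially"
 by (rule uniform_limit_compose_pair[OF fm(2) gm(2) rQ(2) continuous_on_subset[OF that(1) rQ(3)] inQ])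
 show "cts K (%z. B (f z, g z))" by (rule continuous_on_subset[OF comp[OF that(1)] K(2)])
 show "set_int Leb K (pd b (k n))" for n by (rule C1_integrable(2)[OF that(3) K(1) subset_UNIV b])
 show "set_int Leb K u" by (rule integrable_on_compact[OF that(2) K])
 qed
 have "L1lim K h (%z. F (f z, g z))"
 unfolding h_def
 by (rule L1lim_uniform[OF K(1)
 uniform_limit_compose_pair[OF fm(2) gm(2) rQ(2) continuous_on_subset[OF cF rQ(3)] inQ]])
 moreover have "L1lim K (%n. pd b (h n)) (%z. A (f z, g z) * f' z + C (f z, g z) * g' z)"
 proof -
 have l: "L1lim K (%n z. A (fm n z, gm n z) * pd b (fm n) z + C (fm n z, gm n z) * pd b (gm n) z)
 (%z. A (f z, g z) * f' z + C (f z, g z) * g' z)"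
 by (rule L1lim_add[OF int[OF AC(1) fm(1)] int'[OF AC(1) li(1)] L[OF AC(1) li(1) fm(1) fm(3)]
 int[OF AC(2) gm(1)] int'[OF AC(2) li(2)] L[OF AC(2) li(2) gm(1) gm(3)]])
 have e: "ennreal \<bar>pd b (h n) z - w\<bar> * indicator K z
 = ennreal \<bar>A (fm n z, gm n z) * pd b (fm n) z + C (fm n z, gm n z) * pd b (gm n) z - w\<bar> * indicator K z" for n z w
 using D[of z n b] W(2)[of n] by (auto simp: indicator_def)
 show ?thesis using l unfolding L1lim_def e .
 qed
 ultimately show "\<exists>k V. (\<forall>n. open (V n) & K \<subseteq> V n & C1_on (V n) (k n)) & L1lim K k (%z. F (f z, g z))
 & L1lim K (%n. pd b (k n)) (%z. A (f z, g z) * f' z + C (f z, g z) * g' z)"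
 using W C1h by blast
 qed
qed

lemma has_derivative_pd_prod:
 fixes f :: "real \<times> real => real"
 assumes "f differentiable (at z)"
 shows "(f has_derivative (%(s, t). pd ex f z * s + pd ey f z * t)) (at z)"
proof -
 obtain D where D: "(f has_derivative D) (at z)" using assms unfolding differentiable_def by blast
 interpret bounded_linear D by (rule has_derivative_bounded_linear[OF D])
 have "D (s, t) = pd ex f z * s + pd ey f z * t" for s t
 proof -
 have "D (s, t) = D (s *\<^sub>R (1, 0) + t *\<^sub>R (0, 1))" by simp
 also have "... = pd ex f z * s + pd ey f z * t"
 unfolding add scaleR pd_eqI[OF D] by simp
 finally show ?thesis .
 qed
 then have "D = (%(s, t). pd ex f z * s + pd ey f z * t)" by auto
 with D show ?thesis by simp
qed

section \<open>Coordinates in the plane and maps with bounded distortion of measure\<close>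

lemma Basis_prod_real: "(Basis :: (real \<times> real) set) = {ex, ey}"
 by (auto simp: Basis_prod_def)

lemma ex_ey_Basis: "ex \<in> Basis" "ey \<in> Basis"
 by (auto simp: Basis_prod_real)

text \<open>The image under \<open>G\<close> of Lebesgue measure on \<open>T\<close> is at most
  \<open>c\<close> times Lebesgue measure on \<open>S\<close>. This inequality makes preimages of
  null sets null and preserves local integrability, \<open>L\<^sub>r\<close> bounds and
  \<open>L\<^sub>1\<close> limits under composition. It is weaker than a substitution formula, so
  that projections restricted to bounded slabs qualify as well as shears.\<close>

definition nonsingular :: "real => ('a::euclidean_space => 'b::euclidean_space) => 'a set => 'b set => bool" where
 "nonsingular c G T S \<longleftrightarrow> open T & open S & cts T G & G ` T \<subseteq> S &
 (\<forall>w::'b => ennreal. w \<in> borel_measurable borel -->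
 (\<integral>\<^sup>+z. w (G z) * indicator T z \<partial>lborel) <= ennreal c * (\<integral>\<^sup>+z. w z * indicator S z \<partial>lborel))"

lemma nonsingular_measurable_borel:
 assumes G: "nonsingular c G T S" and w: "w \<in> borel_measurable (borel :: 'b::euclidean_space measure)"
 shows "(%z. w (G z) * indicator T z :: real) \<in> borel_measurable borel"
proof -
 have T: "open T" "cts T G" using G unfolding nonsingular_def by auto
 have [measurable]: "T \<in> sets borel" using T by simp
 have "(%z. if z \<in> T then G z else 0) \<in> borel_measurable borel"
 by (rule borel_measurable_continuous_on_if) (use T in auto)
 from measurable_compose[OF this w]
 have "(%z. indicator T z *\<^sub>R w (if z \<in> T then G z else 0)) \<in> borel_measurable borel"
 by measurable
 moreover have "(%z. indicator T z *\<^sub>R w (if z \<in> T then G z else 0)) = (%z. w (G z) * indicator T z)"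
 by (auto simp: indicator_def)
 ultimately show ?thesis by simp
qed

text \<open>The inequality is applied to the indicator of a Borel null set that contains the
  exceptional set.\<close>

lemma nonsingular_AE:
 assumes G: "nonsingular c G T S" and P: "AE z in Leb. z \<in> S --> P z"
 shows "AE z in Leb. z \<in> T --> P (G z)"
proof -
 have T: "open T" "cts T G" "G ` T \<subseteq> S" using G unfolding nonsingular_def by auto
 have "AE z in lborel. z \<in> S --> P z" using P by (simp add: AE_completion_iff)
 then obtain N where N: "N \<in> null_sets lborel" "{z. \<not> (z \<in> S --> P z)} \<subseteq> N"
 unfolding eventually_ae_filter by auto
 have Nm: "N \<in> sets borel" "emeasure lborel N = 0" using N(1) by auto
 have wm: "(indicator N :: _ => ennreal) \<in> borel_measurable borel" using Nm by simp
 have "(\<integral>\<^sup>+z. indicator N z * indicator S z \<partial>lborel) <= (\<integral>\<^sup>+z. indicator N z \<partial>lborel)"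
 by (rule nn_integral_mono) (auto simp: indicator_def)
 also have "... = 0" using Nm by simp
 finally have "(\<integral>\<^sup>+z. indicator N z * indicator S z \<partial>lborel) = (0::ennreal)" by simp
 moreover have "(\<integral>\<^sup>+z. indicator N (G z) * indicator T z \<partial>lborel) <= ennreal c * (\<integral>\<^sup>+z. indicator N z * indicator S z \<partial>lborel)"
 using G wm unfolding nonsingular_def by blast
 ultimately have 0: "(\<integral>\<^sup>+z. indicator N (G z) * indicator T z \<partial>lborel) = (0::ennreal)" by simp
 have "(%z. indicator N (G z) * indicator T z :: real) \<in> borel_measurable borel"
 by (rule nonsingular_measurable_borel[OF G]) (use Nm in simp)
 then have "(%z. ennreal (indicator N (G z) * indicator T z)) \<in> borel_measurable borel" by measurable
 moreover have "(%z. ennreal (indicator N (G z) * indicator T z)) = (%z. indicator N (G z) * indicator T z)"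
 by (auto simp: indicator_def)
 ultimately have m: "(%z. indicator N (G z) * indicator T z :: ennreal) \<in> borel_measurable lborel" by simp
 from 0 have "AE z in lborel. indicator N (G z) * indicator T z = (0::ennreal)"
 using nn_integral_0_iff_AE[OF m] by simp
 then have "AE z in lborel. z \<in> T --> P (G z)"
 proof (rule AE_mp, intro AE_I2 impI)
 fix z assume "indicator N (G z) * indicator T z = (0::ennreal)" "z \<in> T"
 then have "G z \<notin> N" "G z \<in> S" using T(3) by (auto simp: indicator_def)
 then show "P (G z)" using N(2) by auto
 qed
 then show ?thesis by (rule AE_completion)
qed

text \<open>A Lebesgue measurable function composed with a continuous map need not be measurable.
  Here a Borel version differs from \<open>u\<close> only on a null set, and the preimage of that
  set is null.\<close>

lemma nonsingular_measurable:
 fixes u :: "'b::euclidean_space => real"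
 assumes G: "nonsingular c G T S" and u: "(%z. indicator S z * u z) \<in> borel_measurable Leb"
 shows "(%z. indicator T z * u (G z)) \<in> borel_measurable Leb"
proof -
 have T: "G ` T \<subseteq> S" using G unfolding nonsingular_def by auto
 obtain u' where u': "u' \<in> borel_measurable lborel" "AE z in lborel. indicator S z * u z = u' z"
 using completion_ex_borel_measurable_real[OF u] by blast
 have "AE z in Leb. z \<in> S --> u' z = u z" using AE_completion[OF u'(2)] by (rule AE_mp) (auto intro!: AE_I2)
 from nonsingular_AE[OF G this] have AE: "AE z in Leb. u' (G z) * indicator T z = indicator T z * u (G z)"
 by (rule AE_mp) (auto intro!: AE_I2 simp: indicator_def)
 have "(%z. u' (G z) * indicator T z) \<in> borel_measurable borel"
 by (rule nonsingular_measurable_borel[OF G]) (use u' in simp)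
 then have "(%z. u' (G z) * indicator T z) \<in> borel_measurable Leb" by (intro measurable_completion) simp
 from borel_measurable_AE[OF this AE] show ?thesis .
qed

lemma nonsingular_nn:
 fixes w :: "'b::euclidean_space => ennreal"
 assumes G: "nonsingular c G T S" and w: "w \<in> borel_measurable Leb"
 shows "(\<integral>\<^sup>+z. w (G z) * indicator T z \<partial>Leb) <= ennreal c * (\<integral>\<^sup>+z. w z * indicator S z \<partial>Leb)"
proof -
 obtain w' where w': "w' \<in> borel_measurable lborel" "AE z in lborel. w z = w' z"
 using completion_ex_borel_measurable[OF w] by blast
 have AE: "AE z in Leb. w z = w' z" by (rule AE_completion[OF w'(2)])
 then have "AE z in Leb. z \<in> S --> w z = w' z" by (rule AE_mp) (auto intro!: AE_I2)
 from nonsingular_AE[OF G this]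
 have "(\<integral>\<^sup>+z. w (G z) * indicator T z \<partial>Leb) = (\<integral>\<^sup>+z. w' (G z) * indicator T z \<partial>Leb)"
 by (intro nn_integral_cong_AE) (rule AE_mp, auto intro!: AE_I2 simp: indicator_def)
 also have "... <= ennreal c * (\<integral>\<^sup>+z. w' z * indicator S z \<partial>Leb)"
 unfolding nn_integral_completion using G w'(1) unfolding nonsingular_def by simp
 also have "(\<integral>\<^sup>+z. w' z * indicator S z \<partial>Leb) = (\<integral>\<^sup>+z. w z * indicator S z \<partial>Leb)"
 by (rule nn_integral_cong_AE) (use AE in "rule AE_mp, auto intro!: AE_I2")
 finally show ?thesis .
qed

lemma nonsingular_nn_on:
 fixes u :: "'b::euclidean_space => real"
 assumes G: "nonsingular c G T S" and K: "K \<subseteq> T"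
 and u: "(%z. ennreal \<bar>u z\<bar> * indicator (G ` K) z) \<in> borel_measurable Leb"
 shows "(\<integral>\<^sup>+z. ennreal \<bar>u (G z)\<bar> * indicator K z \<partial>Leb)
 <= ennreal c * (\<integral>\<^sup>+z. ennreal \<bar>u z\<bar> * indicator (G ` K) z \<partial>Leb)"
proof -
 have "(\<integral>\<^sup>+z. ennreal \<bar>u (G z)\<bar> * indicator K z \<partial>Leb)
 <= (\<integral>\<^sup>+z. (ennreal \<bar>u (G z)\<bar> * indicator (G ` K) (G z)) * indicator T z \<partial>Leb)"
 by (rule nn_integral_mono) (use K in "auto simp: indicator_def")
 also have "... <= ennreal c * (\<integral>\<^sup>+z. (ennreal \<bar>u z\<bar> * indicator (G ` K) z) * indicator S z \<partial>Leb)"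
 by (rule nonsingular_nn[OF G u])
 also have "... <= ennreal c * (\<integral>\<^sup>+z. ennreal \<bar>u z\<bar> * indicator (G ` K) z \<partial>Leb)"
 by (intro mult_left_mono nn_integral_mono) (auto simp: indicator_def)
 finally show ?thesis .
qed

lemma indicator_subset_measurable:
 fixes u :: "'a::euclidean_space => real"
 assumes "(%z. indicator S z * u z) \<in> borel_measurable Leb" "K \<in> sets Leb" "K \<subseteq> S"
 shows "(%z. indicator K z * u z) \<in> borel_measurable Leb"
proof -
 have "(%z. indicator K z * (indicator S z * u z)) \<in> borel_measurable Leb"
 using assms(1,2) by measurable
 moreover have "(%z. indicator K z * (indicator S z * u z)) = (%z. indicator K z * u z)"
 using assms(3) by (auto simp: indicator_def fun_eq_iff)
 ultimately show ?thesis by (simp only:)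
qed

lemma locally_integrable_measurable:
 fixes u :: "'a::euclidean_space => real"
 assumes S: "open S" and u: "loc_int S u"
 shows "(%z. indicator S z * u z) \<in> borel_measurable Leb"
proof -
 obtain D :: "nat => 'a set" where D: "!!n. compact (D n)" "!!n. D n \<subseteq> S" "!!n. D n \<subseteq> interior (D (Suc n))" "\<Union> (range D) = S"
 proof (rule open_Union_compact_subsets[OF S])
 fix C :: "nat => 'a set"
 assume "!!n. compact (C n)" "!!n. C n \<subseteq> S" "!!n. C n \<subseteq> interior (C (Suc n))" "\<Union> (range C) = S"
 then show thesis by (intro that[of C]) auto
 qed
 have "D n \<subseteq> D (Suc n)" for n using D(3)[of n] interior_subset[of "D (Suc n)"] by (rule subset_trans)
 then have mono: "D n \<subseteq> D m" if "n <= m" for n m using that by (rule lift_Suc_mono_le)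
 show ?thesis
 proof (rule borel_measurable_LIMSEQ_real)
 show "(%z. indicator (D n) z * u z) \<in> borel_measurable Leb" for n
 using integrable_on_compact[OF u D(1,2)] unfolding set_integrable_def
 by (auto dest: borel_measurable_integrable)
 fix z
 show "(%n. indicator (D n) z * u z) \<longlonglongrightarrow> indicator S z * u z"
 proof (cases "z \<in> S")
 case True
 then obtain m where "z \<in> D m" using D(4) by blast
 then have "\<forall>\<^sub>F n in sequentially. indicator (D n) z * u z = indicator S z * u z"
 using mono True unfolding eventually_sequentially by (intro exI[of _ m]) (auto simp: indicator_def)
 then show ?thesis by (rule tendsto_eventually)
 next
 case False
 then have "z \<notin> D n" for n using D(2) by blast
 then show ?thesis using False by simp
 qed
 qed
qed

lemma nonsingular_locally_integrable:
 fixes u :: "'b::euclidean_space => real"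
 assumes G: "nonsingular c G T S" and u: "loc_int S u"
 shows "loc_int T (%z. u (G z))"
 unfolding locally_integrable_def
proof (intro allI impI, elim conjE)
 fix K assume K: "compact K" "K \<subseteq> T"
 have T: "open T" "open S" "cts T G" "G ` T \<subseteq> S" using G unfolding nonsingular_def by auto
 have GK: "compact (G ` K)" "G ` K \<subseteq> S"
 using compact_continuous_image[OF continuous_on_subset[OF T(3) K(2)] K(1)] T(4) K(2) by auto
 note i = integrable_on_compact[OF u GK]
 show "set_int Leb K (%z. u (G z))"
 proof (rule set_integrableI_nn)
 show "(%z. indicator K z * u (G z)) \<in> borel_measurable Leb"
 by (rule indicator_subset_measurable[OF nonsingular_measurable[OF G locally_integrable_measurable[OF T(2) u]]
 fmeasurableD[OF lmeasurable_compact[OF K(1)]] K(2)])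
 have "(\<integral>\<^sup>+z. ennreal \<bar>u (G z)\<bar> * indicator K z \<partial>Leb)
 <= ennreal c * (\<integral>\<^sup>+z. ennreal \<bar>u z\<bar> * indicator (G ` K) z \<partial>Leb)"
 by (rule nonsingular_nn_on[OF G K(2) set_integrable_measurable[OF i]])
 also have "... < \<infinity>" using set_integrable_nn_finite[OF i] by (simp add: ennreal_mult_less_top)
 finally show "(\<integral>\<^sup>+z. ennreal \<bar>u (G z)\<bar> * indicator K z \<partial>Leb) < \<infinity>" .
 qed
qed

lemma nonsingular_L1lim:
 fixes u :: "nat => 'b::euclidean_space => real"
 assumes G: "nonsingular c G T S" and K: "compact K" "K \<subseteq> T"
 and L: "L1lim (G ` K) u v" and i: "!!n. set_int Leb (G ` K) (u n)" "set_int Leb (G ` K) v"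
 shows "L1lim K (%n z. u n (G z)) (%z. v (G z))"
 unfolding L1lim_def
proof (intro allI impI)
 fix e :: real assume e: "e > 0"
 have "e / (abs c + 1) > 0" using e by simp
 with L have "\<forall>\<^sub>F n in sequentially. (\<integral>\<^sup>+z. ennreal \<bar>u n z - v z\<bar> * indicator (G ` K) z \<partial>Leb) <= ennreal (e / (\<bar>c\<bar> + 1))"
 unfolding L1lim_def by blast
 then show "\<forall>\<^sub>F n in sequentially. (\<integral>\<^sup>+z. ennreal \<bar>u n (G z) - v (G z)\<bar> * indicator K z \<partial>Leb) <= ennreal e"
 proof (rule eventually_mono)
 fix n assume n: "(\<integral>\<^sup>+z. ennreal \<bar>u n z - v z\<bar> * indicator (G ` K) z \<partial>Leb) <= ennreal (e / (\<bar>c\<bar> + 1))"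
 have "(\<integral>\<^sup>+z. ennreal \<bar>u n (G z) - v (G z)\<bar> * indicator K z \<partial>Leb)
 <= ennreal c * (\<integral>\<^sup>+z. ennreal \<bar>u n z - v z\<bar> * indicator (G ` K) z \<partial>Leb)"
 using nonsingular_nn_on[OF G K(2) set_integrable_measurable[OF set_integral_diff(1)[OF i]]] .
 also have "... <= ennreal \<bar>c\<bar> * ennreal (e / (\<bar>c\<bar> + 1))"
 by (intro mult_mono n ennreal_leI) auto
 also have "... = ennreal (abs c * (e / (abs c + 1)))" by (rule ennreal_mult[symmetric]) (use e in auto)
 also have "... <= ennreal e"
 proof (rule ennreal_leI)
 have "abs c * e <= e * (abs c + 1)" using e by (simp add: algebra_simps)
 then show "abs c * (e / (abs c + 1)) <= e" by (simp add: field_simps)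
 qed
 finally show "(\<integral>\<^sup>+z. ennreal \<bar>u n (G z) - v (G z)\<bar> * indicator K z \<partial>Leb) <= ennreal e" .
 qed
qed

text \<open>C1 approximants of \<open>f\<close> near the image of \<open>K\<close> are composed with
  \<open>G\<close>. The classical chain rule holds for them, and the bounded distortion of measure
  carries their \<open>L\<^sub>1\<close> convergence back to \<open>K\<close>. The first coordinate
  is kept by \<open>G\<close>, hence the triangular shape of the result.\<close>

lemma weak_deriv_shear:
 fixes k :: "real \<times> real => real"
 assumes G: "nonsingular c G T S" and Gdef: "!!z. G z = (fst z, k z)"
 and k: "!!z. z \<in> T ==> (k has_derivative (%(s, t). kq z * s + kp z * t)) (at z)"
 and kc: "cts T kq" "cts T kp"
 and f: "cts S f" "wder S ex f f1" "wder S ey f f2"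
 shows "wder T ex (%z. f (G z)) (%z. f1 (G z) + kq z * f2 (G z))"
 and "wder T ey (%z. f (G z)) (%z. kp z * f2 (G z))"
proof -
 have T: "open T" "open S" "cts T G" "G ` T \<subseteq> S" using G unfolding nonsingular_def by auto
 have li: "loc_int S f1" "loc_int S f2" using f unfolding has_weak_deriv_def by auto
 have liG: "loc_int T (%z. f1 (G z))" "loc_int T (%z. f2 (G z))"
 by (rule nonsingular_locally_integrable[OF G li(1)]) (rule nonsingular_locally_integrable[OF G li(2)])
 have cf: "cts T (%z. f (G z))" by (rule continuous_on_compose2[OF f(1) T(3,4)])
 have main: "\<exists>h. (\<forall>n. C1_on T (h n)) & L1lim K h (%z. f (G z)) &
 L1lim K (%n. pd ex (h n)) (%z. f1 (G z) + kq z * f2 (G z)) &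
 L1lim K (%n. pd ey (h n)) (%z. kp z * f2 (G z))"
 if K: "compact K" "K \<subseteq> T" for K
 proof -
 have GK: "compact (G ` K)" "G ` K \<subseteq> S"
 using compact_continuous_image[OF continuous_on_subset[OF T(3) K(2)] K(1)] T(4) K(2) by auto
 obtain g where g: "!!n. C1_on UNIV (g n)" "uniform_limit (G ` K) g f sequentially"
 "L1lim (G ` K) (%n. pd ex (g n)) f1" "L1lim (G ` K) (%n. pd ey (g n)) f2"
 using weak_deriv_approx[OF T(2) GK f(1)] f(2,3) ex_ey_Basis by blast
 have D: "((%z. g n (G z)) has_derivative (%(s, t). (pd ex (g n) (G z) + kq z * pd ey (g n) (G z)) * s + (kp z * pd ey (g n) (G z)) * t)) (at z)"
 if "z \<in> T" for n z
 proof -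
 have "(G has_derivative (%h. (fst h, case h of (s, t) => kq z * s + kp z * t))) (at z)"
 unfolding Gdef[abs_def] by (rule has_derivative_Pair[OF has_derivative_fst[OF has_derivative_ident] k[OF that]])
 moreover have "(g n has_derivative (%(s, t). pd ex (g n) (G z) * s + pd ey (g n) (G z) * t)) (at (G z))"
 using g(1)[of n] unfolding C1_on_def by (intro has_derivative_pd_prod) blast
 ultimately have "((%z. g n (G z)) has_derivative (%h. case (fst h, case h of (s, t) => kq z * s + kp z * t) of
 (s, t) => pd ex (g n) (G z) * s + pd ey (g n) (G z) * t)) (at z)"
 by (rule has_derivative_compose)
 moreover have "(%h. case (fst h, case h of (s, t) => kq z * s + kp z * t) of
 (s, t) => pd ex (g n) (G z) * s + pd ey (g n) (G z) * t)
 = (%(s, t). (pd ex (g n) (G z) + kq z * pd ey (g n) (G z)) * s + (kp z * pd ey (g n) (G z)) * t)"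
 by (auto simp: algebra_simps)
 ultimately show ?thesis by simp
 qed
 define h where "h n z = g n (G z)" for n z
 have pdh: "pd ex (h n) z = pd ex (g n) (G z) + kq z * pd ey (g n) (G z)" "pd ey (h n) z = kp z * pd ey (g n) (G z)"
 if "z \<in> T" for n z
 unfolding h_def using pd_eqI[OF D[OF that, of n]] by simp_all
 have gc: "cts X (pd ex (g n))" "cts X (pd ey (g n))" for n X
 using g(1)[of n] ex_ey_Basis continuous_on_subset[OF _ subset_UNIV] unfolding C1_on_def by blast+
 have gGc: "cts T (%z. pd ex (g n) (G z))" "cts T (%z. pd ey (g n) (G z))" for n
 by (rule continuous_on_compose2[OF gc(1)[of UNIV] T(3)], simp)
 (rule continuous_on_compose2[OF gc(2)[of UNIV] T(3)], simp)
 have C1h: "C1_on T (h n)" for n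
 unfolding C1_on_def Basis_prod_real
 proof (intro conjI ballI)
 show "h n differentiable (at z)" if "z \<in> T" for z using D[OF that] unfolding h_def differentiable_def by blast
 fix b assume b: "b \<in> {ex, ey}"
 have "cts T (%z. pd ex (g n) (G z) + kq z * pd ey (g n) (G z))" "cts T (%z. kp z * pd ey (g n) (G z))"
 by (intro continuous_on_add continuous_on_mult gGc kc)+
 moreover have "cts T (pd ex (h n)) \<longleftrightarrow> cts T (%z. pd ex (g n) (G z) + kq z * pd ey (g n) (G z))"
 "cts T (pd ey (h n)) \<longleftrightarrow> cts T (%z. kp z * pd ey (g n) (G z))"
 by (rule continuous_on_cong; simp add: pdh)+
 ultimately show "cts T (pd b (h n))" using b by auto
 qed
 have i: "set_int Leb K (%z. a z * pd b (g n) (G z))" if "cts T a" "b \<in> {ex, ey}" for a b n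
 using that(2) by (auto intro!: set_integrable_continuous_compact K continuous_on_subset[OF _ K(2)]
 continuous_on_mult that(1) gGc)
 have i': "set_int Leb K (%z. a z * u (G z))" if "cts T a" "loc_int S u" for a u
 by (rule integrable_on_compact[OF locally_integrable_mult[OF that(1) nonsingular_locally_integrable[OF G that(2)]] K])
 have L: "L1lim K (%n z. a z * pd b (g n) (G z)) (%z. a z * u (G z))"
 if "cts T a" "L1lim (G ` K) (%n. pd b (g n)) u" "loc_int S u" "b \<in> {ex, ey}" for a u b
 proof (rule L1lim_mult[OF K(1)])
 show "uniform_limit K (%n. a) a sequentially" by (rule uniform_limit_const)
 show "cts K a" by (rule continuous_on_subset[OF that(1) K(2)])
 show "set_int Leb K (%z. pd b (g n) (G z))" for n
 using i[OF continuous_on_const[of _ 1] that(4)] by simp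
 show "set_int Leb K (%z. u (G z))"
 using i'[OF continuous_on_const[of _ 1] that(3)] by simp
 have "b \<in> Basis" using that(4) by (simp add: Basis_prod_real)
 then show "L1lim K (%n z. pd b (g n) (G z)) (%z. u (G z))"
 by (intro nonsingular_L1lim[OF G K that(2)] C1_integrable(2)[OF g(1) GK(1) subset_UNIV] integrable_on_compact[OF that(3) GK])
 qed
 have "L1lim K h (%z. f (G z))" unfolding h_def
 proof (rule L1lim_uniform[OF K(1)])
 show "uniform_limit K (%n z. g n (G z)) (%z. f (G z)) sequentially"
 using g(2) unfolding uniform_limit_iff by simp
 qed
 moreover have "L1lim K (%n. pd ex (h n)) (%z. f1 (G z) + kq z * f2 (G z))"
 proof -
 have 1: "L1lim K (%n z. 1 * pd ex (g n) (G z) + kq z * pd ey (g n) (G z)) (%z. 1 * f1 (G z) + kq z * f2 (G z))"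
 using kc li g(3,4) by (intro L1lim_add i i' L continuous_on_const) simp_all
 have e: "ennreal \<bar>pd ex (h n) z - w\<bar> * indicator K z
 = ennreal \<bar>1 * pd ex (g n) (G z) + kq z * pd ey (g n) (G z) - w\<bar> * indicator K z" for n z w
 using pdh[of z n] K(2) by (auto simp: indicator_def)
 show ?thesis using 1 unfolding L1lim_def e by simp
 qed
 moreover have "L1lim K (%n. pd ey (h n)) (%z. kp z * f2 (G z))"
 proof -
 have 1: "L1lim K (%n z. kp z * pd ey (g n) (G z)) (%z. kp z * f2 (G z))"
 by (rule L) (use kc li g(3,4) in auto)
 have e: "ennreal \<bar>pd ey (h n) z - w\<bar> * indicator K z
 = ennreal \<bar>kp z * pd ey (g n) (G z) - w\<bar> * indicator K z" for n z w
 using pdh[of z n] K(2) by (auto simp: indicator_def)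
 show ?thesis using 1 unfolding L1lim_def e .
 qed
 ultimately show ?thesis using C1h by blast
 qed
 show "wder T ex (%z. f (G z)) (%z. f1 (G z) + kq z * f2 (G z))"
 proof (rule has_weak_derivI_approx[OF ex_ey_Basis(1) locally_integrable_continuous[OF cf]])
 show "loc_int T (%z. f1 (G z) + kq z * f2 (G z))"
 by (intro locally_integrable_add locally_integrable_mult kc liG)
 fix K assume K: "compact K" "K \<subseteq> T"
 then show "\<exists>g V. (\<forall>n. open (V n) & K \<subseteq> V n & C1_on (V n) (g n)) & L1lim K g (%z. f (G z)) &
 L1lim K (%n. pd ex (g n)) (%z. f1 (G z) + kq z * f2 (G z))"
 using main[OF K] T(1) by (auto intro!: exI[of _ "%_. T"])
 qed
 show "wder T ey (%z. f (G z)) (%z. kp z * f2 (G z))"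
 proof (rule has_weak_derivI_approx[OF ex_ey_Basis(2) locally_integrable_continuous[OF cf]])
 show "loc_int T (%z. kp z * f2 (G z))"
 by (intro locally_integrable_add locally_integrable_mult kc liG)
 fix K assume K: "compact K" "K \<subseteq> T"
 then show "\<exists>g V. (\<forall>n. open (V n) & K \<subseteq> V n & C1_on (V n) (g n)) & L1lim K g (%z. f (G z)) &
 L1lim K (%n. pd ey (g n)) (%z. kp z * f2 (G z))"
 using main[OF K] T(1) by (auto intro!: exI[of _ "%_. T"])
 qed
qed

section \<open>Weak derivatives in one and two variables\<close>

lemma set_integral_L1_tendsto:
 fixes u :: "nat => 'a::euclidean_space => real"
 assumes K: "compact K" and i: "!!n. set_int Leb K (u n)" "set_int Leb K v" and L: "L1lim K u v"
 shows "(%n. LINT z:K|Leb. u n z) \<longlonglongrightarrow> (LINT z:K|Leb. v z)"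
proof (rule tendstoI)
 fix e :: real assume e: "e > 0"
 then have "\<forall>\<^sub>F n in sequentially. (\<integral>\<^sup>+z. ennreal \<bar>u n z - v z\<bar> * indicator K z \<partial>Leb) <= ennreal (e / 2)"
 using L unfolding L1lim_def by (meson half_gt_zero)
 then show "\<forall>\<^sub>F n in sequentially. dist (LINT z:K|Leb. u n z) (LINT z:K|Leb. v z) < e"
 proof (rule eventually_mono)
 fix n assume "(\<integral>\<^sup>+z. ennreal \<bar>u n z - v z\<bar> * indicator K z \<partial>Leb) <= ennreal (e / 2)"
 from set_integral_L1lim[OF i(1) i(2) continuous_on_const[of _ 1] _ K this, of 1] e
 have "abs ((LINT z:K|Leb. u n z) - (LINT z:K|Leb. v z)) <= e / 2" by simp
 then show "dist (LINT z:K|Leb. u n z) (LINT z:K|Leb. v z) < e" using e by (simp add: dist_real_def)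
 qed
qed

lemma has_real_derivative_pd:
 fixes f :: "real => real"
 assumes "f differentiable (at x)"
 shows "(f has_real_derivative pd 1 f x) (at x)"
proof -
 have "(%h. \<Sum>b\<in>Basis. (h \<bullet> b) * pd b f x) = (*) (pd 1 f x)" by (auto simp: mult.commute)
 then show ?thesis using has_derivative_pd[OF assms] by (simp add: has_field_derivative_def)
qed

lemma pd_real_eq: "(f has_real_derivative D) (at x) ==> pd 1 f x = D"
 unfolding has_field_derivative_def by (simp add: pd_eqI)

lemma C1_on_real:
 assumes "!!x. x \<in> V ==> (f has_real_derivative f' x) (at x)" "cts V f'"
 shows "C1_on V f"
proof -
 have "cts V (pd 1 f) \<longleftrightarrow> cts V f'"
 by (rule continuous_on_cong) (auto intro: pd_real_eq assms)
 then show ?thesis using assms unfolding C1_on_def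
 by (auto intro: differentiableI simp: has_field_derivative_def)
qed

lemma integral_pd_real:
 fixes g :: "real => real"
 assumes "C1_on UNIV g" "a <= b"
 shows "integral {a..b} (pd 1 g) = g b - g a"
proof (rule integral_unique, rule fundamental_theorem_of_calculus[OF assms(2)])
 fix x
 have "(g has_real_derivative pd 1 g x) (at x)"
 using assms(1) unfolding C1_on_def by (intro has_real_derivative_pd) auto
 then show "(g has_vector_derivative pd 1 g x) (at x within {a..b})"
 by (simp add: has_real_derivative_iff_has_vector_derivative has_vector_derivative_at_within)
qed

text \<open>True for the C1 approximants and preserved in the limit, by uniform convergence at the
  end points and \<open>L\<^sub>1\<close> convergence under the integral.\<close>

lemma weak_deriv_FTC:
 fixes f :: "real => real"
 assumes S: "open S" and f: "cts S f" "wder S 1 f f'" and ab: "a <= b" "{a..b} \<subseteq> S"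
 shows "(LINT x:{a..b}|Leb. f' x) = f b - f a"
proof -
 have K: "compact {a..b}" by simp
 have B: "(1::real) \<in> Basis" by simp
 obtain g where g: "!!n. C1_on UNIV (g n)" "uniform_limit {a..b} g f sequentially"
 "L1lim {a..b} (%n. pd 1 (g n)) f'"
 using weak_deriv_approx[OF S K ab(2) f(1)] f(2) B by blast
 have i: "set_int Leb {a..b} (pd 1 (g n))" for n by (rule C1_integrable(2)[OF g(1) K subset_UNIV B])
 have i': "set_int Leb {a..b} f'"
 using f(2) integrable_on_compact[OF _ K ab(2)] unfolding has_weak_deriv_def by blast
 have "(LINT x:{a..b}|Leb. pd 1 (g n) x) = g n b - g n a" for n
 using set_lebesgue_integral_eq_integral(2)[OF i] integral_pd_real[OF g(1) ab(1)] by simp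
 then have "(%n. g n b - g n a) \<longlonglongrightarrow> (LINT x:{a..b}|Leb. f' x)"
 using set_integral_L1_tendsto[OF K i i' g(3)] by simp
 moreover have "(%n. g n b - g n a) \<longlonglongrightarrow> f b - f a"
 using tendsto_uniform_limitI[OF g(2)] ab(1) by (intro tendsto_diff) auto
 ultimately show ?thesis using LIMSEQ_unique by blast
qed

lemma L1lim_continuous_approx:
 fixes v :: "'a::euclidean_space => real"
 assumes K: "compact K" and v: "set_int Leb K v"
 shows "\<exists>k. (\<forall>n::nat. cts UNIV (k n)) & L1lim K k v"
proof -
 have i: "integrable Leb (%z. indicator K z *\<^sub>R v z)" using v unfolding set_integrable_def .
 obtain u where u: "u \<in> borel_measurable lborel" "AE z in lborel. indicator K z *\<^sub>R v z = u z"
 using completion_ex_borel_measurable_real[OF borel_measurable_integrable[OF i]] by blast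
 have AE: "AE z in Leb. indicator K z *\<^sub>R v z = u z" by (rule AE_completion[OF u(2)])
 have um: "u \<in> borel_measurable Leb" by (rule measurable_completion[OF u(1)])
 have "integrable Leb u" by (rule integrable_cong_AE_imp[OF i um AE])
 then have ui: "integrable lborel u" using integrable_completion[OF u(1)] by simp
 have "\<exists>c. cts UNIV c & (\<integral>\<^sup>+z. ennreal \<bar>u z - c z\<bar> * indicator K z \<partial>lborel) < ennreal (1 / real (Suc n))" for n
 by (rule L1_approx_continuous[OF ui borel_compact[OF K] compact_imp_bounded[OF K]]) simp
 then obtain k where k: "!!n. cts UNIV (k n)"
 "!!n. (\<integral>\<^sup>+z. ennreal \<bar>u z - k n z\<bar> * indicator K z \<partial>lborel) < ennreal (1 / real (Suc n))" by metis
 have e: "(\<integral>\<^sup>+z. ennreal \<bar>k n z - v z\<bar> * indicator K z \<partial>Leb) = (\<integral>\<^sup>+z. ennreal \<bar>u z - k n z\<bar> * indicator K z \<partial>lborel)" for n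
 unfolding nn_integral_completion[symmetric, of lborel]
 by (rule nn_integral_cong_AE, rule AE_mp[OF AE]) (auto intro!: AE_I2 simp: indicator_def abs_minus_commute)
 have "L1lim K k v" unfolding L1lim_def
 proof (intro allI impI)
 fix d :: real assume d: "d > 0"
 have "\<forall>\<^sub>F n in sequentially. inverse (real (Suc n)) < d"
 using order_tendstoD(2)[OF LIMSEQ_inverse_real_of_nat d] .
 then show "\<forall>\<^sub>F n in sequentially. (\<integral>\<^sup>+z. ennreal \<bar>k n z - v z\<bar> * indicator K z \<partial>Leb) <= ennreal d"
 proof (rule eventually_mono)
 fix n assume "inverse (real (Suc n)) < d"
 then have "ennreal (1 / real (Suc n)) <= ennreal d" by (intro ennreal_leI) (simp add: inverse_eq_divide)
 then show "(\<integral>\<^sup>+z. ennreal \<bar>k n z - v z\<bar> * indicator K z \<partial>Leb) <= ennreal d"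
 unfolding e using k(2)[of n] by (meson less_imp_le order_trans)
 qed
 qed
 then show ?thesis using k(1) by blast
qed

lemma integral_less_continuous_derivative:
 fixes k :: "real => real"
 assumes "cts UNIV k" "a < x"
 shows "((%x. integral {a..x} k) has_real_derivative k x) (at x)"
proof -
 have "((%x. integral {a..x} k) has_real_derivative k x) (at x within {a..x+1})"
 by (rule integral_has_real_derivative) (use assms in "auto intro: continuous_on_subset")
 moreover have "at x within {a..x+1} = at x"
 by (rule at_within_interior) (use assms(2) in "simp add: interior_atLeastAtMost_real")
 ultimately show ?thesis by simp
qed

text \<open>Primitives of continuous \<open>L\<^sub>1\<close> approximations of \<open>f'\<close>,
  started at the value \<open>f a\<close>, are C1 and by the assumed formula converge uniformly to
  \<open>f\<close>; the approximation criterion then applies.\<close>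

lemma weak_derivI_FTC:
 fixes f :: "real => real"
 assumes S: "open S" "is_interval S" and f: "cts S f" and f': "loc_int S f'"
 and ftc: "!!a b. a <= b ==> {a..b} \<subseteq> S ==> (LINT x:{a..b}|Leb. f' x) = f b - f a"
 shows "wder S 1 f f'"
proof (rule has_weak_derivI_approx)
 show "loc_int S f" by (rule locally_integrable_continuous[OF f])
 show "loc_int S f'" by fact
 fix K :: "real set" assume K: "compact K" "K \<subseteq> S"
 show "\<exists>g V. (\<forall>n. open (V n) & K \<subseteq> V n & C1_on (V n) (g n)) & L1lim K g f & L1lim K (%n. pd 1 (g n)) f'"
 proof (cases "K = {}")
 case True
 then show ?thesis by (intro exI[of _ "%_ _. 0"] exI[of _ "%_. {}"]) (simp add: L1lim_def C1_on_def)
 next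
 case False
 obtain e K1 where e: "0 < e" "compact K1" "K1 \<subseteq> S" "!!z. z \<in> K ==> cball z e \<subseteq> K1"
 by (rule compact_thicken[OF K(1) S(1) K(2)]) (rule that)
 obtain m where m: "m \<in> K" "!!x. x \<in> K ==> m <= x" using compact_attains_inf[OF K(1) False] by blast
 obtain M where M: "M \<in> K" "!!x. x \<in> K ==> x <= M" using compact_attains_sup[OF K(1) False] by blast
 \<comment> \<open>The interval extends beyond \<open>K\<close> by the margin \<open>e\<close> on
   both sides, so \<open>K\<close> lies in the open interval on which the primitives are C1.\<close>
 define a where "a = m - e"
 define b where "b = M + e"
 have "a \<in> cball m e" "b \<in> cball M e" using e(1) unfolding a_def b_def by (auto simp: dist_real_def)
 then have abS: "a \<in> S" "b \<in> S" using e(3,4) m(1) M(1) by blast+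
 have "{a..b} \<subseteq> S"
 using S(2) abS unfolding is_interval_1 by (meson atLeastAtMost_iff subsetI)
 note ab = this
 have aK: "a < x & x < b" if "x \<in> K" for x
 using m(2)[OF that] M(2)[OF that] e(1) unfolding a_def b_def by linarith
 have cab: "compact {a..b}" by simp
 have i: "set_int Leb {a..b} f'" by (rule integrable_on_compact[OF f' cab ab])
 obtain k where k: "!!n::nat. cts UNIV (k n)" "L1lim {a..b} k f'"
 using L1lim_continuous_approx[OF cab i] by blast
 define g where "g n x = f a + integral {a..x} (k n)" for n x
 have gd: "(g n has_real_derivative k n x) (at x)" if "x \<in> {a<..<b}" for n x
 unfolding g_def using integral_less_continuous_derivative[OF k(1), of a x n] that
 by (auto intro!: derivative_eq_intros)
 have C1: "C1_on {a<..<b} (g n)" for n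
 by (rule C1_on_real[OF gd]) (auto intro: continuous_on_subset[OF k(1)])
 have Kab: "K \<subseteq> {a<..<b}" "K \<subseteq> {a..b}" using aK by force+
 have L: "L1lim K (%n. pd 1 (g n)) f'" unfolding L1lim_def
 proof (intro allI impI)
 fix d :: real assume "d > 0"
 with k(2) have "\<forall>\<^sub>F n in sequentially. (\<integral>\<^sup>+z. ennreal \<bar>k n z - f' z\<bar> * indicator {a..b} z \<partial>Leb) <= ennreal d"
 unfolding L1lim_def by blast
 then show "\<forall>\<^sub>F n in sequentially. (\<integral>\<^sup>+z. ennreal \<bar>pd 1 (g n) z - f' z\<bar> * indicator K z \<partial>Leb) <= ennreal d"
 proof (rule eventually_mono)
 fix n assume le: "(\<integral>\<^sup>+z. ennreal \<bar>k n z - f' z\<bar> * indicator {a..b} z \<partial>Leb) <= ennreal d"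
 have "(\<integral>\<^sup>+z. ennreal \<bar>pd 1 (g n) z - f' z\<bar> * indicator K z \<partial>Leb)
 <= (\<integral>\<^sup>+z. ennreal \<bar>k n z - f' z\<bar> * indicator {a..b} z \<partial>Leb)"
 proof (rule nn_integral_mono)
 fix z show "ennreal \<bar>pd 1 (g n) z - f' z\<bar> * indicator K z <= ennreal \<bar>k n z - f' z\<bar> * indicator {a..b} z"
 using Kab pd_real_eq[OF gd[of z n]] by (cases "z \<in> K") auto
 qed
 with le show "(\<integral>\<^sup>+z. ennreal \<bar>pd 1 (g n) z - f' z\<bar> * indicator K z \<partial>Leb) <= ennreal d" by (rule order_trans[rotated])
 qed
 qed
 have "uniform_limit K g f sequentially"
 unfolding uniform_limit_iff
 proof (intro allI impI)
 fix d :: real assume d: "d > 0"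
 then have "\<forall>\<^sub>F n in sequentially. (\<integral>\<^sup>+z. ennreal \<bar>k n z - f' z\<bar> * indicator {a..b} z \<partial>Leb) <= ennreal (d / 2)"
 using k(2) unfolding L1lim_def by (meson half_gt_zero)
 then show "\<forall>\<^sub>F n in sequentially. \<forall>x\<in>K. dist (g n x) (f x) < d"
 proof (rule eventually_mono, intro ballI)
 fix n x assume le: "(\<integral>\<^sup>+z. ennreal \<bar>k n z - f' z\<bar> * indicator {a..b} z \<partial>Leb) <= ennreal (d / 2)" and x: "x \<in> K"
 have ax: "a <= x" "{a..x} \<subseteq> {a..b}" "{a..x} \<subseteq> S" using aK[OF x] ab by auto
 have ix: "set_int Leb {a..x} (k n)" "set_int Leb {a..x} f'"
 by (rule set_integrable_continuous_compact) (auto intro: continuous_on_subset[OF k(1)] integrable_on_compact[OF f' _ ax(3)])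
 have le': "(\<integral>\<^sup>+z. ennreal \<bar>k n z - f' z\<bar> * indicator {a..x} z \<partial>Leb) <= ennreal (d / 2)"
 proof (rule order_trans[OF nn_integral_mono le])
 fix z show "ennreal \<bar>k n z - f' z\<bar> * indicator {a..x} z <= ennreal \<bar>k n z - f' z\<bar> * indicator {a..b} z"
 using ax(2) by (auto simp: indicator_def)
 qed
 have "abs ((LINT z:{a..x}|Leb. k n z * 1) - (LINT z:{a..x}|Leb. f' z * 1)) <= 1 * (d / 2)"
 by (rule set_integral_L1lim[OF ix continuous_on_const _ _ le']) (use d in auto)
 moreover have "(LINT z:{a..x}|Leb. k n z) = integral {a..x} (k n)"
 by (rule set_lebesgue_integral_eq_integral(2)[OF ix(1)])
 moreover have "(LINT z:{a..x}|Leb. f' z) = f x - f a" by (rule ftc[OF ax(1,3)])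
 ultimately show "dist (g n x) (f x) < d"
 using d unfolding g_def dist_real_def mult_1_right mult_1 by linarith
 qed
 qed
 from L1lim_uniform[OF K(1) this] have "L1lim K g f" .
 with C1 L Kab show ?thesis by (intro exI[of _ g] exI[of _ "%_. {a<..<b}"]) auto
 qed
qed simp

text \<open>The primitive is based at zero. Its second term is responsible for negative arguments;
  one of the two terms always vanishes.\<close>

lemma indefinite_integral_exists:
 fixes u :: "real => real"
 assumes u: "loc_int UNIV u"
 shows "\<exists>F. cts UNIV F & (\<forall>a b. a <= b --> (LINT x:{a..b}|Leb. u x) = F b - F a)"
proof -
 have i: "set_int Leb {a..b} u" for a b by (rule integrable_on_compact[OF u]) auto
 have io: "u integrable_on {a..b}" for a b by (rule set_lebesgue_integral_eq_integral(1)[OF i])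
 define F where "F x = integral {0..x} u - integral {x..0} u" for x
 have F: "F b - F a = integral {a..b} u" if "a <= b" for a b
 proof -
 consider "0 <= a" | "a <= 0" "0 <= b" | "b <= 0" using that by linarith
 then show ?thesis
 proof cases
 case 1
 then have "integral {a..0} u = 0" "integral {b..0} u = 0" using that by (cases "a = 0"; cases "b = 0"; simp)+
 then show ?thesis unfolding F_def using Henstock_Kurzweil_Integration.integral_combine[OF 1 that io] by simp
 next
 case 2
 then have "integral {0..a} u = 0" "integral {b..0} u = 0" by (cases "a = 0"; cases "b = 0"; simp)+
 then show ?thesis unfolding F_def using Henstock_Kurzweil_Integration.integral_combine[OF 2 io] by simp
 next
 case 3
 then have "integral {0..a} u = 0" "integral {0..b} u = 0" using that by (cases "a = 0"; cases "b = 0"; simp)+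
 then show ?thesis unfolding F_def using Henstock_Kurzweil_Integration.integral_combine[OF that 3 io] by simp
 qed
 qed
 have "isCont F x" for x
 proof -
 have "cts {x-1..x+1} (%y. integral {x-1..y} u)"
 by (rule indefinite_integral_continuous_1[OF io])
 moreover have "cts {x-1..x+1} (%y. integral {x-1..y} u) \<longleftrightarrow> cts {x-1..x+1} (%y. F y - F (x-1))"
 by (rule continuous_on_cong[OF refl]) (simp add: F)
 ultimately have "cts {x-1..x+1} (%y. F y - F (x-1))" by blast
 from continuous_on_add[OF this continuous_on_const[of _ "F (x-1)"]]
 have "cts {x-1..x+1} F" by simp
 then show "isCont F x" by (rule continuous_on_interior) simp
 qed
 then have "cts UNIV F" by (simp add: continuous_at_imp_continuous_on)
 moreover have "(LINT x:{a..b}|Leb. u x) = F b - F a" if "a <= b" for a b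
 using set_lebesgue_integral_eq_integral(2)[OF i] F[OF that] by simp
 ultimately show ?thesis by blast
qed

lemma has_weak_deriv_diff:
 fixes f g :: "'a::euclidean_space => real"
 assumes f: "wder S b f f'" and g: "wder S b g g'" and b: "b \<in> Basis"
 shows "wder S b (%z. f z - g z) (%z. f' z - g' z)"
 unfolding has_weak_deriv_def
proof (intro conjI ballI)
 have li: "loc_int S f" "loc_int S g" "loc_int S f'" "loc_int S g'"
 using f g unfolding has_weak_deriv_def by auto
 have diff: "loc_int S (%z. u z - v z)" if "loc_int S u" "loc_int S v" for u v
 using that unfolding locally_integrable_def by (blast intro: set_integral_diff(1))
 show "loc_int S (%z. f z - g z)" "loc_int S (%z. f' z - g' z)" using li diff by blast+
 fix \<phi> assume ph: "\<phi> \<in> test_functions S"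
 define K where "K = closure {z. \<phi> z ~= 0}"
 have sm: "smooth \<phi>" and K: "compact K" "K \<subseteq> S" using ph unfolding test_functions_def K_def by auto
 have out: "\<phi> z = 0" if "z \<notin> K" for z using that closure_subset[of "{z. \<phi> z ~= 0}"] unfolding K_def by blast
 have oK: "open (- K)" unfolding K_def by (rule open_Compl) (rule closed_closure)
 have out': "pd b \<phi> z = 0" if "z \<notin> K" for z using pd_zero[OF oK, of z \<phi> b] that out by blast
 have int: "set_int Leb S (%z. u z * p z)"
 if "loc_int S u" "cts UNIV p" "!!z. z \<notin> K ==> p z = 0" for u p
 proof -
 have "set_int Leb K (%z. p z * u z)"
 by (rule integrable_on_compact[OF locally_integrable_mult[OF continuous_on_subset[OF that(2)] that(1)] K]) simp
 moreover have "(%z. indicator K z *\<^sub>R (p z * u z)) = (%z. indicator S z *\<^sub>R (u z * p z))"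
 proof
 fix z show "indicator K z *\<^sub>R (p z * u z) = indicator S z *\<^sub>R (u z * p z)"
 using that(3)[of z] K(2) by (cases "z \<in> K") auto
 qed
 ultimately show ?thesis unfolding set_integrable_def by simp
 qed
 have c: "cts UNIV \<phi>" "cts UNIV (pd b \<phi>)"
 using smooth_continuous[OF sm] smooth_continuous[OF smooth_pd[OF sm b]] by auto
 have eqs: "(LINT z:S|Leb. f z * pd b \<phi> z) = - (LINT z:S|Leb. f' z * \<phi> z)"
 "(LINT z:S|Leb. g z * pd b \<phi> z) = - (LINT z:S|Leb. g' z * \<phi> z)"
 using f g ph unfolding has_weak_deriv_def by auto
 have "(LINT z:S|Leb. (f z - g z) * pd b \<phi> z) = (LINT z:S|Leb. f z * pd b \<phi> z) - (LINT z:S|Leb. g z * pd b \<phi> z)"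
 using set_integral_diff(2)[OF int[OF li(1) c(2) out'] int[OF li(2) c(2) out']] by (simp add: left_diff_distrib)
 moreover have "(LINT z:S|Leb. (f' z - g' z) * \<phi> z) = (LINT z:S|Leb. f' z * \<phi> z) - (LINT z:S|Leb. g' z * \<phi> z)"
 using set_integral_diff(2)[OF int[OF li(3) c(1) out] int[OF li(4) c(1) out]] by (simp add: left_diff_distrib)
 ultimately show "(LINT z:S|Leb. (f z - g z) * pd b \<phi> z) = - (LINT z:S|Leb. (f' z - g' z) * \<phi> z)"
 using eqs by simp
qed

text \<open>Two integrations by parts against translated kernels show that the mollified function
  has zero second derivative and is affine. That relation is evaluated only at \<open>0\<close>,
  \<open>1\<close> and \<open>x\<close>, where mollification changes \<open>w\<close> arbitrarily
  little.\<close>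

lemma weak_second_deriv_zero_affine:
 fixes w :: "real => real"
 assumes w: "cts UNIV w" "wder UNIV 1 w w1" "wder UNIV 1 w1 w2"
 and w2: "!!x. w2 x = 0"
 shows "w x = w 0 + (w 1 - w 0) * x"
proof -
 have wm: "w \<in> borel_measurable borel" by (rule borel_measurable_continuous_onI[OF w(1)])
 have affine: "mconv k w y = mconv k w 0 + (mconv k w 1 - mconv k w 0) * y" if k: "mollifier e k" for k e y
 proof -
 have ks: "smooth k" "!!x. k x ~= 0 ==> norm x <= e" using k unfolding mollifier_def by auto
 have k1: "smooth (pd 1 k)" "!!x. pd 1 k x ~= 0 ==> norm x <= e"
 using smooth_pd[OF ks(1)] pd_support[OF ks(2)] by auto
 have k2: "smooth (pd 1 (pd 1 k))" "!!x. pd 1 (pd 1 k) x ~= 0 ==> norm x <= e"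
 using smooth_pd[OF k1(1)] pd_support[OF k1(2)] by auto
 have zero: "mconv (pd 1 (pd 1 k)) w z = 0" for z
 proof -
 have km: "pd 1 (pd 1 k) \<in> borel_measurable borel"
 by (rule borel_measurable_continuous_onI[OF smooth_continuous[OF k2(1)]])
 have "mconv (pd 1 (pd 1 k)) w z = (LINT x:UNIV|Leb. w x * pd 1 (pd 1 k) (x - z))"
 by (rule set_lebesgue_integral_mconv[symmetric, OF wm km k2(2)]) auto
 also have "... = (LINT x:UNIV|Leb. w x * pd 1 (%x. pd 1 k (x - z)) x)"
 by (simp add: pd_translate[OF smooth_differentiable[OF k1(1)]])
 also have "... = - (LINT x:UNIV|Leb. w1 x * pd 1 k (x - z))"
 using w(2) test_function_translate[OF k1, of z UNIV] unfolding has_weak_deriv_def by blast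
 also have "(LINT x:UNIV|Leb. w1 x * pd 1 k (x - z)) = (LINT x:UNIV|Leb. w1 x * pd 1 (%x. k (x - z)) x)"
 by (simp add: pd_translate[OF smooth_differentiable[OF ks(1)]])
 also have "... = - (LINT x:UNIV|Leb. w2 x * k (x - z))"
 using w(3) test_function_translate[OF ks, of z UNIV] unfolding has_weak_deriv_def by blast
 finally show ?thesis using w2 by (simp add: set_lebesgue_integral_def)
 qed
 have D1: "(mconv k w has_real_derivative - mconv (pd 1 k) w z) (at z)" for z
 using has_real_derivative_pd[OF differentiableI[OF mconv_has_derivative[OF w(1) ks, of z]]] mconv_pd[OF w(1) ks, of 1 z] by simp
 have D2: "(mconv (pd 1 k) w has_real_derivative 0) (at z)" for z
 using has_real_derivative_pd[OF differentiableI[OF mconv_has_derivative[OF w(1) k1, of z]]] mconv_pd[OF w(1) k1, of 1 z] zero by simp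
 define c where "c = - mconv (pd 1 k) w 0"
 have c: "- mconv (pd 1 k) w z = c" for z
 unfolding c_def using DERIV_isconst_all[of "mconv (pd 1 k) w" z 0] D2 by simp
 have "((%z. mconv k w z - c * z) has_real_derivative 0) (at z)" for z
 using D1[of z] unfolding c by (auto intro!: derivative_eq_intros)
 then have "mconv k w y - c * y = mconv k w 0 - c * 0" for y
 using DERIV_isconst_all[of "%z. mconv k w z - c * z" y 0] by simp
 from this[of y] this[of 1] show ?thesis by (simp add: algebra_simps)
 qed
 have le: "abs (w x - (w 0 + (w 1 - w 0) * x)) <= d" if d: "d > 0" for d
 proof -
 \<comment> \<open>With error at most \<open>q\<close> at each of the three points, the error in the
   affine relation is at most \<open>q * (2 + 2 * abs x)\<close>.\<close>
 define q where "q = d / (2 + 2 * abs x)"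
 have q: "q > 0" unfolding q_def using d by (intro divide_pos_pos) auto
 obtain r where r: "r > 0" "!!z s. z \<in> {0, 1, x} ==> norm s <= r ==> abs (w (z + s) - w z) <= q"
 proof -
 have "compact {0, 1, x}" by simp
 from uniformly_near_compact[OF w(1) this q] show ?thesis using that by blast
 qed
 obtain k :: "real => real" where k: "mollifier r k" using mollifier_exists[OF r(1), where 'a = real] by (elim exE) (rule that)
 have n: "abs (mconv k w z - w z) <= q" if "z \<in> {0, 1, x}" for z by (rule mconv_near[OF w(1) k r(2)[OF that]])
 define e1 where "e1 = w x - mconv k w x"
 define e2 where "e2 = mconv k w 0 - w 0"
 define e3 where "e3 = (mconv k w 1 - w 1) - (mconv k w 0 - w 0)"
 have e: "abs e1 <= q" "abs e2 <= q" "abs e3 <= 2 * q"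
 unfolding e1_def e2_def e3_def using n[of x] n[of 0] n[of 1] by simp_all
 have "w x - (w 0 + (w 1 - w 0) * x) = e1 + e2 + e3 * x"
 unfolding e1_def e2_def e3_def using affine[OF k, of x] by (simp add: algebra_simps)
 also have "abs (...) <= abs e1 + abs e2 + abs (e3 * x)"
 by (rule order_trans[OF abs_triangle_ineq add_right_mono[OF abs_triangle_ineq]])
 also have "... <= q + q + (2 * q) * abs x"
 unfolding abs_mult by (intro add_mono mult_right_mono e) simp
 also have "... = q * (2 + 2 * abs x)" by (simp add: algebra_simps)
 also have "... = d" unfolding q_def by simp
 finally show ?thesis .
 qed
 have "abs (w x - (w 0 + (w 1 - w 0) * x)) <= 0"
 proof (rule field_le_epsilon)
 fix d :: real assume "0 < d"
 then show "abs (w x - (w 0 + (w 1 - w 0) * x)) <= 0 + d" using le[of d] by linarith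
 qed
 then show ?thesis by simp
qed

text \<open>The first weak derivative \<open>f1\<close> is not known to be continuous, so it cannot
  be compared directly with a primitive of \<open>f2\<close>. Instead, \<open>f\<close> minus a
  twofold primitive of \<open>f2\<close> is continuous with vanishing second weak derivative and is
  therefore affine.\<close>

lemma weak_second_deriv_C1:
 fixes f :: "real => real"
 assumes f: "cts UNIV f" "wder UNIV 1 f f1" "wder UNIV 1 f1 f2"
 shows "(\<forall>x. (f has_real_derivative deriv f x) (at x)) & cts UNIV (deriv f) & wder UNIV 1 (deriv f) f2"
proof -
 have li: "loc_int UNIV f2" using f(3) unfolding has_weak_deriv_def by blast
 obtain F where F: "cts UNIV F" "!!a b. a <= b ==> (LINT x:{a..b}|Leb. f2 x) = F b - F a"
 using indefinite_integral_exists[OF li] by blast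
 have wF: "wder UNIV 1 (%x. F x + c) f2" for c
 by (rule weak_derivI_FTC) (use F li in "auto intro!: continuous_intros")
 obtain P where P: "!!x. (P has_real_derivative F x) (at x)"
 proof -
 obtain P where P: "cts UNIV P" "!!a b. a <= b ==> (LINT x:{a..b}|Leb. F x) = P b - P a"
 using indefinite_integral_exists[OF locally_integrable_continuous[OF F(1)]] by blast
 have "(P has_real_derivative F x) (at x)" for x
 proof -
 have "((%y. integral {x - 1..y} F) has_real_derivative F x) (at x)"
 by (rule integral_less_continuous_derivative[OF F(1)]) simp
 then have D: "((%y. integral {x - 1..y} F + P (x - 1)) has_real_derivative F x) (at x)"
 by (auto intro!: derivative_eq_intros)
 have "integral {x - 1..y} F + P (x - 1) = P y" if "y \<in> {x - 1<..}" for y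
 using P(2)[of "x - 1" y] that
 set_lebesgue_integral_eq_integral(2)[OF set_integrable_continuous_compact[of "{x - 1..y}" F]]
 by (simp add: continuous_on_subset[OF F(1)])
 then show ?thesis
 by (intro has_field_derivative_transform_within_open[OF D, of "{x - 1<..}"]) auto
 qed
 then show ?thesis using that by blast
 qed
 have C1P: "C1_on UNIV P" by (rule C1_on_real[OF P F(1)])
 have pdP: "pd 1 P = F" using pd_real_eq[OF P] by blast
 have B: "(1::real) \<in> Basis" by simp
 have wP: "wder UNIV 1 P F" using has_weak_deriv_C1[OF open_UNIV C1P B] pdP by simp
 define w where "w x = f x - P x" for x
 have "cts UNIV w" unfolding w_def by (intro continuous_intros f C1_on_continuous[OF C1P])
 moreover have "wder UNIV 1 w (%x. f1 x - F x)" unfolding w_def by (rule has_weak_deriv_diff[OF f(2) wP B])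
 moreover have "wder UNIV 1 (%x. f1 x - F x) (%x. f2 x - f2 x)"
 using has_weak_deriv_diff[OF f(3) wF[of 0] B] by simp
 ultimately have w: "w x = w 0 + (w 1 - w 0) * x" for x by (rule weak_second_deriv_zero_affine) simp
 have "f = (%x. P x + (w 0 + (w 1 - w 0) * x))" using w unfolding w_def by (metis add.commute diff_add_cancel)
 moreover have "((%x. P x + (w 0 + (w 1 - w 0) * x)) has_real_derivative F x + (w 1 - w 0)) (at x)" for x
 by (auto intro!: derivative_eq_intros P)
 ultimately have D: "(f has_real_derivative F x + (w 1 - w 0)) (at x)" for x by simp
 then have d: "deriv f = (%x. F x + (w 1 - w 0))" by (auto intro!: ext DERIV_imp_deriv)
 show ?thesis unfolding d using D wF F(1) by (auto intro!: continuous_intros)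
qed

section \<open>Box integrals and functions of one coordinate\<close>

lemma set_integral_eq_HK:
 fixes g :: "'a::euclidean_space => real"
 assumes "cts (cbox a b) g"
 shows "(LINT z:cbox a b|Leb. g z) = integral (cbox a b) g"
 by (rule set_lebesgue_integral_eq_integral(2)[OF set_integrable_continuous_compact[OF compact_cbox assms]])

lemma C1_on_lines:
 fixes g :: "real \<times> real => real"
 assumes "g differentiable (at (x, y))"
 shows "((%x. g (x, y)) has_real_derivative pd ex g (x, y)) (at x)"
 and "((%y. g (x, y)) has_real_derivative pd ey g (x, y)) (at y)"
proof -
 note D = has_derivative_pd_prod[OF assms]
 have "((%x. (x, y)) has_derivative (%h. (h, 0))) (at x)" by (auto intro!: derivative_eq_intros)
 from has_derivative_compose[OF this D] have "((%x. g (x, y)) has_derivative (%h. pd ex g (x, y) * h)) (at x)" by simp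
 then show "((%x. g (x, y)) has_real_derivative pd ex g (x, y)) (at x)" by (simp add: has_field_derivative_def)
 have "((%y. (x, y)) has_derivative (%h. (0, h))) (at y)" by (auto intro!: derivative_eq_intros)
 from has_derivative_compose[OF this D] have "((%y. g (x, y)) has_derivative (%h. pd ey g (x, y) * h)) (at y)" by simp
 then show "((%y. g (x, y)) has_real_derivative pd ey g (x, y)) (at y)" by (simp add: has_field_derivative_def)
qed

lemma FTC_real:
 fixes f :: "real => real"
 assumes "a <= b" "!!x. x \<in> {a..b} ==> (f has_real_derivative f' x) (at x)"
 shows "integral {a..b} f' = f b - f a"
 by (rule integral_unique, rule fundamental_theorem_of_calculus[OF assms(1)])
 (use assms(2) in "auto simp: has_real_derivative_iff_has_vector_derivative intro: has_vector_derivative_at_within")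

text \<open>Iterated integration and the fundamental theorem for the C1 approximants, followed by
  the limit. Integrating over boxes takes the place of statements about almost every line; the
  boundary integrals are unambiguous because \<open>f\<close> is continuous.\<close>

lemma weak_deriv_box:
 fixes f :: "real \<times> real => real"
 assumes S: "open S" and f: "cts S f" and ab: "a <= b" "c <= e" and sub: "cbox (a, c) (b, e) \<subseteq> S"
 shows "wder S ex f f1 ==> (LINT z:cbox (a, c) (b, e)|Leb. f1 z) = integral {c..e} (%y. f (b, y) - f (a, y))"
 and "wder S ey f f2 ==> (LINT z:cbox (a, c) (b, e)|Leb. f2 z) = integral {a..b} (%x. f (x, e) - f (x, c))"
proof -
 have K: "compact (cbox (a, c) (b, e))" by (rule compact_cbox)
 obtain g where g: "!!n. C1_on UNIV (g n)" "uniform_limit (cbox (a, c) (b, e)) g f sequentially"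
 "!!f1. wder S ex f f1 ==> L1lim (cbox (a, c) (b, e)) (%n. pd ex (g n)) f1"
 "!!f2. wder S ey f f2 ==> L1lim (cbox (a, c) (b, e)) (%n. pd ey (g n)) f2"
 using weak_deriv_approx[OF S K sub f] ex_ey_Basis by blast
 have gc: "cts X (g n)" "cts X (pd ex (g n))" "cts X (pd ey (g n))" for n X
 using g(1)[of n] ex_ey_Basis continuous_on_subset[OF C1_on_continuous[OF g(1)[of n]] subset_UNIV]
 continuous_on_subset[OF _ subset_UNIV] unfolding C1_on_def by blast+
 have gd: "g n differentiable (at z)" for n z using g(1)[of n] unfolding C1_on_def by blast
 have mem: "(x, y) \<in> cbox (a, c) (b, e) \<longleftrightarrow> x \<in> {a..b} & y \<in> {c..e}" for x y
 by (auto simp: cbox_Pair_eq)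
 have ge: "(LINT z:cbox (a, c) (b, e)|Leb. pd ey (g n) z) = integral {a..b} (%x. g n (x, e) - g n (x, c))" for n
 proof -
 have "(LINT z:cbox (a, c) (b, e)|Leb. pd ey (g n) z) = integral (cbox (a, c) (b, e)) (pd ey (g n))"
 by (rule set_integral_eq_HK[OF gc(3)])
 also have "... = integral (cbox a b) (%x. integral (cbox c e) (%y. pd ey (g n) (x, y)))"
 by (rule integral_prod_continuous) (rule gc)
 also have "... = integral {a..b} (%x. g n (x, e) - g n (x, c))"
 using FTC_real[OF ab(2) C1_on_lines(2)[OF gd]] by simp
 finally show ?thesis .
 qed
 have gx: "(LINT z:cbox (a, c) (b, e)|Leb. pd ex (g n) z) = integral {c..e} (%y. g n (b, y) - g n (a, y))" for n
 proof -
 have "(LINT z:cbox (a, c) (b, e)|Leb. pd ex (g n) z) = integral (cbox (a, c) (b, e)) (pd ex (g n))"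
 by (rule set_integral_eq_HK[OF gc(2)])
 also have "... = integral (cbox a b) (%x. integral (cbox c e) (%y. pd ex (g n) (x, y)))"
 by (rule integral_prod_continuous) (rule gc)
 also have "... = integral (cbox c e) (%y. integral (cbox a b) (%x. pd ex (g n) (x, y)))"
 by (rule integral_swap_continuous) (simp add: gc)
 also have "... = integral {c..e} (%y. g n (b, y) - g n (a, y))"
 using FTC_real[OF ab(1) C1_on_lines(1)[OF gd]] by simp
 finally show ?thesis .
 qed
 have lim: "(%n. integral {s..t} (%x. g n (p x) - g n (q x))) \<longlonglongrightarrow> integral {s..t} (%x. f (p x) - f (q x))"
 if pq: "!!x. x \<in> {s..t} ==> p x \<in> cbox (a, c) (b, e)" "!!x. x \<in> {s..t} ==> q x \<in> cbox (a, c) (b, e)"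
 "cts {s..t} p" "cts {s..t} q" for s t :: real and p q
 proof -
 have u: "uniform_limit {s..t} (%n x. g n (p x) - g n (q x)) (%x. f (p x) - f (q x)) sequentially"
 by (rule uniform_limit_minus) (use g(2) pq in "auto simp: uniform_limit_iff elim!: eventually_mono all_forward")
 obtain I J where IJ: "!!n. ((%x. g n (p x) - g n (q x)) has_integral I n) {s..t}"
 "((%x. f (p x) - f (q x)) has_integral J) {s..t}" "I \<longlonglongrightarrow> J"
 proof (rule uniform_limit_integral[OF u])
 show "cts {s..t} (%x. g n (p x) - g n (q x))" for n
 by (intro continuous_on_diff continuous_on_compose2[OF gc(1)[of UNIV n]] pq) auto
 fix I J assume "!!n. ((%x. g n (p x) - g n (q x)) has_integral I n) {s..t}"
 "((%x. f (p x) - f (q x)) has_integral J) {s..t}" "I \<longlonglongrightarrow> J"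
 then show thesis by (rule that)
 qed simp
 show ?thesis using IJ(3) unfolding integral_unique[OF IJ(1)] integral_unique[OF IJ(2)] .
 qed
 show "(LINT z:cbox (a, c) (b, e)|Leb. f1 z) = integral {c..e} (%y. f (b, y) - f (a, y))" if w: "wder S ex f f1"
 proof -
 have "(%n. LINT z:cbox (a, c) (b, e)|Leb. pd ex (g n) z) \<longlonglongrightarrow> (LINT z:cbox (a, c) (b, e)|Leb. f1 z)"
 by (rule set_integral_L1_tendsto[OF K C1_integrable(2)[OF g(1) K subset_UNIV ex_ey_Basis(1)] _ g(3)[OF w]])
 (use w in "auto simp: has_weak_deriv_def intro!: integrable_on_compact[OF _ K sub]")
 moreover have "(%n. LINT z:cbox (a, c) (b, e)|Leb. pd ex (g n) z) \<longlonglongrightarrow> integral {c..e} (%y. f (b, y) - f (a, y))"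
 unfolding gx by (rule lim) (use ab in "auto simp: mem intro!: continuous_intros")
 ultimately show ?thesis using LIMSEQ_unique by blast
 qed
 show "(LINT z:cbox (a, c) (b, e)|Leb. f2 z) = integral {a..b} (%x. f (x, e) - f (x, c))" if w: "wder S ey f f2"
 proof -
 have "(%n. LINT z:cbox (a, c) (b, e)|Leb. pd ey (g n) z) \<longlonglongrightarrow> (LINT z:cbox (a, c) (b, e)|Leb. f2 z)"
 by (rule set_integral_L1_tendsto[OF K C1_integrable(2)[OF g(1) K subset_UNIV ex_ey_Basis(2)] _ g(4)[OF w]])
 (use w in "auto simp: has_weak_deriv_def intro!: integrable_on_compact[OF _ K sub]")
 moreover have "(%n. LINT z:cbox (a, c) (b, e)|Leb. pd ey (g n) z) \<longlonglongrightarrow> integral {a..b} (%x. f (x, e) - f (x, c))"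
 unfolding ge by (rule lim) (use ab in "auto simp: mem intro!: continuous_intros")
 ultimately show ?thesis using LIMSEQ_unique by blast
 qed
qed

text \<open>The projection is not injective, but over a slab of width \<open>2 * M\<close> every
  level is counted with the weight \<open>2 * M\<close>.\<close>

lemma nonsingular_snd:
 fixes S :: "real set"
 assumes S: "open S" and M: "0 < M"
 shows "nonsingular (2 * M) (snd :: real \<times> real => real) ({-M<..<M} \<times> S) S"
 unfolding nonsingular_def
proof (intro conjI allI impI)
 show "open ({-M<..<M} \<times> S)" by (intro open_Times S) simp
 show "open S" by fact
 show "cts ({-M<..<M} \<times> S) snd" by (intro continuous_intros)
 show "snd ` ({-M<..<M} \<times> S) \<subseteq> S" by auto
 fix w :: "real => ennreal" assume w[measurable]: "w \<in> borel_measurable borel"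
 have [measurable]: "S \<in> sets borel" using S by simp
 have "(\<integral>\<^sup>+z. w (snd z) * indicator ({-M<..<M} \<times> S) z \<partial>(lborel :: (real \<times> real) measure))
 = (\<integral>\<^sup>+z. indicator {-M<..<M} (fst z) * (w (snd z) * indicator S (snd z)) \<partial>(lborel \<Otimes>\<^sub>M lborel))"
 unfolding lborel_prod by (rule nn_integral_cong) (auto simp: indicator_def)
 also have "... = (\<integral>\<^sup>+q. \<integral>\<^sup>+p. indicator {-M<..<M} q * (w p * indicator S p) \<partial>lborel \<partial>lborel)"
 proof -
 have "(%z. indicator {-M<..<M} (fst z) * (w (snd z) * indicator S (snd z))) \<in> borel_measurable (lborel \<Otimes>\<^sub>M lborel)"
 by measurable
 from lborel.nn_integral_fst[OF this] show ?thesis by simp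
 qed
 also have "... = (\<integral>\<^sup>+q. indicator {-M<..<M} q * (\<integral>\<^sup>+p. w p * indicator S p \<partial>lborel) \<partial>lborel)"
 by (rule nn_integral_cong, rule nn_integral_cmult) measurable
 also have "... = (\<integral>\<^sup>+q. indicator {-M<..<M} q \<partial>lborel) * (\<integral>\<^sup>+p. w p * indicator S p \<partial>lborel)"
 by (rule nn_integral_multc) measurable
 also have "(\<integral>\<^sup>+q. indicator {-M<..<M} q \<partial>lborel) = ennreal (2 * M)" using M by simp
 finally show "(\<integral>\<^sup>+z. w (snd z) * indicator ({-M<..<M} \<times> S) z \<partial>lborel) <= ennreal (2 * M) * (\<integral>\<^sup>+z. w z * indicator S z \<partial>lborel)"
 by simp
qed

lemma compact_in_product:
 fixes K :: "(real \<times> real) set"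
 assumes "compact K" "K \<subseteq> UNIV \<times> S"
 obtains M where "0 < M" "K \<subseteq> {-M<..<M} \<times> S"
proof -
 obtain B where B: "!!z. z \<in> K ==> norm z <= B" using compact_imp_bounded[OF assms(1)] unfolding bounded_iff by blast
 have "K \<subseteq> {-(abs B + 1)<..<abs B + 1} \<times> S"
 proof
 fix z assume z: "z \<in> K"
 have "abs (fst z) <= norm z" using norm_fst_le[of "fst z" "snd z"] by simp
 then have "abs (fst z) < abs B + 1" using B[OF z] by linarith
 then show "z \<in> {-(abs B + 1)<..<abs B + 1} \<times> S" using assms(2) z by (cases z) auto
 qed
 moreover have "0 < abs B + 1" by linarith
 ultimately show ?thesis using that by blast
qed

lemma locally_integrable_snd:
 fixes u :: "real => real"
 assumes S: "open S" and u: "loc_int S u"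
 shows "loc_int (UNIV \<times> S) (%z::real \<times> real. u (snd z))"
 unfolding locally_integrable_def
proof (intro allI impI, elim conjE)
 fix K :: "(real \<times> real) set" assume K: "compact K" "K \<subseteq> UNIV \<times> S"
 obtain M where M: "0 < M" "K \<subseteq> {-M<..<M} \<times> S" by (rule compact_in_product[OF K])
 from integrable_on_compact[OF nonsingular_locally_integrable[OF nonsingular_snd[OF S M(1)] u] K(1) M(2)]
 show "set_int Leb K (%z. u (snd z))" .
qed

text \<open>One-variable approximants of \<open>f\<close>, read as functions of the second
  coordinate, approximate the lifted function; their \<open>L\<^sub>1\<close> convergence is carried
  over by the projection on a slab that contains the given compact set.\<close>

lemma weak_deriv_snd:
 fixes f :: "real => real"
 assumes S: "open S" and f: "cts S f" "wder S 1 f f'"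
 shows "wder (UNIV \<times> S) ey (%z::real \<times> real. f (snd z)) (%z. f' (snd z))"
 and "wder (UNIV \<times> S) ex (%z::real \<times> real. f (snd z)) (%z. 0)"
proof -
 have cf: "cts (UNIV \<times> S) (%z::real \<times> real. f (snd z))"
 by (intro continuous_on_compose2[OF f(1)] continuous_intros) auto
 have li: "loc_int S f'" using f unfolding has_weak_deriv_def by auto
 have B: "(1::real) \<in> Basis" by simp
 have main: "\<exists>h. (\<forall>n. C1_on UNIV (h n)) & L1lim K h (%z. f (snd z)) &
 L1lim K (%n. pd ex (h n)) (%z. 0) & L1lim K (%n. pd ey (h n)) (%z. f' (snd z))"
 if K: "compact K" "K \<subseteq> UNIV \<times> S" for K :: "(real \<times> real) set"
 proof -
 obtain M where M: "0 < M" "K \<subseteq> {-M<..<M} \<times> S" by (rule compact_in_product[OF K])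
 have cs: "cts K (snd :: real \<times> real => real)" by (intro continuous_intros)
 have K1: "compact (snd ` K)" "snd ` K \<subseteq> S"
 using compact_continuous_image[OF cs K(1)] K(2) by auto
 obtain g where g: "!!n. C1_on UNIV (g n)" "uniform_limit (snd ` K) g f sequentially" "L1lim (snd ` K) (%n. pd 1 (g n)) f'"
 using weak_deriv_approx[OF S K1 f(1)] f(2) B by blast
 have gd: "g n differentiable (at x)" for n x using g(1)[of n] unfolding C1_on_def by blast
 have gc: "cts UNIV (pd 1 (g n))" for n using g(1)[of n] B unfolding C1_on_def by blast
 define h where "h n z = g n (snd z)" for n and z :: "real \<times> real"
 have D: "(h n has_derivative (%(s, t). pd 1 (g n) (snd z) * t)) (at z)" for n z
 proof -
 have "(snd has_derivative snd) (at z)" by (rule has_derivative_snd[OF has_derivative_ident])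
 from has_derivative_compose[OF this has_real_derivative_pd[OF gd, unfolded has_field_derivative_def]]
 show ?thesis unfolding h_def by (simp add: case_prod_unfold)
 qed
 have pdh: "pd ex (h n) = (%z. 0)" "pd ey (h n) = (%z. pd 1 (g n) (snd z))" for n
 using pd_eqI[OF D] by auto
 have C1h: "C1_on UNIV (h n)" for n
 unfolding C1_on_def Basis_prod_real
 proof (intro conjI ballI)
 show "h n differentiable (at z)" for z using D unfolding differentiable_def by blast
 fix b assume "b \<in> {ex, ey}"
 then show "cts UNIV (pd b (h n))"
 using pdh by (auto intro!: continuous_on_compose2[OF gc] continuous_intros)
 qed
 have "uniform_limit K h (%z. f (snd z)) sequentially"
 using g(2) unfolding uniform_limit_iff h_def by simp
 from L1lim_uniform[OF K(1) this] have "L1lim K h (%z. f (snd z))" .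
 moreover have "L1lim K (%n. pd ex (h n)) (%z. 0)" unfolding pdh by (rule L1lim_const)
 moreover have "L1lim K (%n. pd ey (h n)) (%z. f' (snd z))" unfolding pdh
 by (rule nonsingular_L1lim[OF nonsingular_snd[OF S M(1)] K(1) M(2) g(3)
 C1_integrable(2)[OF g(1) K1(1) subset_UNIV B] integrable_on_compact[OF li K1]])
 ultimately show ?thesis using C1h by blast
 qed
 show "wder (UNIV \<times> S) ey (%z::real \<times> real. f (snd z)) (%z. f' (snd z))"
 proof (rule has_weak_derivI_approx[OF ex_ey_Basis(2) locally_integrable_continuous[OF cf] locally_integrable_snd[OF S li]])
 fix K :: "(real \<times> real) set" assume "compact K" "K \<subseteq> UNIV \<times> S"
 from main[OF this] show "\<exists>g V. (\<forall>n. open (V n) & K \<subseteq> V n & C1_on (V n) (g n)) & L1lim K g (%z. f (snd z)) &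
 L1lim K (%n. pd ey (g n)) (%z. f' (snd z))"
 by (auto intro!: exI[of _ "%_. UNIV"])
 qed
 show "wder (UNIV \<times> S) ex (%z::real \<times> real. f (snd z)) (%z. 0)"
 proof (rule has_weak_derivI_approx[OF ex_ey_Basis(1) locally_integrable_continuous[OF cf] locally_integrable_continuous[OF continuous_on_const]])
 fix K :: "(real \<times> real) set" assume "compact K" "K \<subseteq> UNIV \<times> S"
 from main[OF this] show "\<exists>g V. (\<forall>n. open (V n) & K \<subseteq> V n & C1_on (V n) (g n)) & L1lim K g (%z. f (snd z)) &
 L1lim K (%n. pd ex (g n)) (%z. 0)"
 by (auto intro!: exI[of _ "%_. UNIV"])
 qed
qed

text \<open>In one direction the product set is covered by countably many bounded slabs. In the
  other, almost every vertical line satisfies the property, which does not depend on the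
  line.\<close>

lemma AE_snd_iff:
 fixes S :: "real set"
 assumes S: "open S"
 shows "(AE z in Leb. z \<in> UNIV \<times> S --> P (snd (z :: real \<times> real))) \<longleftrightarrow> (AE p in Leb. p \<in> S --> P p)"
proof
 assume a: "AE p in Leb. p \<in> S --> P p"
 have "AE z in Leb. z \<in> {- real (Suc n)<..<real (Suc n)} \<times> S --> P (snd z)" for n
 by (rule nonsingular_AE[OF nonsingular_snd[OF S] a]) simp
 then have "AE z in Leb. \<forall>n. z \<in> {- real (Suc n)<..<real (Suc n)} \<times> S --> P (snd z)"
 unfolding AE_all_countable by blast
 then show "AE z in Leb. z \<in> UNIV \<times> S --> P (snd (z :: real \<times> real))"
 proof (rule AE_mp, intro AE_I2 impI)
 fix z :: "real \<times> real" assume h: "\<forall>n. z \<in> {- real (Suc n)<..<real (Suc n)} \<times> S --> P (snd z)" and z: "z \<in> UNIV \<times> S"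
 obtain n where "abs (fst z) < real n" using reals_Archimedean2 by blast
 then have "z \<in> {- real (Suc n)<..<real (Suc n)} \<times> S" using z by (cases z) auto
 then show "P (snd z)" using h by blast
 qed
next
 assume "AE z in Leb. z \<in> UNIV \<times> S --> P (snd (z :: real \<times> real))"
 then have "AE z in (lborel \<Otimes>\<^sub>M lborel). z \<in> UNIV \<times> S --> P (snd (z :: real \<times> real))"
 unfolding lborel_prod by (simp add: AE_completion_iff)
 from lborel_pair.AE_pair[OF this]
 have "AE q in (lborel :: real measure). AE p in lborel. p \<in> S --> P p" by simp
 moreover have "ae_filter (lborel :: real measure) ~= bot" by (simp add: ae_filter_eq_bot_iff)
 ultimately have "AE p in lborel. p \<in> S --> P p" by (simp add: eventually_const)
 then show "AE p in Leb. p \<in> S --> P p" by (rule AE_completion)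
qed

text \<open>The candidate for the one-variable derivative is the mean of \<open>f'\<close> over
  horizontal positions in the unit interval. Integration over the box above the segment from
  \<open>a\<close> to \<open>b\<close> yields \<open>R b - R a\<close>, so the candidate is a weak
  derivative of \<open>R\<close>; lifted back to the plane it agrees with \<open>f'\<close> by
  uniqueness.\<close>

lemma weak_deriv_of_snd:
 fixes R :: "real => real"
 assumes R: "cts {s<..<t} R"
 and w: "wder (UNIV \<times> {s<..<t}) ey (%z::real \<times> real. R (snd z)) f'"
 shows "\<exists>R'. R' \<in> borel_measurable borel & wder {s<..<t} 1 R R' &
 (AE z in Leb. z \<in> UNIV \<times> {s<..<t} --> f' z = R' (snd z))"
proof -
 let ?S = "{s<..<t}"
 let ?T = "UNIV \<times> ?S :: (real \<times> real) set"
 have T: "open ?T" by (intro open_Times) auto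
 have cR: "cts ?T (%z. R (snd z))"
 by (intro continuous_on_compose2[OF R] continuous_intros) auto
 have li: "loc_int ?T f'" using w unfolding has_weak_deriv_def by blast
 obtain u where u: "u \<in> borel_measurable lborel" "AE z in lborel. indicator ?T z * f' z = u z"
 using completion_ex_borel_measurable_real[OF locally_integrable_measurable[OF T li]] by blast
 have um[measurable]: "u \<in> borel_measurable (borel \<Otimes>\<^sub>M borel)" using u(1) by (simp add: borel_prod)
 \<comment> \<open>The Borel version \<open>u\<close> of \<open>f'\<close> makes the partial
   integral a Borel function of \<open>p\<close>, which later allows its integrability to be read
   off fibrewise.\<close>
 define R' where "R' p = integral\<^sup>L lborel (%q. indicator {0..1} q * u (q, p))" for p
 have R'm[measurable]: "R' \<in> borel_measurable borel" unfolding R'_def by measurable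
 have key: "set_int Leb {a..b} R' & (LINT p:{a..b}|Leb. R' p) = R b - R a"
 if ab: "a <= b" "{a..b} \<subseteq> ?S" for a b
 proof -
 have sub: "cbox (0, a) (1, b) \<subseteq> ?T" using ab(2) by (auto simp: cbox_Pair_eq)
 have AE: "AE z in Leb. indicator (cbox (0, a) (1, b)) z *\<^sub>R f' z = indicator (cbox (0, a) (1, b)) z * u z"
 using AE_completion[OF u(2)] by (rule AE_mp) (use sub in "auto intro!: AE_I2 simp: indicator_def")
 have i: "integrable Leb (%z. indicator (cbox (0, a) (1, b)) z *\<^sub>R f' z)"
 using integrable_on_compact[OF li compact_cbox sub] unfolding set_integrable_def .
 have m: "(%z. indicator (cbox (0, a) (1, b)) z * u z) \<in> borel_measurable lborel" using u(1) by measurable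
 have i2: "integrable lborel (%z. indicator (cbox (0, a) (1, b)) z * u z)"
 using integrable_cong_AE_imp[OF i measurable_completion[OF m] AE] integrable_completion[OF m] by simp
 have e: "(%z. indicator (cbox (0, a) (1, b)) z * u z) = (%(q, p). indicator {a..b} p * (indicator {0..1} q * u (q, p)))"
 by (auto simp: indicator_def cbox_Pair_eq)
 have i3: "integrable (lborel \<Otimes>\<^sub>M lborel) (%(q, p). indicator {a..b} p * (indicator {0..1} q * u (q, p)))"
 using i2 unfolding e lborel_prod .
 have i4: "integrable lborel (%p. integral\<^sup>L lborel (%q. indicator {a..b} p * (indicator {0..1} q * u (q, p))))"
 by (rule lborel_pair.integrable_snd[OF i3])
 have e4: "integral\<^sup>L lborel (%q. indicator {a..b} p * (indicator {0..1} q * u (q, p))) = indicator {a..b} p * R' p" for p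
 unfolding R'_def by (rule integral_mult_right_zero)
 have "integral\<^sup>L lborel (%p. indicator {a..b} p * R' p) = integral\<^sup>L (lborel \<Otimes>\<^sub>M lborel) (%(q, p). indicator {a..b} p * (indicator {0..1} q * u (q, p)))"
 using lborel_pair.integral_snd[OF i3] unfolding e4 .
 also have "... = integral\<^sup>L lborel (%z. indicator (cbox (0, a) (1, b)) z * u z)" unfolding e lborel_prod ..
 also have "... = integral\<^sup>L Leb (%z. indicator (cbox (0, a) (1, b)) z * u z)"
 by (rule integral_completion[symmetric, OF m])
 also have "... = (LINT z:cbox (0, a) (1, b)|Leb. f' z)"
 unfolding set_lebesgue_integral_def by (rule lebesgue_integral_cong_AE[symmetric, OF borel_measurable_integrable[OF i] AE])
 also have "... = integral {0..1} (%x. R (snd (x::real, b)) - R (snd (x, a)))"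
 by (rule weak_deriv_box(2)[OF T cR _ ab(1) sub w]) simp
 also have "... = R b - R a" by simp
 finally have I: "integral\<^sup>L lborel (%p. indicator {a..b} p * R' p) = R b - R a" .
 have m5: "(%p. indicator {a..b} p *\<^sub>R R' p) \<in> borel_measurable lborel" by measurable
 have "integrable lborel (%p. indicator {a..b} p *\<^sub>R R' p)" using i4 unfolding e4 by simp
 then show ?thesis unfolding set_integrable_def set_lebesgue_integral_def
 using integrable_completion[OF m5] integral_completion[OF m5] I by simp
 qed
 have liR: "loc_int ?S R'"
 unfolding locally_integrable_def
 proof (intro allI impI, elim conjE)
 fix K assume K: "compact K" "K \<subseteq> ?S"
 show "set_int Leb K R'"
 proof (cases "K = {}")
 case False
 obtain a where a: "a \<in> K" "!!x. x \<in> K ==> a <= x" using compact_attains_inf[OF K(1) False] by blast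
 obtain b where b: "b \<in> K" "!!x. x \<in> K ==> x <= b" using compact_attains_sup[OF K(1) False] by blast
 have ab: "a <= b" "{a..b} \<subseteq> ?S" "K \<subseteq> {a..b}" using a b K(2) by (force)+
 show ?thesis
 by (rule set_integrable_subset[OF key[OF ab(1,2), THEN conjunct1] fmeasurableD[OF lmeasurable_compact[OF K(1)]] ab(3)])
 qed simp
 qed
 have w1: "wder ?S 1 R R'"
 by (rule weak_derivI_FTC[OF _ _ R liR]) (use key in "auto simp: is_interval_oo")
 have "AE z in Leb. z \<in> ?T --> f' z = R' (snd z)"
 by (rule has_weak_deriv_unique[OF T cR ex_ey_Basis(2) w weak_deriv_snd(1)[OF _ R w1]]) simp
 with w1 R'm show ?thesis by blast
qed

text \<open>Symmetry is derived from integrals: both mixed derivatives have the same integral over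
  every box, namely the alternating sum of \<open>\<phi>\<close> over the corners, and a continuous
  function whose box integrals all vanish is zero.\<close>

lemma smooth_pd_commute:
 fixes \<phi> :: "real \<times> real => real"
 assumes sm: "smooth \<phi>"
 shows "pd ey (pd ex \<phi>) = pd ex (pd ey \<phi>)"
proof
 fix z :: "real \<times> real"
 obtain x y where z: "z = (x, y)" by (cases z)
 have C1: "C1_on UNIV \<theta>" if "smooth \<theta>" for \<theta> :: "real \<times> real => real"
 unfolding C1_on_def using smooth_differentiable[OF that] smooth_continuous[OF smooth_pd[OF that]] by blast
 note sx = smooth_pd[OF sm ex_ey_Basis(1)] and sy = smooth_pd[OF sm ex_ey_Basis(2)]
 have box0: "integral (cbox (a, c) (b, e)) (pd ex (pd ey \<phi>)) = \<phi> (b, e) - \<phi> (b, c) - (\<phi> (a, e) - \<phi> (a, c))"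
 "integral (cbox (a, c) (b, e)) (pd ey (pd ex \<phi>)) = \<phi> (b, e) - \<phi> (b, c) - (\<phi> (a, e) - \<phi> (a, c))"
 if ab: "a <= b" "c <= e" for a b c e
 proof -
 have i: "(%x. pd ey \<phi> (p x)) integrable_on {s..t}" "(%x. pd ex \<phi> (p x)) integrable_on {s..t}"
 if "cts {s..t} p" for p :: "real => real \<times> real" and s t
 by (intro integrable_continuous_real continuous_on_compose2[OF smooth_continuous[OF sy, of UNIV] that]
 continuous_on_compose2[OF smooth_continuous[OF sx, of UNIV] that] subset_UNIV)+
 have "integral (cbox (a, c) (b, e)) (pd ex (pd ey \<phi>)) = integral {c..e} (%y. pd ey \<phi> (b, y) - pd ey \<phi> (a, y))"
 using weak_deriv_box(1)[OF open_UNIV smooth_continuous[OF sy] ab subset_UNIV has_weak_deriv_C1[OF open_UNIV C1[OF sy] ex_ey_Basis(1)]]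
 set_integral_eq_HK[OF smooth_continuous[OF smooth_pd[OF sy ex_ey_Basis(1)]]] by simp
 also have "... = integral {c..e} (%y. pd ey \<phi> (b, y)) - integral {c..e} (%y. pd ey \<phi> (a, y))"
 by (intro Henstock_Kurzweil_Integration.integral_diff i(1) continuous_on_Pair continuous_on_const continuous_on_id)
 also have "... = \<phi> (b, e) - \<phi> (b, c) - (\<phi> (a, e) - \<phi> (a, c))"
 using FTC_real[OF ab(2) C1_on_lines(2)[OF smooth_differentiable[OF sm]]] by simp
 finally show "integral (cbox (a, c) (b, e)) (pd ex (pd ey \<phi>)) = \<phi> (b, e) - \<phi> (b, c) - (\<phi> (a, e) - \<phi> (a, c))" .
 have "integral (cbox (a, c) (b, e)) (pd ey (pd ex \<phi>)) = integral {a..b} (%x. pd ex \<phi> (x, e) - pd ex \<phi> (x, c))"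
 using weak_deriv_box(2)[OF open_UNIV smooth_continuous[OF sx] ab subset_UNIV has_weak_deriv_C1[OF open_UNIV C1[OF sx] ex_ey_Basis(2)]]
 set_integral_eq_HK[OF smooth_continuous[OF smooth_pd[OF sx ex_ey_Basis(2)]]] by simp
 also have "... = integral {a..b} (%x. pd ex \<phi> (x, e)) - integral {a..b} (%x. pd ex \<phi> (x, c))"
 by (intro Henstock_Kurzweil_Integration.integral_diff i(2) continuous_on_Pair continuous_on_const continuous_on_id)
 also have "... = \<phi> (b, e) - \<phi> (b, c) - (\<phi> (a, e) - \<phi> (a, c))"
 using FTC_real[OF ab(1) C1_on_lines(1)[OF smooth_differentiable[OF sm]]] by simp
 finally show "integral (cbox (a, c) (b, e)) (pd ey (pd ex \<phi>)) = \<phi> (b, e) - \<phi> (b, c) - (\<phi> (a, e) - \<phi> (a, c))" .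
 qed
 define D where "D w = pd ey (pd ex \<phi>) w - pd ex (pd ey \<phi>) w" for w
 have cD: "cts A D" for A
 unfolding D_def by (intro continuous_on_diff smooth_continuous smooth_pd sm ex_ey_Basis)
 have iD: "integral (cbox (a, c) (b, e)) D = 0" if ab: "a <= b" "c <= e" for a b c e
 unfolding D_def using box0[OF ab]
 by (subst Henstock_Kurzweil_Integration.integral_diff)
 (auto intro!: integrable_continuous smooth_continuous smooth_pd sm ex_ey_Basis)
 have "D z = 0"
 proof (rule ccontr)
 assume n: "D z ~= 0"
 have "isCont D z" using cD[of UNIV] by (simp add: continuous_on_eq_continuous_at z)
 then obtain r where r: "r > 0" "!!w. dist w z < r ==> dist (D w) (D z) < abs (D z) / 2"
 unfolding continuous_at_eps_delta using n by (metis half_gt_zero zero_less_abs_iff)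
 \<comment> \<open>All points of a box of this side with corner \<open>z\<close> are within distance
   \<open>r / 2\<close> of \<open>z\<close>.\<close>
 define d where "d = r / 4"
 have d: "d > 0" unfolding d_def using r(1) by simp
 let ?B = "cbox (x, y) (x + d, y + d)"
 have near: "norm (D w - D z) <= abs (D z) / 2" if w: "w \<in> ?B" for w
 proof -
 obtain p q where pq: "w = (p, q)" by (cases w)
 have "abs (p - x) <= d" "abs (q - y) <= d" using w unfolding pq by (auto simp: cbox_Pair_eq)
 then have "dist w z <= d + d"
 unfolding pq z dist_Pair_Pair dist_real_def by (intro order_trans[OF sqrt_sum_squares_le_sum]) auto
 then have "dist w z < r" using d unfolding d_def by simp
 from r(2)[OF this] show ?thesis by (simp add: dist_norm)
 qed
 have cont: "measure lborel ?B = d * d" using d by (simp add: content_Pair)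
 have le: "norm (integral ?B (%w. D w - D z)) <= abs (D z) / 2 * measure lborel ?B"
 by (rule integrable_bound) (use near n in "auto intro!: integrable_continuous continuous_intros cD")
 have e1: "integral ?B (%w. D w - D z) = integral ?B D - integral ?B (%w. D z)"
 by (rule Henstock_Kurzweil_Integration.integral_diff) (auto intro!: integrable_continuous cD)
 have e2: "integral ?B (%w. D z) = d * d * D z"
 unfolding integral_const cont by simp
 have "integral ?B (%w. D w - D z) = - (d * d * D z)"
 unfolding e1 e2 using iD[of x "x + d" y "y + d"] d by simp
 with le have "d * d * abs (D z) <= abs (D z) / 2 * (d * d)"
 unfolding cont by (simp add: abs_mult)
 moreover have "0 < d * d * abs (D z)" using d n by simp
 ultimately show False by (simp add: field_simps)
 qed
 then show "pd ey (pd ex \<phi>) z = pd ex (pd ey \<phi>) z" unfolding D_def by simp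
qed

text \<open>Both derivatives are moved onto the test function, where they commute. Thus
  \<open>v\<close> is also a weak derivative of \<open>pd ex f\<close> in the direction
  \<open>ey\<close>, and uniqueness compares it with \<open>u\<close>.\<close>

lemma mixed_weak_deriv:
 fixes f :: "real \<times> real => real"
 assumes S: "open S" and f: "C1_on S f"
 and w: "wder S ey (pd ex f) u" "wder S ex (pd ey f) v"
 shows "AE z in Leb. z \<in> S --> u z = v z"
proof -
 have pc: "cts S (pd ex f)" "cts S (pd ey f)" using f ex_ey_Basis unfolding C1_on_def by auto
 have wf: "wder S ex f (pd ex f)" "wder S ey f (pd ey f)"
 by (rule has_weak_deriv_C1[OF S f ex_ey_Basis(1)]) (rule has_weak_deriv_C1[OF S f ex_ey_Basis(2)])
 have "wder S ey (pd ex f) v"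
 unfolding has_weak_deriv_def
 proof (intro conjI ballI)
 show "loc_int S (pd ex f)" "loc_int S v"
 using w unfolding has_weak_deriv_def by auto
 fix \<phi> assume ph: "\<phi> \<in> test_functions S"
 then have sm: "smooth \<phi>" and K: "compact (closure {z. \<phi> z ~= 0})" "closure {z. \<phi> z ~= 0} \<subseteq> S"
 unfolding test_functions_def by auto
 have T: "pd b \<phi> \<in> test_functions S" if b: "b \<in> Basis" for b
 proof -
 have "{z. pd b \<phi> z ~= 0} \<subseteq> closure {z. \<phi> z ~= 0}"
 proof (rule ccontr)
 assume "\<not> ?thesis"
 then obtain z where z: "pd b \<phi> z ~= 0" "z \<in> - closure {z. \<phi> z ~= 0}" by blast
 have "pd b \<phi> z = 0"
 using pd_zero[OF open_Compl[OF closed_closure] z(2), of \<phi> b] closure_subset[of "{z. \<phi> z ~= 0}"] by blast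
 with z(1) show False by simp
 qed
 then have "closure {z. pd b \<phi> z ~= 0} \<subseteq> closure {z. \<phi> z ~= 0}" by (rule closure_minimal) simp
 then show ?thesis using K smooth_pd[OF sm b] unfolding test_functions_def
 by (auto intro: compact_closure[THEN iffD2] bounded_subset[OF compact_imp_bounded[OF K(1)] order_trans[OF closure_subset]])
 qed
 have comm: "pd ey (pd ex \<phi>) = pd ex (pd ey \<phi>)"
 using smooth_pd_commute[OF sm] by blast
 have wt: "(LINT z:S|Leb. f z * pd b \<theta> z) = - (LINT z:S|Leb. g z * \<theta> z)"
 if "wder S b f g" "\<theta> \<in> test_functions S" for b f g \<theta>
 using that unfolding has_weak_deriv_def by blast
 show "(LINT z:S|Leb. pd ex f z * pd ey \<phi> z) = - (LINT z:S|Leb. v z * \<phi> z)"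
 using wt[OF wf(1) T[OF ex_ey_Basis(2)]] wt[OF wf(2) T[OF ex_ey_Basis(1)]] wt[OF w(2) ph]
 unfolding comm by simp
 qed
 then show ?thesis using has_weak_deriv_unique[OF S pc(1) ex_ey_Basis(2) w(1)] by blast
qed

section \<open>Sobolev and Hoelder functions\<close>

lemma Lr_iff:
 fixes f :: "'a::euclidean_space => real"
 assumes C: "open C"
 shows "Lr r C f \<longleftrightarrow> (%z. indicator C z * f z) \<in> borel_measurable Leb &
 (\<integral>\<^sup>+z. ennreal (abs (f z) powr r) * indicator C z \<partial>Leb) < \<infinity>"
proof -
 have Cm: "C \<inter> space Leb \<in> sets Leb" using C by simp
 have m: "f \<in> borel_measurable (lebesgue_on C) \<longleftrightarrow> (%z. indicator C z * f z) \<in> borel_measurable Leb"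
 using borel_measurable_restrict_space_iff[OF Cm, of f] by simp
 have "integrable (lebesgue_on C) (%z. abs (f z) powr r) \<longleftrightarrow> (\<integral>\<^sup>+z. ennreal (abs (f z) powr r) * indicator C z \<partial>Leb) < \<infinity>"
 if f: "f \<in> borel_measurable (lebesgue_on C)"
 proof -
 have "(%z. abs (f z) powr r) \<in> borel_measurable (lebesgue_on C)" using f by measurable
 then have "integrable (lebesgue_on C) (%z. abs (f z) powr r) \<longleftrightarrow> (\<integral>\<^sup>+z. ennreal (norm (abs (f z) powr r)) \<partial>lebesgue_on C) < \<infinity>"
 unfolding integrable_iff_bounded by simp
 also have "(\<integral>\<^sup>+z. ennreal (norm (abs (f z) powr r)) \<partial>lebesgue_on C) = (\<integral>\<^sup>+z. ennreal (abs (f z) powr r) * indicator C z \<partial>Leb)"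
 by (subst nn_integral_restrict_space[OF Cm]) simp
 finally show ?thesis .
 qed
 then show ?thesis unfolding Lr_def using m by blast
qed

lemma Lr_cong_AE:
 fixes f g :: "'a::euclidean_space => real"
 assumes C: "open C" and f: "Lr r C f" and AE: "AE z in Leb. z \<in> C --> f z = g z"
 shows "Lr r C g"
proof -
 have f': "(%z. indicator C z * f z) \<in> borel_measurable Leb"
 "(\<integral>\<^sup>+z. ennreal (abs (f z) powr r) * indicator C z \<partial>Leb) < \<infinity>" using f unfolding Lr_iff[OF C] by auto
 have AE1: "AE z in Leb. indicator C z * f z = indicator C z * g z"
 using AE by (rule AE_mp) (auto intro!: AE_I2 simp: indicator_def)
 have "(\<integral>\<^sup>+z. ennreal (abs (f z) powr r) * indicator C z \<partial>Leb) = (\<integral>\<^sup>+z. ennreal (abs (g z) powr r) * indicator C z \<partial>Leb)"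
 by (rule nn_integral_cong_AE, rule AE_mp[OF AE]) (auto intro!: AE_I2 simp: indicator_def)
 then show ?thesis unfolding Lr_iff[OF C] using borel_measurable_AE[OF f'(1) AE1] f'(2) by simp
qed

lemma Lr_mult_bounded:
 fixes f a :: "'a::euclidean_space => real"
 assumes C: "open C" and f: "Lr r C f" and r: "1 <= r"
 and a: "cts C a" "!!z. z \<in> C ==> abs (a z) <= M"
 shows "Lr r C (%z. a z * f z)"
proof -
 have f': "(%z. indicator C z * f z) \<in> borel_measurable Leb"
 "(\<integral>\<^sup>+z. ennreal (abs (f z) powr r) * indicator C z \<partial>Leb) < \<infinity>" using f unfolding Lr_iff[OF C] by auto
 have "(%z. indicator C z *\<^sub>R a z) \<in> borel_measurable borel"
 by (rule borel_measurable_continuous_on_indicator) (use C a in auto)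
 then have "(%z. indicator C z * a z) \<in> borel_measurable Leb" by (intro measurable_completion) simp
 then have "(%z. (indicator C z * a z) * (indicator C z * f z)) \<in> borel_measurable Leb"
 using f'(1) by (rule borel_measurable_times)
 moreover have "(%z. (indicator C z * a z) * (indicator C z * f z)) = (%z. indicator C z * (a z * f z))"
 by (auto simp: indicator_def)
 ultimately have m: "(%z. indicator C z * (a z * f z)) \<in> borel_measurable Leb" by (simp only:)
 have pm: "(%z. ennreal (abs (f z) powr r) * indicator C z) \<in> borel_measurable Leb"
 proof -
 have "(%z. ennreal (abs (indicator C z * f z) powr r)) \<in> borel_measurable Leb" using f'(1) by measurable
 moreover have "(%z. ennreal (abs (indicator C z * f z) powr r)) = (%z. ennreal (abs (f z) powr r) * indicator C z)"
 by (auto simp: indicator_def fun_eq_iff)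
 ultimately show ?thesis by (simp only:)
 qed
 have "(\<integral>\<^sup>+z. ennreal (abs (a z * f z) powr r) * indicator C z \<partial>Leb)
 <= (\<integral>\<^sup>+z. ennreal (abs M powr r) * (ennreal (abs (f z) powr r) * indicator C z) \<partial>Leb)"
 proof (rule nn_integral_mono)
 fix z
 show "ennreal (abs (a z * f z) powr r) * indicator C z <= ennreal (abs M powr r) * (ennreal (abs (f z) powr r) * indicator C z)"
 proof (cases "z \<in> C")
 case True
 have "abs (a z) <= abs M" using a(2)[OF True] by linarith
 then have "abs (a z) powr r <= abs M powr r" using r by (intro powr_mono2) auto
 then have "abs (a z * f z) powr r <= abs M powr r * abs (f z) powr r"
 by (simp add: abs_mult powr_mult mult_right_mono)
 then have "ennreal (abs (a z * f z) powr r) <= ennreal (abs M powr r) * ennreal (abs (f z) powr r)"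
 by (subst ennreal_mult[symmetric]) (auto intro: ennreal_leI)
 then show ?thesis using True by simp
 qed simp
 qed
 also have "... = ennreal (abs M powr r) * (\<integral>\<^sup>+z. ennreal (abs (f z) powr r) * indicator C z \<partial>Leb)"
 by (rule nn_integral_cmult[OF pm])
 also have "... < \<infinity>" using f'(2) by (simp add: ennreal_mult_less_top)
 finally show ?thesis unfolding Lr_iff[OF C] using m by simp
qed

lemma Lr_add:
 fixes f g :: "'a::euclidean_space => real"
 assumes C: "open C" and f: "Lr r C f" and g: "Lr r C g" and r: "1 <= r"
 shows "Lr r C (%z. f z + g z)"
proof -
 have m: "f \<in> borel_measurable (lebesgue_on C)" "g \<in> borel_measurable (lebesgue_on C)"
 and i: "integrable (lebesgue_on C) (%z. abs (f z) powr r)" "integrable (lebesgue_on C) (%z. abs (g z) powr r)"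
 using f g unfolding Lr_def by auto
 have "integrable (lebesgue_on C) (%z. abs (f z + g z) powr r)"
 proof (rule Bochner_Integration.integrable_bound)
 show "integrable (lebesgue_on C) (%z. 2 powr r * (abs (f z) powr r + abs (g z) powr r))"
 by (intro integrable_mult_right Bochner_Integration.integrable_add i)
 show "(%z. abs (f z + g z) powr r) \<in> borel_measurable (lebesgue_on C)" using m by measurable
 show "AE z in lebesgue_on C. norm (abs (f z + g z) powr r) <= norm (2 powr r * (abs (f z) powr r + abs (g z) powr r))"
 proof (rule AE_I2)
 fix z
 have "\<bar>f z + g z\<bar> <= 2 * max \<bar>f z\<bar> \<bar>g z\<bar>" by linarith
 then have "\<bar>f z + g z\<bar> powr r <= (2 * max \<bar>f z\<bar> \<bar>g z\<bar>) powr r" using r by (intro powr_mono2) auto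
 also have "... = 2 powr r * max \<bar>f z\<bar> \<bar>g z\<bar> powr r" by (rule powr_mult)
 also have "... <= 2 powr r * (abs (f z) powr r + abs (g z) powr r)"
 by (intro mult_left_mono) (auto simp: max_def)
 finally show "norm (abs (f z + g z) powr r) <= norm (2 powr r * (abs (f z) powr r + abs (g z) powr r))" by simp
 qed
 qed
 then show ?thesis unfolding Lr_def using m by simp
qed

lemma Lr_bounded_continuous:
 fixes f :: "'a::euclidean_space => real"
 assumes C: "open C" "bounded C" and f: "cts C f" "!!z. z \<in> C ==> abs (f z) <= M" and r: "1 <= r"
 shows "Lr r C f"
proof -
 have "Lr r C (%z. 1::real)" unfolding Lr_iff[OF C(1)]
 proof
 have "C \<in> sets Leb" using C(1) by simp
 then show "(%z. indicator C z * (1::real)) \<in> borel_measurable Leb" by measurable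
 have "(\<integral>\<^sup>+z. ennreal (abs 1 powr r) * indicator C z \<partial>Leb) = emeasure lborel C"
 unfolding nn_integral_completion using C(1) by simp
 also have "... < \<infinity>" by (rule emeasure_bounded_finite[OF C(2)])
 finally show "(\<integral>\<^sup>+z. ennreal (abs 1 powr r) * indicator C z \<partial>Leb) < \<infinity>" .
 qed
 from Lr_mult_bounded[OF C(1) this r f] show ?thesis by simp
qed

lemma Lr_nonsingular:
 fixes f :: "'b::euclidean_space => real" and G :: "'a::euclidean_space => 'b"
 assumes G: "nonsingular c G T S" and C: "open C" "C \<subseteq> T" and D: "open D" "D \<subseteq> S" "!!z. z \<in> C ==> G z \<in> D"
 and f: "Lr r D f"
 shows "Lr r C (%z. f (G z))"
proof -
 have f': "(%z. indicator D z * f z) \<in> borel_measurable Leb"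
 "(\<integral>\<^sup>+z. ennreal (abs (f z) powr r) * indicator D z \<partial>Leb) < \<infinity>" using f unfolding Lr_iff[OF D(1)] by auto
 have "(%z. indicator S z * (indicator D z * f z)) = (%z. indicator D z * f z)"
 using D(2) by (auto simp: indicator_def fun_eq_iff)
 then have "(%z. indicator T z * (indicator D (G z) * f (G z))) \<in> borel_measurable Leb"
 using nonsingular_measurable[OF G, of "%z. indicator D z * f z"] f'(1) by simp
 from indicator_subset_measurable[OF this _ C(2)] C(1)
 have "(%z. indicator C z * (indicator D (G z) * f (G z))) \<in> borel_measurable Leb" by simp
 moreover have "(%z. indicator C z * (indicator D (G z) * f (G z))) = (%z. indicator C z * f (G z))"
 using D(3) by (auto simp: indicator_def fun_eq_iff)
 ultimately have m: "(%z. indicator C z * f (G z)) \<in> borel_measurable Leb" by (simp only:)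
 have pm: "(%z. ennreal (abs (f z) powr r) * indicator D z) \<in> borel_measurable Leb"
 proof -
 have "(%z. ennreal (abs (indicator D z * f z) powr r)) \<in> borel_measurable Leb" using f'(1) by measurable
 moreover have "(%z. ennreal (abs (indicator D z * f z) powr r)) = (%z. ennreal (abs (f z) powr r) * indicator D z)"
 by (auto simp: indicator_def fun_eq_iff)
 ultimately show ?thesis by (simp only:)
 qed
 have "(\<integral>\<^sup>+z. ennreal (abs (f (G z)) powr r) * indicator C z \<partial>Leb)
 <= (\<integral>\<^sup>+z. (ennreal (abs (f (G z)) powr r) * indicator D (G z)) * indicator T z \<partial>Leb)"
 by (rule nn_integral_mono) (use C(2) D(3) in "auto simp: indicator_def")
 also have "... <= ennreal c * (\<integral>\<^sup>+z. (ennreal (abs (f z) powr r) * indicator D z) * indicator S z \<partial>Leb)"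
 by (rule nonsingular_nn[OF G pm])
 also have "... <= ennreal c * (\<integral>\<^sup>+z. ennreal (abs (f z) powr r) * indicator D z \<partial>Leb)"
 by (intro mult_left_mono nn_integral_mono) (auto simp: indicator_def)
 also have "... < \<infinity>" using f'(2) by (simp add: ennreal_mult_less_top)
 finally show ?thesis unfolding Lr_iff[OF C(1)] using m by simp
qed

text \<open>The weak partial derivatives \<open>f1\<close> and \<open>f2\<close> are carried
  explicitly, so that chain rules compute them. They are taken on the full domain \<open>S\<close>,
  while integrability is asked on the period cell \<open>C\<close>. Continuity of \<open>f\<close>
  is built in because approximation and uniqueness rely on it.\<close>

definition W1r :: "real => (real \<times> real) set => (real \<times> real) set => (real \<times> real => real) =>
 (real \<times> real => real) => (real \<times> real => real) => bool" where
 "W1r r S C f f1 f2 \<longleftrightarrow> open S & open C & C \<subseteq> S & 1 <= r & cts S f &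
 wder S ex f f1 & wder S ey f f2 & Lr r C f1 & Lr r C f2"

text \<open>The master rule: products, linear combinations, quotients and one-variable compositions
  are obtained by choosing \<open>F\<close>. Boundedness of the partial derivatives is asked on the
  cell, where it preserves \<open>L\<^sub>r\<close>; on \<open>S\<close> their continuity takes care
  of local integrability.\<close>

lemma W1r_chain:
 assumes f: "W1r r S C f f1 f2" and g: "W1r r S C g g1 g2"
 and V: "open V" "!!z. z \<in> S ==> (f z, g z) \<in> V"
 and F: "!!w. w \<in> V ==> (F has_derivative (%(s, t). A w * s + B w * t)) (at w)"
 and AB: "cts V A" "cts V B"
 and bd: "!!z. z \<in> C ==> abs (A (f z, g z)) <= M" "!!z. z \<in> C ==> abs (B (f z, g z)) <= M"
 shows "W1r r S C (%z. F (f z, g z)) (%z. A (f z, g z) * f1 z + B (f z, g z) * g1 z)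
 (%z. A (f z, g z) * f2 z + B (f z, g z) * g2 z)"
proof -
 have S: "open S" "open C" "C \<subseteq> S" "1 <= r" and fc: "cts S f" "cts S g"
 and w: "wder S ex f f1" "wder S ey f f2" "wder S ex g g1" "wder S ey g g2"
 and L: "Lr r C f1" "Lr r C f2" "Lr r C g1" "Lr r C g2" using f g unfolding W1r_def by auto
 have cfg: "cts S (%z. (f z, g z))" using fc by (intro continuous_intros)
 have comp: "cts S (%z. P (f z, g z))" if "cts V P" for P :: "real \<times> real => real"
 by (rule continuous_on_compose2[OF that cfg]) (use V(2) in auto)
 have cF: "cts V F"
 using has_derivative_continuous[OF F] by (simp add: continuous_at_imp_continuous_on)
 have c: "cts C (%z. A (f z, g z))" "cts C (%z. B (f z, g z))"
 using comp[OF AB(1)] comp[OF AB(2)] S(3) by (auto intro: continuous_on_subset)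
 show ?thesis unfolding W1r_def
 by (intro conjI S comp[OF cF] has_weak_deriv_chain[OF S(1) ex_ey_Basis(1) fc(1) w(1) fc(2) w(3) V F AB]
 has_weak_deriv_chain[OF S(1) ex_ey_Basis(2) fc(1) w(2) fc(2) w(4) V F AB]
 Lr_add[OF S(2) _ _ S(4)] Lr_mult_bounded[OF S(2) L(1) S(4) c(1) bd(1)] Lr_mult_bounded[OF S(2) L(2) S(4) c(1) bd(1)]
 Lr_mult_bounded[OF S(2) L(3) S(4) c(2) bd(2)] Lr_mult_bounded[OF S(2) L(4) S(4) c(2) bd(2)])
qed

lemma W1r_cong_AE:
 assumes "W1r r S C f f1 f2" and "AE z in Leb. z \<in> S --> f1 z = g1 z" "AE z in Leb. z \<in> S --> f2 z = g2 z"
 shows "W1r r S C f g1 g2"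
proof -
 have S: "open S" "open C" "C \<subseteq> S" using assms(1) unfolding W1r_def by auto
 have "AE z in Leb. z \<in> C --> f1 z = g1 z"
 using assms(2) by (rule AE_mp) (use S(3) in "auto intro!: AE_I2")
 moreover have "AE z in Leb. z \<in> C --> f2 z = g2 z"
 using assms(3) by (rule AE_mp) (use S(3) in "auto intro!: AE_I2")
 ultimately show ?thesis using assms(1) unfolding W1r_def
 by (auto intro: Lr_cong_AE[OF S(2)] has_weak_deriv_cong_AE[OF _ _ assms(2)] has_weak_deriv_cong_AE[OF _ _ assms(3)])
qed

lemma W1r_cong:
 assumes "W1r r S C f f1 f2" and "!!z. z \<in> S ==> f z = g z"
 shows "W1r r S C g f1 f2"
proof -
 have "cts S f \<longleftrightarrow> cts S g" by (rule continuous_on_cong) (use assms(2) in auto)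
 then show ?thesis using assms unfolding W1r_def
 by (auto intro!: has_weak_deriv_cong_AE[of S _ f _ g])
qed

lemma W1r_unique:
 assumes "W1r r S C f f1 f2" "W1r r S C f g1 g2"
 shows "AE z in Leb. z \<in> S --> f1 z = g1 z & f2 z = g2 z"
proof -
 have "AE z in Leb. z \<in> S --> f1 z = g1 z" "AE z in Leb. z \<in> S --> f2 z = g2 z"
 using assms has_weak_deriv_unique ex_ey_Basis unfolding W1r_def by blast+
 then show ?thesis by eventually_elim auto
qed

lemma W1r_mult:
 assumes f: "W1r r S C f f1 f2" and g: "W1r r S C g g1 g2"
 and bd: "!!z. z \<in> C ==> abs (f z) <= M" "!!z. z \<in> C ==> abs (g z) <= N"
 shows "W1r r S C (%z. f z * g z) (%z. g z * f1 z + f z * g1 z) (%z. g z * f2 z + f z * g2 z)"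
proof -
 have D: "((%w. fst w * snd w) has_derivative (%(s, t). snd w * s + fst w * t)) (at w)" for w :: "real \<times> real"
 unfolding case_prod_unfold by (auto intro!: derivative_eq_intros simp: algebra_simps)
 have b: "abs (snd (f z, g z)) <= max M N" "abs (fst (f z, g z)) <= max M N" if "z \<in> C" for z using bd[OF that] by auto
 from W1r_chain[OF f g open_UNIV UNIV_I D continuous_on_snd[OF continuous_on_id] continuous_on_fst[OF continuous_on_id] b]
 show ?thesis by simp
qed

lemma W1r_lin:
 assumes f: "W1r r S C f f1 f2" and g: "W1r r S C g g1 g2"
 shows "W1r r S C (%z. a * f z + b * g z) (%z. a * f1 z + b * g1 z) (%z. a * f2 z + b * g2 z)"
proof -
 have D: "((%w. a * fst w + b * snd w) has_derivative (%(s, t). a * s + b * t)) (at w)" for w :: "real \<times> real"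
 unfolding case_prod_unfold by (auto intro!: derivative_eq_intros)
 from W1r_chain[OF f g open_UNIV UNIV_I D, of "max \<bar>a\<bar> \<bar>b\<bar>"] show ?thesis
 by (auto intro!: continuous_intros)
qed

lemma W1r_compose:
 assumes f: "W1r r S C f f1 f2" and V: "open V" "!!z. z \<in> S ==> f z \<in> V"
 and F: "!!w. w \<in> V ==> (F has_real_derivative F' w) (at w)" and c: "cts V F'"
 and bd: "!!z. z \<in> C ==> abs (F' (f z)) <= M"
 shows "W1r r S C (%z. F (f z)) (%z. F' (f z) * f1 z) (%z. F' (f z) * f2 z)"
proof -
 have D: "((%w. F (fst w)) has_derivative (%(s, t). F' (fst w) * s + 0 * t)) (at w)" if "w \<in> V \<times> UNIV" for w :: "real \<times> real"
 proof -
 have "(fst has_derivative fst) (at w)" by (rule has_derivative_fst[OF has_derivative_ident])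
 moreover have "fst w \<in> V" using that by auto
 ultimately show ?thesis
 using has_derivative_compose[of fst fst w UNIV F "%s. F' (fst w) * s"] F unfolding has_field_derivative_def
 by (simp add: case_prod_unfold)
 qed
 have "cts (V \<times> UNIV) (%w::real \<times> real. F' (fst w))"
 by (rule continuous_on_compose2[OF c]) (auto intro!: continuous_intros)
 from W1r_chain[OF f f open_Times[OF V(1) open_UNIV] _ D this continuous_on_const, of "abs M"] V(2) bd
 show ?thesis by (force intro: order_trans)
qed

lemma W1r_C1:
 assumes "open S" "open C" "C \<subseteq> S" "bounded C" "1 <= r" "C1_on S f"
 and "!!z. z \<in> C ==> abs (pd ex f z) <= M" "!!z. z \<in> C ==> abs (pd ey f z) <= M"
 shows "W1r r S C f (pd ex f) (pd ey f)"
proof -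
 have c: "cts C (pd ex f)" "cts C (pd ey f)"
 using assms(3,6) ex_ey_Basis unfolding C1_on_def by (auto intro: continuous_on_subset)
 show ?thesis unfolding W1r_def
 using assms C1_on_continuous[OF assms(6)] c
 by (auto intro!: has_weak_deriv_C1 ex_ey_Basis Lr_bounded_continuous)
qed

lemma W1r_shear:
 assumes G: "nonsingular c G T S" and Gdef: "!!z. G z = (fst z, k z)"
 and k: "!!z. z \<in> T ==> (k has_derivative (%(s, t). kq z * s + kp z * t)) (at z)"
 and kc: "cts T kq" "cts T kp"
 and C: "open C" "C \<subseteq> T" "!!z. z \<in> C ==> G z \<in> D"
 and bd: "!!z. z \<in> C ==> abs (kq z) <= M" "!!z. z \<in> C ==> abs (kp z) <= M"
 and f: "W1r r S D f f1 f2"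
 shows "W1r r T C (%z. f (G z)) (%z. f1 (G z) + kq z * f2 (G z)) (%z. kp z * f2 (G z))"
proof -
 have T: "open T" "open S" "cts T G" "G ` T \<subseteq> S" using G unfolding nonsingular_def by auto
 have D: "open D" "D \<subseteq> S" "1 <= r" and fc: "cts S f"
 and w: "wder S ex f f1" "wder S ey f f2" and L: "Lr r D f1" "Lr r D f2" using f unfolding W1r_def by auto
 have L': "Lr r C (%z. f1 (G z))" "Lr r C (%z. f2 (G z))"
 by (rule Lr_nonsingular[OF G C(1,2) D(1,2) C(3) L(1)], simp) (rule Lr_nonsingular[OF G C(1,2) D(1,2) C(3) L(2)], simp)
 have c: "cts C kq" "cts C kp" using kc C(2) by (auto intro: continuous_on_subset)
 show ?thesis unfolding W1r_def
 by (intro conjI T C D(3) continuous_on_compose2[OF fc T(3,4)] weak_deriv_shear[OF G Gdef k kc fc w]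
 Lr_add[OF C(1) L'(1) _ D(3)] Lr_mult_bounded[OF C(1) L'(2) D(3) c(1) bd(1)] Lr_mult_bounded[OF C(1) L'(2) D(3) c(2) bd(2)])
qed

text \<open>On a bounded cell a bounded continuous function lies in \<open>L\<^sub>r\<close>, so the
  only condition left is the one on its derivatives.\<close>

lemma sobolev1_iff_W1r:
 assumes S: "open S" "open C" "C \<subseteq> S" "bounded C" "1 <= r" and f: "cts S f" "!!z. z \<in> C ==> abs (f z) <= M"
 shows "sobolev 1 r S C f \<longleftrightarrow> (\<exists>f1 f2. W1r r S C f f1 f2)"
proof -
 have "Lr r C f" by (rule Lr_bounded_continuous[OF S(2,4) continuous_on_subset[OF f(1) S(3)] f(2) S(5)])
 moreover have "loc_int S f" by (rule locally_integrable_continuous[OF f(1)])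
 ultimately have "sobolev 1 r S C f \<longleftrightarrow> (\<exists>f1 f2. wder S ex f f1 & wder S ey f f2 &
 loc_int S f1 & loc_int S f2 & Lr r C f1 & Lr r C f2)"
 by (auto simp: Basis_prod_real)
 then show ?thesis using S f(1) unfolding W1r_def by (auto simp: has_weak_deriv_def)
qed

lemma W1r_wd:
 assumes f: "W1r r S C f f1 f2"
 shows "W1r r S C f (wd S ex f) (wd S ey f)"
 and "AE z in Leb. z \<in> S --> wd S ex f z = f1 z & wd S ey f z = f2 z"
proof -
 have S: "open S" "cts S f" and w: "wder S ex f f1" "wder S ey f f2"
 using f unfolding W1r_def by auto
 have a: "AE z in Leb. z \<in> S --> f1 z = wd S ex f z" "AE z in Leb. z \<in> S --> f2 z = wd S ey f z"
 by (rule has_weak_deriv_unique[OF S ex_ey_Basis(1) w(1) has_weak_deriv_wd[OF w(1)]])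
 (rule has_weak_deriv_unique[OF S ex_ey_Basis(2) w(2) has_weak_deriv_wd[OF w(2)]])
 show "W1r r S C f (wd S ex f) (wd S ey f)" by (rule W1r_cong_AE[OF f a])
 show "AE z in Leb. z \<in> S --> wd S ex f z = f1 z & wd S ey f z = f2 z"
 using a by eventually_elim auto
qed

lemma sobolev1_cong_AE:
 assumes C: "open C" "C \<subseteq> S" and f: "sobolev 1 r S C f" and AE: "AE z in Leb. z \<in> S --> f z = g z"
 shows "sobolev 1 r S C g"
proof -
 have AE': "AE z in Leb. z \<in> C --> f z = g z"
 using AE by (rule AE_mp) (use C(2) in "auto intro!: AE_I2")
 have "wder S b g f'" if "wder S b f f'" for b f'
 by (rule has_weak_deriv_cong_AE[OF that AE]) simp
 then show ?thesis using f locally_integrable_cong_AE[OF _ AE] Lr_cong_AE[OF C(1) _ AE']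
 by (simp, blast)
qed

text \<open>The classical partial derivatives of a C1 function are weak derivatives and, by
  uniqueness, the only ones up to null sets. Second order membership therefore becomes first order
  membership of the gradient.\<close>

lemma sobolev2_iff_W1r:
 assumes S: "open S" "open C" "C \<subseteq> S" "bounded C" "1 <= r" and f: "C1_on S f" "!!z. z \<in> C ==> abs (f z) <= M"
 and bd: "!!z b. z \<in> C ==> b \<in> Basis ==> abs (pd b f z) <= M"
 shows "sobolev 2 r S C f \<longleftrightarrow> (\<exists>f11 f12. W1r r S C (pd ex f) f11 f12) & (\<exists>f21 f22. W1r r S C (pd ey f) f21 f22)"
proof -
 have cf: "cts S f" by (rule C1_on_continuous[OF f(1)])
 have w: "wder S b f (pd b f)" if "b \<in> Basis" for b by (rule has_weak_deriv_C1[OF S(1) f(1) that])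
 have pc: "cts S (pd b f)" if "b \<in> Basis" for b using f(1) that unfolding C1_on_def by blast
 have "Lr r C f" by (rule Lr_bounded_continuous[OF S(2,4) continuous_on_subset[OF cf S(3)] f(2) S(5)])
 moreover have "loc_int S f" by (rule locally_integrable_continuous[OF cf])
 ultimately have "sobolev 2 r S C f \<longleftrightarrow> (\<forall>b\<in>Basis. \<exists>f'. wder S b f f' & sobolev 1 r S C f')"
 by (simp add: numeral_2_eq_2)
 also have "... \<longleftrightarrow> (\<forall>b\<in>Basis. sobolev 1 r S C (pd b f))"
 proof (intro ball_cong refl iffI)
 fix b :: "real \<times> real" assume b: "b \<in> Basis" and "\<exists>f'. wder S b f f' & sobolev 1 r S C f'"
 then obtain f' where f': "wder S b f f'" "sobolev 1 r S C f'" by blast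
 show "sobolev 1 r S C (pd b f)"
 by (rule sobolev1_cong_AE[OF S(2,3) f'(2) has_weak_deriv_unique[OF S(1) cf b f'(1) w[OF b]]])
 qed (use w in blast)
 also have "... \<longleftrightarrow> (\<exists>f11 f12. W1r r S C (pd ex f) f11 f12) & (\<exists>f21 f22. W1r r S C (pd ey f) f21 f22)"
 using sobolev1_iff_W1r[OF S pc[OF ex_ey_Basis(1)] bd[OF _ ex_ey_Basis(1)]]
 sobolev1_iff_W1r[OF S pc[OF ex_ey_Basis(2)] bd[OF _ ex_ey_Basis(2)]] by (simp add: Basis_prod_real)
 finally show ?thesis .
qed

section \<open>Hoelder functions\<close>

lemma holderE:
 assumes "holder al S f"
 obtains K B where "cts (closure S) f" "!!z. z \<in> closure S ==> abs (f z) <= B" "0 <= B" "0 <= K"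
 "!!z w. z \<in> closure S ==> w \<in> closure S ==> abs (f z - f w) <= K * dist z w powr al"
proof -
 obtain K where c: "cts (closure S) f" and K: "\<forall>z\<in>closure S. \<forall>w\<in>closure S. abs (f z - f w) <= K * dist z w powr al"
 and b: "bounded (f ` closure S)"
 using assms unfolding holder_def by blast
 from b obtain B where B: "\<forall>x\<in>f ` closure S. norm x <= B" unfolding bounded_iff by blast
 show ?thesis
 proof (rule that[OF c, of "abs B" "abs K"])
 fix z w assume zw: "z \<in> closure S" "w \<in> closure S"
 have "abs (f z - f w) <= K * dist z w powr al" using K zw by blast
 also have "... <= abs K * dist z w powr al" by (intro mult_right_mono) auto
 finally show "abs (f z - f w) <= abs K * dist z w powr al" .
 next
 fix z assume "z \<in> closure S"
 then have "abs (f z) <= B" using B by auto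
 then show "abs (f z) <= abs B" by linarith
 qed auto
qed

lemma holderI:
 assumes "cts (closure S) f" "!!z. z \<in> closure S ==> abs (f z) <= B"
 "!!z w. z \<in> closure S ==> w \<in> closure S ==> abs (f z - f w) <= K * dist z w powr al"
 shows "holder al S f"
proof -
 have "bounded (f ` closure S)" unfolding bounded_iff using assms(2) by auto
 then show ?thesis unfolding holder_def using assms(1,3) by blast
qed

lemma holder_lipschitz_compose:
 assumes f: "holder al S f" and F: "!!x y. x \<in> X ==> y \<in> X ==> abs (F x - F y) <= L * abs (x - y)"
 and X: "!!z. z \<in> closure S ==> f z \<in> X"
 shows "holder al S (%z. F (f z))"
proof -
 obtain K B where KB: "cts (closure S) f" "!!z. z \<in> closure S ==> abs (f z) <= B" "0 <= B" "0 <= K"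
 "!!z w. z \<in> closure S ==> w \<in> closure S ==> abs (f z - f w) <= K * dist z w powr al"
 by (rule holderE[OF f]) (rule that)
 have F': "abs (F x - F y) <= abs L * abs (x - y)" if "x \<in> X" "y \<in> X" for x y
 by (rule order_trans[OF F[OF that] mult_right_mono[OF abs_ge_self abs_ge_zero]])
 have cF: "cts X F"
 proof (rule continuous_onI)
 fix x e assume x: "x \<in> X" and e: "0 < (e::real)"
 show "\<exists>d>0. \<forall>x'\<in>X. dist x' x < d --> dist (F x') (F x) <= e"
 proof (intro exI[of _ "e / (abs L + 1)"] conjI ballI impI)
 show "0 < e / (abs L + 1)" using e by simp
 fix y assume y: "y \<in> X" "dist y x < e / (abs L + 1)"
 have "dist (F y) (F x) <= abs L * dist y x" using F'[OF y(1) x] by (simp add: dist_real_def)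
 also have "... <= (abs L + 1) * dist y x" by (intro mult_right_mono) auto
 also have "... <= e" using y(2) by (simp add: field_simps less_imp_le)
 finally show "dist (F y) (F x) <= e" .
 qed
 qed
 show ?thesis
 proof (cases "closure S = {}")
 case True
 then show ?thesis unfolding holder_def by simp
 next
 case False
 then obtain z0 where z0: "z0 \<in> closure S" by (meson ex_in_conv)
 show ?thesis
 proof (rule holderI)
 show "cts (closure S) (%z. F (f z))" by (rule continuous_on_compose2[OF cF KB(1)]) (use X in auto)
 fix z assume z: "z \<in> closure S"
 have "abs (F (f z)) <= abs (F (f z0)) + abs (F (f z) - F (f z0))" by linarith
 also have "abs (F (f z) - F (f z0)) <= abs L * abs (f z - f z0)" by (rule F'[OF X[OF z] X[OF z0]])
 also have "... <= abs L * (2 * B)" using KB(2)[OF z] KB(2)[OF z0] by (intro mult_left_mono) linarith+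
 finally show "abs (F (f z)) <= abs (F (f z0)) + abs L * (2 * B)" by simp
 fix w assume w: "w \<in> closure S"
 have "abs (F (f z) - F (f w)) <= abs L * abs (f z - f w)" by (rule F'[OF X[OF z] X[OF w]])
 also have "... <= abs L * (K * dist z w powr al)" by (intro mult_left_mono KB(5) z w) auto
 finally show "abs (F (f z) - F (f w)) <= (abs L * K) * dist z w powr al" by (simp add: mult.assoc)
 qed
 qed
qed

lemma holder_mult:
 assumes f: "holder al S f" and g: "holder al S g"
 shows "holder al S (%z. f z * g z)"
proof -
 obtain K B where KB: "cts (closure S) f" "!!z. z \<in> closure S ==> abs (f z) <= B" "0 <= B" "0 <= K"
 "!!z w. z \<in> closure S ==> w \<in> closure S ==> abs (f z - f w) <= K * dist z w powr al"
 by (rule holderE[OF f]) (rule that)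
 obtain K' B' where KB': "cts (closure S) g" "!!z. z \<in> closure S ==> abs (g z) <= B'" "0 <= B'" "0 <= K'"
 "!!z w. z \<in> closure S ==> w \<in> closure S ==> abs (g z - g w) <= K' * dist z w powr al"
 by (rule holderE[OF g]) (rule that)
 show ?thesis
 proof (rule holderI)
 show "cts (closure S) (%z. f z * g z)" by (intro continuous_intros KB(1) KB'(1))
 fix z assume z: "z \<in> closure S"
 show "abs (f z * g z) <= B * B'" unfolding abs_mult by (intro mult_mono KB KB' z) auto
 fix w assume w: "w \<in> closure S"
 have "f z * g z - f w * g w = f z * (g z - g w) + (f z - f w) * g w" by (simp add: algebra_simps)
 then have "abs (f z * g z - f w * g w) <= abs (f z) * abs (g z - g w) + abs (f z - f w) * abs (g w)"
 by (metis abs_mult abs_triangle_ineq)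
 also have "... <= B * (K' * dist z w powr al) + (K * dist z w powr al) * B'"
 using KB KB' z w by (intro add_mono mult_mono) auto
 also have "... = (B * K' + K * B') * dist z w powr al" by (simp add: algebra_simps)
 finally show "abs (f z * g z - f w * g w) <= (B * K' + K * B') * dist z w powr al" .
 qed
qed

lemma holder_lin:
 assumes f: "holder al S f" and g: "holder al S g"
 shows "holder al S (%z. a * f z + b * g z)"
proof -
 obtain K B where KB: "cts (closure S) f" "!!z. z \<in> closure S ==> abs (f z) <= B" "0 <= B" "0 <= K"
 "!!z w. z \<in> closure S ==> w \<in> closure S ==> abs (f z - f w) <= K * dist z w powr al"
 by (rule holderE[OF f]) (rule that)
 obtain K' B' where KB': "cts (closure S) g" "!!z. z \<in> closure S ==> abs (g z) <= B'" "0 <= B'" "0 <= K'"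
 "!!z w. z \<in> closure S ==> w \<in> closure S ==> abs (g z - g w) <= K' * dist z w powr al"
 by (rule holderE[OF g]) (rule that)
 show ?thesis
 proof (rule holderI)
 show "cts (closure S) (%z. a * f z + b * g z)" by (intro continuous_intros KB(1) KB'(1))
 fix z assume z: "z \<in> closure S"
 have "abs (a * f z + b * g z) <= abs a * abs (f z) + abs b * abs (g z)" by (metis abs_mult abs_triangle_ineq)
 also have "... <= abs a * B + abs b * B'" by (intro add_mono mult_left_mono KB KB' z) auto
 finally show "abs (a * f z + b * g z) <= abs a * B + abs b * B'" .
 fix w assume w: "w \<in> closure S"
 have "a * f z + b * g z - (a * f w + b * g w) = a * (f z - f w) + b * (g z - g w)" by (simp add: algebra_simps)
 then have "abs (a * f z + b * g z - (a * f w + b * g w)) <= abs a * abs (f z - f w) + abs b * abs (g z - g w)"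
 by (metis abs_mult abs_triangle_ineq)
 also have "... <= abs a * (K * dist z w powr al) + abs b * (K' * dist z w powr al)"
 by (intro add_mono mult_left_mono KB KB' z w) auto
 also have "... = (abs a * K + abs b * K') * dist z w powr al" by (simp add: algebra_simps)
 finally show "abs (a * f z + b * g z - (a * f w + b * g w)) <= (abs a * K + abs b * K') * dist z w powr al" .
 qed
qed

lemma holder_cong:
 assumes "holder al S f" "!!z. z \<in> closure S ==> f z = g z"
 shows "holder al S g"
proof -
 have "cts (closure S) f \<longleftrightarrow> cts (closure S) g" by (rule continuous_on_cong) (use assms(2) in auto)
 moreover have "f ` closure S = g ` closure S" by (rule image_cong) (use assms(2) in auto)
 ultimately show ?thesis using assms unfolding holder_def by (metis (no_types, lifting))
qed

lemma holder_compose_lipschitz: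
 fixes G :: "'a::euclidean_space => 'b::euclidean_space"
 assumes f: "holder al S f" and G: "!!z. z \<in> closure T ==> G z \<in> closure S"
 and L: "!!z w. z \<in> closure T ==> w \<in> closure T ==> dist (G z) (G w) <= L * dist z w"
 and a: "0 <= al"
 shows "holder al T (%z. f (G z))"
proof -
 obtain K B where KB: "cts (closure S) f" "!!z. z \<in> closure S ==> abs (f z) <= B" "0 <= B" "0 <= K"
 "!!z w. z \<in> closure S ==> w \<in> closure S ==> abs (f z - f w) <= K * dist z w powr al"
 by (rule holderE[OF f]) (rule that)
 have L': "dist (G z) (G w) <= abs L * dist z w" if "z \<in> closure T" "w \<in> closure T" for z w
 by (rule order_trans[OF L[OF that] mult_right_mono[OF abs_ge_self zero_le_dist]])
 have cG: "cts (closure T) G"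
 proof (rule continuous_onI)
 fix x e assume x: "x \<in> closure T" and e: "0 < (e::real)"
 show "\<exists>d>0. \<forall>x'\<in>closure T. dist x' x < d --> dist (G x') (G x) <= e"
 proof (intro exI[of _ "e / (abs L + 1)"] conjI ballI impI)
 show "0 < e / (abs L + 1)" using e by simp
 fix y assume y: "y \<in> closure T" "dist y x < e / (abs L + 1)"
 have "dist (G y) (G x) <= abs L * dist y x" by (rule L'[OF y(1) x])
 also have "... <= (abs L + 1) * dist y x" by (intro mult_right_mono) auto
 also have "... <= e" using y(2) by (simp add: field_simps less_imp_le)
 finally show "dist (G y) (G x) <= e" .
 qed
 qed
 show ?thesis
 proof (rule holderI)
 show "cts (closure T) (%z. f (G z))" by (rule continuous_on_compose2[OF KB(1) cG]) (use G in auto)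
 fix z assume z: "z \<in> closure T"
 show "abs (f (G z)) <= B" by (rule KB(2)[OF G[OF z]])
 fix w assume w: "w \<in> closure T"
 have "abs (f (G z) - f (G w)) <= K * dist (G z) (G w) powr al" by (rule KB(5)[OF G[OF z] G[OF w]])
 also have "... <= K * (abs L * dist z w) powr al" by (intro mult_left_mono powr_mono2 L' z w KB a) auto
 also have "... = (K * abs L powr al) * dist z w powr al" by (simp add: powr_mult)
 finally show "abs (f (G z) - f (G w)) <= (K * abs L powr al) * dist z w powr al" .
 qed
qed

text \<open>A distance of at most one is at most its power \<open>al\<close>; for larger distances
  the bound of \<open>f\<close> takes over.\<close>

lemma holder_lipschitz:
 fixes f :: "'a::euclidean_space => real"
 assumes c: "cts (closure S) f" and B: "!!z. z \<in> closure S ==> abs (f z) <= B"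
 and L: "!!z w. z \<in> closure S ==> w \<in> closure S ==> abs (f z - f w) <= L * dist z w"
 and a: "0 <= al" "al <= 1"
 shows "holder al S f"
proof (rule holderI[OF c B])
 fix z w assume zw: "z \<in> closure S" "w \<in> closure S"
 show "abs (f z - f w) <= (abs L + 2 * abs B) * dist z w powr al"
 proof (cases "dist z w <= 1")
 case True
 have "abs (f z - f w) <= abs L * dist z w"
 by (rule order_trans[OF L[OF zw] mult_right_mono[OF abs_ge_self zero_le_dist]])
 also have "... <= abs L * dist z w powr al"
 using powr_mono'[of al 1 "dist z w"] True a by (intro mult_left_mono) auto
 also have "... <= (abs L + 2 * abs B) * dist z w powr al" by (intro mult_right_mono) auto
 finally show ?thesis .
 next
 case False
 have "abs (f z - f w) <= 2 * abs B * 1" using B[OF zw(1)] B[OF zw(2)] by linarith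
 also have "... <= 2 * abs B * dist z w powr al"
 using ge_one_powr_ge_zero[of "dist z w" al] False a by (intro mult_left_mono) auto
 also have "... <= (abs L + 2 * abs B) * dist z w powr al" by (intro mult_right_mono) auto
 finally show ?thesis .
 qed
qed auto

text \<open>Above the height \<open>t\<close> the factor \<open>abs x powr (1 - r)\<close> is at
  most \<open>t powr (1 - r)\<close>. With a well chosen \<open>t\<close> this replaces the Hoelder
  inequality for integrals and covers \<open>r = 1\<close> uniformly.\<close>

lemma young_bound:
 fixes x t :: real
 assumes "1 <= r" "0 < t"
 shows "abs x <= t + t powr (1 - r) * abs x powr r"
proof (cases "abs x <= t")
 case True
 have "0 <= t powr (1 - r) * abs x powr r" by simp
 with True show ?thesis by linarith
next
 case False
 then have x: "0 < abs x" "t <= abs x" using assms by auto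
 have "abs x = abs x powr (1 - r) * abs x powr r" using x by (simp flip: powr_add)
 also have "... <= t powr (1 - r) * abs x powr r"
 using powr_mono2'[of "1 - r" t "abs x"] x assms by (intro mult_right_mono) auto
 finally show ?thesis using assms by linarith
qed

lemma Lr_set_integrable:
 fixes f :: "real => real"
 assumes r: "1 <= r" and f: "Lr r {s<..<t} f" and ab: "s <= a" "b <= t"
 shows "set_int Leb {a..b} f" "set_int Leb {s<..<t} (%x. abs (f x) powr r)"
proof -
 have Cm: "{s<..<t} \<inter> space Leb \<in> sets Leb" by simp
 show i: "set_int Leb {s<..<t} (%x. abs (f x) powr r)"
 using f integrable_restrict_space[OF Cm, of "%x. abs (f x) powr r"] unfolding Lr_def set_integrable_def by simp
 have m: "(%x. indicator {s<..<t} x *\<^sub>R f x) \<in> borel_measurable Leb"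
 using f borel_measurable_restrict_space_iff[OF Cm, of f] unfolding Lr_def by simp
 have "integrable Leb (indicator {s<..<t} :: real => real)"
 using lmeasurable_box[of s t] by (simp add: lmeasurable_iff_integrable box_real)
 then have i1: "integrable Leb (%x. indicator {s<..<t} x * 1 :: real)" by simp
 have i2: "integrable Leb (%x. indicator {s<..<t} x *\<^sub>R f x)"
 proof (rule Bochner_Integration.integrable_bound[OF Bochner_Integration.integrable_add[OF i1 i[unfolded set_integrable_def]] m], rule AE_I2)
 fix x
 show "norm (indicator {s<..<t} x *\<^sub>R f x) <= norm (indicator {s<..<t} x * 1 + indicator {s<..<t} x *\<^sub>R \<bar>f x\<bar> powr r)"
 using young_bound[OF r, of 1 "f x"] by (simp add: indicator_def)
 qed
 have "AE x in Leb. x ~= s & x ~= t"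
 using AE_not_in[of "{s, t}" Leb] negligible_iff_null_sets[of "{s, t}"] by simp
 then have AE: "AE x in Leb. indicator {s<..<t} x *\<^sub>R f x = indicator {s..t} x *\<^sub>R f x"
 by (rule AE_mp) (auto intro!: AE_I2 simp: indicator_def)
 have "set_int Leb {s..t} f" unfolding set_integrable_def
 by (rule integrable_cong_AE_imp[OF i2 borel_measurable_AE[OF borel_measurable_integrable[OF i2] AE] AE])
 then show "set_int Leb {a..b} f" by (rule set_integrable_subset) (use ab in auto)
qed

text \<open>The pointwise bound is integrated over an interval of length \<open>d\<close> with the
  height \<open>d powr (- 1 / r)\<close>. Both resulting terms scale like
  \<open>d powr ((r - 1) / r)\<close>, which is the origin of the exponent.\<close>

lemma Lr_holder_primitive:
 fixes f F :: "real => real"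
 assumes r: "1 <= r" and f: "Lr r {s<..<t} f"
 and F: "!!a b. s <= a ==> a <= b ==> b <= t ==> F b - F a = (LINT x:{a..b}|Leb. f x)"
 shows "\<exists>K. \<forall>a\<in>{s..t}. \<forall>b\<in>{s..t}. abs (F a - F b) <= K * abs (a - b) powr ((r - 1) / r)"
proof -
 define A where "A = (LINT x:{s<..<t}|Leb. abs (f x) powr r)"
 note ir = Lr_set_integrable(2)[OF r f order_refl order_refl]
 have A0: "0 <= A" unfolding A_def set_lebesgue_integral_def by (rule Bochner_Integration.integral_nonneg) auto
 have main: "abs (F b - F a) <= (1 + A) * (b - a) powr ((r - 1) / r)" if ab: "s <= a" "a < b" "b <= t" for a b
 proof -
 define d where "d = b - a"
 define \<tau> where "\<tau> = d powr (- 1 / r)"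
 have d: "0 < d" unfolding d_def using ab by simp
 have tau: "0 < \<tau>" unfolding \<tau>_def using d by simp
 have i: "set_int Leb {a..b} f" by (rule Lr_set_integrable(1)[OF r f]) (use ab in auto)
 have "integrable Leb (indicator {a..b} :: real => real)"
 using lmeasurable_cbox[of a b] by (simp add: lmeasurable_iff_integrable)
 then have i1: "integrable Leb (%x. indicator {a..b} x * \<tau>)" by simp
 have i2: "integrable Leb (%x. \<tau> powr (1 - r) * (indicator {s<..<t} x *\<^sub>R \<bar>f x\<bar> powr r))"
 using ir unfolding set_integrable_def by (rule integrable_mult_right)
 have "abs (F b - F a) <= (LINT x|Leb. abs (indicator {a..b} x *\<^sub>R f x))"
 using ab F[of a b] integral_abs_bound[of Leb "%x. indicator {a..b} x *\<^sub>R f x"] by (simp add: set_lebesgue_integral_def)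
 also have "... <= (LINT x|Leb. indicator {a..b} x * \<tau> + \<tau> powr (1 - r) * (indicator {s<..<t} x *\<^sub>R \<bar>f x\<bar> powr r))"
 proof (rule integral_mono_AE)
 show "integrable Leb (%x. abs (indicator {a..b} x *\<^sub>R f x))" using i unfolding set_integrable_def by (rule integrable_abs)
 show "integrable Leb (%x. indicator {a..b} x * \<tau> + \<tau> powr (1 - r) * (indicator {s<..<t} x *\<^sub>R \<bar>f x\<bar> powr r))"
 by (intro Bochner_Integration.integrable_add i1 i2)
 have "AE x in Leb. x ~= s & x ~= t"
 using AE_not_in[of "{s, t}" Leb] negligible_iff_null_sets[of "{s, t}"] by simp
 then show "AE x in Leb. \<bar>indicator {a..b} x *\<^sub>R f x\<bar> <= indicator {a..b} x * \<tau> + \<tau> powr (1 - r) * (indicator {s<..<t} x *\<^sub>R \<bar>f x\<bar> powr r)"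
 proof (rule AE_mp, intro AE_I2 impI)
 fix x assume x: "x ~= s & x ~= t"
 show "\<bar>indicator {a..b} x *\<^sub>R f x\<bar> <= indicator {a..b} x * \<tau> + \<tau> powr (1 - r) * (indicator {s<..<t} x *\<^sub>R \<bar>f x\<bar> powr r)"
 proof (cases "x \<in> {a..b}")
 case True
 then have "x \<in> {s<..<t}" using x ab by auto
 then show ?thesis using True young_bound[OF r tau, of "f x"] by simp
 next
 case False
 have "0 <= \<tau> powr (1 - r) * (indicator {s<..<t} x *\<^sub>R \<bar>f x\<bar> powr r)" by simp
 then show ?thesis using False by simp
 qed
 qed
 qed
 also have "... = (b - a) * \<tau> + \<tau> powr (1 - r) * A"
 unfolding A_def set_lebesgue_integral_def
 using Bochner_Integration.integral_add[OF i1 i2] ab by simp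
 also have "(b - a) * \<tau> = d powr ((r - 1) / r)"
 proof -
 have "d * \<tau> = d powr 1 * d powr (- 1 / r)" unfolding \<tau>_def using d by simp
 also have "... = d powr (1 + (- 1 / r))" by (rule powr_add[symmetric])
 also have "1 + (- 1 / r) = (r - 1) / r" using r by (simp add: field_simps)
 finally show ?thesis unfolding d_def .
 qed
 also have "\<tau> powr (1 - r) = d powr ((r - 1) / r)"
 proof -
 have "(- 1 / r) * (1 - r) = (r - 1) / r" using r by (simp add: field_simps)
 then show ?thesis unfolding \<tau>_def powr_powr by (simp only:)
 qed
 finally show ?thesis unfolding d_def by (simp add: algebra_simps)
 qed
 have "abs (F a - F b) <= (1 + A) * abs (a - b) powr ((r - 1) / r)" if "a \<in> {s..t}" "b \<in> {s..t}" for a b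
 proof -
 consider "a < b" | "b < a" | "a = b" by linarith
 then show ?thesis
 proof cases
 case 1
 then show ?thesis using main[of a b] that by (simp add: abs_minus_commute)
 next
 case 2
 then show ?thesis using main[of b a] that by simp
 qed simp
 qed
 then show ?thesis by blast
qed

section \<open>The hodograph transform\<close>

lemma closure_strip: "p0 < 0 ==> closure (strip p0) = UNIV \<times> {p0..0}"
 unfolding strip_def by (simp add: closure_Times)

lemma mem_fluid: "(x, y) \<in> fluid d et \<longleftrightarrow> - d < y & y < et x"
 by (simp add: fluid_def)

lemma open_fluid: "cts UNIV et ==> open (fluid d et)"
proof -
 assume c: "cts UNIV et"
 have e: "fluid d et = {z. - d < snd z} \<inter> {z. snd z < et (fst z)}" by (auto simp: fluid_def)
 show ?thesis unfolding e
 by (intro open_Int open_Collect_less continuous_intros continuous_on_compose2[OF c]) auto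
qed

text \<open>For the nontrivial inclusion the vertical segment through a point is enough: it is the
  closure of its open part, which lies in the fluid.\<close>

lemma closure_fluid:
 assumes c: "cts UNIV et" and b: "!!x. - d < et x"
 shows "closure (fluid d et) = {(x, y). - d <= y & y <= et x}"
proof
 have e: "{(x, y). - d <= y & y <= et x} = {z. - d <= snd z} \<inter> {z. snd z <= et (fst z)}" by auto
 have "closed {(x, y). - d <= y & y <= et x}" unfolding e
 by (intro closed_Int closed_Collect_le continuous_intros continuous_on_compose2[OF c]) auto
 then show "closure (fluid d et) \<subseteq> {(x, y). - d <= y & y <= et x}"
 by (intro closure_minimal) (auto simp: fluid_def)
 show "{(x, y). - d <= y & y <= et x} \<subseteq> closure (fluid d et)"
 proof (clarify)
 fix x y assume y: "- d <= y" "y <= et x"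
 have "closure ({x} \<times> {- d<..<et x}) = {x} \<times> {- d..et x}" using b[of x] by (simp add: closure_Times)
 then have "(x, y) \<in> closure ({x} \<times> {- d<..<et x})" using y by simp
 moreover have "{x} \<times> {- d<..<et x} \<subseteq> fluid d et" by (auto simp: fluid_def)
 ultimately show "(x, y) \<in> closure (fluid d et)" using closure_mono by blast
 qed
qed

text \<open>The inverse of a continuous injection is continuous on the image of a compact set. The
  unbounded domain is cut into compact slices; since the first coordinate is preserved, the image of
  a slice contains all points of \<open>B\<close> with \<open>abs (fst w) < n\<close>, a relatively
  open part.\<close>

lemma shear_inverse_continuous:
 fixes k j :: "real \<times> real => real"
 assumes k: "cts A k" and A: "!!n::nat. compact (A \<inter> {z. abs (fst z) <= real n})"
 and j: "!!z. z \<in> A ==> j (fst z, k z) = snd z"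
 and B: "!!w. w \<in> B ==> \<exists>z\<in>A. w = (fst z, k z)"
 shows "cts B j"
proof (rule continuous_on_eq_continuous_within[THEN iffD2], intro ballI)
 fix w assume w: "w \<in> B"
 obtain n :: nat where n: "abs (fst w) < real n" using reals_Archimedean2 by blast
 let ?A = "A \<inter> {z. abs (fst z) <= real n}"
 have "cts ?A (%z. (fst z, k z))" by (intro continuous_intros continuous_on_subset[OF k]) auto
 then have "cts ((%z. (fst z, k z)) ` ?A) (%w. (fst w, j w))"
 by (rule continuous_on_inv[OF _ A]) (auto simp: j)
 then have c: "cts ((%z. (fst z, k z)) ` ?A) (%w. snd (fst w, j w))" by (rule continuous_on_snd)
 let ?U = "{w :: real \<times> real. abs (fst w) < real n}"
 have U: "open ?U" by (intro open_Collect_less continuous_intros)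
 have sub: "B \<inter> ?U \<subseteq> (%z. (fst z, k z)) ` ?A" using B by force
 have "cts (B \<inter> ?U) j" using continuous_on_subset[OF c sub] by simp
 then have "continuous (at w within B \<inter> ?U) j" using w n by (simp add: continuous_on_eq_continuous_within)
 moreover have "at w within B \<inter> ?U = at w within B" using U n by (intro at_within_nhd[of _ ?U]) auto
 ultimately show "continuous (at w within B) j" by simp
qed

text \<open>The derivative of a shear is triangular and its inverse can be written down. Continuity
  of the inverse map is already available, so differentiability of \<open>k\<close> at a single
  point is enough.\<close>

lemma shear_inverse_derivative:
 fixes k j :: "real \<times> real => real"
 assumes k: "(k has_derivative (%(s, t). a * s + c * t)) (at (fst w, j w))" and c: "c ~= 0"
 and B: "open B" "w \<in> B" "cts B j" and inv: "!!w. w \<in> B ==> k (fst w, j w) = snd w"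
 shows "(j has_derivative (%(s, t). (- a / c) * s + (1 / c) * t)) (at w)"
proof -
 let ?g' = "%(s, t). (s, (- a / c) * s + (1 / c) * t)"
 have f: "((%z. (fst z, k z)) has_derivative (%h. (fst h, case h of (s, t) => a * s + c * t))) (at (fst w, j w))"
 by (rule has_derivative_Pair[OF has_derivative_fst[OF has_derivative_ident] k])
 have bl: "bounded_linear ?g'"
 unfolding case_prod_unfold by (intro bounded_linear_intros)
 have "((%w. (fst w, j w)) has_derivative ?g') (at w)"
 proof (rule has_derivative_inverse_basic[where f = "%z. (fst z, k z)" and T = B and g = "%w. (fst w, j w)" and y = w, OF f bl _ _ B(1,2)])
 show "?g' \<circ> (%h. (fst h, case h of (s, t) => a * s + c * t)) = id"
 using c by (auto simp: field_simps)
 have "cts B (%w. (fst w, j w))" by (intro continuous_intros B)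
 then show "continuous (at w) (%w. (fst w, j w))"
 using B by (simp add: continuous_on_eq_continuous_at)
 show "(fst (fst w, j w), k (fst w, j w)) = w" if "w \<in> B" for w using inv[OF that] by simp
 qed
 from has_derivative_snd[OF this] show ?thesis by (simp add: case_prod_unfold)
qed

section \<open>Change of variables as an inequality\<close>

lemma nn_integral_incseq_le:
 fixes f :: "real => ennreal"
 assumes f[measurable]: "f \<in> borel_measurable borel" and A[measurable]: "!!n. A n \<in> sets borel" and inc: "incseq A"
 and le: "!!n. (\<integral>\<^sup>+x. f x * indicator (A n) x \<partial>lborel) <= B"
 shows "(\<integral>\<^sup>+x. f x * indicator (\<Union>n. A n) x \<partial>lborel) <= B"
proof -
 have "(\<integral>\<^sup>+x. f x * indicator (\<Union>n. A n) x \<partial>lborel) = emeasure (density lborel f) (\<Union>n. A n)"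
 by (subst emeasure_density) auto
 also have "... = (SUP n. emeasure (density lborel f) (A n))"
 by (rule SUP_emeasure_incseq[symmetric]) (use inc in auto)
 also have "... <= B"
 by (rule SUP_least) (use le in "simp add: emeasure_density")
 finally show ?thesis .
qed

text \<open>A substitution whose derivative is at least \<open>c\<close> stretches lengths by at
  least \<open>c\<close>, hence the factor \<open>1 / c\<close>. The substitution rule is applied on
  compact intervals that exhaust the open one, and their images stay in the interval
  \<open>S\<close>.\<close>

lemma nn_integral_expanding:
 fixes k k' :: "real => real" and w :: "real => ennreal"
 assumes w[measurable]: "w \<in> borel_measurable borel" and c: "0 < c"
 and k: "!!y. y \<in> {a<..<b} ==> (k has_real_derivative k' y) (at y)" "cts {a<..<b} k'"
 and k': "!!y. y \<in> {a<..<b} ==> c <= k' y" and S: "!!y. y \<in> {a<..<b} ==> k y \<in> S" and Sm: "is_interval S" "S \<in> sets borel"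
 shows "(\<integral>\<^sup>+y. w (k y) * indicator {a<..<b} y \<partial>lborel) <= ennreal (1 / c) * (\<integral>\<^sup>+y. w y * indicator S y \<partial>lborel)"
proof (cases "a < b")
 case True
 \<comment> \<open>The offset three makes the two margins together smaller than \<open>b - a\<close>
   already for \<open>n = 0\<close>.\<close>
 define s where "s n = a + (b - a) / (real n + 3)" for n
 define t where "t n = b - (b - a) / (real n + 3)" for n
 have st: "a < s n" "s n < t n" "t n < b" for n
 proof -
 define e where "e = (b - a) / (real n + 3)"
 have e: "e < (b - a) / 2" unfolding e_def using True by (intro divide_strict_left_mono) auto
 have e0: "0 < e" unfolding e_def using True by simp
 show "a < s n" "s n < t n" "t n < b" unfolding s_def t_def e_def[symmetric] using e e0 by auto
 qed
 have inc: "incseq (%n. {s n..t n})"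
 proof (rule incseq_SucI)
 fix n
 have "(b - a) / (real (Suc n) + 3) <= (b - a) / (real n + 3)" using True by (intro divide_left_mono) auto
 then show "{s n..t n} \<subseteq> {s (Suc n)..t (Suc n)}" unfolding s_def t_def by auto
 qed
 have un: "(\<Union>n. {s n..t n}) = {a<..<b}"
 proof
 show "(\<Union>n. {s n..t n}) \<subseteq> {a<..<b}"
 proof
 fix y assume "y \<in> (\<Union>n. {s n..t n})"
 then obtain n where "s n <= y" "y <= t n" by auto
 then show "y \<in> {a<..<b}" using st(1)[of n] st(3)[of n] by simp
 qed
 show "{a<..<b} \<subseteq> (\<Union>n. {s n..t n})"
 proof
 fix y assume y: "y \<in> {a<..<b}"
 define e where "e = min (y - a) (b - y)"
 have e: "0 < e" using y unfolding e_def by auto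
 obtain n :: nat where "(b - a) / e < real n" using reals_Archimedean2 by blast
 then have "b - a < e * real n" using e by (simp add: field_simps)
 also have "... <= e * (real n + 3)" using e by simp
 finally have "(b - a) / (real n + 3) <= e" by (simp add: divide_le_eq less_imp_le)
 then have "y \<in> {s n..t n}" unfolding s_def t_def e_def by auto
 then show "y \<in> (\<Union>n. {s n..t n})" by blast
 qed
 qed
 have ck: "cts {a<..<b} k"
 by (rule continuous_at_imp_continuous_on) (use DERIV_isCont[OF k(1)] in blast)
 define kk where "kk y = (if y \<in> {a<..<b} then k y else 0)" for y
 have kkm[measurable]: "kk \<in> borel_measurable borel"
 unfolding kk_def by (rule borel_measurable_continuous_on_if) (use ck in auto)
 have "(\<integral>\<^sup>+y. w (kk y) * indicator (\<Union>n. {s n..t n}) y \<partial>lborel) <= ennreal (1 / c) * (\<integral>\<^sup>+y. w y * indicator S y \<partial>lborel)"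
 proof (rule nn_integral_incseq_le[OF _ _ inc])
 fix n
 have sub: "{s n..t n} \<subseteq> {a<..<b}" using st[of n] by auto
 have "(\<integral>\<^sup>+y. w (kk y) * indicator {s n..t n} y \<partial>lborel)
 <= (\<integral>\<^sup>+y. ennreal (1 / c) * (w (k y) * ennreal (k' y) * indicator {s n..t n} y) \<partial>lborel)"
 proof (rule nn_integral_mono)
 fix y
 show "w (kk y) * indicator {s n..t n} y <= ennreal (1 / c) * (w (k y) * ennreal (k' y) * indicator {s n..t n} y)"
 proof (cases "y \<in> {s n..t n}")
 case True
 then have y: "y \<in> {a<..<b}" using sub by blast
 have "1 <= (1 / c) * k' y" using k'[OF y] c by (simp add: field_simps)
 then have "ennreal 1 <= ennreal (1 / c) * ennreal (k' y)"
 using c k'[OF y] by (subst ennreal_mult[symmetric]) (auto intro!: ennreal_leI)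
 then have "w (k y) * 1 <= w (k y) * (ennreal (1 / c) * ennreal (k' y))" by (intro mult_left_mono) auto
 then show ?thesis using True y unfolding kk_def by (simp add: mult_ac)
 qed simp
 qed
 also have "... = ennreal (1 / c) * (\<integral>\<^sup>+y. w (k y) * ennreal (k' y) * indicator {s n..t n} y \<partial>lborel)"
 proof (rule nn_integral_cmult)
 define kk' where "kk' y = (if y \<in> {a<..<b} then k' y else 0)" for y
 have [measurable]: "kk' \<in> borel_measurable borel"
 unfolding kk'_def by (rule borel_measurable_continuous_on_if) (use k(2) in auto)
 have "(%y. w (kk y) * ennreal (kk' y) * indicator {s n..t n} y) \<in> borel_measurable lborel" by measurable
 moreover have "(%y. w (kk y) * ennreal (kk' y) * indicator {s n..t n} y) = (%y. w (k y) * ennreal (k' y) * indicator {s n..t n} y)"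
 using sub by (auto simp: kk_def kk'_def indicator_def fun_eq_iff)
 ultimately show "(%y. w (k y) * ennreal (k' y) * indicator {s n..t n} y) \<in> borel_measurable lborel" by (simp only:)
 qed
 also have "(\<integral>\<^sup>+y. w (k y) * ennreal (k' y) * indicator {s n..t n} y \<partial>lborel)
 = (\<integral>\<^sup>+y. w y * indicator {k (s n)..k (t n)} y \<partial>lborel)"
 proof (rule nn_integral_substitution_aux[symmetric, OF w])
 show "(k has_real_derivative k' x) (at x)" if "x \<in> {s n..t n}" for x using k(1) sub that by blast
 show "cts {s n..t n} k'" by (rule continuous_on_subset[OF k(2) sub])
 show "0 <= k' x" if "x \<in> {s n..t n}" for x using k'[of x] c sub that by force
 qed (use st in auto)
 also have "ennreal (1 / c) * (\<integral>\<^sup>+y. w y * indicator {k (s n)..k (t n)} y \<partial>lborel)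
 <= ennreal (1 / c) * (\<integral>\<^sup>+y. w y * indicator S y \<partial>lborel)"
 proof (rule mult_left_mono[OF nn_integral_mono])
 fix y
 have "s n \<in> {a<..<b}" "t n \<in> {a<..<b}" using st[of n] by auto
 then have kS: "k (s n) \<in> S" "k (t n) \<in> S" using S by blast+
 show "w y * indicator {k (s n)..k (t n)} y <= w y * indicator S y"
 proof (cases "y \<in> {k (s n)..k (t n)}")
 case True
 then have "y \<in> S" using mem_is_interval_1_I[OF Sm(1) kS] by simp
 then show ?thesis using True by simp
 qed simp
 qed simp
 finally show "(\<integral>\<^sup>+y. w (kk y) * indicator {s n..t n} y \<partial>lborel) <= ennreal (1 / c) * (\<integral>\<^sup>+y. w y * indicator S y \<partial>lborel)" .
 qed auto
 moreover have "(\<integral>\<^sup>+y. w (kk y) * indicator (\<Union>n. {s n..t n}) y \<partial>lborel) = (\<integral>\<^sup>+y. w (k y) * indicator {a<..<b} y \<partial>lborel)"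
 unfolding un by (rule nn_integral_cong) (auto simp: kk_def indicator_def)
 ultimately show ?thesis by simp
qed simp

text \<open>Because the first coordinate is preserved, integration over vertical fibres reduces the
  estimate to a one-variable substitution with derivative at least \<open>c\<close>.\<close>

lemma nonsingular_shear:
 fixes k :: "real \<times> real => real"
 assumes T: "open T" "!!x y. (x, y) \<in> T \<longleftrightarrow> y \<in> {a x<..<b x}" and S: "open S" "!!x y. (x, y) \<in> S \<longleftrightarrow> y \<in> {a' x<..<b' x}"
 and G: "!!z. z \<in> T ==> (fst z, k z) \<in> S"
 and k: "!!z. z \<in> T ==> (k has_derivative (%(s, t). kq z * s + kp z * t)) (at z)" "cts T kp"
 and c: "0 < c" "!!z. z \<in> T ==> c <= kp z"
 shows "nonsingular (1 / c) (%z. (fst z, k z)) T S"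
 unfolding nonsingular_def
proof (intro conjI allI impI T(1) S(1))
 have ck: "cts T k"
 by (rule continuous_at_imp_continuous_on) (use has_derivative_continuous[OF k(1)] in blast)
 then show cG: "cts T (%z. (fst z, k z))" by (intro continuous_intros)
 show "(%z. (fst z, k z)) ` T \<subseteq> S" using G by blast
 fix w :: "real \<times> real => ennreal" assume w: "w \<in> borel_measurable borel"
 have w2: "w \<in> borel_measurable (borel \<Otimes>\<^sub>M borel)" using w by (simp add: borel_prod)
 have [measurable]: "T \<in> sets borel" "S \<in> sets borel" using T S by auto
 define G' where "G' z = (if z \<in> T then (fst z, k z) else 0)" for z
 have G'm: "G' \<in> borel_measurable borel" unfolding G'_def by (rule borel_measurable_continuous_on_if) (use cG in auto)
 have wG: "(%z. w (G' z) * indicator T z) \<in> borel_measurable (lborel \<Otimes>\<^sub>M lborel)"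
 using measurable_compose[OF G'm w] unfolding lborel_prod by measurable
 have wS: "(%z. w z * indicator S z) \<in> borel_measurable (lborel \<Otimes>\<^sub>M lborel)"
 using w unfolding lborel_prod by measurable
 have "(\<integral>\<^sup>+z. w (fst z, k z) * indicator T z \<partial>lborel) = (\<integral>\<^sup>+z. w (G' z) * indicator T z \<partial>(lborel \<Otimes>\<^sub>M lborel))"
 unfolding lborel_prod by (rule nn_integral_cong) (auto simp: G'_def indicator_def)
 also have "... = (\<integral>\<^sup>+x. \<integral>\<^sup>+y. w (G' (x, y)) * indicator T (x, y) \<partial>lborel \<partial>lborel)"
 by (rule lborel.nn_integral_fst[OF wG, symmetric])
 also have "... <= (\<integral>\<^sup>+x. ennreal (1 / c) * (\<integral>\<^sup>+y. w (x, y) * indicator S (x, y) \<partial>lborel) \<partial>lborel)"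
 proof (rule nn_integral_mono)
 fix x
 have "(\<integral>\<^sup>+y. w (G' (x, y)) * indicator T (x, y) \<partial>lborel) = (\<integral>\<^sup>+y. w (x, k (x, y)) * indicator {a x<..<b x} y \<partial>lborel)"
 by (rule nn_integral_cong) (auto simp: G'_def indicator_def T(2))
 also have "... <= ennreal (1 / c) * (\<integral>\<^sup>+y. w (x, y) * indicator {a' x<..<b' x} y \<partial>lborel)"
 proof (rule nn_integral_expanding[where k' = "%y. kp (x, y)"])
 show "(%y. w (x, y)) \<in> borel_measurable borel" using w2 by measurable
 show "cts {a x<..<b x} (%y. kp (x, y))"
 by (rule continuous_on_compose2[OF k(2)]) (auto intro!: continuous_intros simp: T(2))
 fix y assume "y \<in> {a x<..<b x}"
 then have xy: "(x, y) \<in> T" using T(2) by blast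
 have "((%y. (x, y)) has_derivative (%h. (0, h))) (at y)" by (auto intro!: derivative_eq_intros)
 from has_derivative_compose[OF this k(1)[OF xy]]
 show "((%y. k (x, y)) has_real_derivative kp (x, y)) (at y)" by (simp add: has_field_derivative_def)
 show "c <= kp (x, y)" by (rule c(2)[OF xy])
 show "k (x, y) \<in> {a' x<..<b' x}" using G[OF xy] S(2) by simp
 qed (auto simp: c is_interval_oo)
 also have "(\<integral>\<^sup>+y. w (x, y) * indicator {a' x<..<b' x} y \<partial>lborel) = (\<integral>\<^sup>+y. w (x, y) * indicator S (x, y) \<partial>lborel)"
 by (rule nn_integral_cong) (auto simp: indicator_def S(2))
 finally show "(\<integral>\<^sup>+y. w (G' (x, y)) * indicator T (x, y) \<partial>lborel) <= ennreal (1 / c) * (\<integral>\<^sup>+y. w (x, y) * indicator S (x, y) \<partial>lborel)" .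
 qed
 also have "... = ennreal (1 / c) * (\<integral>\<^sup>+x. \<integral>\<^sup>+y. w (x, y) * indicator S (x, y) \<partial>lborel \<partial>lborel)"
 by (rule nn_integral_cmult) (use lborel.borel_measurable_nn_integral_fst[OF wS] in simp)
 also have "(\<integral>\<^sup>+x. \<integral>\<^sup>+y. w (x, y) * indicator S (x, y) \<partial>lborel \<partial>lborel) = (\<integral>\<^sup>+z. w z * indicator S z \<partial>lborel)"
 using lborel.nn_integral_fst[OF wS] unfolding lborel_prod .
 finally show "(\<integral>\<^sup>+z. w (fst z, k z) * indicator T z \<partial>lborel) <= ennreal (1 / c) * (\<integral>\<^sup>+z. w z * indicator S z \<partial>lborel)" .
qed

lemma open_closure_islimpt:
 fixes S :: "'a::euclidean_space set"
 assumes "open S" "z \<in> closure S"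
 shows "at z within S ~= bot"
proof -
 have "z islimpt S"
 using assms interior_limit_point[of z S] by (auto simp: closure_def interior_open)
 then show ?thesis by (simp add: trivial_limit_within)
qed

lemma pd_cl_eq:
 assumes S: "open S" "z \<in> closure S" and c: "cts (closure S) f'" and e: "!!w. w \<in> S ==> pd b f w = f' w"
 shows "pd_cl S b f z = f' z"
proof -
 have "(f' \<longlongrightarrow> f' z) (at z within closure S)" using c S(2) unfolding continuous_on_def by blast
 then have "(f' \<longlongrightarrow> f' z) (at z within S)" by (rule tendsto_within_subset) (rule closure_subset)
 then have "(pd b f \<longlongrightarrow> f' z) (at z within S)"
 by (rule Lim_transform_eventually) (auto simp: eventually_at_filter e)
 then show ?thesis unfolding pd_cl_def by (rule tendsto_Lim[OF open_closure_islimpt[OF S]])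
qed

section \<open>Period cells and the pair of inverse shears\<close>

lemma open_cell: "open S ==> open (cell l S)"
proof -
 assume S: "open S"
 have e: "cell l S = S \<inter> {z. 0 < fst z} \<inter> {z. fst z < l}" by (auto simp: cell_def)
 show ?thesis unfolding e by (intro open_Int S open_Collect_less continuous_intros)
qed

lemma open_strip: "open (strip p0)"
 unfolding strip_def by (intro open_Times) auto

lemma bounded_cell_strip: "bounded (cell l (strip p0))"
proof -
 have "cell l (strip p0) \<subseteq> {0..l} \<times> {p0..0}" by (auto simp: cell_def strip_def)
 then show ?thesis by (rule bounded_subset[rotated]) (intro bounded_Times bounded_closed_interval)
qed

lemma bounded_cell_fluid:
 assumes "cts UNIV et"
 shows "bounded (cell l (fluid d et))"
proof -
 have "bounded (et ` {0..l})" by (intro compact_imp_bounded compact_continuous_image continuous_on_subset[OF assms]) auto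
 then obtain B where "\<forall>x\<in>et ` {0..l}. norm x <= B" unfolding bounded_iff by blast
 then have B: "!!x. x \<in> {0..l} ==> abs (et x) <= B" by simp
 have "cell l (fluid d et) \<subseteq> {0..l} \<times> {-d..B}"
 proof
 fix z assume z: "z \<in> cell l (fluid d et)"
 obtain x y where xy: "z = (x, y)" by (cases z)
 have "0 <= x" "x <= l" "- d <= y" "y < et x" using z unfolding xy by (auto simp: cell_def fluid_def)
 then show "z \<in> {0..l} \<times> {-d..B}" using B[of x] unfolding xy by auto
 qed
 then show ?thesis by (rule bounded_subset[rotated]) (intro bounded_Times bounded_closed_interval)
qed

lemma dist_le_sum: "dist (z::real \<times> real) w <= abs (fst z - fst w) + abs (snd z - snd w)"
 unfolding dist_prod_def dist_real_def by (rule sqrt_sum_squares_le_sum) auto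

lemma abs_fst_snd_le_dist: "abs (fst z - fst w) <= dist z w" "abs (snd z - snd w) <= dist (z::real \<times> real) w"
 using dist_fst_le[of z w] dist_snd_le[of z w] by (auto simp: dist_real_def)

text \<open>A common frame for both directions. \<open>h\<close> and \<open>ps\<close> are tied by
  an implicit relation, and differentiability is postulated for \<open>h\<close> alone because that
  of \<open>ps\<close> follows. \<open>hq\<close> and \<open>hp\<close> are continuous up to the
  boundary but are derivatives of \<open>h\<close> only inside; \<open>m\<close> and
  \<open>M\<close> make the shear bi-Lipschitz.\<close>

locale hodo =
 fixes d p0 m M :: real and et :: "real => real" and ps h hq hp :: "real \<times> real => real"
 assumes p0: "p0 < 0" and m: "0 < m"
 and eta: "cts UNIV et" "!!x. - d < et x"
 and h_cont: "cts (UNIV \<times> {p0..0}) h"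
 and h_bot: "!!q. h (q, p0) = 0" and h_top: "!!q. h (q, 0) = et q + d"
 and h_der: "!!z. z \<in> strip p0 ==> (h has_derivative (%(s, t). hq z * s + hp z * t)) (at z)"
 and hq_cont: "cts (UNIV \<times> {p0..0}) hq" and hp_cont: "cts (UNIV \<times> {p0..0}) hp"
 and hq_bound: "!!z. z \<in> UNIV \<times> {p0..0} ==> abs (hq z) <= M"
 and hp_bound: "!!z. z \<in> UNIV \<times> {p0..0} ==> m <= hp z" "!!z. z \<in> UNIV \<times> {p0..0} ==> hp z <= M"
 and psi: "!!x y. - d <= y ==> y <= et x ==> ps (x, y) \<in> {0..-p0} & h (x, - ps (x, y)) = y + d"
begin

abbreviation "S \<equiv> strip p0"
abbreviation "OM \<equiv> fluid d et"

definition H :: "real \<times> real => real \<times> real" where "H z = (fst z, - ps z)"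
definition G :: "real \<times> real => real \<times> real" where "G z = (fst z, h z - d)"

lemma clS: "closure S = UNIV \<times> {p0..0}" by (rule closure_strip[OF p0])
lemma clO: "closure OM = {(x, y). - d <= y & y <= et x}" by (rule closure_fluid[OF eta])
lemma oO: "open OM" by (rule open_fluid[OF eta(1)])
lemma memS: "(q, p) \<in> S \<longleftrightarrow> p0 < p & p < 0" by (simp add: strip_def)
lemma M: "0 < M" using m hp_bound[of "(0,0)"] p0 by force

lemma h_line_p: "p0 < p ==> p < 0 ==> ((%p. h (q, p)) has_real_derivative hp (q, p)) (at p)"
proof -
 assume p: "p0 < p" "p < 0"
 have "((%p. (q, p)) has_derivative (%t. (0, t))) (at p)" by (auto intro!: derivative_eq_intros)
 from has_derivative_compose[OF this h_der] p show ?thesis by (simp add: memS has_field_derivative_def)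
qed

lemma h_line_q: "p0 < p ==> p < 0 ==> ((%q. h (q, p)) has_real_derivative hq (q, p)) (at q)"
proof -
 assume p: "p0 < p" "p < 0"
 have "((%q. (q, p)) has_derivative (%t. (t, 0))) (at q)" by (auto intro!: derivative_eq_intros)
 from has_derivative_compose[OF this h_der] p show ?thesis by (simp add: memS has_field_derivative_def)
qed

lemma h_mono:
 assumes "p0 <= p" "p <= p'" "p' <= 0"
 shows "m * (p' - p) <= h (q, p') - h (q, p)" "h (q, p') - h (q, p) <= M * (p' - p)"
proof -
 have "m * (p' - p) <= h (q, p') - h (q, p) & h (q, p') - h (q, p) <= M * (p' - p)"
 proof (cases "p = p'")
 case False
 then have pp: "p < p'" using assms by simp
 have "cts {p..p'} (%p. h (q, p))"
 by (rule continuous_on_compose2[OF h_cont]) (use assms in "auto intro!: continuous_intros")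
 moreover have "(%p. h (q, p)) differentiable (at x)" if "p < x" "x < p'" for x
 using h_line_p[of x q] that assms by (auto simp: real_differentiable_def)
 ultimately obtain l z where z: "p < z" "z < p'" "((%p. h (q, p)) has_real_derivative l) (at z)"
 "h (q, p') - h (q, p) = (p' - p) * l" using MVT[OF pp, of "%p. h (q, p)"] by blast
 have "l = hp (q, z)" using z assms h_line_p[of z q] by (intro DERIV_unique[OF z(3)]) auto
 moreover have "m <= hp (q, z)" "hp (q, z) <= M" using hp_bound[of "(q, z)"] z assms by auto
 ultimately show ?thesis using z(4) pp mult_left_mono[of m l "p' - p"] mult_left_mono[of l M "p' - p"]
 by (simp add: mult.commute)
 qed simp
 then show "m * (p' - p) <= h (q, p') - h (q, p)" "h (q, p') - h (q, p) <= M * (p' - p)" by auto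
qed

lemma h_less: "p0 <= p ==> p < p' ==> p' <= 0 ==> h (q, p) < h (q, p')"
 using h_mono(1)[of p p' q] mult_pos_pos[OF m, of "p' - p"] by simp

lemma h_range: "p0 <= p ==> p <= 0 ==> 0 <= h (q, p) & h (q, p) <= et q + d"
 using h_less[of p0 p q] h_less[of p 0 q] h_bot[of q] h_top[of q] by (cases "p = p0"; cases "p = 0") auto

lemma G_cl: "z \<in> closure S ==> G z \<in> closure OM"
proof -
 assume "z \<in> closure S"
 then obtain q p where z: "z = (q, p)" "p0 <= p" "p <= 0" unfolding clS by (cases z) auto
 from h_range[OF z(2,3), of q] show ?thesis unfolding clO z(1) G_def by simp
qed

lemma H_cl: "z \<in> closure OM ==> H z \<in> closure S"
proof -
 assume "z \<in> closure OM"
 then obtain x y where z: "z = (x, y)" "- d <= y" "y <= et x" unfolding clO by (cases z) auto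
 from psi[OF z(2,3)] show ?thesis unfolding clS z(1) H_def by auto
qed

lemma GH: "z \<in> closure OM ==> G (H z) = z"
 unfolding clO H_def G_def using psi by (cases z) auto

text \<open>Strict monotonicity of \<open>h\<close> in the second variable: the level assigned by
  \<open>ps\<close> and the original level have the same height, so they coincide.\<close>

lemma HG: assumes "z \<in> closure S" shows "H (G z) = z"
proof -
 obtain q p where z: "z = (q, p)" "p0 <= p" "p <= 0" using assms unfolding clS by (cases z) auto
 have r: "0 <= h (q, p)" "h (q, p) <= et q + d" using h_range z by auto
 let ?p = "- ps (q, h (q, p) - d)"
 have "ps (q, h (q, p) - d) \<in> {0..-p0} & h (q, ?p) = (h (q, p) - d) + d" using r by (intro psi) auto
 then have "?p \<in> {p0..0}" "h (q, ?p) = h (q, p)" by auto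
 then have "?p = p" using h_less[of p ?p q] h_less[of ?p p q] z by (cases "p < ?p"; cases "?p < p") auto
 then show ?thesis unfolding z H_def G_def by simp
qed

lemma psi_h: "p0 <= p ==> p <= 0 ==> ps (q, h (q, p) - d) = - p"
 using HG[of "(q, p)"] by (simp add: clS H_def G_def)

lemma psi_top: "ps (x, et x) = 0"
 using psi_h[of 0 x] p0 by (simp add: h_top)

lemma psi_bot: "ps (x, - d) = - p0"
 using psi_h[of p0 x] p0 by (simp add: h_bot)

lemma G_S: "z \<in> S ==> G z \<in> OM"
proof -
 assume "z \<in> S"
 then obtain q p where z: "z = (q, p)" "p0 < p" "p < 0" by (cases z) (auto simp: memS)
 then show ?thesis using h_less[of p0 p q] h_less[of p 0 q] by (simp add: h_bot h_top G_def mem_fluid)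
qed

lemma H_O: "z \<in> OM ==> H z \<in> S"
proof -
 assume z: "z \<in> OM"
 obtain x y where xy: "z = (x, y)" "- d < y" "y < et x" using z by (cases z) (auto simp: mem_fluid)
 have p: "ps (x, y) \<in> {0..-p0}" "h (x, - ps (x, y)) = y + d" using psi[of y x] xy by auto
 have "- ps (x, y) ~= p0" "ps (x, y) ~= 0" using p xy h_bot[of x] h_top[of x] by auto
 then show ?thesis using p unfolding xy H_def by (auto simp: memS)
qed

lemma O_cl: "z \<in> OM ==> z \<in> closure OM" and S_cl: "z \<in> S ==> z \<in> closure S"
 using closure_subset by blast+

lemma bij: "bij_betw (hodograph ps) (closure OM) (closure S)"
proof -
 have e: "hodograph ps = H" by (auto simp: hodograph_def H_def)
 show ?thesis unfolding e
 by (rule bij_betw_byWitness[where f' = G]) (use GH HG H_cl G_cl in auto)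
qed

lemma inv_hodograph: "w \<in> closure S ==> inv_hodograph d et ps w = G w"
proof -
 assume w: "w \<in> closure S"
 have "hodograph ps (G w) = w" using HG[OF w] by (simp add: hodograph_def H_def)
 then show ?thesis using inv_into_f_eq[OF bij_betw_imp_inj_on[OF bij] G_cl[OF w]] by simp
qed

text \<open>Inside the strip this is the mean value theorem. On the top line \<open>hq\<close> is
  not yet known to be a derivative of \<open>h\<close>, so the estimate is taken on the line
  \<open>p = - s\<close> and transferred upwards at a cost of at most
  \<open>2 * (M * s)\<close>.\<close>

lemma h_lip_q:
 assumes p: "p0 <= p" "p <= 0"
 shows "abs (h (q, p) - h (q', p)) <= M * abs (q - q')"
proof -
 have open_case: "abs (h (q, p) - h (q', p)) <= M * abs (q - q')" if p: "p0 < p" "p < 0" for p q q'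
 proof -
 have "norm (h (q, p) - h (q', p)) <= M * norm (q - q')"
 proof (rule field_differentiable_bound[where S = UNIV and f' = "%q. hq (q, p)"])
 show "((%q. h (q, p)) has_field_derivative hq (z, p)) (at z within UNIV)" for z using h_line_q[OF p] by simp
 show "norm (hq (z, p)) <= M" for z using hq_bound[of "(z, p)"] p by simp
 qed auto
 then show ?thesis by simp
 qed
 consider "p0 < p" "p < 0" | "p = p0" | "p = 0" using p by linarith
 then show ?thesis
 proof cases
 case 2
 then show ?thesis using M by (simp add: h_bot)
 next
 case 3
 have "abs (h (q, 0) - h (q', 0)) <= M * abs (q - q') + e" if e: "e > 0" for e
 proof -
 define s where "s = min (- p0 / 2) (e / (2 * M))"
 have s: "0 < s" "s < - p0" "2 * (M * s) <= e"
 proof -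
 show "0 < s" "s < - p0" unfolding s_def using p0 e M by auto
 have "s <= e / (2 * M)" unfolding s_def by simp
 then show "2 * (M * s) <= e" using M by (simp add: field_simps)
 qed
 have "abs (h (q, -s) - h (q', -s)) <= M * abs (q - q')" by (rule open_case) (use s in auto)
 moreover have "0 <= h (q, 0) - h (q, -s)" "h (q, 0) - h (q, -s) <= M * s" "0 <= h (q', 0) - h (q', -s)" "h (q', 0) - h (q', -s) <= M * s"
 using h_mono(2)[of "-s" 0 q] h_mono(2)[of "-s" 0 q'] h_less[of "-s" 0 q] h_less[of "-s" 0 q'] s by auto
 ultimately show ?thesis using s(3) by linarith
 qed
 then show ?thesis unfolding 3 by (rule field_le_epsilon)
 qed (use open_case in auto)
qed

lemma h_lip_p:
 assumes p: "p \<in> {p0..0}" "p' \<in> {p0..0}"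
 shows "abs (h (q, p) - h (q, p')) <= M * abs (p - p')" "m * abs (p - p') <= abs (h (q, p) - h (q, p'))"
proof -
 have "abs (h (q, p) - h (q, p')) <= M * abs (p - p') & m * abs (p - p') <= abs (h (q, p) - h (q, p'))"
 proof (cases "p <= p'")
 case True
 then have "0 <= m * (p' - p)" "abs (p - p') = p' - p" using m by auto
 moreover have "m * (p' - p) <= h (q, p') - h (q, p)" "h (q, p') - h (q, p) <= M * (p' - p)"
 using h_mono[of p p' q] p True by auto
 ultimately show ?thesis by simp
 next
 case False
 then have "0 <= m * (p - p')" "abs (p - p') = p - p'" using m by auto
 moreover have "m * (p - p') <= h (q, p) - h (q, p')" "h (q, p) - h (q, p') <= M * (p - p')"
 using h_mono[of p' p q] p False by auto
 ultimately show ?thesis by simp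
 qed
 then show "abs (h (q, p) - h (q, p')) <= M * abs (p - p')" "m * abs (p - p') <= abs (h (q, p) - h (q, p'))" by auto
qed

lemma G_lip:
 assumes "z \<in> closure S" "w \<in> closure S"
 shows "dist (G z) (G w) <= (1 + 2 * M) * dist z w"
proof -
 obtain q p where z: "z = (q, p)" "p \<in> {p0..0}" using assms unfolding clS by (cases z) auto
 obtain q' p' where w: "w = (q', p')" "p' \<in> {p0..0}" using assms unfolding clS by (cases w) auto
 have a: "abs (q - q') <= dist z w" "abs (p - p') <= dist z w" using abs_fst_snd_le_dist[of z w] unfolding z w by auto
 have "abs (h (q, p) - h (q', p')) <= abs (h (q, p) - h (q', p)) + abs (h (q', p) - h (q', p'))" by linarith
 also have "... <= M * abs (q - q') + M * abs (p - p')" using h_lip_q[of p q q'] h_lip_p(1)[OF z(2) w(2), of q'] z(2) by auto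
 also have "... <= M * dist z w + M * dist z w" using M by (intro add_mono mult_left_mono a) auto
 finally have "abs (h z - h w) <= 2 * M * dist z w" unfolding z w by simp
 moreover have "dist (G z) (G w) <= abs (q - q') + abs (h z - h w)" using dist_le_sum[of "G z" "G w"] unfolding G_def z w by simp
 ultimately show ?thesis using a(1) by (simp add: algebra_simps)
qed

text \<open>The lower bound \<open>m\<close> of \<open>hp\<close> controls a difference of levels by
  a difference of heights; comparing heights over different abscissae contributes the additional
  \<open>M\<close>.\<close>

lemma psi_lip:
 assumes "z \<in> closure OM" "w \<in> closure OM"
 shows "abs (ps z - ps w) <= (1 + M) / m * dist z w"
proof -
 obtain x y where z: "z = (x, y)" "- d <= y" "y <= et x" using assms unfolding clO by (cases z) auto
 obtain x' y' where w: "w = (x', y')" "- d <= y'" "y' <= et x'" using assms unfolding clO by (cases w) auto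
 have a: "abs (x - x') <= dist z w" "abs (y - y') <= dist z w" using abs_fst_snd_le_dist[of z w] unfolding z w by auto
 let ?p = "- ps (x, y)" and ?p' = "- ps (x', y')"
 have p: "?p \<in> {p0..0}" "h (x, ?p) = y + d" "?p' \<in> {p0..0}" "h (x', ?p') = y' + d" using psi[of y x] psi[of y' x'] z w by auto
 have "m * abs (?p - ?p') <= abs (h (x, ?p) - h (x, ?p'))" by (rule h_lip_p(2)[OF p(1) p(3)])
 also have "... <= abs (h (x, ?p) - h (x', ?p')) + abs (h (x', ?p') - h (x, ?p'))" by linarith
 also have "... <= abs (y - y') + M * abs (x' - x)" using h_lip_q[of ?p' x' x] p by auto
 also have "... <= dist z w + M * dist z w" using M a by (intro add_mono mult_left_mono) (auto simp: abs_minus_commute)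
 finally have "m * abs (?p - ?p') <= (1 + M) * dist z w" by (simp add: algebra_simps)
 then have "abs (?p - ?p') <= (1 + M) * dist z w / m" using m by (simp add: field_simps)
 moreover have "abs (?p - ?p') = abs (ps z - ps w)" unfolding z w by linarith
 ultimately show ?thesis by simp
qed

lemma H_lip:
 assumes "z \<in> closure OM" "w \<in> closure OM"
 shows "dist (H z) (H w) <= (1 + (1 + M) / m) * dist z w"
proof -
 have "dist (H z) (H w) <= abs (fst z - fst w) + abs (ps z - ps w)"
 using dist_le_sum[of "H z" "H w"] by (simp add: H_def abs_minus_commute)
 also have "... <= dist z w + (1 + M) / m * dist z w" by (intro add_mono abs_fst_snd_le_dist psi_lip assms)
 finally show ?thesis by (simp add: algebra_simps)
qed

lemma H_cont: "cts (closure OM) H"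
 by (rule lipschitz_on_continuous_on[of "1 + (1 + M) / m"], rule lipschitz_onI)
 (use H_lip m M in auto)

lemma psi_cont: "cts (closure OM) ps"
proof -
 have "cts (closure OM) (%z. - snd (H z))" by (intro continuous_intros H_cont)
 then show ?thesis by (simp add: H_def)
qed

lemma G_cont: "cts (closure S) G"
 unfolding G_def clS by (intro continuous_intros h_cont)

text \<open>The partial derivatives of \<open>ps\<close> as they come out of inverting the
  triangular derivative. Written through \<open>H\<close>, they make sense and are continuous on the
  closed fluid domain.\<close>

definition psx :: "real \<times> real => real" where "psx z = hq (H z) / hp (H z)"
definition psy :: "real \<times> real => real" where "psy z = - 1 / hp (H z)"

lemma hp_pos: "z \<in> closure S ==> 0 < hp z"
 using hp_bound(1)[of z] m unfolding clS by linarith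

lemma psx_cont: "cts (closure OM) psx" and psy_cont: "cts (closure OM) psy"
proof -
 have c: "cts (closure OM) (%z. hq (H z))" "cts (closure OM) (%z. hp (H z))"
 by (rule continuous_on_compose2[OF hq_cont H_cont], use H_cl clS in blast)
 (rule continuous_on_compose2[OF hp_cont H_cont], use H_cl clS in blast)
 have n: "hp (H z) ~= 0" if "z \<in> closure OM" for z using hp_pos[OF H_cl[OF that]] by simp
 show "cts (closure OM) psx" "cts (closure OM) psy"
 unfolding psx_def psy_def by (intro continuous_intros c; use n in blast)+
qed

lemma psi_der: assumes "z \<in> OM" shows "(ps has_derivative (%(s, t). psx z * s + psy z * t)) (at z)"
proof -
 have n: "hp (H z) ~= 0" using hp_pos[OF H_cl[OF O_cl[OF assms]]] by simp
 have "((%w. - ps w) has_derivative (%(s, t). (- hq (H z) / hp (H z)) * s + (1 / hp (H z)) * t)) (at z)"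
 proof (rule shear_inverse_derivative[where k = "%w. h w - d" and B = OM, OF _ n oO assms])
 have e: "(fst z, - ps z) = H z" by (simp add: H_def)
 show "((%w. h w - d) has_derivative (%(s, t). hq (H z) * s + hp (H z) * t)) (at (fst z, - ps z))"
 unfolding e using has_derivative_diff[OF h_der[OF H_O[OF assms]] has_derivative_const[of d]] by simp
 show "cts OM (%w. - ps w)" by (intro continuous_intros continuous_on_subset[OF psi_cont] closure_subset)
 show "h (fst w, - ps w) - d = snd w" if "w \<in> OM" for w
 using GH[OF O_cl[OF that]] by (simp add: G_def H_def prod_eq_iff)
 qed
 from has_derivative_minus[OF this] show ?thesis
 by (simp add: psx_def psy_def case_prod_unfold)
qed

lemma pd_psi: "z \<in> OM ==> pd ex ps z = psx z" "z \<in> OM ==> pd ey ps z = psy z"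
 using pd_eqI[OF psi_der] by simp_all

lemma pd_h: "z \<in> S ==> pd ex h z = hq z" "z \<in> S ==> pd ey h z = hp z"
 using pd_eqI[OF h_der] by simp_all

lemma psi_C1: "C1_on OM ps"
proof -
 have "cts OM (pd ex ps) \<longleftrightarrow> cts OM psx" "cts OM (pd ey ps) \<longleftrightarrow> cts OM psy"
 by (rule continuous_on_cong; simp add: pd_psi)+
 then show ?thesis unfolding C1_on_def Basis_prod_real
 using continuous_on_subset[OF psx_cont closure_subset] continuous_on_subset[OF psy_cont closure_subset] psi_der
 by (auto intro: differentiableI)
qed

lemma h_C1: "C1_on S h"
proof -
 have "cts S (pd ex h) \<longleftrightarrow> cts S hq" "cts S (pd ey h) \<longleftrightarrow> cts S hp"
 by (rule continuous_on_cong; simp add: pd_h)+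
 moreover have "cts S hq" "cts S hp"
 using hq_cont hp_cont closure_subset[of S] unfolding clS by (auto intro: continuous_on_subset)
 ultimately show ?thesis unfolding C1_on_def Basis_prod_real
 using h_der by (auto intro: differentiableI)
qed

lemma nonsing_G: "nonsingular (1 / m) G S OM"
 unfolding G_def
proof (rule nonsingular_shear[OF open_strip _ oO _ _ _ _ m, where kq = hq and kp = hp
 and a = "%_. p0" and b = "%_. 0" and a' = "%_. -d" and b' = et])
 show "((%w. h w - d) has_derivative (%(s, t). hq z * s + hp z * t)) (at z)" if "z \<in> S" for z
 using has_derivative_diff[OF h_der[OF that] has_derivative_const[of d]] by simp
 show "cts S hp" using hp_cont closure_subset[of S] unfolding clS by (rule continuous_on_subset)
 show "m <= hp z" if "z \<in> S" for z using hp_bound(1) S_cl[OF that] unfolding clS by blast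
 show "(fst z, h z - d) \<in> OM" if "z \<in> S" for z using G_S[OF that] by (simp add: G_def)
qed (auto simp: memS mem_fluid)

text \<open>The vertical derivative of \<open>- ps\<close> is \<open>1 / hp\<close>, which is at
  least \<open>1 / M\<close>; this explains the unreduced constant.\<close>

lemma nonsing_H: "nonsingular (1 / (1 / M)) H OM S"
 unfolding H_def
proof (rule nonsingular_shear[OF oO _ open_strip, where kq = "%z. - psx z" and kp = "%z. - psy z"
 and a' = "%_. p0" and b' = "%_. 0" and a = "%_. -d" and b = et])
 show "((%w. - ps w) has_derivative (%(s, t). - psx z * s + - psy z * t)) (at z)" if "z \<in> OM" for z
 using has_derivative_minus[OF psi_der[OF that]] by (simp add: case_prod_unfold)
 show "cts OM (%z. - psy z)" by (intro continuous_intros continuous_on_subset[OF psy_cont closure_subset])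
 show "1 / M <= - psy z" if "z \<in> OM" for z
 proof -
 have "H z \<in> UNIV \<times> {p0..0}" using H_cl[OF O_cl[OF that]] clS by simp
 then have "hp (H z) <= M" "0 < hp (H z)" using hp_bound[of "H z"] m by linarith+
 then show ?thesis unfolding psy_def by (simp add: frac_le)
 qed
 show "(fst z, - ps z) \<in> S" if "z \<in> OM" for z using H_O[OF that] by (simp add: H_def)
 show "0 < 1 / M" using M by simp
qed (auto simp: memS mem_fluid)

lemma AE_to_fluid: "AE w in Leb. w \<in> S --> P w ==> AE z in Leb. z \<in> OM --> P (H z)"
 by (rule nonsingular_AE[OF nonsing_H])

lemma AE_to_strip: "AE z in Leb. z \<in> OM --> P z ==> AE w in Leb. w \<in> S --> P (G w)"
 by (rule nonsingular_AE[OF nonsing_G])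

lemma bound_psx: "z \<in> closure OM ==> abs (psx z) <= M / m"
 and bound_psy: "z \<in> closure OM ==> abs (psy z) <= 1 / m"
 and psy_le: "z \<in> closure OM ==> psy z <= - (1 / M)"
proof -
 assume z: "z \<in> closure OM"
 have Hz: "H z \<in> UNIV \<times> {p0..0}" using H_cl[OF z] clS by simp
 note b = hq_bound[OF Hz] hp_bound[OF Hz]
 show "abs (psx z) <= M / m" unfolding psx_def abs_divide using b m by (intro frac_le) auto
 show "abs (psy z) <= 1 / m" unfolding psy_def abs_divide using b m by (intro frac_le) auto
 show "psy z <= - (1 / M)" unfolding psy_def using b m by (simp add: frac_le)
qed

lemma W1r_to_fluid:
 assumes "W1r r S (cell l S) f f1 f2"
 shows "W1r r OM (cell l OM) (%z. f (H z)) (%z. f1 (H z) + (- psx z) * f2 (H z)) (%z. (- psy z) * f2 (H z))"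
proof (rule W1r_shear[OF nonsing_H H_def _ _ _ open_cell[OF oO] _ _ _ _ assms, where M = "max (M / m) (1 / m)"])
 show "((%w. - ps w) has_derivative (%(s, t). - psx z * s + - psy z * t)) (at z)" if "z \<in> OM" for z
 using has_derivative_minus[OF psi_der[OF that]] by (simp add: case_prod_unfold)
 show "cts OM (%z. - psy z)" "cts OM (%z. - psx z)"
 by (intro continuous_intros continuous_on_subset[OF psy_cont closure_subset] continuous_on_subset[OF psx_cont closure_subset])+
 show "cell l OM \<subseteq> OM" by (auto simp: cell_def)
 fix z assume z: "z \<in> cell l OM"
 then have z': "z \<in> OM" by (auto simp: cell_def)
 show "H z \<in> cell l S" using z H_O[OF z'] by (auto simp: cell_def H_def)
 show "abs (- psx z) <= max (M / m) (1 / m)" "abs (- psy z) <= max (M / m) (1 / m)"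
 using bound_psx[OF O_cl[OF z']] bound_psy[OF O_cl[OF z']] by auto
qed

lemma W1r_to_strip:
 assumes "W1r r OM (cell l OM) f f1 f2"
 shows "W1r r S (cell l S) (%w. f (G w)) (%w. f1 (G w) + hq w * f2 (G w)) (%w. hp w * f2 (G w))"
proof (rule W1r_shear[OF nonsing_G G_def _ _ _ open_cell[OF open_strip] _ _ _ _ assms, where M = M])
 show "((%w. h w - d) has_derivative (%(s, t). hq z * s + hp z * t)) (at z)" if "z \<in> S" for z
 using has_derivative_diff[OF h_der[OF that] has_derivative_const[of d]] by simp
 show "cts S hp" "cts S hq"
 using hq_cont hp_cont closure_subset[of S] unfolding clS by (auto intro: continuous_on_subset)
 show "cell l S \<subseteq> S" by (auto simp: cell_def)
 fix z assume z: "z \<in> cell l S"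
 then have z': "z \<in> S" by (auto simp: cell_def)
 show "G z \<in> cell l OM" using z G_S[OF z'] by (auto simp: cell_def G_def)
 have "z \<in> UNIV \<times> {p0..0}" using S_cl[OF z'] clS by simp
 then show "abs (hq z) <= M" "abs (hp z) <= M" using hq_bound[of z] hp_bound[of z] m by auto
qed

lemma holder_to_fluid: "holder al S f ==> 0 <= al ==> holder al OM (%z. f (H z))"
 by (rule holder_compose_lipschitz[OF _ H_cl H_lip])

lemma holder_to_strip: "holder al OM f ==> 0 <= al ==> holder al S (%w. f (G w))"
 by (rule holder_compose_lipschitz[OF _ G_cl G_lip])

text \<open>The surface is the limit of the lines \<open>p = - s\<close>, along which
  \<open>h\<close> is differentiable. On such a line the increment is close to
  \<open>hq (x, 0)\<close> times the step, by continuity of \<open>hq\<close>. The step is held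
  fixed while the vertical error, of order \<open>M * s\<close>, is made arbitrarily small.\<close>

lemma eta_der: "(et has_real_derivative hq (x, 0)) (at x)"
proof -
 have "((%y. (et y - et x) / (y - x)) \<longlongrightarrow> hq (x, 0)) (at x)"
 proof (rule tendstoI)
 fix e :: real assume e: "e > 0"
 have "continuous (at (x, 0) within UNIV \<times> {p0..0}) hq"
 using hq_cont p0 by (simp add: continuous_on_eq_continuous_within)
 then obtain r where r: "r > 0" "!!w. w \<in> UNIV \<times> {p0..0} ==> dist w (x, 0) < r ==> dist (hq w) (hq (x, 0)) < e / 2"
 unfolding continuous_within_eps_delta using e by (metis half_gt_zero)
 have key: "abs (et y - et x - (y - x) * hq (x, 0)) <= e / 2 * abs (y - x)" if y: "abs (y - x) < r / 2" "y ~= x" for y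
 proof (rule field_le_epsilon)
 fix k :: real assume k: "k > 0"
 \<comment> \<open>Three demands: the line lies in the strip, it is close enough to the surface for
   the continuity bound of \<open>hq\<close>, and the two vertical errors together stay below
   \<open>k\<close>.\<close>
 define s where "s = min (min (- p0 / 2) (r / 4)) (k / (2 * M))"
 have s: "0 < s" "s < - p0" "s < r / 2" "2 * (M * s) <= k"
 proof -
 show "0 < s" "s < - p0" "s < r / 2" unfolding s_def using p0 k M r by auto
 have "s <= k / (2 * M)" unfolding s_def by simp
 then show "2 * (M * s) <= k" using M by (simp add: field_simps)
 qed
 have near: "abs (hq (t, -s) - hq (x, 0)) < e / 2" if "abs (t - x) <= abs (y - x)" for t
 proof -
 have "dist (t, -s) (x, 0) <= abs (t - x) + s" using dist_le_sum[of "(t, -s)" "(x, 0)"] s by simp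
 then have "dist (t, -s) (x, 0) < r" using that y(1) s(3) by simp
 then show ?thesis using r(2)[of "(t, -s)"] s by (simp add: dist_real_def)
 qed
 have lip: "abs ((h (y, -s) - y * hq (x, 0)) - (h (x, -s) - x * hq (x, 0))) <= e / 2 * abs (y - x)"
 proof -
 have "norm ((h (y, -s) - y * hq (x, 0)) - (h (x, -s) - x * hq (x, 0))) <= e / 2 * norm (y - x)"
 proof (rule field_differentiable_bound[where S = "{t. abs (t - x) <= abs (y - x)}" and f' = "%t. hq (t, -s) - hq (x, 0)"])
 have "{t. abs (t - x) <= abs (y - x)} = {x - abs (y - x)..x + abs (y - x)}" by auto
 then show "convex {t. abs (t - x) <= abs (y - x)}" by simp
 fix t assume t: "t \<in> {t. abs (t - x) <= abs (y - x)}"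
 have "((%t. h (t, -s)) has_real_derivative hq (t, -s)) (at t)" by (rule h_line_q) (use s in auto)
 then have "((%t. h (t, -s) - t * hq (x, 0)) has_real_derivative hq (t, -s) - hq (x, 0)) (at t)"
 by (auto intro!: derivative_eq_intros)
 then show "((%t. h (t, -s) - t * hq (x, 0)) has_field_derivative hq (t, -s) - hq (x, 0)) (at t within {t. abs (t - x) <= abs (y - x)})"
 by (rule has_field_derivative_at_within)
 show "norm (hq (t, -s) - hq (x, 0)) <= e / 2" using near[of t] t by simp
 qed auto
 then show ?thesis by simp
 qed
 have b: "0 <= h (q, 0) - h (q, -s)" "h (q, 0) - h (q, -s) <= M * s" for q
 using h_mono(2)[of "-s" 0 q] h_less[of "-s" 0 q] s by auto
 have a1: "et y - et x - (y - x) * hq (x, 0) = ((h (y, -s) - y * hq (x, 0)) - (h (x, -s) - x * hq (x, 0)))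
 + (h (y, 0) - h (y, -s)) - (h (x, 0) - h (x, -s))"
 by (simp add: h_top algebra_simps)
 show "abs (et y - et x - (y - x) * hq (x, 0)) <= e / 2 * abs (y - x) + k"
 unfolding a1 using lip b[of x] b[of y] s(4) by linarith
 qed
 show "\<forall>\<^sub>F y in at x. dist ((et y - et x) / (y - x)) (hq (x, 0)) < e"
 unfolding eventually_at
 proof (intro exI[of _ "r / 2"] conjI ballI impI)
 fix y assume y: "y ~= x & dist y x < r / 2"
 have "(et y - et x) / (y - x) - hq (x, 0) = (et y - et x - (y - x) * hq (x, 0)) / (y - x)"
 using y by (simp add: field_simps)
 then have "abs ((et y - et x) / (y - x) - hq (x, 0)) = abs (et y - et x - (y - x) * hq (x, 0)) / abs (y - x)"
 by (simp add: abs_divide)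
 also have "... <= e / 2" using key[of y] y by (simp add: dist_real_def divide_le_eq)
 finally show "dist ((et y - et x) / (y - x)) (hq (x, 0)) < e" using e by (simp add: dist_real_def)
 qed (use r in simp)
 qed
 then show ?thesis by (simp add: has_field_derivative_iff)
qed

end

section \<open>Transfer of the classes and of the elliptic equation\<close>

lemma holder_inverse:
 assumes f: "holder al S f" and c: "0 < c" "!!z. z \<in> closure S ==> c <= abs (f z)"
 shows "holder al S (%z. inverse (f z))"
proof (rule holder_lipschitz_compose[OF f, where X = "{x. c <= abs x}" and L = "1 / (c * c)"])
 fix x y :: real assume xy: "x \<in> {x. c <= abs x}" "y \<in> {x. c <= abs x}"
 have n: "x ~= 0" "y ~= 0" using xy c(1) by auto
 have "inverse x - inverse y = (y - x) / (x * y)" using n by (simp add: field_simps)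
 then have "abs (inverse x - inverse y) = abs (x - y) / (abs x * abs y)" by (simp add: abs_divide abs_mult abs_minus_commute)
 also have "... <= abs (x - y) / (c * c)" using xy c(1) by (intro divide_left_mono mult_mono mult_pos_pos) auto
 finally show "abs (inverse x - inverse y) <= 1 / (c * c) * abs (x - y)" by simp
qed (use c(2) in auto)

lemma W1r_quotients:
 assumes f: "W1r r S C f f1 f2" and g: "W1r r S C g g1 g2"
 and c: "0 < c" "!!z. z \<in> S ==> c <= abs (g z)" and bd: "!!z. z \<in> C ==> abs (f z) <= B"
 shows "W1r r S C (%z. f z / g z) (%z. (1 / g z) * f1 z + (- f z / (g z)\<^sup>2) * g1 z) (%z. (1 / g z) * f2 z + (- f z / (g z)\<^sup>2) * g2 z)"
 and "W1r r S C (%z. 1 / g z) (%z. (- 1 / (g z)\<^sup>2) * g1 z) (%z. (- 1 / (g z)\<^sup>2) * g2 z)"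
proof -
 have CS: "C \<subseteq> S" using f unfolding W1r_def by auto
 let ?V = "UNIV \<times> (- {0}) :: (real \<times> real) set"
 have V: "open ?V" by (intro open_Times open_UNIV open_Compl) auto
 have gn: "g z ~= 0" if "z \<in> S" for z using c(1) c(2)[OF that] by auto
 have D: "((%w. fst w / snd w) has_derivative (%(s, t). (1 / snd w) * s + (- fst w / (snd w)\<^sup>2) * t)) (at w)" if "w \<in> ?V" for w :: "real \<times> real"
 proof -
 have n: "snd w ~= 0" using that by auto
 have "((%w. fst w / snd w) has_derivative (%h. - fst w * (inverse (snd w) * snd h * inverse (snd w)) + fst h / snd w)) (at w)"
 by (rule has_derivative_divide[OF has_derivative_fst[OF has_derivative_ident] has_derivative_snd[OF has_derivative_ident] n])
 moreover have "(%h. - fst w * (inverse (snd w) * snd h * inverse (snd w)) + fst h / snd w) = (%(s, t). (1 / snd w) * s + (- fst w / (snd w)\<^sup>2) * t)"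
 using n by (auto simp: field_simps power2_eq_square)
 ultimately show ?thesis by simp
 qed
 have bds: "abs (1 / g z) <= max (1 / c) (abs B / c\<^sup>2)" "abs (- f z / (g z)\<^sup>2) <= max (1 / c) (abs B / c\<^sup>2)" "abs (- 1 / (g z)\<^sup>2) <= 1 / c\<^sup>2" if "z \<in> C" for z
 proof -
 have g: "c <= abs (g z)" using c(2) CS that by blast
 have g2: "c\<^sup>2 <= (g z)\<^sup>2" using power_mono[OF g, of 2] c(1) by simp
 have c2: "0 < c\<^sup>2" using c(1) by simp
 have "abs (1 / g z) <= 1 / c" unfolding abs_divide using g c(1) by (intro frac_le) auto
 then show "abs (1 / g z) <= max (1 / c) (abs B / c\<^sup>2)" by simp
 have "abs (f z) <= abs B" using bd[OF that] by linarith
 then have "abs (- f z / (g z)\<^sup>2) <= abs B / c\<^sup>2" unfolding abs_divide using g2 c2 by (intro frac_le) auto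
 then show "abs (- f z / (g z)\<^sup>2) <= max (1 / c) (abs B / c\<^sup>2)" by simp
 show "abs (- 1 / (g z)\<^sup>2) <= 1 / c\<^sup>2" unfolding abs_divide using g2 c2 by (intro frac_le) auto
 qed
 have c1: "cts ?V (%w. 1 / snd w)" "cts ?V (%w. - fst w / (snd w)\<^sup>2)"
 by (intro continuous_intros; auto)+
 have "W1r r S C (%z. fst (f z, g z) / snd (f z, g z))
 (%z. (1 / snd (f z, g z)) * f1 z + (- fst (f z, g z) / (snd (f z, g z))\<^sup>2) * g1 z)
 (%z. (1 / snd (f z, g z)) * f2 z + (- fst (f z, g z) / (snd (f z, g z))\<^sup>2) * g2 z)"
 by (rule W1r_chain[OF f g V _ D c1, where M = "max (1 / c) (abs B / c\<^sup>2)"]) (use gn bds in auto)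
 then show "W1r r S C (%z. f z / g z) (%z. (1 / g z) * f1 z + (- f z / (g z)\<^sup>2) * g1 z) (%z. (1 / g z) * f2 z + (- f z / (g z)\<^sup>2) * g2 z)"
 by simp
 show "W1r r S C (%z. 1 / g z) (%z. (- 1 / (g z)\<^sup>2) * g1 z) (%z. (- 1 / (g z)\<^sup>2) * g2 z)"
 proof (rule W1r_compose[OF g, where V = "- {0}" and F = "%t. 1 / t" and F' = "%t. - 1 / t\<^sup>2" and M = "1 / c\<^sup>2"])
 show "((%t. 1 / t) has_real_derivative - 1 / w\<^sup>2) (at w)" if "w \<in> - {0}" for w :: real
 using that by (auto intro!: derivative_eq_intros simp: power2_eq_square)
 show "cts (- {0}) (%t::real. - 1 / t\<^sup>2)" by (intro continuous_intros) auto
 qed (use gn bds(3) in auto)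
qed

lemma periodic_bounded:
 fixes et :: "real => real"
 assumes c: "cts UNIV et" and per: "!!x. et (x + l) = et x" and l: "0 < l"
 obtains B where "!!x. abs (et x) <= B"
proof -
 have "bounded (et ` {0..l})" by (intro compact_imp_bounded compact_continuous_image continuous_on_subset[OF c]) auto
 then obtain B where "\<forall>x\<in>et ` {0..l}. norm x <= B" unfolding bounded_iff by blast
 then have B: "!!x. x \<in> {0..l} ==> abs (et x) <= B" by simp
 have shift: "et (x + real n * l) = et x" for x n
 proof (induction n)
 case (Suc n)
 have "et (x + real (Suc n) * l) = et ((x + real n * l) + l)" by (simp add: algebra_simps)
 then show ?case using per Suc by simp
 qed simp
 have shift': "et (x + of_int k * l) = et x" for x k
 proof (cases "0 <= k")
 case True
 then show ?thesis using shift[of x "nat k"] by simp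
 next
 case False
 then show ?thesis using shift[of "x + of_int k * l" "nat (- k)"] by (simp add: algebra_simps)
 qed
 have "abs (et x) <= B" for x
 proof -
 define k where "k = \<lfloor>x / l\<rfloor>"
 have "of_int k <= x / l" "x / l < of_int k + 1" unfolding k_def by linarith+
 then have "0 <= x - of_int k * l" "x - of_int k * l <= l" using l by (auto simp: field_simps)
 then have "abs (et (x - of_int k * l)) <= B" by (intro B) auto
 then show ?thesis using shift'[of x "- k"] by simp
 qed
 then show ?thesis using that by blast
qed

lemma AE_cong_iff_AE:
 assumes "AE x in M. P x = Q x"
 shows "(AE x in M. P x) \<longleftrightarrow> (AE x in M. Q x)"
proof
 assume "AE x in M. P x"
 then show "AE x in M. Q x" using assms by eventually_elim simp
next
 assume "AE x in M. Q x"
 then show "AE x in M. P x" using assms by eventually_elim simp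
qed

text \<open>Here \<open>a\<close> and \<open>b\<close> stand for the partial derivatives of the
  stream function, \<open>F1\<close> and \<open>F2\<close> for those of \<open>a / b\<close>, and
  \<open>E2\<close> for the vertical one of \<open>1 / b\<close>. The quasilinear operator of the
  height function turns into \<open>hp ^ 3\<close> times the Laplacian. A single letter
  \<open>a12\<close> serves for both mixed derivatives, so their equality has to be known
  beforehand.\<close>

lemma second_order_identity:
 fixes a b a11 a12 a22 hq hp :: real
 assumes b: "b ~= 0" and hq: "hq = - (a / b)" and hp: "hp = - (1 / b)"
 and F1: "F1 = (1 / b) * a11 + (- a / b\<^sup>2) * a12" and F2: "F2 = (1 / b) * a12 + (- a / b\<^sup>2) * a22" and E2: "E2 = (- 1 / b\<^sup>2) * a22"
 shows "(1 + hq\<^sup>2) * (- (hp * E2)) - 2 * hq * hp * (- (hp * F2)) + hp\<^sup>2 * (- (F1 + hq * F2)) = hp ^ 3 * (a11 + a22)"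
 unfolding hq hp F1 F2 E2 using b
 by (simp add: field_simps power2_eq_square power3_eq_cube)

context hodo
begin

lemma cO_sub: "cell l OM \<subseteq> OM" "cell l S \<subseteq> S" by (auto simp: cell_def)

lemma psy_bd: "z \<in> closure OM ==> 1 / M <= abs (psy z)"
 using psy_le[of z] M by auto

lemma h_via_psi: assumes w: "w \<in> closure S"
 shows "hq w = - (psx (G w) / psy (G w))" "hp w = - (1 / psy (G w))"
 using HG[OF w] hp_pos[OF w] by (auto simp: psx_def psy_def)

lemma clS_open: "S \<subseteq> closure S" "OM \<subseteq> closure OM" by (rule closure_subset)+

text \<open>At corresponding points \<open>hq\<close> and \<open>hp\<close> are minus the quotients
  \<open>psx / psy\<close> and \<open>1 / psy\<close>. The quotient rule in the fluid followed by
  the chain rule for the shear gives explicit second derivatives of \<open>h\<close>; the four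
  auxiliary functions name the inner ones.\<close>

lemma psi_W1r_to_h:
 assumes x: "W1r r OM (cell l OM) psx a11 a12" and y: "W1r r OM (cell l OM) psy a21 a22"
 and F1: "!!z. F1 z = (1 / psy z) * a11 z + (- psx z / (psy z)\<^sup>2) * a21 z"
 and F2: "!!z. F2 z = (1 / psy z) * a12 z + (- psx z / (psy z)\<^sup>2) * a22 z"
 and E1: "!!z. E1 z = (- 1 / (psy z)\<^sup>2) * a21 z" and E2: "!!z. E2 z = (- 1 / (psy z)\<^sup>2) * a22 z"
 shows "W1r r S (cell l S) hq (%w. - (F1 (G w) + hq w * F2 (G w))) (%w. - (hp w * F2 (G w)))"
 and "W1r r S (cell l S) hp (%w. - (E1 (G w) + hq w * E2 (G w))) (%w. - (hp w * E2 (G w)))"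
proof -
 have M1: "0 < 1 / M" using M by simp
 have b: "1 / M <= abs (psy z)" if "z \<in> OM" for z using psy_bd[of z] clS_open that by blast
 have bx: "abs (psx z) <= M / m" if "z \<in> cell l OM" for z using bound_psx[of z] clS_open cO_sub that by blast
 have Q: "W1r r OM (cell l OM) (%z. psx z / psy z) F1 F2" "W1r r OM (cell l OM) (%z. 1 / psy z) E1 E2"
 unfolding F1[abs_def] F2[abs_def] E1[abs_def] E2[abs_def]
 by (rule W1r_quotients(1)[OF x y M1 b bx]; assumption) (rule W1r_quotients(2)[OF x y M1 b bx]; assumption)
 \<comment> \<open>The vanishing second summand makes negation an instance of the rule for linear
   combinations.\<close>
 have "W1r r S (cell l S) (%w. -1 * (psx (G w) / psy (G w)) + 0 * (psx (G w) / psy (G w)))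
 (%w. -1 * (F1 (G w) + hq w * F2 (G w)) + 0 * (F1 (G w) + hq w * F2 (G w))) (%w. -1 * (hp w * F2 (G w)) + 0 * (hp w * F2 (G w)))"
 by (rule W1r_lin[OF W1r_to_strip[OF Q(1)] W1r_to_strip[OF Q(1)]])
 then have "W1r r S (cell l S) (%w. - (psx (G w) / psy (G w))) (%w. - (F1 (G w) + hq w * F2 (G w))) (%w. - (hp w * F2 (G w)))" by simp
 then show "W1r r S (cell l S) hq (%w. - (F1 (G w) + hq w * F2 (G w))) (%w. - (hp w * F2 (G w)))"
 by (rule W1r_cong) (use h_via_psi(1) clS_open in force)
 have "W1r r S (cell l S) (%w. -1 * (1 / psy (G w)) + 0 * (1 / psy (G w)))
 (%w. -1 * (E1 (G w) + hq w * E2 (G w)) + 0 * (E1 (G w) + hq w * E2 (G w))) (%w. -1 * (hp w * E2 (G w)) + 0 * (hp w * E2 (G w)))"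
 by (rule W1r_lin[OF W1r_to_strip[OF Q(2)] W1r_to_strip[OF Q(2)]])
 then have "W1r r S (cell l S) (%w. - (1 / psy (G w))) (%w. - (E1 (G w) + hq w * E2 (G w))) (%w. - (hp w * E2 (G w)))" by simp
 then show "W1r r S (cell l S) hp (%w. - (E1 (G w) + hq w * E2 (G w))) (%w. - (hp w * E2 (G w)))"
 by (rule W1r_cong) (use h_via_psi(2) clS_open in force)
qed

lemma h_W1r_to_psi:
 assumes x: "W1r r S (cell l S) hq b11 b12" and y: "W1r r S (cell l S) hp b21 b22"
 shows "\<exists>a11 a12 a21 a22. W1r r OM (cell l OM) psx a11 a12 & W1r r OM (cell l OM) psy a21 a22"
proof -
 have b: "m <= abs (hp w)" if "w \<in> S" for w using hp_bound(1)[of w] m S_cl[OF that] clS by auto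
 have bx: "abs (hq w) <= M" if "w \<in> cell l S" for w
 proof -
 have "w \<in> S" using that cO_sub by blast
 then show ?thesis using hq_bound[of w] S_cl[of w] clS by simp
 qed
 note Q = W1r_to_fluid[OF W1r_quotients(1)[OF x y m b bx]] W1r_to_fluid[OF W1r_quotients(2)[OF x y m b bx]]
 from W1r_lin[OF Q(2) Q(2), of "-1" 0] Q(1) show ?thesis
 unfolding psx_def[abs_def] psy_def[abs_def] by auto
qed

lemma W1r_psi_pd:
 "W1r r OM C psx f1 f2 \<longleftrightarrow> W1r r OM C (pd ex ps) f1 f2" "W1r r OM C psy f1 f2 \<longleftrightarrow> W1r r OM C (pd ey ps) f1 f2"
 using W1r_cong[of r OM C _ f1 f2] pd_psi by metis+

lemma W1r_h_pd:
 "W1r r S C hq f1 f2 \<longleftrightarrow> W1r r S C (pd ex h) f1 f2" "W1r r S C hp f1 f2 \<longleftrightarrow> W1r r S C (pd ey h) f1 f2"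
 using W1r_cong[of r S C _ f1 f2] pd_h by metis+

lemma AE_iff: "(AE z in Leb. z \<in> OM --> P z) \<longleftrightarrow> (AE w in Leb. w \<in> S --> P (G w))"
proof
 assume "AE w in Leb. w \<in> S --> P (G w)"
 from AE_to_fluid[OF this] show "AE z in Leb. z \<in> OM --> P z"
 by (rule AE_mp) (use GH clS_open in "auto intro!: AE_I2")
qed (rule AE_to_strip)

lemma surface_grad: "surface_grad_sq d ps et x = (1 + (hq (x, 0))\<^sup>2) / (hp (x, 0))\<^sup>2"
proof -
 have z: "(x, et x) \<in> closure OM" unfolding clO using eta(2)[of x] by simp
 have H0: "H (x, et x) = (x, 0)" by (simp add: H_def psi_top)
 have "pd_cl OM ex ps (x, et x) = psx (x, et x)" "pd_cl OM ey ps (x, et x) = psy (x, et x)"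
 by (rule pd_cl_eq[OF oO z psx_cont pd_psi(1)], assumption) (rule pd_cl_eq[OF oO z psy_cont pd_psi(2)], assumption)
 then show ?thesis unfolding surface_grad_sq_def psx_def psy_def H0
 by (simp add: power_divide add_divide_distrib)
qed

lemma mem0: "(q, 0) \<in> closure S" unfolding clS using p0 by simp

lemma pd_cl_h: "pd_cl S ex h (q, 0) = hq (q, 0)" "pd_cl S ey h (q, 0) = hp (q, 0)"
proof -
 have c: "cts (closure S) hq" "cts (closure S) hp" unfolding clS by (rule hq_cont, rule hp_cont)
 show "pd_cl S ex h (q, 0) = hq (q, 0)" by (rule pd_cl_eq[OF open_strip mem0 c(1) pd_h(1)])
 show "pd_cl S ey h (q, 0) = hp (q, 0)" by (rule pd_cl_eq[OF open_strip mem0 c(2) pd_h(2)])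
qed

lemma deriv_eta: "deriv et = (%x. hq (x, 0))"
 by (rule ext, rule DERIV_imp_deriv, rule eta_der)

lemma deriv_h0: "deriv (%q. h (q, 0)) = (%x. hq (x, 0))"
proof (rule ext, rule DERIV_imp_deriv)
 fix x
 have "((%q. et q + d) has_real_derivative hq (x, 0)) (at x)" using eta_der[of x] by (auto intro!: derivative_eq_intros)
 then show "((%q. h (q, 0)) has_real_derivative hq (x, 0)) (at x)" by (simp add: h_top)
qed

text \<open>Moved to the strip, the interior equations differ by the nonvanishing factor
  \<open>hp ^ 3\<close>; the surface equations differ by the square of \<open>hp\<close>. The strict
  sign conditions hold on both sides thanks to the bounds \<open>m\<close> and
  \<open>M\<close>.\<close>

lemma stream_iff_height:
 assumes x: "W1r r OM (cell l OM) psx a11 a12" and y: "W1r r OM (cell l OM) psy a21 a22" and l: "0 < l"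
 shows "stream_problem g d \<sigma> rh0 l p0 R be ps et \<longleftrightarrow> height_problem g d \<sigma> rh0 l p0 R be h"
proof -
 define F1 where "F1 z = (1 / psy z) * a11 z + (- psx z / (psy z)\<^sup>2) * a21 z" for z
 define F2 where "F2 z = (1 / psy z) * a12 z + (- psx z / (psy z)\<^sup>2) * a22 z" for z
 define E1 where "E1 z = (- 1 / (psy z)\<^sup>2) * a21 z" for z
 define E2 where "E2 z = (- 1 / (psy z)\<^sup>2) * a22 z" for z
 note hW = psi_W1r_to_h[OF x y F1_def F2_def E1_def E2_def]
 have mixed: "AE z in Leb. z \<in> OM --> a12 z = a21 z"
 using mixed_weak_deriv[OF oO psi_C1] x[unfolded W1r_psi_pd] y[unfolded W1r_psi_pd] unfolding W1r_def by blast
 note wpsi = W1r_wd(2)[OF x[unfolded W1r_psi_pd]] W1r_wd(2)[OF y[unfolded W1r_psi_pd]]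
 note wh = W1r_wd(2)[OF hW(1)[unfolded W1r_h_pd]] W1r_wd(2)[OF hW(2)[unfolded W1r_h_pd]]
 define R' where "R' = wd {p0<..<0} 1 R"
 have Gfacts: "snd (G w) = h w - d" "- ps (G w) = snd w" if "w \<in> S" for w
 using HG[OF S_cl[OF that]] by (auto simp: G_def H_def prod_eq_iff)
 have "(AE z in lebesgue_on OM. wd OM ex (pd ex ps) z + wd OM ey (pd ey ps) z = g * snd z * R' (- ps z) + be (- ps z))
 \<longleftrightarrow> (AE z in Leb. z \<in> OM --> wd OM ex (pd ex ps) z + wd OM ey (pd ey ps) z = g * snd z * R' (- ps z) + be (- ps z))"
 by (rule AE_restrict_space_iff) (simp add: oO)
 also have "... \<longleftrightarrow> (AE z in Leb. z \<in> OM --> a11 z + a22 z = g * snd z * R' (- ps z) + be (- ps z))"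
 by (rule AE_cong_iff_AE) (use wpsi in eventually_elim, auto)
 also have "... \<longleftrightarrow> (AE w in Leb. w \<in> S --> a11 (G w) + a22 (G w) = g * snd (G w) * R' (- ps (G w)) + be (- ps (G w)))"
 by (rule AE_iff)
 also have "... \<longleftrightarrow> (AE w in Leb. w \<in> S -->
 (1 + (pd ex h w)\<^sup>2) * wd S ey (pd ey h) w - 2 * pd ex h w * pd ey h w * wd S ey (pd ex h) w
 + (pd ey h w)\<^sup>2 * wd S ex (pd ex h) w - (g * R' (snd w) * (h w - d) + be (snd w)) * (pd ey h w)^3 = 0)"
 proof (rule AE_cong_iff_AE)
 show "AE w in Leb. (w \<in> S --> a11 (G w) + a22 (G w) = g * snd (G w) * R' (- ps (G w)) + be (- ps (G w))) =
 (w \<in> S --> (1 + (pd ex h w)\<^sup>2) * wd S ey (pd ey h) w - 2 * pd ex h w * pd ey h w * wd S ey (pd ex h) w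
 + (pd ey h w)\<^sup>2 * wd S ex (pd ex h) w - (g * R' (snd w) * (h w - d) + be (snd w)) * (pd ey h w)^3 = 0)"
 using wh AE_to_strip[OF mixed]
 proof eventually_elim
 case (elim w)
 show ?case
 proof (cases "w \<in> S")
 case True
 have b: "psy (G w) ~= 0" using psy_bd[OF G_cl[OF S_cl[OF True]]] M by auto
 have hp3: "hp w ^ 3 ~= 0" using hp_pos[OF S_cl[OF True]] by simp
 have id: "(1 + (hq w)\<^sup>2) * (- (hp w * E2 (G w))) - 2 * hq w * hp w * (- (hp w * F2 (G w))) + (hp w)\<^sup>2 * (- (F1 (G w) + hq w * F2 (G w)))
 = hp w ^ 3 * (a11 (G w) + a22 (G w))"
 by (rule second_order_identity[OF b h_via_psi[OF S_cl[OF True]] _ F2_def E2_def])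
 (use elim(3) True in "simp add: F1_def")
 have "((1 + (pd ex h w)\<^sup>2) * wd S ey (pd ey h) w - 2 * pd ex h w * pd ey h w * wd S ey (pd ex h) w
 + (pd ey h w)\<^sup>2 * wd S ex (pd ex h) w - (g * R' (snd w) * (h w - d) + be (snd w)) * (pd ey h w)^3)
 = hp w ^ 3 * (a11 (G w) + a22 (G w) - (g * (h w - d) * R' (snd w) + be (snd w)))"
 proof -
 have e: "wd S ex (pd ex h) w = - (F1 (G w) + hq w * F2 (G w))" "wd S ey (pd ex h) w = - (hp w * F2 (G w))"
 "wd S ey (pd ey h) w = - (hp w * E2 (G w))" using elim(1,2) True by auto
 show ?thesis unfolding pd_h[OF True] e id by (simp add: algebra_simps)
 qed
 then show ?thesis using True hp3 unfolding Gfacts[OF True] by simp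
 qed simp
 qed
 qed
 also have "... \<longleftrightarrow> (AE w in lebesgue_on S.
 (1 + (pd ex h w)\<^sup>2) * wd S ey (pd ey h) w - 2 * pd ex h w * pd ey h w * wd S ey (pd ex h) w
 + (pd ey h w)\<^sup>2 * wd S ex (pd ex h) w - (g * R' (snd w) * (h w - d) + be (snd w)) * (pd ey h w)^3 = 0)"
 by (rule AE_restrict_space_iff[symmetric]) (simp add: open_strip)
 finally have interior: "(AE z in lebesgue_on OM. wd OM ex (pd ex ps) z + wd OM ey (pd ey ps) z = g * snd z * R' (- ps z) + be (- ps z)) \<longleftrightarrow>
 (AE w in lebesgue_on S. (1 + (pd ex h w)\<^sup>2) * wd S ey (pd ey h) w - 2 * pd ex h w * pd ey h w * wd S ey (pd ex h) w
 + (pd ey h w)\<^sup>2 * wd S ex (pd ex h) w - (g * R' (snd w) * (h w - d) + be (snd w)) * (pd ey h w)^3 = 0)" .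
 define Q where "Q = (1 / l) * integral {0..l} (%q. (1 + (hq (q, 0))\<^sup>2) / (hp (q, 0))\<^sup>2)"
 define X where "X q = 2 * \<sigma> * wd UNIV 1 (%x. hq (x, 0)) q / (1 + (hq (q, 0))\<^sup>2) powr (3 / 2)" for q
 have bd: "(1 + (hq (q, 0))\<^sup>2) / (hp (q, 0))\<^sup>2 - X q + 2 * g * R 0 * et q = Q \<longleftrightarrow>
 1 + (hq (q, 0))\<^sup>2 + (hp (q, 0))\<^sup>2 * (2 * g * R 0 * (h (q, 0) - d) - X q - Q) = 0" for q
 proof -
 have n: "hp (q, 0) ~= 0" using hp_pos[OF mem0[of q]] by simp
 have "1 + (hq (q, 0))\<^sup>2 + (hp (q, 0))\<^sup>2 * (2 * g * R 0 * (h (q, 0) - d) - X q - Q)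
 = (hp (q, 0))\<^sup>2 * ((1 + (hq (q, 0))\<^sup>2) / (hp (q, 0))\<^sup>2 - X q + 2 * g * R 0 * et q - Q)"
 using n by (simp add: h_top field_simps)
 then show ?thesis using n by simp
 qed
 have S0: "(0, p0 / 2) \<in> S" using p0 by (simp add: memS)
 then have neS: "S ~= {}" and neO: "OM ~= {}" using G_S[OF S0] by blast+
 have "(SUP z\<in>OM. pd ey ps z) <= - (1 / M)"
 by (rule cSUP_least[OF neO]) (use pd_psi(2) psy_le clS_open in force)
 then have sup: "(SUP z\<in>OM. pd ey ps z) < 0" using M by (smt (verit) divide_pos_pos)
 have "m <= (INF z\<in>S. pd ey h z)"
 by (rule cINF_greatest[OF neS]) (use pd_h(2) hp_bound(1) S_cl clS in force)
 then have inf: "0 < (INF z\<in>S. pd ey h z)" using m by linarith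
 have sg: "surface_grad_sq d ps et = (%x. (1 + (hq (x, 0))\<^sup>2) / (hp (x, 0))\<^sup>2)" using surface_grad by blast
 show ?thesis
 unfolding stream_problem_def height_problem_def Let_def deriv_h0 sg pd_cl_h deriv_eta
 using interior sup inf bd unfolding R'_def X_def Q_def
 by (simp add: psi_top psi_bot h_bot)
qed

text \<open>Translation by \<open>l\<close> keeps points in the closed domains, because the surface
  is periodic. The shears are inverse to each other, so the period of one function determines the
  value of the other at the translated point.\<close>

lemma per_G:
 assumes eta_per: "!!x. et (x + l) = et x"
 shows "periodic_on l (closure OM) ps \<longleftrightarrow> periodic_on l (closure S) h"
proof
 assume per: "periodic_on l (closure OM) ps"
 show "periodic_on l (closure S) h" unfolding periodic_on_def
 proof (clarify)
 fix q p assume w: "(q, p) \<in> closure S"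
 then have w': "(q + l, p) \<in> closure S" unfolding clS by auto
 have G1: "G (q, p) \<in> closure OM" by (rule G_cl[OF w])
 then have G2: "(q + l, h (q, p) - d) \<in> closure OM" unfolding clO G_def using eta_per by auto
 have "ps (q + l, h (q, p) - d) = ps (q, h (q, p) - d)" using per G1 unfolding periodic_on_def G_def by auto
 also have "... = - p" using HG[OF w] by (simp add: H_def G_def)
 finally have "H (q + l, h (q, p) - d) = (q + l, p)" by (simp add: H_def)
 with GH[OF G2] have "G (q + l, p) = (q + l, h (q, p) - d)" by simp
 then show "h (q + l, p) = h (q, p)" by (simp add: G_def)
 qed
next
 assume per: "periodic_on l (closure S) h"
 show "periodic_on l (closure OM) ps" unfolding periodic_on_def
 proof (clarify)
 fix x y assume z: "(x, y) \<in> closure OM"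
 then have z': "(x + l, y) \<in> closure OM" unfolding clO using eta_per by auto
 have H1: "H (x, y) \<in> closure S" by (rule H_cl[OF z])
 then have H2: "(x + l, - ps (x, y)) \<in> closure S" unfolding clS H_def by auto
 have "h (x + l, - ps (x, y)) = h (x, - ps (x, y))" using per H1 unfolding periodic_on_def H_def by auto
 also have "... - d = y" using GH[OF z] by (simp add: H_def G_def)
 finally have "G (x + l, - ps (x, y)) = (x + l, y)" by (simp add: G_def)
 with HG[OF H2] have "H (x + l, y) = (x + l, - ps (x, y))" by simp
 then show "ps (x + l, y) = ps (x, y)" by (simp add: H_def)
 qed
qed

lemma psi_bounded: "z \<in> closure OM ==> abs (ps z) <= - p0"
 using H_cl[of z] unfolding clS H_def by auto

lemma sobolev2_psi:
 assumes r: "1 <= r"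
 shows "sobolev 2 r OM (cell l OM) ps \<longleftrightarrow>
 (\<exists>a11 a12. W1r r OM (cell l OM) psx a11 a12) & (\<exists>a21 a22. W1r r OM (cell l OM) psy a21 a22)"
 unfolding W1r_psi_pd
proof (rule sobolev2_iff_W1r[OF oO open_cell[OF oO] cO_sub(1) bounded_cell_fluid[OF eta(1)] r psi_C1])
 let ?B = "max (- p0) (max (M / m) (1 / m))"
 fix z assume z: "z \<in> cell l OM"
 then have zO: "z \<in> OM" using cO_sub by blast
 note zc = O_cl[OF zO]
 show "abs (ps z) <= ?B" using psi_bounded[OF zc] by simp
 fix b :: "real \<times> real" assume "b \<in> Basis"
 then have "b = ex \<or> b = ey" by (simp add: Basis_prod_real)
 then show "abs (pd b ps z) <= ?B" using bound_psx[OF zc] bound_psy[OF zc] pd_psi[OF zO] by auto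
qed

lemma class_psi:
 assumes l: "0 < l" and r: "1 <= r" and c: "per_W2_holder1 l r al OM ps"
 shows "holder al OM psx" "holder al OM psy" "periodic_on l (closure OM) ps"
 "\<exists>a11 a12 a21 a22. W1r r OM (cell l OM) psx a11 a12 & W1r r OM (cell l OM) psy a21 a22"
proof -
 have sob: "sobolev 2 r OM (cell l OM) ps" and ho: "holder1 al OM ps" and per: "periodic_on l (closure OM) ps"
 using c unfolding per_W2_holder1_def by auto
 show "periodic_on l (closure OM) ps" by fact
 obtain f1 f2 where f: "holder al OM f1" "!!z. z \<in> OM ==> pd ex ps z = f1 z" "holder al OM f2" "!!z. z \<in> OM ==> pd ey ps z = f2 z"
 using ho ex_ey_Basis unfolding holder1_def by (metis (no_types, lifting))
 have fc: "cts (closure OM) f1" "cts (closure OM) f2" using f unfolding holder_def by auto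
 \<comment> \<open>Both sides are continuous extensions of the same interior derivative and hence
   agree on the closure.\<close>
 have "f1 z = psx z" "f2 z = psy z" if "z \<in> closure OM" for z
 using pd_cl_eq[OF oO that fc(1) f(2)] pd_cl_eq[OF oO that psx_cont pd_psi(1)]
 pd_cl_eq[OF oO that fc(2) f(4)] pd_cl_eq[OF oO that psy_cont pd_psi(2)] by simp_all
 then show "holder al OM psx" "holder al OM psy" using holder_cong[OF f(1)] holder_cong[OF f(3)] by blast+
 show "\<exists>a11 a12 a21 a22. W1r r OM (cell l OM) psx a11 a12 & W1r r OM (cell l OM) psy a21 a22"
 using sob unfolding sobolev2_psi[OF r] by blast
qed

lemma class_psiI:
 assumes r: "1 <= r" and h: "holder al OM psx" "holder al OM psy" and per: "periodic_on l (closure OM) ps"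
 and W: "W1r r OM (cell l OM) psx a11 a12" "W1r r OM (cell l OM) psy a21 a22"
 shows "per_W2_holder1 l r al OM ps"
proof -
 have "sobolev 2 r OM (cell l OM) ps" unfolding sobolev2_psi[OF r] using W by blast
 moreover have "holder1 al OM ps" unfolding holder1_def Basis_prod_real
 proof (intro conjI ballI)
 show "cts (closure OM) ps" by (rule psi_cont)
 show "bounded (ps ` closure OM)" unfolding bounded_iff using psi_bounded by (intro exI[of _ "- p0"]) auto
 show "ps differentiable (at z)" if "z \<in> OM" for z using psi_der[OF that] by (rule differentiableI)
 fix b assume "b \<in> {ex, ey}"
 then consider "b = ex" | "b = ey" by blast
 then show "\<exists>f'. holder al OM f' & (\<forall>z\<in>OM. f' z = pd b ps z)"
 proof cases
 case 1
 then show ?thesis using h(1) pd_psi(1) by (intro exI[of _ psx]) simp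
 next
 case 2
 then show ?thesis using h(2) pd_psi(2) by (intro exI[of _ psy]) simp
 qed
 qed
 ultimately show ?thesis unfolding per_W2_holder1_def using per by blast
qed

lemma h_bounded:
 assumes "!!x. abs (et x) <= B" "z \<in> closure S"
 shows "abs (h z) <= B + abs d"
proof -
 obtain q p where z: "z = (q, p)" "p0 <= p" "p <= 0" using assms(2) unfolding clS by (cases z) auto
 show ?thesis using h_range[OF z(2,3), of q] assms(1)[of q] unfolding z by linarith
qed

lemma sobolev2_h:
 assumes r: "1 <= r" and B: "!!x. abs (et x) <= B"
 shows "sobolev 2 r S (cell l S) h \<longleftrightarrow>
 (\<exists>b11 b12. W1r r S (cell l S) hq b11 b12) & (\<exists>b21 b22. W1r r S (cell l S) hp b21 b22)"
 unfolding W1r_h_pd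
proof (rule sobolev2_iff_W1r[OF open_strip open_cell[OF open_strip] cO_sub(2) bounded_cell_strip r h_C1])
 let ?B = "max (B + abs d) M"
 fix z assume z: "z \<in> cell l S"
 then have zS: "z \<in> S" using cO_sub by blast
 then have z': "z \<in> UNIV \<times> {p0..0}" using S_cl clS by blast
 show "abs (h z) <= ?B" using h_bounded[OF B S_cl[OF zS]] by simp
 fix b :: "real \<times> real" assume "b \<in> Basis"
 then have "b = ex \<or> b = ey" by (simp add: Basis_prod_real)
 then show "abs (pd b h z) <= ?B" using pd_h[OF zS] hq_bound[OF z'] hp_bound[OF z'] m by auto
qed

lemma class_h:
 assumes l: "0 < l" and r: "1 <= r" and c: "per_W2_holder1 l r al S h" and eta_per: "!!x. et (x + l) = et x"
 shows "holder al S hq" "holder al S hp" "periodic_on l (closure S) h"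
 "\<exists>b11 b12 b21 b22. W1r r S (cell l S) hq b11 b12 & W1r r S (cell l S) hp b21 b22"
proof -
 obtain B where B: "!!x. abs (et x) <= B" by (rule periodic_bounded[OF eta(1) eta_per l]) (rule that)
 have sob: "sobolev 2 r S (cell l S) h" and ho: "holder1 al S h" and per: "periodic_on l (closure S) h"
 using c unfolding per_W2_holder1_def by auto
 show "periodic_on l (closure S) h" by fact
 obtain f1 f2 where f: "holder al S f1" "!!z. z \<in> S ==> pd ex h z = f1 z" "holder al S f2" "!!z. z \<in> S ==> pd ey h z = f2 z"
 using ho ex_ey_Basis unfolding holder1_def by (metis (no_types, lifting))
 have fc: "cts (closure S) f1" "cts (closure S) f2" using f unfolding holder_def by auto
 have hc: "cts (closure S) hq" "cts (closure S) hp" unfolding clS by (rule hq_cont hp_cont)+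
 have "f1 z = hq z" "f2 z = hp z" if "z \<in> closure S" for z
 using pd_cl_eq[OF open_strip that fc(1) f(2)] pd_cl_eq[OF open_strip that hc(1) pd_h(1)]
 pd_cl_eq[OF open_strip that fc(2) f(4)] pd_cl_eq[OF open_strip that hc(2) pd_h(2)] by simp_all
 then show "holder al S hq" "holder al S hp" using holder_cong[OF f(1)] holder_cong[OF f(3)] by blast+
 show "\<exists>b11 b12 b21 b22. W1r r S (cell l S) hq b11 b12 & W1r r S (cell l S) hp b21 b22"
 using sob unfolding sobolev2_h[OF r B] by blast
qed

lemma class_hI:
 assumes l: "0 < l" and r: "1 <= r" and h: "holder al S hq" "holder al S hp" and per: "periodic_on l (closure S) h"
 and eta_per: "!!x. et (x + l) = et x"
 and W: "W1r r S (cell l S) hq b11 b12" "W1r r S (cell l S) hp b21 b22"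
 shows "per_W2_holder1 l r al S h"
proof -
 obtain B where B: "!!x. abs (et x) <= B" by (rule periodic_bounded[OF eta(1) eta_per l]) (rule that)
 have "sobolev 2 r S (cell l S) h" unfolding sobolev2_h[OF r B] using W by blast
 moreover have "holder1 al S h" unfolding holder1_def Basis_prod_real
 proof (intro conjI ballI)
 show "cts (closure S) h" unfolding clS by (rule h_cont)
 show "bounded (h ` closure S)" unfolding bounded_iff using h_bounded[OF B] by (intro exI[of _ "B + abs d"]) auto
 show "h differentiable (at z)" if "z \<in> S" for z using h_der[OF that] by (rule differentiableI)
 fix b assume "b \<in> {ex, ey}"
 then consider "b = ex" | "b = ey" by blast
 then show "\<exists>f'. holder al S f' & (\<forall>z\<in>S. f' z = pd b h z)"
 proof cases
 case 1
 then show ?thesis using h(1) pd_h(1) by (intro exI[of _ hq]) simp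
 next
 case 2
 then show ?thesis using h(2) pd_h(2) by (intro exI[of _ hp]) simp
 qed
 qed
 ultimately show ?thesis unfolding per_W2_holder1_def using per by blast
qed

lemma class_psi_to_h:
 assumes l: "0 < l" and r: "1 <= r" and a: "0 <= al" and eta_per: "!!x. et (x + l) = et x"
 and c: "per_W2_holder1 l r al OM ps"
 shows "per_W2_holder1 l r al S h"
proof -
 note cp = class_psi[OF l r c]
 obtain a11 a12 a21 a22 where W: "W1r r OM (cell l OM) psx a11 a12" "W1r r OM (cell l OM) psy a21 a22" using cp(4) by blast
 have M1: "0 < 1 / M" using M by simp
 have i: "holder al OM (%z. inverse (psy z))" by (rule holder_inverse[OF cp(2) M1 psy_bd])
 have "holder al OM (%z. -1 * (psx z * inverse (psy z)) + 0 * psx z)" by (rule holder_lin[OF holder_mult[OF cp(1) i] cp(1)])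
 from holder_to_strip[OF this a] have h1: "holder al S hq"
 by (rule holder_cong) (simp add: h_via_psi divide_inverse)
 have "holder al OM (%z. -1 * inverse (psy z) + 0 * psx z)" by (rule holder_lin[OF i cp(1)])
 from holder_to_strip[OF this a] have h2: "holder al S hp"
 by (rule holder_cong) (simp add: h_via_psi divide_inverse)
 show ?thesis
 by (rule class_hI[OF l r h1 h2 _ eta_per psi_W1r_to_h[OF W refl refl refl refl]])
 (use per_G[OF eta_per] cp(3) in blast)
qed

lemma class_h_to_psi:
 assumes l: "0 < l" and r: "1 <= r" and a: "0 <= al" and eta_per: "!!x. et (x + l) = et x"
 and c: "per_W2_holder1 l r al S h"
 shows "per_W2_holder1 l r al OM ps"
proof -
 note ch = class_h[OF l r c eta_per]
 obtain a11 a12 a21 a22 where W: "W1r r OM (cell l OM) psx a11 a12" "W1r r OM (cell l OM) psy a21 a22"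
 using ch(4) h_W1r_to_psi by blast
 have i: "holder al S (%z. inverse (hp z))"
 proof (rule holder_inverse[OF ch(2) m])
 fix w assume "w \<in> closure S"
 then show "m <= abs (hp w)" using hp_bound(1)[of w] m clS by simp
 qed
 from holder_to_fluid[OF holder_mult[OF ch(1) i] a] have h1: "holder al OM psx"
 by (rule holder_cong) (simp add: psx_def divide_inverse)
 have "holder al S (%z. -1 * inverse (hp z) + 0 * hp z)" by (rule holder_lin[OF i ch(2)])
 from holder_to_fluid[OF this a] have h2: "holder al OM psy"
 by (rule holder_cong) (simp add: psy_def divide_inverse)
 show ?thesis
 by (rule class_psiI[OF r h1 h2 _ W]) (use per_G[OF eta_per] ch(3) in blast)
qed

end

section \<open>Height function and velocity\<close>

text \<open>Strict decrease of \<open>ps\<close> in \<open>y\<close> and the intermediate value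
  theorem invert it on every vertical segment. The inverse is continuous by compactness of the
  slices and differentiable because \<open>b\<close> stays away from zero, also on the
  boundary.\<close>

lemma hodo_of_psi:
 fixes ps a b :: "real \<times> real => real"
 assumes p0: "p0 < 0" and eta: "cts UNIV et" "!!x. - d < et x"
 and psi: "cts (closure (fluid d et)) ps" "!!x. ps (x, et x) = 0" "!!x. ps (x, - d) = - p0"
 and der: "!!z. z \<in> fluid d et ==> (ps has_derivative (%(s, t). a z * s + b z * t)) (at z)"
 and a: "cts (closure (fluid d et)) a" "!!z. z \<in> closure (fluid d et) ==> abs (a z) <= B"
 and b: "cts (closure (fluid d et)) b" "!!z. z \<in> closure (fluid d et) ==> abs (b z) <= B"
 and c: "0 < c" "!!z. z \<in> fluid d et ==> b z <= - c"
 shows "\<exists>h hq hp m M. hodo d p0 m M et ps h hq hp"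
proof -
 let ?A = "closure (fluid d et)" and ?B = "UNIV \<times> {p0..0}"
 have cl: "?A = {(x, y). - d <= y & y <= et x}" by (rule closure_fluid[OF eta])
 have bc: "b z <= - c" if "z \<in> ?A" for z by (rule continuous_le_on_closure[OF b(1) that c(2)])
 have B: "0 < B" using bc[of "(0, et 0)"] b(2)[of "(0, et 0)"] eta(2)[of 0] c(1) unfolding cl by force
 have line: "cts {- d..et x} (%y. ps (x, y))" for x
 by (rule continuous_on_compose2[OF psi(1)]) (auto intro!: continuous_intros simp: cl)
 have dec: "ps (x, y') < ps (x, y)" if y: "- d <= y" "y < y'" "y' <= et x" for x y y'
 proof (rule DERIV_neg_imp_decreasing_open[OF y(2)])
 fix t assume t: "y < t" "t < y'"
 hence O: "(x, t) \<in> fluid d et" using y by (auto simp: mem_fluid)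
 have "((%t. ps (x, t)) has_derivative (%s. (%(s, t'). a (x, t) * s + b (x, t) * t') (0, s))) (at t)"
 by (rule has_derivative_eq_rhs[OF has_derivative_compose[of "%t. (x, t)" "%s. (0, s)", OF _ der[OF O]]]) (auto intro!: derivative_eq_intros)
 hence "((%t. ps (x, t)) has_real_derivative b (x, t)) (at t)" by (simp add: has_field_derivative_def)
 moreover have "b (x, t) < 0" using c(2)[OF O] c(1) by linarith
 ultimately show "\<exists>D. ((%t. ps (x, t)) has_real_derivative D) (at t) & D < 0" by blast
 next
 show "cts {y..y'} (%t. ps (x, t))" by (rule continuous_on_subset[OF line]) (use y in auto)
 qed
 have range: "ps (x, y) \<in> {0..-p0}" if y: "- d <= y" "y <= et x" for x y
 using dec[of y "et x" x] dec[of "-d" y x] psi(2,3)[of x] y by (cases "y = et x"; cases "y = -d") auto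
 define j where "j w = (SOME y. - d <= y & y <= et (fst w) & - ps (fst w, y) = snd w)" for w
 have j: "- d <= j w & j w <= et (fst w) & - ps (fst w, j w) = snd w" if w: "w \<in> ?B" for w
 proof -
 have "\<exists>y\<ge>- d. y <= et (fst w) & ps (fst w, y) = - snd w"
 by (rule IVT2') (use w p0 psi eta(2)[of "fst w"] line in auto)
 hence "\<exists>y. - d <= y & y <= et (fst w) & - ps (fst w, y) = snd w" by force
 thus ?thesis unfolding j_def by (rule someI_ex)
 qed
 have j_unique: "j (x, - ps (x, y)) = y" if y: "- d <= y" "y <= et x" for x y
 proof -
 have "(x, - ps (x, y)) \<in> ?B" using range[OF y] by auto
 from j[OF this] have k: "- d <= j (x, - ps (x, y))" "j (x, - ps (x, y)) <= et x" "ps (x, j (x, - ps (x, y))) = ps (x, y)" by auto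
 show ?thesis using dec[of y "j (x, - ps (x, y))" x] dec[of "j (x, - ps (x, y))" y x] k y by (cases "j (x, - ps (x, y))" y rule: linorder_cases) auto
 qed
 have jA: "(fst w, j w) \<in> ?A" if "w \<in> ?B" for w using j[OF that] by (simp add: cl)
 have comp: "compact (?A \<inter> {z. abs (fst z) <= real n})" for n
 proof -
 have "compact (et ` {- real n..real n})" by (rule compact_continuous_image[OF continuous_on_subset[OF eta(1)]]) auto
 then obtain C where C: "!!x. x \<in> {- real n..real n} ==> abs (et x) <= C" unfolding compact_eq_bounded_closed bounded_iff by (metis image_eqI real_norm_def)
 have "?A \<inter> {z. abs (fst z) <= real n} \<subseteq> {- real n..real n} \<times> {- d..C}"
 proof
 fix z assume "z \<in> ?A \<inter> {z. abs (fst z) <= real n}"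
 thus "z \<in> {- real n..real n} \<times> {- d..C}" using C[of "fst z"] by (cases z) (auto simp: cl abs_le_iff)
 qed
 moreover have "closed {z::real \<times> real. abs (fst z) <= real n}" by (intro closed_Collect_le continuous_intros)
 ultimately show ?thesis unfolding compact_eq_bounded_closed
 using bounded_subset[OF compact_imp_bounded[OF compact_Times[OF compact_Icc compact_Icc]]] by blast
 qed
 have jc: "cts ?B j"
 proof (rule shear_inverse_continuous[where k = "%z. - ps z" and A = ?A])
 show "cts ?A (%z. - ps z)" by (intro continuous_intros psi(1))
 show "j (fst z, - ps z) = snd z" if "z \<in> ?A" for z using j_unique[of "snd z" "fst z"] that by (auto simp: cl)
 show "\<exists>z\<in>?A. w = (fst z, - ps z)" if "w \<in> ?B" for w
 by (rule bexI[OF _ jA[OF that]]) (use j[OF that] in "auto simp: prod_eq_iff")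
 qed (rule comp)
 have SB: "strip p0 \<subseteq> ?B" by (auto simp: strip_def)
 have jO: "(fst w, j w) \<in> fluid d et" if w: "w \<in> strip p0" for w
 proof -
 have "j w ~= - d" "j w ~= et (fst w)" using j[of w] w psi(2,3)[of "fst w"] by (auto simp: strip_def)
 thus ?thesis using j[of w] w SB by (auto simp: mem_fluid)
 qed
 let ?h = "%w. j w + d" and ?hq = "%w. - (a (fst w, j w) / b (fst w, j w))" and ?hp = "%w. - (1 / b (fst w, j w))"
 have jpc: "cts ?B (%w. f (fst w, j w))" if f: "cts ?A f" for f :: "real \<times> real => real"
 by (rule continuous_on_compose2[OF f]) (use jA in "auto intro!: continuous_intros jc")
 have b0: "b (fst w, j w) ~= 0" if "w \<in> ?B" for w using bc[OF jA[OF that]] c(1) by linarith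
 \<comment> \<open>\<open>hp\<close> is the reciprocal of the absolute value of \<open>b\<close>,
   which lies between \<open>c\<close> and \<open>B\<close>; the sum \<open>B / c + 1 / c\<close>
   bounds both \<open>hq\<close> and \<open>hp\<close>.\<close>
 have "hodo d p0 (1 / B) (B / c + 1 / c) et ps ?h ?hq ?hp"
 proof
 show "p0 < 0" "0 < 1 / B" "cts UNIV et" "!!x. - d < et x" using p0 B eta by auto
 show "cts ?B ?h" by (intro continuous_intros jc)
 show "j (q, p0) + d = 0" for q using j_unique[of "- d" q] eta(2)[of q] psi(3)[of q] by simp
 show "j (q, 0) + d = et q + d" for q using j_unique[of "et q" q] eta(2)[of q] psi(2)[of q] by simp
 show "(?h has_derivative (%(s, t). ?hq z * s + ?hp z * t)) (at z)" if z: "z \<in> strip p0" for z :: "real \<times> real"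
 proof -
 have b0: "- b (fst z, j z) ~= 0" using b0[of z] z SB by auto
 have jd: "(j has_derivative (%(s::real, t). (- (- a (fst z, j z)) / (- b (fst z, j z))) * s + (1 / (- b (fst z, j z))) * t)) (at z)"
 proof (rule shear_inverse_derivative[where k = "%z. - ps z" and B = "strip p0", OF _ b0 open_strip z])
 have "((%z. - ps z) has_derivative (%x. - (%(s, t). a (fst z, j z) * s + b (fst z, j z) * t) x)) (at (fst z, j z))"
 by (rule has_derivative_minus[OF der[OF jO[OF z]]])
 thus "((%z. - ps z) has_derivative (%(s, t). - a (fst z, j z) * s + - b (fst z, j z) * t)) (at (fst z, j z))"
 by (rule has_derivative_eq_rhs) auto
 show "cts (strip p0) j" by (rule continuous_on_subset[OF jc SB])
 show "- ps (fst w, j w) = snd w" if "w \<in> strip p0" for w using j[of w] that SB by auto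
 qed
 from has_derivative_add_const[OF this, of d] show ?thesis by (rule has_derivative_eq_rhs) (use b0 in auto)
 qed
 show "cts ?B ?hq" "cts ?B ?hp" by (intro continuous_intros jpc a b, use b0 in blast)+
 fix z :: "real \<times> real" assume z: "z \<in> ?B"
 have bz: "c <= abs (b (fst z, j z))" "abs (b (fst z, j z)) <= B" "b (fst z, j z) < 0" "abs (a (fst z, j z)) <= B"
 using bc[OF jA[OF z]] b(2)[OF jA[OF z]] a(2)[OF jA[OF z]] c(1) by auto
 have "abs (a (fst z, j z)) / abs (b (fst z, j z)) <= B / c" by (rule frac_le) (use bz c B in auto)
 moreover have "abs (?hq z) = abs (a (fst z, j z)) / abs (b (fst z, j z))" by (simp add: abs_divide)
 moreover have "0 <= 1 / c" "0 <= B / c" using c B by auto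
 ultimately show "abs (?hq z) <= B / c + 1 / c" by linarith
 have hp: "?hp z = 1 / abs (b (fst z, j z))" using bz(3) by (simp add: divide_simps)
 show "1 / B <= ?hp z" unfolding hp by (rule frac_le) (use bz in auto)
 have "1 / abs (b (fst z, j z)) <= 1 / c" by (rule frac_le) (use bz c in auto)
 thus "?hp z <= B / c + 1 / c" unfolding hp using \<open>0 <= B / c\<close> by linarith
 next
 fix x y assume y: "- d <= y" "y <= et x"
 show "ps (x, y) \<in> {0..-p0} & j (x, - ps (x, y)) + d = y + d" using range[OF y] j_unique[OF y] by simp
 qed
 thus ?thesis by blast
qed

text \<open>For \<open>ps\<close> only the implicit relation has to be produced, and the
  intermediate value theorem provides it. Positivity of \<open>hp\<close> places the surface
  strictly above the bottom.\<close>

lemma hodo_of_h: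
 fixes h hq hp :: "real \<times> real => real"
 assumes p0: "p0 < 0" and m: "0 < m" and h: "cts (UNIV \<times> {p0..0}) h" "!!q. h (q, p0) = 0"
 and der: "!!z. z \<in> strip p0 ==> (h has_derivative (%(s, t). hq z * s + hp z * t)) (at z)"
 and c: "cts (UNIV \<times> {p0..0}) hq" "cts (UNIV \<times> {p0..0}) hp"
 and bd: "!!z. z \<in> UNIV \<times> {p0..0} ==> abs (hq z) <= M" "!!z. z \<in> UNIV \<times> {p0..0} ==> m <= hp z & hp z <= M"
 shows "\<exists>ps. hodo d p0 m M (%q. h (q, 0) - d) ps h hq hp"
proof -
 have pos: "0 < h (q, 0)" for q
 proof -
 have "h (q, p0) < h (q, 0)"
 proof (rule DERIV_pos_imp_increasing_open[OF p0])
 fix p assume p: "p0 < p" "p < 0"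
 hence O: "(q, p) \<in> strip p0" by (auto simp: strip_def)
 have "((%t. h (q, t)) has_derivative (%s. (%(s, t'). hq (q, p) * s + hp (q, p) * t') (0, s))) (at p)"
 by (rule has_derivative_eq_rhs[OF has_derivative_compose[of "%t. (q, t)" "%s. (0, s)", OF _ der[OF O]]]) (auto intro!: derivative_eq_intros)
 hence "((%t. h (q, t)) has_real_derivative hp (q, p)) (at p)" by (simp add: has_field_derivative_def)
 moreover have "0 < hp (q, p)" using bd(2)[of "(q, p)"] p m by auto
 ultimately show "\<exists>D. ((%t. h (q, t)) has_real_derivative D) (at p) & 0 < D" by blast
 next
 show "cts {p0..0} (%t. h (q, t))"
 by (rule continuous_on_compose2[OF h(1)]) (auto intro!: continuous_intros)
 qed
 thus ?thesis by (simp add: h)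
 qed
 define ps where "ps z = - (SOME p. p0 <= p & p <= 0 & h (fst z, p) = snd z + d)" for z
 have psi: "p0 <= - ps (x, y) & - ps (x, y) <= 0 & h (x, - ps (x, y)) = y + d"
 if y: "- d <= y" "y <= h (x, 0) - d" for x y
 proof -
 have "\<exists>p\<ge>p0. p <= 0 & h (x, p) = y + d"
 by (rule IVT') (use y p0 h(2) in "auto intro!: continuous_on_compose2[OF h(1)] continuous_intros")
 hence "\<exists>p. p0 <= p & p <= 0 & h (x, p) = y + d" by blast
 from someI_ex[OF this] show ?thesis by (simp add: ps_def)
 qed
 have "hodo d p0 m M (%q. h (q, 0) - d) ps h hq hp"
 proof
 show "cts UNIV (%q. h (q, 0) - d)"
 by (intro continuous_intros continuous_on_compose2[OF h(1)]) (use p0 in auto)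
 fix x y assume "- d <= y" "y <= h (x, 0) - d"
 from psi[OF this] show "ps (x, y) \<in> {0..- p0} & h (x, - ps (x, y)) = y + d" by auto
 qed (use p0 m h der c bd pos in auto)
 thus ?thesis by blast
qed

section \<open>Surface profile, one-variable data and boundary values\<close>

lemma per_W2_C1:
 assumes "per_W2 l r f"
 shows "(f has_real_derivative deriv f x) (at x)" "cts UNIV (deriv f)" "wder UNIV 1 (deriv f) (deriv2 f)"
 "deriv f (x + l) = deriv f x"
proof -
 have c: "cts UNIV f" and per: "!!x. f (x + l) = f x" using assms by (auto simp: per_W2_def)
 have "\<exists>f1 f2. wder UNIV 1 f f1 & wder UNIV 1 f1 f2"
 using assms by (auto simp: per_W2_def numeral_2_eq_2)
 then obtain f1 f2 where w: "wder UNIV 1 f f1" "wder UNIV 1 f1 f2" by blast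
 note C = weak_second_deriv_C1[OF c w]
 show d: "(f has_real_derivative deriv f x) (at x)" for x using C by blast
 show "cts UNIV (deriv f)" using C by blast
 show "wder UNIV 1 (deriv f) (deriv2 f)"
 using conjunct2[OF conjunct2[OF C]] by (rule has_weak_deriv_wd)
 have "((%x. f (x + l)) has_real_derivative deriv f (x + l)) (at x)" using d[of "x + l"] by (simp add: DERIV_shift)
 hence "(f has_real_derivative deriv f (x + l)) (at x)" by (simp add: per)
 from DERIV_unique[OF this d] show "deriv f (x + l) = deriv f x" .
qed

text \<open>Serves to pass between the surface \<open>et\<close> and the trace \<open>et + d\<close>
  of the height function.\<close>

lemma per_W2_add_const:
 assumes f: "per_W2 l r f" and r: "1 <= r"
 shows "per_W2 l r (%x. f x + c)"
proof -
 have cf: "cts UNIV f" using f by (simp add: per_W2_def)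
 hence cont: "cts UNIV (%x. f x + c)" by (intro continuous_intros)
 have "bounded ((%x. f x + c) ` {0..l})"
 by (intro compact_imp_bounded compact_continuous_image continuous_on_subset[OF cont]) auto
 then obtain B where B: "!!x. x \<in> {0..l} ==> abs (f x + c) <= B" unfolding bounded_iff by (metis image_eqI real_norm_def)
 have L: "Lr r {0<..<l} (%x. f x + c)"
 by (rule Lr_bounded_continuous[OF _ _ continuous_on_subset[OF cont] B r]) auto
 have k: "wder UNIV 1 (%x. - c) (%x::real. 0)"
 by (rule weak_derivI_FTC) (auto intro!: locally_integrable_continuous continuous_intros)
 have w: "wder UNIV 1 (%x. f x + c) f1" if "wder UNIV 1 f f1" for f1
 using has_weak_deriv_diff[OF that k] by simp
 have li: "loc_int UNIV (%x. f x + c)" by (rule locally_integrable_continuous[OF cont])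
 show ?thesis using f cont L w li by (auto simp: per_W2_def numeral_2_eq_2)
qed

text \<open>The curvature is the derivative of \<open>et' / sqrt (1 + et'\<^sup>2)\<close>.\<close>

lemma curvature_mean_zero:
 assumes f: "per_W2 l r f" and l: "0 < l" and K: "cts UNIV K"
 and AE: "AE x in Leb. K x = deriv2 f x / (1 + (deriv f x)\<^sup>2) powr (3/2)"
 shows "integral {0..l} K = 0"
proof -
 note c = per_W2_C1[OF f]
 \<comment> \<open>Through the continuous version \<open>K\<close> of the curvature,
   \<open>f''\<close> agrees almost everywhere with the continuous function \<open>k\<close>. Hence
   \<open>deriv f\<close> is classically differentiable and the fundamental theorem is
   available.\<close>
 define k where "k x = K x * (1 + (deriv f x)\<^sup>2) powr (3/2)" for x
 have nz: "0 < 1 + (deriv f x)\<^sup>2" for x by (rule add_pos_nonneg) auto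
 have kc: "cts UNIV k" unfolding k_def
 by (intro continuous_intros K c) (use nz in "auto simp: less_imp_neq[symmetric]")
 have "AE x in Leb. x \<in> UNIV --> deriv2 f x = k x" using AE
 by eventually_elim (use nz in "auto simp: k_def less_imp_neq[symmetric]")
 hence wk: "wder UNIV 1 (deriv f) k" by (intro has_weak_deriv_cong_AE[OF c(3)]) auto
 have d: "(deriv f has_real_derivative k x) (at x)" for x
 proof -
 have eq: "deriv f t = deriv f (x - 1) + integral {x - 1..t} k" if "x - 1 < t" for t
 using weak_deriv_FTC[OF open_UNIV c(2) wk, of "x - 1" t] set_integral_eq_HK[of "x - 1" t k] continuous_on_subset[OF kc] that by simp
 have "((%t. deriv f (x - 1) + integral {x - 1..t} k) has_real_derivative k x) (at x)"
 using integral_less_continuous_derivative[OF kc, of "x - 1" x] by (auto intro!: derivative_eq_intros)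
 thus ?thesis by (rule has_field_derivative_transform_within_open[where S = "{x - 1<..}"]) (use eq in auto)
 qed
 define T where "T x = deriv f x / sqrt (1 + (deriv f x)\<^sup>2)" for x
 have "(T has_real_derivative K x) (at x)" for x
 proof -
 let ?s = "1 + (deriv f x)\<^sup>2"
 have p: "?s powr (3/2) = sqrt ?s * ?s"
 using powr_add[of ?s "1/2" 1] nz[of x] by (simp add: powr_half_sqrt)
 have sq: "sqrt ?s * sqrt ?s = ?s" using nz[of x] by (simp add: less_imp_le)
 have "(T has_real_derivative (k x * sqrt ?s - deriv f x * (deriv f x * k x / sqrt ?s)) / ?s) (at x)"
 unfolding T_def using nz[of x] sq
 by (auto intro!: derivative_eq_intros d simp: less_imp_neq[symmetric] field_simps)
 moreover have "(k x * sqrt ?s - deriv f x * (deriv f x * k x / sqrt ?s)) / ?s = k x * (sqrt ?s * sqrt ?s - (deriv f x)\<^sup>2) / (sqrt ?s * ?s)"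
 using nz[of x] by (simp add: field_simps power2_eq_square)
 moreover have "... = K x" unfolding sq k_def p using nz[of x] by simp
 ultimately show ?thesis by simp
 qed
 from FTC_real[OF less_imp_le[OF l] this] show ?thesis using c(4)[of 0] by (simp add: T_def)
qed

text \<open>Over a period cell the integral of a function of \<open>p\<close> factorises, with the
  length \<open>l\<close> as one factor. In the second part \<open>f\<close> is Borel so that the
  product integral can be evaluated on fibres.\<close>

lemma Lr_snd_iff:
 fixes f :: "real => real"
 assumes l: "0 < l" and r: "1 <= r"
 shows "Lr r {p0<..<0} f ==> Lr r (cell l (strip p0)) (%z. f (snd z))"
 and "f \<in> borel_measurable borel ==> Lr r (cell l (strip p0)) (%z. f (snd z)) ==> Lr r {p0<..<0} f"
proof -
 have oc: "open (cell l (strip p0))" by (rule open_cell[OF open_strip])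
 show "Lr r (cell l (strip p0)) (%z. f (snd z))" if "Lr r {p0<..<0} f"
 by (rule Lr_nonsingular[OF nonsingular_snd[of "{p0<..<0}" l] oc _ _ _ _ that])
 (use l in "auto simp: cell_def strip_def")
 assume f[measurable]: "f \<in> borel_measurable borel" and L: "Lr r (cell l (strip p0)) (%z. f (snd z))"
 let ?g = "%p. ennreal (abs (f p) powr r) * indicator {p0<..<0} p"
 have "(\<integral>\<^sup>+z. ennreal (abs (f (snd z)) powr r) * indicator (cell l (strip p0)) z \<partial>lborel) < \<infinity>"
 using L unfolding Lr_iff[OF oc] nn_integral_completion by blast
 also have "(\<integral>\<^sup>+z. ennreal (abs (f (snd z)) powr r) * indicator (cell l (strip p0)) z \<partial>lborel)
 = (\<integral>\<^sup>+z. indicator {0<..<l} (fst z) * ?g (snd z) \<partial>(lborel \<Otimes>\<^sub>M lborel))"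
 unfolding lborel_prod by (intro nn_integral_cong) (auto simp: cell_def strip_def indicator_def)
 also have "... = (\<integral>\<^sup>+x. \<integral>\<^sup>+p. indicator {0<..<l} x * ?g p \<partial>lborel \<partial>lborel)"
 by (subst lborel.nn_integral_fst[symmetric]) auto
 also have "... = (\<integral>\<^sup>+x. indicator {0<..<l} x * (\<integral>\<^sup>+p. ?g p \<partial>lborel) \<partial>lborel)"
 by (intro nn_integral_cong nn_integral_cmult) measurable
 also have "... = (\<integral>\<^sup>+p. ?g p \<partial>lborel) * ennreal l"
 using l by (subst nn_integral_multc) (auto simp: mult.commute)
 finally have "(\<integral>\<^sup>+p. ?g p \<partial>lborel) < \<infinity>" using l by (auto simp: ennreal_mult_less_top)
 moreover have "(%z. indicator {p0<..<0} z * f z) \<in> borel_measurable Leb"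
 by (rule measurable_completion) measurable
 ultimately show "Lr r {p0<..<0} f" unfolding Lr_iff[OF open_greaterThanLessThan] nn_integral_completion by blast
qed

lemma AE_lebesgue_on_open_iff:
 fixes S :: "'a::euclidean_space set"
 assumes "open S"
 shows "(AE z in lebesgue_on S. P z) \<longleftrightarrow> (AE z in Leb. z \<in> S --> P z)"
 using assms by (simp add: AE_restrict_space_iff)

text \<open>\<open>f\<close> is cut off to the closed interval so that primitives on the whole line
  apply. The additive constant is fixed by the value at the right end point, through which the
  Bernoulli constant will be prescribed at the surface.\<close>

lemma Lr_primitive:
 fixes f :: "real => real"
 assumes r: "1 <= r" and st: "s < t" and f: "Lr r {s<..<t} f"
 shows "\<exists>F K. F t = e & cts {s..t} F & wder {s<..<t} 1 F f &
 (\<forall>a\<in>{s..t}. \<forall>b\<in>{s..t}. abs (F a - F b) <= K * abs (a - b) powr ((r - 1) / r))"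
proof -
 define u where "u x = indicator {s..t} x * f x" for x
 have int: "set_int Leb {s..t} f" by (rule Lr_set_integrable(1)[OF r f]) auto
 have li: "loc_int UNIV u" unfolding locally_integrable_def
 proof (intro allI impI)
 fix K :: "real set" assume K: "compact K & K \<subseteq> UNIV"
 have "integrable Leb u" using int by (simp add: set_integrable_def u_def[abs_def])
 moreover have "K \<in> sets Leb" using K fmeasurableD[OF lmeasurable_compact] by blast
 ultimately show "set_int Leb K u"
 unfolding set_integrable_def by (rule integrable_mult_indicator[rotated])
 qed
 obtain F where F: "cts UNIV F" "!!a b. a <= b ==> (LINT x:{a..b}|Leb. u x) = F b - F a"
 using indefinite_integral_exists[OF li] by blast
 define E where "E x = F x + (e - F t)" for x
 have E: "E b - E a = (LINT x:{a..b}|Leb. f x)" if "s <= a" "a <= b" "b <= t" for a b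
 proof -
 have "(LINT x:{a..b}|Leb. u x) = (LINT x:{a..b}|Leb. f x)"
 by (rule set_lebesgue_integral_cong) (use that in "auto simp: u_def")
 thus ?thesis using F(2)[OF that(2)] by (simp add: E_def)
 qed
 have Ec: "cts X E" for X unfolding E_def by (intro continuous_intros continuous_on_subset[OF F(1)]) auto
 have lf: "loc_int {s<..<t} f" unfolding locally_integrable_def
 proof (intro allI impI)
 fix K :: "real set" assume K: "compact K & K \<subseteq> {s<..<t}"
 show "set_int Leb K f"
 by (rule set_integrable_subset[OF int]) (use K fmeasurableD[OF lmeasurable_compact, of K] in auto)
 qed
 have "wder {s<..<t} 1 E f"
 proof (rule weak_derivI_FTC[OF _ _ Ec lf])
 fix a b :: real assume ab: "a <= b" "{a..b} \<subseteq> {s<..<t}"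
 hence "a \<in> {s<..<t}" "b \<in> {s<..<t}" by auto
 thus "(LINT x:{a..b}|Leb. f x) = E b - E a" using E[of a b] ab by simp
 qed (auto simp: is_interval_def)
 moreover have "\<exists>K. \<forall>a\<in>{s..t}. \<forall>b\<in>{s..t}. abs (E a - E b) <= K * abs (a - b) powr ((r - 1) / r)"
 by (rule Lr_holder_primitive[OF r f E])
 moreover have "E t = e" by (simp add: E_def)
 ultimately show ?thesis using Ec[of "{s..t}"] by (intro exI[of _ E]) simp
qed

text \<open>\<open>R\<close> differs from a primitive of \<open>R'\<close> by a constant: inside the
  interval by the fundamental theorem, at the end points by continuity.\<close>

lemma Lr_weak_deriv_holder:
 fixes R :: "real => real"
 assumes r: "1 <= r" and st: "s < t" and R: "cts {s..t} R" "wder {s<..<t} 1 R R'" and L: "Lr r {s<..<t} R'"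
 shows "\<exists>K. \<forall>a\<in>{s..t}. \<forall>b\<in>{s..t}. abs (R a - R b) <= K * abs (a - b) powr ((r - 1) / r)"
proof -
 obtain F K where F: "cts {s..t} F" "wder {s<..<t} 1 F R'"
 and K: "\<forall>a\<in>{s..t}. \<forall>b\<in>{s..t}. abs (F a - F b) <= K * abs (a - b) powr ((r - 1) / r)"
 using Lr_primitive[OF r st L, of 0] by blast
 let ?c = "(s + t) / 2"
 have sub: "{s<..<t} \<subseteq> {s..t}" by auto
 have *: "R b - F b = R a - F a" if "a \<in> {s<..<t}" "b \<in> {s<..<t}" "a <= b" for a b
 proof -
 have ab: "{a..b} \<subseteq> {s<..<t}" using that by auto
 show ?thesis
 using weak_deriv_FTC[OF _ continuous_on_subset[OF R(1) sub] R(2) that(3) ab]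
 weak_deriv_FTC[OF _ continuous_on_subset[OF F(1) sub] F(2) that(3) ab] by simp
 qed
 have in_open: "R b - F b = R ?c - F ?c" if "b \<in> {s<..<t}" for b
 proof (cases "b <= ?c")
 case True
 have "?c \<in> {s<..<t}" using st by auto
 from *[OF that this True] show ?thesis by simp
 next
 case False
 have "?c \<in> {s<..<t}" using st by auto
 from *[OF this that] False show ?thesis by simp
 qed
 have cl: "closure {s<..<t} = {s..t}" using st by simp
 have eq: "R b - F b = R ?c - F ?c" if "b \<in> {s..t}" for b
 proof (rule continuous_constant_on_closure[of "{s<..<t}" "%b. R b - F b"])
 show "cts (closure {s<..<t}) (%b. R b - F b)" unfolding cl by (intro continuous_on_diff R F)
 show "b \<in> closure {s<..<t}" unfolding cl by (rule that)
 qed (rule in_open)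
 have "R a - R b = F a - F b" if "a \<in> {s..t}" "b \<in> {s..t}" for a b using eq[OF that(1)] eq[OF that(2)] by linarith
 thus ?thesis using K by (intro exI[of _ K]) simp
qed

text \<open>\<open>wd\<close> is some chosen weak derivative; uniqueness transfers to it the
  integrability that the class grants to one of them.\<close>

lemma data_class_wd:
 assumes "data_class r p0 R be"
 shows "wder {p0<..<0} 1 R (wd {p0<..<0} 1 R)" "Lr r {p0<..<0} (wd {p0<..<0} 1 R)"
proof -
 obtain f' where f': "wder {p0<..<0} 1 R f'" "Lr r {p0<..<0} f'"
 using assms unfolding data_class_def One_nat_def sobolev.simps by auto
 show w: "wder {p0<..<0} 1 R (wd {p0<..<0} 1 R)" by (rule has_weak_deriv_wd[OF f'(1)])
 have c: "cts {p0<..<0} R" using assms unfolding data_class_def by (auto intro: continuous_on_subset)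
 show "Lr r {p0<..<0} (wd {p0<..<0} 1 R)"
 by (rule Lr_cong_AE[OF _ f'(2) has_weak_deriv_unique[OF _ c _ f'(1) w]]) auto
qed

text \<open>\<open>a\<close> and \<open>b\<close> are the partial derivatives of the stream function
  and \<open>i\<close> is the reciprocal of the square root of the density. The gradients of density
  and stream function are parallel, so the terms with derivatives of \<open>i\<close> cancel through
  \<open>b * i1 = a * i2\<close>. What remains is the equation for the Laplacian.\<close>

lemma euler_identities:
 fixes a b :: real
 assumes i: "rh * i\<^sup>2 = 1" and lap: "a11 + a22 = g * y * R' + be"
 and r1: "rh1 = - a * R'" "rh2 = - b * R'" and i1: "i1 = k * rh1" "i2 = k * rh2"
 and U: "U = b * i" "U1 = i * a12 + b * i1" "U2 = i * a22 + b * i2"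
 and v: "v = - (a * i)" "v1 = - (i * a11 + a * i1)" "v2 = - (i * a12 + a * i2)"
 and P: "P1 = a * be - (a * a11 + b * a12) - g * (y * rh1)" "P2 = b * be - (a * a12 + b * a22) - g * (rh + y * rh2)"
 shows "rh * U * U1 + rh * v * U2 = - P1" "rh * U * v1 + rh * v * v2 = - P2 - g * rh"
 "U * rh1 + v * rh2 = 0" "U1 + v2 = 0"
proof -
 have ki: "b * i1 = a * i2" unfolding i1 r1 by simp
 have be: "be = a11 + a22 - g * y * R'" using lap by simp
 have "rh * U * U1 + rh * v * U2 = (rh * i\<^sup>2) * (b * a12 - a * a22) + rh * i * b * (b * i1 - a * i2)"
 unfolding U v by (simp add: algebra_simps power2_eq_square)
 also have "... = - P1" unfolding i ki P be r1 by (simp add: algebra_simps)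
 finally show "rh * U * U1 + rh * v * U2 = - P1" .
 have "rh * U * v1 + rh * v * v2 = (rh * i\<^sup>2) * (a * a12 - b * a11) + rh * i * a * (a * i2 - b * i1)"
 unfolding U v by (simp add: algebra_simps power2_eq_square)
 also have "... = - P2 - g * rh" unfolding i ki P be r1 by (simp add: algebra_simps)
 finally show "rh * U * v1 + rh * v * v2 = - P2 - g * rh" .
 show "U * rh1 + v * rh2 = 0" "U1 + v2 = 0" using ki unfolding U v r1 by (simp_all add: algebra_simps)
qed

context hodo
begin

text \<open>The bottom values of \<open>h\<close> vanish, but \<open>hq\<close> is there only a
  limit of interior derivatives. Were it nonzero, a horizontal step of length \<open>r / 2\<close>
  at the level \<open>p0 + s\<close> would change \<open>h\<close> by at least
  \<open>e * r / 2\<close>, whereas \<open>h\<close> lies between \<open>0\<close> and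
  \<open>M * s\<close> on that level.\<close>

lemma hq_bot: "hq (x, p0) = 0"
proof (rule ccontr)
 assume ne: "hq (x, p0) ~= 0"
 define e where "e = abs (hq (x, p0)) / 2"
 have e: "0 < e" using ne by (simp add: e_def)
 have "continuous (at (x, p0) within UNIV \<times> {p0..0}) hq"
 using hq_cont p0 by (simp add: continuous_on_eq_continuous_within)
 then obtain r where r: "r > 0" "!!w. w \<in> UNIV \<times> {p0..0} ==> dist w (x, p0) < r ==> dist (hq w) (hq (x, p0)) < e"
 unfolding continuous_within_eps_delta using e by metis
 define s where "s = min (min (- p0 / 2) (r / 4)) (e * r / (4 * M))"
 have s: "0 < s" "s < - p0" "s <= r / 4" unfolding s_def using p0 r e M by auto
 have "s <= e * r / (4 * M)" unfolding s_def by simp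
 hence sM: "M * s <= e * r / 4" using M by (simp add: field_simps)
 obtain t where t: "x < t" "t < x + r / 2" "h (x + r / 2, p0 + s) - h (x, p0 + s) = (x + r / 2 - x) * hq (t, p0 + s)"
 using MVT2[of x "x + r / 2" "%q. h (q, p0 + s)" "%q. hq (q, p0 + s)"] h_line_q[of "p0 + s"] s r(1) by auto
 have "dist (t, p0 + s) (x, p0) < r" using dist_le_sum[of "(t, p0 + s)" "(x, p0)"] t s r(1) by simp
 hence "abs (hq (t, p0 + s) - hq (x, p0)) < e" using r(2)[of "(t, p0 + s)"] s by (simp add: dist_real_def)
 hence "e <= abs (hq (t, p0 + s))" unfolding e_def by linarith
 hence "r / 2 * e <= abs (h (x + r / 2, p0 + s) - h (x, p0 + s))" unfolding t(3) using r(1) by (simp add: abs_mult)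
 moreover have "0 <= h (q, p0 + s) & h (q, p0 + s) <= M * s" for q
 using h_mono(2)[of p0 "p0 + s" q] h_range[of "p0 + s" q] h_bot[of q] s by simp
 hence "abs (h (x + r / 2, p0 + s) - h (x, p0 + s)) <= M * s" by (smt (verit))
 moreover have "0 < r * e" using r(1) e by simp
 ultimately show False using sM by (simp add: mult.commute)
qed

lemma psx_bot: "psx (x, - d) = 0"
 by (simp add: psx_def H_def psi_bot hq_bot)

lemma top_cl: "(x, et x) \<in> closure OM" unfolding clO using eta(2)[of x] by simp

lemma psx_top: "- psx (x, et x) = psy (x, et x) * deriv et x"
 by (simp add: psx_def psy_def H_def psi_top deriv_eta)

lemma surface_grad_psx: "surface_grad_sq d ps et x = (psx (x, et x))\<^sup>2 + (psy (x, et x))\<^sup>2"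
 unfolding surface_grad_sq_def
 by (simp add: pd_cl_eq[OF oO top_cl psx_cont pd_psi(1)] pd_cl_eq[OF oO top_cl psy_cont pd_psi(2)])

text \<open>Inside, the derivative of the translated function is unique; on the boundary the
  identity persists by continuity.\<close>

lemma psx_periodic:
 assumes eta_per: "!!x. et (x + l) = et x" and per: "periodic_on l (closure OM) ps"
 shows "periodic_on l (closure OM) psx" "periodic_on l (closure OM) psy"
proof -
 let ?T = "%z::real \<times> real. z + (l, 0)"
 have T: "?T z \<in> OM \<longleftrightarrow> z \<in> OM" "?T z \<in> closure OM \<longleftrightarrow> z \<in> closure OM" for z
 by (cases z, simp add: mem_fluid eta_per) (cases z, simp add: clO eta_per)
 have eq: "psx (?T z) = psx z & psy (?T z) = psy z" if z: "z \<in> OM" for z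
 proof -
 have "((%w. ps (?T w)) has_derivative (%w. (%(s, t). psx (?T z) * s + psy (?T z) * t) w)) (at z)"
 by (rule has_derivative_compose[of ?T "%w. w", OF _ psi_der]) (use z T in "auto intro!: derivative_eq_intros")
 hence "(ps has_derivative (%(s, t). psx (?T z) * s + psy (?T z) * t)) (at z)"
 by (rule has_derivative_transform_within_open[OF _ oO z])
 (use bspec[OF per[unfolded periodic_on_def] O_cl] in fastforce)
 from fun_cong[OF has_derivative_unique[OF this psi_der[OF z]], of "(1, 0)"] fun_cong[OF has_derivative_unique[OF this psi_der[OF z]], of "(0, 1)"]
 show ?thesis by simp
 qed
 have per_f: "periodic_on l (closure OM) f" if f: "cts (closure OM) f" "!!z. z \<in> OM ==> f (?T z) = f z" for f :: "real \<times> real => real"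
 proof -
 have "f (?T z) - f z = 0" if z: "z \<in> closure OM" for z
 proof (rule continuous_constant_on_closure[of OM "%z. f (?T z) - f z"])
 show "cts (closure OM) (%z. f (?T z) - f z)"
 by (intro continuous_intros f(1) continuous_on_compose2[OF f(1)]) (use T in auto)
 qed (simp_all add: f(2) z)
 from this[of "(x, y)" for x y] show ?thesis by (auto simp: periodic_on_def)
 qed
 show "periodic_on l (closure OM) psx" by (rule per_f[OF psx_cont]) (rule conjunct1[OF eq])
 show "periodic_on l (closure OM) psy" by (rule per_f[OF psy_cont]) (rule conjunct2[OF eq])
qed

text \<open>Lifted to the strip, \<open>f\<close> has the derivatives \<open>0\<close> and
  \<open>f'\<close>; pulling back along \<open>H\<close> multiplies \<open>f'\<close> by the
  gradient of \<open>- ps\<close>.\<close>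

lemma W1r_profile:
 assumes l: "0 < l" and r: "1 <= r" and f: "cts {p0..0} f" "wder {p0<..<0} 1 f f'" "Lr r {p0<..<0} f'"
 shows "W1r r OM (cell l OM) (%z. f (- ps z)) (%z. - psx z * f' (- ps z)) (%z. - psy z * f' (- ps z))"
proof -
 have c: "cts {p0<..<0} f" by (rule continuous_on_subset[OF f(1)]) auto
 note w = weak_deriv_snd[OF open_greaterThanLessThan c f(2)]
 have cS: "cts S (%z. f (snd z))"
 by (rule continuous_on_compose2[OF c]) (auto intro!: continuous_intros simp: strip_def)
 have "Lr r (cell l S) (%z. 0)"
 by (rule Lr_bounded_continuous[OF open_cell[OF open_strip] bounded_cell_strip _ _ r, of _ _ _ 0]) auto
 hence "W1r r S (cell l S) (%z. f (snd z)) (%z. 0) (%z. f' (snd z))"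
 unfolding W1r_def
 by (intro conjI Lr_snd_iff(1)[OF l r f(3)] w[folded strip_def] cS r open_cell[OF open_strip] open_strip cO_sub(2))
 from W1r_to_fluid[OF this] show ?thesis by (simp add: H_def)
qed

lemma holder_profile:
 assumes a: "0 <= al" and f: "cts {p0..0} f" "!!a b. a \<in> {p0..0} ==> b \<in> {p0..0} ==> abs (f a - f b) <= K * abs (a - b) powr al"
 shows "holder al OM (%z. f (- ps z))"
proof -
 have "bounded (f ` {p0..0})" by (intro compact_imp_bounded compact_continuous_image f(1)) auto
 then obtain B where B: "!!x. x \<in> {p0..0} ==> abs (f x) <= B" unfolding bounded_iff by (metis image_eqI real_norm_def)
 have "holder al S (%z. f (snd z))"
 proof (rule holderI[where K = "abs K" and B = B])
 show "cts (closure S) (%z. f (snd z))" unfolding clS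
 by (rule continuous_on_compose2[OF f(1)]) (auto intro!: continuous_intros)
 show "abs (f (snd z)) <= B" if "z \<in> closure S" for z using that B unfolding clS by auto
 fix z w assume "z \<in> closure S" "w \<in> closure S"
 hence "abs (f (snd z) - f (snd w)) <= K * abs (snd z - snd w) powr al" unfolding clS by (intro f(2)) auto
 also have "... <= abs K * dist z w powr al"
 by (intro mult_mono powr_mono2 a abs_fst_snd_le_dist) auto
 finally show "abs (f (snd z) - f (snd w)) <= abs K * dist z w powr al" .
 qed
 from holder_to_fluid[OF this a] show ?thesis by (simp add: H_def)
qed

lemma per_W1_holderI:
 assumes "W1r r OM (cell l OM) f f1 f2" "holder al OM f" "periodic_on l (closure OM) f"
 shows "per_W1_holder l r al OM f"
proof -
 obtain B where B: "!!z. z \<in> closure OM ==> abs (f z) <= B"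
 using assms(2) unfolding holder_def bounded_iff by (metis image_eqI real_norm_def)
 have "sobolev 1 r OM (cell l OM) f"
 by (rule iffD2[OF sobolev1_iff_W1r[OF oO open_cell[OF oO] cO_sub(1) bounded_cell_fluid[OF eta(1)], where M = B]])
 (use assms(1)[unfolded W1r_def] B[OF O_cl] cO_sub assms(1) in auto)
 thus ?thesis using assms by (simp add: per_W1_holder_def)
qed

lemma W1r_snd_fluid: "1 <= r ==> W1r r OM (cell l OM) snd (%z. 0) (%z. 1)"
proof -
 assume r: "1 <= r"
 have d: "(snd has_derivative (snd :: real \<times> real => real)) (at z)" for z by (auto intro!: derivative_eq_intros)
 have p: "pd b (snd :: real \<times> real => real) = (%z. snd b)" for b by (rule ext) (rule pd_eqI[OF d])
 have C: "C1_on OM snd" unfolding C1_on_def p using d by (auto simp: differentiable_def)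
 have "W1r r OM (cell l OM) snd (pd ex snd) (pd ey snd)"
 by (rule W1r_C1[OF oO open_cell[OF oO] cO_sub(1) bounded_cell_fluid[OF eta(1)] r C, where M = 1]) (simp_all add: p)
 thus ?thesis by (simp add: p)
qed

lemma holder_snd_fluid:
 assumes "0 <= al" "al <= 1" "!!x. abs (et x) <= B"
 shows "holder al OM snd"
proof (rule holder_lipschitz[where B = "B + abs d" and L = 1])
 show "abs (snd z) <= B + abs d" if "z \<in> closure OM" for z
 using that assms(3)[of "fst z"] by (cases z) (auto simp: clO)
qed (use assms abs_fst_snd_le_dist in "auto intro!: continuous_intros")

end

section \<open>From the stream function to the velocity\<close>

lemma inverse_sqrt_derivative:
 "0 < t ==> ((%t. inverse (sqrt t)) has_real_derivative - ((inverse (sqrt t)) ^ 3 / 2)) (at t)"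
 by (auto intro!: derivative_eq_intros simp: divide_simps power2_eq_square power3_eq_cube)

text \<open>The lower bound of the density keeps the square root away from its singularity, so that
  it preserves Hoelder classes.\<close>

lemma sqrt_lipschitz:
 assumes c: "0 < c" "c <= x" "c <= y"
 shows "abs (sqrt x - sqrt y) <= (1 / sqrt c) * abs (x - y)"
proof -
 have s: "0 < sqrt c" "sqrt c <= sqrt x" "sqrt c <= sqrt y" using c by auto
 have "x - y = (sqrt x - sqrt y) * (sqrt x + sqrt y)" using c by (simp add: algebra_simps)
 hence "abs (x - y) = abs (sqrt x - sqrt y) * (sqrt x + sqrt y)" using s by (simp add: abs_mult)
 moreover have "abs (sqrt x - sqrt y) * sqrt c <= abs (sqrt x - sqrt y) * (sqrt x + sqrt y)"
 using s by (intro mult_left_mono) linarith+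
 ultimately show ?thesis using s by (simp add: pos_le_divide_eq)
qed

context hodo
begin

text \<open>Integration of the surface condition over a period removes the curvature. The constant
  \<open>Q\<close> is left general because the identity is read in both directions: either
  \<open>Q\<close> is the mean of the squared gradient and the mean of \<open>et\<close> must
  vanish, or the mean of \<open>et\<close> is zero and \<open>Q\<close> is recognised as that mean.
  The factor \<open>k\<close> stands for gravity times the surface density.\<close>

lemma mean_eta_zero:
 assumes l: "0 < l" and per: "per_W2 l r et" and s: "0 < \<sigma>" and k: "0 < k"
 and AE: "AE x in Leb. (psx (x, et x))\<^sup>2 + (psy (x, et x))\<^sup>2 - 2 * \<sigma> * deriv2 et x / (1 + (deriv et x)\<^sup>2) powr (3/2) + 2 * k * et x = Q"
 shows "integral {0..l} (%x. (psx (x, et x))\<^sup>2 + (psy (x, et x))\<^sup>2) + 2 * k * integral {0..l} et = l * Q"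
proof -
 \<comment> \<open>Solving the condition for the curvature expresses it through continuous
   functions.\<close>
 define K where "K x = ((psx (x, et x))\<^sup>2 + (psy (x, et x))\<^sup>2 + 2 * k * et x - Q) / (2 * \<sigma>)" for x
 have ct: "cts X (%x. f (x, et x))" if "cts (closure OM) f" for f :: "real \<times> real => real" and X
 by (rule continuous_on_compose2[OF that]) (auto intro!: continuous_intros continuous_on_subset[OF eta(1)] top_cl)
 note c = ct[OF psx_cont] ct[OF psy_cont] continuous_on_subset[OF eta(1) subset_UNIV]
 have "integral {0..l} K = 0"
 proof (rule curvature_mean_zero[OF per l])
 show "cts UNIV K" unfolding K_def by (intro continuous_intros c) (use s in auto)
 show "AE x in Leb. K x = deriv2 et x / (1 + (deriv et x)\<^sup>2) powr (3/2)"
 using AE by eventually_elim (use s in "simp add: K_def field_simps")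
 qed
 hence "integral {0..l} (%x. ((psx (x, et x))\<^sup>2 + (psy (x, et x))\<^sup>2) + 2 * k * et x - Q) = 0"
 using s by (simp add: K_def[abs_def])
 moreover have "((%x. ((psx (x, et x))\<^sup>2 + (psy (x, et x))\<^sup>2) + 2 * k * et x - Q) has_integral
 (integral {0..l} (%x. (psx (x, et x))\<^sup>2 + (psy (x, et x))\<^sup>2) + 2 * k * integral {0..l} et - l * Q)) {0..l}"
 using has_integral_const_real[of Q 0 l] l
 by (intro has_integral_diff has_integral_add has_integral_mult_right integrable_integral integrable_continuous_interval continuous_intros c) auto
 ultimately show ?thesis by (simp add: integral_unique)
qed

text \<open>The velocity is the rotated gradient of \<open>ps\<close> divided by the square root of
  the density \<open>R (- ps)\<close>; the pressure is what remains of the Bernoulli function after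
  subtracting kinetic and potential energy. The density bound makes the division harmless in all
  classes.\<close>

lemma velocity_of_stream:
 assumes pos: "0 < g" "0 < rh0" "0 < \<sigma>" and l: "0 < l" and r: "1 <= r" and al: "al = (r - 1) / r"
 and per: "per_W2 l r et" and cl: "per_W2_holder1 l r al OM ps" and dc: "data_class r p0 R be"
 and sp: "stream_problem g d \<sigma> rh0 l p0 R be ps et"
 shows "\<exists>U v P rh. velocity_class d l r al U v P rh et & velocity_problem g d \<sigma> rh0 l U v P rh et &
 velocity_to_stream g d U v P rh et p0 R be ps"
proof -
 have al01: "0 <= al" "al <= 1" using r by (auto simp: al divide_simps)
 have eta_per: "et (x + l) = et x" for x using per by (simp add: per_W2_def)
 note C = class_psi[OF l r cl]
 note pp = psx_periodic[OF eta_per C(3)]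
 obtain a11 a12 a21 a22 where x: "W1r r OM (cell l OM) psx a11 a12" and y: "W1r r OM (cell l OM) psy a21 a22"
 using C(4) by blast
 define R' where "R' = wd {p0<..<0} 1 R"
 define Q where "Q = (1 / l) * integral {0..l} (surface_grad_sq d ps et)"
 note sp = sp[unfolded stream_problem_def Let_def, folded R'_def Q_def]
 have Rc: "cts {p0..0} R" and Lbe: "Lr r {p0<..<0} be" using dc by (auto simp: data_class_def)
 note dR = data_class_wd[OF dc, folded R'_def]
 have Rrh: "rh0 <= R p" if "p \<in> {p0..0}" for p using sp that by blast
 have "Lr r {p0<..<0} (%p. - 1 * be p)" by (rule Lr_mult_bounded[OF _ Lbe r, of _ 1]) auto
 hence Lm: "Lr r {p0<..<0} (%p. - be p)" by simp
 \<comment> \<open>On the surface half the squared gradient of \<open>ps\<close> is the kinetic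
   energy. The value \<open>Q / 2\<close> therefore turns the surface condition with constant
   \<open>Q\<close> into the capillary law for the pressure.\<close>
 obtain E KE where E: "E 0 = Q / 2" "cts {p0..0} E" "wder {p0<..<0} 1 E (%p. - be p)"
 and KE: "\<forall>a\<in>{p0..0}. \<forall>b\<in>{p0..0}. abs (E a - E b) <= KE * abs (a - b) powr ((r - 1) / r)"
 using Lr_primitive[OF r p0 Lm, of "Q / 2"] by blast
 obtain KR where KR: "\<forall>a\<in>{p0..0}. \<forall>b\<in>{p0..0}. abs (R a - R b) <= KR * abs (a - b) powr ((r - 1) / r)"
 using Lr_weak_deriv_holder[OF r p0 Rc dR] by blast
 obtain B where B: "!!x. abs (et x) <= B" by (rule periodic_bounded[OF eta(1) eta_per l]) (rule that)
 have rng: "- ps z \<in> {p0..0}" if "z \<in> closure OM" for z using H_cl[OF that] by (auto simp: clS H_def)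
 have "bounded (R ` {p0..0})" by (intro compact_imp_bounded compact_continuous_image Rc) auto
 then obtain BR where BR: "!!p. p \<in> {p0..0} ==> abs (R p) <= BR" unfolding bounded_iff by (metis image_eqI real_norm_def)

 define rh where "rh z = R (- ps z)" for z
 define s where "s z = inverse (sqrt (rh z))" for z
 define U where "U z = psy z * s z" for z
 \<comment> \<open>The explicit coefficients, also in \<open>P\<close>, reproduce the form of the
   rules for linear combinations in \<open>W1r\<close> and \<open>holder\<close>, which then apply
   without rewriting.\<close>
 define v where "v z = - 1 * (psx z * s z) + 0 * (psx z * s z)" for z
 define P where "P z = 1 * E (- ps z) + - 1 * (1 * (1/2 * (psx z * psx z) + 1/2 * (psy z * psy z)) + g * (rh z * snd z))" for z
 have rh_ge: "rh0 <= rh z" if "z \<in> closure OM" for z unfolding rh_def by (rule Rrh[OF rng[OF that]])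
 have rh_le: "abs (rh z) <= BR" if "z \<in> closure OM" for z unfolding rh_def by (rule BR[OF rng[OF that]])
 have s_sq: "rh z * (s z)\<^sup>2 = 1" "sqrt (rh z) * s z = 1" "0 < s z" if "z \<in> closure OM" for z
 using rh_ge[OF that] pos(2) by (simp_all add: s_def power_inverse)
 have s_le: "abs (s z) <= inverse (sqrt rh0)" if "z \<in> closure OM" for z
 using rh_ge[OF that] pos(2) by (simp add: s_def le_imp_inverse_le)
 have cell_cl: "z \<in> closure OM" if "z \<in> cell l OM" for z using that cO_sub(1) O_cl by blast

 have Wrh: "W1r r OM (cell l OM) rh (%z. - psx z * R' (- ps z)) (%z. - psy z * R' (- ps z))"
 unfolding rh_def by (rule W1r_profile[OF l r Rc dR])
 have WE: "W1r r OM (cell l OM) (%z. E (- ps z)) (%z. - psx z * - be (- ps z)) (%z. - psy z * - be (- ps z))"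
 by (rule W1r_profile[OF l r E(2,3) Lm])
 define k where "k z = - ((inverse (sqrt (rh z))) ^ 3 / 2)" for z
 have Ws: "W1r r OM (cell l OM) s (%z. k z * (- psx z * R' (- ps z))) (%z. k z * (- psy z * R' (- ps z)))"
 unfolding s_def[abs_def] k_def
 proof (rule W1r_compose[OF Wrh, where V = "{rh0 / 2<..}" and F = "%t. inverse (sqrt t)" and F' = "%t. - ((inverse (sqrt t)) ^ 3 / 2)" and M = "inverse (sqrt rh0) ^ 3"])
 show "rh z \<in> {rh0 / 2<..}" if "z \<in> OM" for z using rh_ge[OF O_cl[OF that]] pos(2) by auto
 show "((%t. inverse (sqrt t)) has_real_derivative - ((inverse (sqrt t)) ^ 3 / 2)) (at t)" if "t \<in> {rh0 / 2<..}" for t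
 using that pos(2) by (intro inverse_sqrt_derivative) auto
 show "cts {rh0 / 2<..} (%t. - ((inverse (sqrt t)) ^ 3 / 2))"
 using pos(2) by (auto intro!: continuous_intros)
 fix z assume z: "z \<in> cell l OM"
 have "abs (s z) ^ 3 <= inverse (sqrt rh0) ^ 3" by (rule power_mono[OF s_le[OF cell_cl[OF z]]]) auto
 moreover have "abs (- ((inverse (sqrt (rh z))) ^ 3 / 2)) = abs (s z) ^ 3 / 2" by (simp add: s_def power_abs)
 moreover have "0 <= abs (s z) ^ 3" by simp
 ultimately show "abs (- ((inverse (sqrt (rh z))) ^ 3 / 2)) <= inverse (sqrt rh0) ^ 3" by linarith
 qed auto
 have bx: "abs (psx z) <= M / m" and by': "abs (psy z) <= 1 / m" and bs: "abs (s z) <= inverse (sqrt rh0)" and brh: "abs (rh z) <= BR" and bsnd: "abs (snd z) <= B + abs d" if "z \<in> cell l OM" for z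
 using bound_psx[OF cell_cl[OF that]] bound_psy[OF cell_cl[OF that]] s_le[OF cell_cl[OF that]] rh_le[OF cell_cl[OF that]] cell_cl[OF that] B[of "fst z"]
 by (auto simp: clO)
 have WU: "W1r r OM (cell l OM) U (%z. s z * a21 z + psy z * (k z * (- psx z * R' (- ps z))))
 (%z. s z * a22 z + psy z * (k z * (- psy z * R' (- ps z))))"
 unfolding U_def[abs_def] by (rule W1r_mult[OF y Ws by' bs])
 have Wxs: "W1r r OM (cell l OM) (%z. psx z * s z) (%z. s z * a11 z + psx z * (k z * (- psx z * R' (- ps z))))
 (%z. s z * a12 z + psx z * (k z * (- psy z * R' (- ps z))))"
 by (rule W1r_mult[OF x Ws bx bs])
 note Wv = W1r_lin[OF Wxs Wxs, of "- 1" 0, folded v_def]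
 have WP: "\<exists>P1 P2. W1r r OM (cell l OM) P P1 P2 & (\<forall>z. P1 z = psx z * be (- ps z) - (psx z * a11 z + psy z * a21 z) - g * (snd z * (- psx z * R' (- ps z)))) &
 (\<forall>z. P2 z = psy z * be (- ps z) - (psx z * a12 z + psy z * a22 z) - g * (rh z + snd z * (- psy z * R' (- ps z))))"
 proof -
 note W1 = W1r_lin[OF W1r_mult[OF x x bx bx] W1r_mult[OF y y by' by'], of "1/2" "1/2"]
 note W2 = W1r_lin[OF W1 W1r_mult[OF Wrh W1r_snd_fluid[OF r] brh bsnd], of 1 g]
 note W3 = W1r_lin[OF WE W2, of 1 "- 1", folded P_def]
 show ?thesis by (rule exI, rule exI, rule conjI[OF W3], assumption+) (intro conjI allI; simp add: field_simps)
 qed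
 then obtain P1 P2 where WP: "W1r r OM (cell l OM) P P1 P2"
 and P1: "!!z. P1 z = psx z * be (- ps z) - (psx z * a11 z + psy z * a21 z) - g * (snd z * (- psx z * R' (- ps z)))"
 and P2: "!!z. P2 z = psy z * be (- ps z) - (psx z * a12 z + psy z * a22 z) - g * (rh z + snd z * (- psy z * R' (- ps z)))"
 by blast

 have hx: "holder al OM psx" and hy: "holder al OM psy" by (rule C)+
 have hrh: "holder al OM rh" unfolding rh_def[abs_def]
 by (rule holder_profile[OF al01(1) Rc, of KR]) (use KR in "simp add: al")
 have hE: "holder al OM (%z. E (- ps z))"
 by (rule holder_profile[OF al01(1) E(2), of KE]) (use KE in "simp add: al")
 have hsq: "holder al OM (%z. sqrt (rh z))"
 by (rule holder_lipschitz_compose[OF hrh, where X = "{rh0..}" and L = "1 / sqrt rh0"])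
 (use sqrt_lipschitz[OF pos(2)] rh_ge in auto)
 have hs: "holder al OM s" unfolding s_def[abs_def]
 proof (rule holder_inverse[OF hsq, of "sqrt rh0"])
 show "sqrt rh0 <= abs (sqrt (rh z))" if "z \<in> closure OM" for z
 by (rule order_trans[OF real_sqrt_le_mono[OF rh_ge[OF that]] abs_ge_self])
 qed (use pos in simp)
 have hU: "holder al OM U" unfolding U_def[abs_def] by (rule holder_mult[OF hy hs])
 have hv: "holder al OM v" unfolding v_def[abs_def] by (rule holder_lin[OF holder_mult[OF hx hs] holder_mult[OF hx hs]])
 have hP: "holder al OM P" unfolding P_def[abs_def]
 by (intro holder_lin holder_mult hE hx hy hrh holder_snd_fluid[OF al01 B])
 have perps: "ps (a + l, b) = ps (a, b)" "psx (a + l, b) = psx (a, b)" "psy (a + l, b) = psy (a, b)" if "(a, b) \<in> closure OM" for a b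
 using bspec[OF C(3)[unfolded periodic_on_def] that] bspec[OF pp(1)[unfolded periodic_on_def] that]
 bspec[OF pp(2)[unfolded periodic_on_def] that] by auto
 have pers: "periodic_on l (closure OM) U" "periodic_on l (closure OM) v" "periodic_on l (closure OM) P" "periodic_on l (closure OM) rh"
 unfolding periodic_on_def U_def v_def P_def s_def rh_def by (auto simp: perps)
 have vc: "velocity_class d l r al U v P rh et" unfolding velocity_class_def
 by (intro conjI allI per eta(2) per_W1_holderI[OF WU hU pers(1)] per_W1_holderI[OF Wv hv pers(2)]
 per_W1_holderI[OF WP hP pers(3)] per_W1_holderI[OF Wrh hrh pers(4)])

 have AE: "AE z in lebesgue_on OM.
 rh z * U z * wd OM ex U z + rh z * v z * wd OM ey U z = - wd OM ex P z &
 rh z * U z * wd OM ex v z + rh z * v z * wd OM ey v z = - wd OM ey P z - g * rh z &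
 U z * wd OM ex rh z + v z * wd OM ey rh z = 0 & wd OM ex U z + wd OM ey v z = 0"
 proof -
 have "AE z in Leb. z \<in> OM --> a12 z = a21 z"
 by (rule mixed_weak_deriv[OF oO psi_C1]) (use iffD1[OF W1r_psi_pd(1) x] iffD1[OF W1r_psi_pd(2) y] in "auto simp: W1r_def")
 moreover have "AE z in Leb. z \<in> OM --> wd OM ex (pd ex ps) z + wd OM ey (pd ey ps) z = g * snd z * R' (- ps z) + be (- ps z)"
 using sp unfolding AE_lebesgue_on_open_iff[OF oO] by blast
 ultimately show ?thesis unfolding AE_lebesgue_on_open_iff[OF oO]
 using W1r_wd(2)[OF iffD1[OF W1r_psi_pd(1) x]] W1r_wd(2)[OF iffD1[OF W1r_psi_pd(2) y]]
 W1r_wd(2)[OF WU] W1r_wd(2)[OF Wv] W1r_wd(2)[OF WP] W1r_wd(2)[OF Wrh]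
 proof eventually_elim
 case (elim z)
 show ?case
 proof
 assume z: "z \<in> OM"
 note e = elim[rule_format, OF z]
 have lap: "a11 z + a22 z = g * snd z * R' (- ps z) + be (- ps z)" using e by simp
 have v: "v z = - (psx z * s z)" "U z = psy z * s z" by (simp_all add: v_def U_def)
 have rh12: "wd OM ex rh z = - psx z * R' (- ps z)" "wd OM ey rh z = - psy z * R' (- ps z)" using e by auto
 have U12: "wd OM ex U z = s z * a12 z + psy z * (k z * wd OM ex rh z)" "wd OM ey U z = s z * a22 z + psy z * (k z * wd OM ey rh z)"
 using e by auto
 have v12: "wd OM ex v z = - (s z * a11 z + psx z * (k z * wd OM ex rh z))" "wd OM ey v z = - (s z * a12 z + psx z * (k z * wd OM ey rh z))"
 using e by auto
 have P12: "wd OM ex P z = psx z * be (- ps z) - (psx z * a11 z + psy z * a12 z) - g * (snd z * wd OM ex rh z)"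
 "wd OM ey P z = psy z * be (- ps z) - (psx z * a12 z + psy z * a22 z) - g * (rh z + snd z * wd OM ey rh z)"
 using e by (simp_all add: P1 P2)
 note I = euler_identities[OF s_sq(1)[OF O_cl[OF z]] lap rh12 refl refl v(2) U12 v(1) v12 P12]
 show "rh z * U z * wd OM ex U z + rh z * v z * wd OM ey U z = - wd OM ex P z &
 rh z * U z * wd OM ex v z + rh z * v z * wd OM ey v z = - wd OM ey P z - g * rh z &
 U z * wd OM ex rh z + v z * wd OM ey rh z = 0 & wd OM ex U z + wd OM ey v z = 0"
 using I by blast
 qed
 qed
 qed
 have sg: "surface_grad_sq d ps et = (%x. (psx (x, et x))\<^sup>2 + (psy (x, et x))\<^sup>2)" by (rule ext) (rule surface_grad_psx)
 have AEs: "AE x in Leb. (psx (x, et x))\<^sup>2 + (psy (x, et x))\<^sup>2 - 2 * \<sigma> * deriv2 et x / (1 + (deriv et x)\<^sup>2) powr (3/2) + 2 * (g * R 0) * et x = Q"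
 proof -
 have "AE x in Leb. surface_grad_sq d ps et x - 2 * \<sigma> * deriv2 et x / (1 + (deriv et x)\<^sup>2) powr (3/2) + 2 * g * R 0 * et x = Q"
 using sp by blast
 thus ?thesis by eventually_elim (simp add: surface_grad_psx mult.assoc)
 qed
 have R0: "0 < R 0" using Rrh[of 0] p0 pos(2) by auto
 have "integral {0..l} et = 0"
 using mean_eta_zero[OF l per pos(3) _ AEs] R0 pos(1) l by (simp add: Q_def sg)
 moreover have "AE x in Leb. P (x, et x) = - (\<sigma> * deriv2 et x / (1 + (deriv et x)\<^sup>2) powr (3/2))"
 using AEs
 proof eventually_elim
 case (elim x)
 have "P (x, et x) = Q / 2 - ((psx (x, et x))\<^sup>2 + (psy (x, et x))\<^sup>2) / 2 - g * R 0 * et x"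
 by (simp add: P_def rh_def psi_top E(1) power2_eq_square field_simps)
 moreover have "2 * \<sigma> * deriv2 et x / (1 + (deriv et x)\<^sup>2) powr (3/2) = 2 * (\<sigma> * deriv2 et x / (1 + (deriv et x)\<^sup>2) powr (3/2))"
 by simp
 moreover have "2 * (g * R 0) * et x = 2 * (g * R 0 * et x)" by simp
 moreover have "p = - D" if "p = q / 2 - s / 2 - t" "A = 2 * D" "B = 2 * t" "s - A + B = q" for p q s t A B D :: real
 using that by linarith
 ultimately show ?case using elim by blast
 qed
 moreover have "v (x, et x) = U (x, et x) * deriv et x" for x
 proof -
 have "v (x, et x) = (- psx (x, et x)) * s (x, et x)" by (simp add: v_def)
 thus ?thesis unfolding psx_top by (simp add: U_def mult_ac)
 qed
 moreover have "v (x, - d) = 0" for x by (simp add: v_def psx_bot)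
 moreover have "(SUP z\<in>OM. U z) < 0"
 proof -
 have BR0: "0 < BR" using BR[of 0] R0 p0 by auto
 \<comment> \<open>A supremum strictly below zero requires a uniform bound: the upper bound of the
   density together with the lower bound \<open>1 / M\<close> of \<open>- psy\<close>.\<close>
 have "U z <= - (1 / M) * inverse (sqrt BR)" if "z \<in> OM" for z
 proof -
 have z: "z \<in> closure OM" by (rule O_cl[OF that])
 have "inverse (sqrt BR) <= s z" unfolding s_def
 by (rule le_imp_inverse_le) (use rh_le[OF z] rh_ge[OF z] pos(2) in auto)
 moreover have "1 / M <= - psy z" using psy_le[OF z] by simp
 ultimately have "(1 / M) * inverse (sqrt BR) <= (- psy z) * s z"
 by (intro mult_mono) (use M BR0 s_sq(3)[OF z] psy_le[OF z] in "auto intro: order_trans")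
 thus ?thesis by (simp add: U_def)
 qed
 moreover have "OM ~= {}" using G_S[of "(0, p0 / 2)"] p0 by (auto simp: memS)
 ultimately have "(SUP z\<in>OM. U z) <= - (1 / M) * inverse (sqrt BR)" by (intro cSUP_least) auto
 also have "... < 0" using M BR0 by simp
 finally show ?thesis .
 qed
 ultimately have vp: "velocity_problem g d \<sigma> rh0 l U v P rh et"
 unfolding velocity_problem_def Let_def using AE rh_ge by (intro conjI) auto

 have "velocity_to_stream g d U v P rh et p0 R be ps" unfolding velocity_to_stream_def
 proof (intro conjI)
 show "\<forall>z\<in>OM. (ps has_derivative (%(a, b). - sqrt (rh z) * v z * a + sqrt (rh z) * U z * b)) (at z)"
 proof
 fix z assume z: "z \<in> OM"
 have "- sqrt (rh z) * v z = psx z * (sqrt (rh z) * s z)" "sqrt (rh z) * U z = psy z * (sqrt (rh z) * s z)"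
 by (simp_all add: v_def U_def)
 hence "- sqrt (rh z) * v z = psx z" "sqrt (rh z) * U z = psy z" using s_sq(2)[OF O_cl[OF z]] by simp_all
 thus "(ps has_derivative (%(a, b). - sqrt (rh z) * v z * a + sqrt (rh z) * U z * b)) (at z)"
 using psi_der[OF z] by simp
 qed
 show "\<forall>(q, p)\<in>closure S. (rh \<circ> inv_hodograph d et ps) (q, p) = R p"
 proof (clarify)
 fix q p assume w: "(q, p) \<in> closure S"
 show "(rh \<circ> inv_hodograph d et ps) (q, p) = R p"
 using inv_hodograph[OF w] HG[OF w] by (simp add: rh_def H_def)
 qed
 show "wder S ey (energy g U v P rh \<circ> inv_hodograph d et ps) (%(q, p). - be p)"
 proof (rule has_weak_deriv_cong_AE)
 show "wder S ey (%z. E (snd z)) (%z. - be (snd z))"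
 unfolding strip_def
 by (rule weak_deriv_snd(1)[OF open_greaterThanLessThan continuous_on_subset[OF E(2)] E(3)]) auto
 show "AE z in Leb. z \<in> S --> E (snd z) = (energy g U v P rh \<circ> inv_hodograph d et ps) z"
 proof (rule AE_I2, rule impI)
 fix w assume "w \<in> S"
 hence w: "w \<in> closure S" by (rule S_cl)
 let ?z = "G w"
 have z: "?z \<in> closure OM" by (rule G_cl[OF w])
 have "rh ?z * (((U ?z)\<^sup>2 + (v ?z)\<^sup>2) / 2) = (rh ?z * (s ?z)\<^sup>2) * ((psx ?z)\<^sup>2 + (psy ?z)\<^sup>2) / 2"
 by (simp add: U_def v_def power_mult_distrib algebra_simps)
 hence "energy g U v P rh ?z = E (- ps ?z)" unfolding s_sq(1)[OF z]
 by (simp add: energy_def P_def power2_eq_square algebra_simps)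
 moreover have "- ps ?z = snd w" using arg_cong[OF HG[OF w], of snd] by (simp add: H_def)
 ultimately show "E (snd w) = (energy g U v P rh \<circ> inv_hodograph d et ps) w"
 using inv_hodograph[OF w] by simp
 qed
 qed auto
 qed (use psi_cont psi_top psi_bot bij in auto)
 thus ?thesis using vc vp by blast
qed

end

section \<open>Between stream function and height function, and back to the velocity\<close>

lemma hodo_of_stream:
 assumes p0: "p0 < 0" and per: "per_W2 l r et" and d: "!!x. - d < et x" and h1: "holder1 al (fluid d et) ps"
 and top: "!!x. ps (x, et x) = 0" and bot: "!!x. ps (x, - d) = - p0" and sup: "(SUP z\<in>fluid d et. pd ey ps z) < 0"
 shows "\<exists>h hq hp m M. hodo d p0 m M et ps h hq hp"
proof -
 let ?O = "fluid d et"
 have eta: "cts UNIV et" using per by (simp add: per_W2_def)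
 obtain a b where a: "holder al ?O a" "!!z. z \<in> ?O ==> a z = pd ex ps z" and b: "holder al ?O b" "!!z. z \<in> ?O ==> b z = pd ey ps z"
 using h1 unfolding holder1_def Basis_prod_real by auto
 obtain A where A: "\<forall>z\<in>closure ?O. abs (a z) <= A" using a(1) by (auto simp: holder_def bounded_iff)
 obtain B where B: "\<forall>z\<in>closure ?O. abs (b z) <= B" using b(1) by (auto simp: holder_def bounded_iff)
 have sub: "?O \<subseteq> closure ?O" by (rule closure_subset)
 have bdd: "bdd_above (pd ey ps ` ?O)"
 using B b(2) sub by (intro bdd_aboveI[of _ B]) (metis (no_types, lifting) abs_le_D1 imageE subsetD)
 show ?thesis
 proof (rule hodo_of_psi[OF p0 eta d _ top bot, where a = a and b = b and B = "max A B" and c = "- (SUP z\<in>?O. pd ey ps z)"])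
 show "cts (closure ?O) ps" using h1 by (simp add: holder1_def)
 show "(ps has_derivative (%(s, t). a z * s + b z * t)) (at z)" if "z \<in> ?O" for z
 using has_derivative_pd_prod[of ps z] h1 that by (simp add: holder1_def a(2) b(2))
 show "cts (closure ?O) a" "cts (closure ?O) b" using a b by (auto simp: holder_def)
 show "abs (a z) <= max A B" if "z \<in> closure ?O" for z using A that by (simp add: max.coboundedI1)
 show "abs (b z) <= max A B" if "z \<in> closure ?O" for z using B that by (simp add: max.coboundedI2)
 show "b z <= - (- (SUP z\<in>?O. pd ey ps z))" if "z \<in> ?O" for z using cSUP_upper[OF that bdd] b(2)[OF that] by simp
 qed (use sup in simp)
qed

text \<open>The correspondence prescribes the height function on the closed strip, where it has to
  be the inverse shear. Existence and uniqueness are read off from this one equivalence.\<close>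

lemma stream_to_height_hodo:
 assumes "hodo d p0 m M et ps h hq hp"
 shows "stream_to_height d p0 ps et h1 \<longleftrightarrow> (\<forall>w\<in>closure (strip p0). h1 w = h w)"
proof -
 interpret hodo d p0 m M et ps h hq hp by (rule assms)
 show ?thesis unfolding stream_to_height_def using bij by (simp add: inv_hodograph G_def)
qed

text \<open>The bounds of the frame come from the Hoelder extensions of the derivatives (above) and
  from the positive infimum of \<open>pd ey h\<close> (below), which continuity carries to the
  closed strip.\<close>

lemma hodo_of_height:
 assumes p0: "p0 < 0" and h1: "holder1 al (strip p0) h" and bot: "!!q. h (q, p0) = 0"
 and inf: "0 < (INF z\<in>strip p0. pd ey h z)"
 shows "\<exists>ps hq hp m M. hodo d p0 m M (%q. h (q, 0) - d) ps h hq hp"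
proof -
 let ?S = "strip p0"
 note cl = closure_strip[OF p0]
 obtain a b where a: "holder al ?S a" "!!z. z \<in> ?S ==> a z = pd ex h z" and b: "holder al ?S b" "!!z. z \<in> ?S ==> b z = pd ey h z"
 using h1 unfolding holder1_def Basis_prod_real by auto
 obtain A where A: "\<forall>z\<in>closure ?S. abs (a z) <= A" using a(1) by (auto simp: holder_def bounded_iff)
 obtain B where B: "\<forall>z\<in>closure ?S. abs (b z) <= B" using b(1) by (auto simp: holder_def bounded_iff)
 have sub: "?S \<subseteq> closure ?S" by (rule closure_subset)
 have bdd: "bdd_below (pd ey h ` ?S)"
 using B b(2) sub by (intro bdd_belowI[of _ "- B"]) (metis (no_types, lifting) abs_le_D2 imageE minus_le_iff subsetD)
 have cc: "cts (closure ?S) a" "cts (closure ?S) b" "cts (closure ?S) h"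
 using a b h1 by (auto simp: holder_def holder1_def)
 have low: "(INF z\<in>?S. pd ey h z) <= b z" if "z \<in> closure ?S" for z
 by (rule continuous_ge_on_closure[OF cc(2) that]) (use cINF_lower[OF bdd] b(2) in simp)
 have "\<exists>ps. hodo d p0 (INF z\<in>?S. pd ey h z) (max A B) (%q. h (q, 0) - d) ps h a b"
 proof (rule hodo_of_h[OF p0 inf cc(3)[unfolded cl] bot _ cc(1,2)[unfolded cl], folded cl])
 show "(h has_derivative (%(s, t). a z * s + b z * t)) (at z)" if "z \<in> ?S" for z
 using has_derivative_pd_prod[of h z] h1 that by (simp add: holder1_def a(2) b(2))
 show "abs (a z) <= max A B" if "z \<in> closure ?S" for z using A that by (simp add: max.coboundedI1)
 show "(INF z\<in>?S. pd ey h z) <= b z & b z <= max A B" if "z \<in> closure ?S" for z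
 using B that low by (auto simp: max.coboundedI2 abs_le_iff le_max_iff_disj)
 qed
 thus ?thesis by blast
qed

theorem stream_to_height_formulation:
 assumes l: "0 < l" and r: "1 <= r" and al: "al = (r - 1) / r" and p0: "p0 < 0"
 and cl: "stream_class d l r al p0 R be ps et" and sp: "stream_problem g d \<sigma> rh0 l p0 R be ps et"
 shows "\<exists>h. stream_to_height d p0 ps et h & height_class l r al p0 R be h & height_problem g d \<sigma> rh0 l p0 R be h &
 (\<forall>h1. stream_to_height d p0 ps et h1 --> (\<forall>w\<in>closure (strip p0). h1 w = h w))"
proof -
 have c: "per_W2 l r et" "!!x. - d < et x" "per_W2_holder1 l r al (fluid d et) ps" "data_class r p0 R be"
 using cl by (auto simp: stream_class_def)
 have al0: "0 <= al" using r by (simp add: al)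
 have s: "!!x. ps (x, et x) = 0" "!!x. ps (x, - d) = - p0" "(SUP z\<in>fluid d et. pd ey ps z) < 0"
 using sp unfolding stream_problem_def Let_def by blast+
 have h1: "holder1 al (fluid d et) ps" using c(3) by (simp add: per_W2_holder1_def)
 obtain h hq hp m M where hd: "hodo d p0 m M et ps h hq hp"
 using hodo_of_stream[OF p0 c(1,2) h1 s] by blast
 then interpret hodo d p0 m M et ps h hq hp .
 have eta_per: "et (x + l) = et x" for x using c(1) by (simp add: per_W2_def)
 obtain a11 a12 a21 a22 where x: "W1r r OM (cell l OM) psx a11 a12" and y: "W1r r OM (cell l OM) psy a21 a22"
 using class_psi(4)[OF l r c(3)] by blast
 have hc: "height_class l r al p0 R be h"
 using class_psi_to_h[OF l r al0 eta_per c(3)] per_W2_add_const[OF c(1) r, of d] c(4)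
 by (simp add: height_class_def h_top)
 have hp: "height_problem g d \<sigma> rh0 l p0 R be h" by (rule iffD1[OF stream_iff_height[OF x y l] sp])
 show ?thesis using stream_to_height_hodo[OF hd] hc hp by (intro exI[of _ h]) simp
qed

text \<open>The surface is read off as \<open>h (q, 0) - d\<close>. The equivalence of the two
  problems, used backwards, gives the stream function, from which the velocity is built.\<close>

theorem height_to_velocity_formulation:
 assumes pos: "0 < g" "0 < rh0" "0 < \<sigma>" and l: "0 < l" and r: "1 <= r" and al: "al = (r - 1) / r" and p0: "p0 < 0"
 and cl: "height_class l r al p0 R be h" and hp: "height_problem g d \<sigma> rh0 l p0 R be h"
 shows "\<exists>U v P rh et ps. velocity_class d l r al U v P rh et & velocity_problem g d \<sigma> rh0 l U v P rh et &
 velocity_to_stream g d U v P rh et p0 R be ps & stream_class d l r al p0 R be ps et &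
 stream_problem g d \<sigma> rh0 l p0 R be ps et & stream_to_height d p0 ps et h"
proof -
 let ?et = "%q. h (q, 0) - d"
 have c: "per_W2_holder1 l r al (strip p0) h" "per_W2 l r (%q. h (q, 0))" "data_class r p0 R be"
 using cl by (auto simp: height_class_def)
 have al0: "0 <= al" using r by (simp add: al)
 have s: "!!q. h (q, p0) = 0" "0 < (INF z\<in>strip p0. pd ey h z)" using hp unfolding height_problem_def Let_def by blast+
 have h1: "holder1 al (strip p0) h" using c(1) by (simp add: per_W2_holder1_def)
 obtain ps hq hp' m M where hd: "hodo d p0 m M ?et ps h hq hp'" using hodo_of_height[OF p0 h1 s] by blast
 then interpret hodo d p0 m M ?et ps h hq hp' .
 have per: "per_W2 l r ?et" using per_W2_add_const[OF c(2) r, of "- d"] by simp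
 have eta_per: "?et (x + l) = ?et x" for x using per by (simp add: per_W2_def)
 have cp: "per_W2_holder1 l r al OM ps" by (rule class_h_to_psi[OF l r al0 eta_per c(1)])
 obtain a11 a12 a21 a22 where x: "W1r r OM (cell l OM) psx a11 a12" and y: "W1r r OM (cell l OM) psy a21 a22"
 using class_psi(4)[OF l r cp] by blast
 have sp: "stream_problem g d \<sigma> rh0 l p0 R be ps ?et" by (rule iffD2[OF stream_iff_height[OF x y l] hp])
 have sc: "stream_class d l r al p0 R be ps ?et"
 unfolding stream_class_def using per cp c(3) eta(2) by blast
 have sh: "stream_to_height d p0 ps ?et h" using stream_to_height_hodo[OF hd] by blast
 show ?thesis using velocity_of_stream[OF pos l r al per cp c(3) sp] sp sc sh by blast
qed

section \<open>Velocity and stream function\<close>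

lemma stream_function_exists:
 fixes F1 F2 :: "real \<times> real => real"
 assumes eta: "cts UNIV et" "!!x. - d < et x" "!!x. (et has_real_derivative et' x) (at x)" "cts UNIV et'"
 and F: "cts (closure (fluid d et)) F1" "cts (closure (fluid d et)) F2"
 and B: "!!z. z \<in> closure (fluid d et) ==> abs (F2 z) <= B"
 and w: "wder (fluid d et) ey F1 w1" "wder (fluid d et) ex F2 w2"
 and curl: "AE z in Leb. z \<in> fluid d et --> w1 z = w2 z"
 and bot: "!!x. F1 (x, - d) = 0" and top: "!!x. F1 (x, et x) + F2 (x, et x) * et' x = 0"
 shows "\<exists>ps c. cts (closure (fluid d et)) ps &
 (\<forall>z\<in>fluid d et. (ps has_derivative (%(s, t). F1 z * s + F2 z * t)) (at z)) & (\<forall>x. ps (x, et x) = 0) & (\<forall>x. ps (x, - d) = c)"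
proof -
 let ?O = "fluid d et"
 note cl = closure_fluid[OF eta(1,2)]
 have oO: "open ?O" by (rule open_fluid[OF eta(1)])
 \<comment> \<open>Clamping the second coordinate to the vertical segment extends the field
   continuously to the plane, so integrals with a parameter can be formed without regard to the
   domain.\<close>
 define ka where "ka z = (fst z, max (- d) (min (snd z) (et (fst z))))" for z :: "real \<times> real"
 have ka: "ka z \<in> closure ?O" for z using eta(2)[of "fst z"] by (auto simp: ka_def cl)
 have ka_id: "ka z = z" if "z \<in> closure ?O" for z using that by (cases z) (auto simp: ka_def cl)
 have O_cl: "z \<in> closure ?O" if "z \<in> ?O" for z using that closure_subset by blast
 have kac: "cts UNIV ka" unfolding ka_def
 by (intro continuous_intros continuous_on_compose2[OF eta(1)]) auto
 define f1 f2 where "f1 z = F1 (ka z)" and "f2 z = F2 (ka z)" for z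
 have fc: "cts X f1" "cts X f2" for X unfolding f1_def f2_def
 by (rule continuous_on_compose2[OF F(1) continuous_on_subset[OF kac]], use ka in auto)
 (rule continuous_on_compose2[OF F(2) continuous_on_subset[OF kac]], use ka in auto)
 have fF: "f1 z = F1 z" "f2 z = F2 z" if "z \<in> closure ?O" for z using that by (simp_all add: f1_def f2_def ka_id)
 have f2B: "abs (f2 z) <= B" for z unfolding f2_def by (rule B[OF ka])
 have line: "cts X (%t. f2 (x, t))" "cts X (%x. f1 (x, t))" for X x t
 by (rule continuous_on_compose2[OF fc(2)[of UNIV]]; auto intro!: continuous_intros)
 (rule continuous_on_compose2[OF fc(1)[of UNIV]]; auto intro!: continuous_intros)
 \<comment> \<open>The potential is a vertical integral from the flat bottom, so the derivative in
   \<open>y\<close> is immediate. The derivative in \<open>x\<close> has to come from the weak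
   condition on the curl.\<close>
 define J where "J x y = integral {- d..y} (%t. f2 (x, t))" for x y
 have Jy: "((%y. J x y) has_real_derivative f2 (x, y)) (at y)" if "- d < y" for x y
 unfolding J_def by (rule integral_less_continuous_derivative[OF line(1) that])
 have J_lip1: "abs (J x y' - J x y) <= B * (y' - y)" if "- d <= y" "y <= y'" for x y y'
 proof -
 have "J x y + integral {y..y'} (%t. f2 (x, t)) = J x y'" unfolding J_def
 by (rule Henstock_Kurzweil_Integration.integral_combine[OF that]) (intro integrable_continuous_interval line)
 moreover have "norm (integral {y..y'} (%t. f2 (x, t))) <= B * (y' - y)"
 by (rule integral_bound[OF that(2) line(1)]) (use f2B in auto)
 ultimately show ?thesis by (smt (verit) real_norm_def)
 qed
 have J_lip: "abs (J x y' - J x y) <= B * abs (y' - y)" if "- d <= y" "- d <= y'" for x y y'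
 using J_lip1[of y y' x] J_lip1[of y' y x] that by (cases "y <= y'") auto
 have Jx_cont: "cts UNIV (%x. J x y)" for y unfolding J_def
 using integral_continuous_on_param[of UNIV "- d" y "%x t. f2 (x, t)"] fc(2)[of "UNIV \<times> cbox (- d) y"]
 by (simp add: case_prod_beta')
 have Jc: "cts {z. - d <= snd z} (%z. J (fst z) (snd z))"
 unfolding continuous_on_def
 proof
 fix z0 :: "real \<times> real" assume z0: "z0 \<in> {z. - d <= snd z}"
 let ?F = "at z0 within {z. - d <= snd z}"
 let ?g = "%z. abs (J (fst z) (snd z0) - J (fst z0) (snd z0)) + B * abs (snd z - snd z0)"
 have k: "cts UNIV (%z::real \<times> real. J (fst z) (snd z0))"
 by (rule continuous_on_compose2[OF Jx_cont]) (auto intro!: continuous_intros)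
 have "cts UNIV ?g" by (intro continuous_intros k)
 hence "(?g \<longlongrightarrow> ?g z0) (at z0)" unfolding continuous_on_def by blast
 hence "(?g \<longlongrightarrow> ?g z0) ?F" by (rule tendsto_within_subset) simp
 hence g: "(?g \<longlongrightarrow> 0) ?F" by simp
 have "((%z. J (fst z) (snd z) - J (fst z0) (snd z0)) \<longlongrightarrow> 0) ?F"
 proof (rule Lim_null_comparison[OF _ g])
 have "norm (J (fst z) (snd z) - J (fst z0) (snd z0)) <= ?g z" if "- d <= snd z" for z
 using J_lip[of "snd z0" "snd z" "fst z"] z0 that by simp
 thus "\<forall>\<^sub>F z in ?F. norm (J (fst z) (snd z) - J (fst z0) (snd z0)) <= ?g z"
 by (auto simp: eventually_at_filter)
 qed
 thus "((%z. J (fst z) (snd z)) \<longlongrightarrow> J (fst z0) (snd z0)) ?F" by (rule LIM_zero_cancel)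
 qed
 have Jcomp: "cts X (%c. J x (k c))" if k: "cts X k" "!!c. c \<in> X ==> - d <= k c" for X x and k :: "real => real"
 proof -
 have "cts X (%c. (x, k c))" by (intro continuous_intros k)
 from continuous_on_compose2[OF Jc this] k(2) show ?thesis by force
 qed
 have vanish: "g a = (0::real)" if g: "cts {a..e} g" "!!c. a < c ==> c < e ==> g c = 0" "a < e" for g and a e :: real
 proof (rule continuous_constant_on_closure[of "{a<..<e}" g])
 show "cts (closure {a<..<e}) g" using g(1,3) by simp
 qed (use g in auto)

 \<comment> \<open>Boxes have to stay inside the open domain, so the identity is established above a
   level \<open>c > - d\<close>. Letting \<open>c\<close> tend to the bottom uses that
   \<open>F1\<close> vanishes there.\<close>
 have Jx_diff: "J b e - J a e = integral {a..b} (%x. f1 (x, e))"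
 if ab: "a <= b" and e: "- d < e" and sub: "!!x. x \<in> {a..b} ==> e < et x" for a b e
 proof -
 let ?g = "%c. (J b e - J a e) - (J b c - J a c) - integral {a..b} (%x. f1 (x, e) - f1 (x, c))"
 have Jl: "cts {- d..e} (%c. J x c)" for x
 by (rule Jcomp) (auto intro!: continuous_intros)
 have "?g (- d) = 0"
 proof (rule vanish[OF _ _ e])
 have "cts {- d..e} (%c. integral (cbox a b) (%x. f1 (x, e) - f1 (x, c)))"
 by (rule integral_continuous_on_param) (auto intro!: continuous_intros continuous_on_compose2[OF fc(1)[of UNIV]] simp: case_prod_beta')
 thus "cts {- d..e} ?g" by (intro continuous_intros Jl) simp_all
 fix c assume c: "- d < c" "c < e"
 have sub': "cbox (a, c) (b, e) \<subseteq> ?O" using c sub by (force simp: mem_fluid)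
 have w1: "wder ?O ey F1 w2" by (rule has_weak_deriv_cong_AE[OF w(1) _ curl]) simp
 have Fc: "cts ?O F1" "cts ?O F2" using F O_cl by (auto intro: continuous_on_subset)
 have "integral {a..b} (%x. f1 (x, e) - f1 (x, c)) = integral {a..b} (%x. F1 (x, e) - F1 (x, c))"
 proof (rule integral_cong)
 fix x assume x: "x \<in> {a..b}"
 have "(x, e) \<in> closure ?O" "(x, c) \<in> closure ?O" using c sub[OF x] by (auto simp: cl)
 thus "f1 (x, e) - f1 (x, c) = F1 (x, e) - F1 (x, c)" by (simp add: fF)
 qed
 also have "... = integral {c..e} (%y. F2 (b, y) - F2 (a, y))"
 using weak_deriv_box(2)[OF oO Fc(1) ab less_imp_le[OF c(2)] sub' w1] weak_deriv_box(1)[OF oO Fc(2) ab less_imp_le[OF c(2)] sub' w(2)] by simp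
 also have "... = integral {c..e} (%y. f2 (b, y) - f2 (a, y))"
 proof (rule integral_cong)
 fix y assume y: "y \<in> {c..e}"
 have "(a, y) \<in> closure ?O" "(b, y) \<in> closure ?O" using y c sub[of a] sub[of b] ab by (auto simp: cl)
 thus "F2 (b, y) - F2 (a, y) = f2 (b, y) - f2 (a, y)" by (simp add: fF)
 qed
 also have "... = (J b e - J a e) - (J b c - J a c)"
 by (rule FTC_real[OF less_imp_le[OF c(2)]]) (use c in "auto intro!: derivative_intros Jy")
 finally show "?g c = 0" by simp
 qed
 moreover have "J x (- d) = 0" for x by (simp add: J_def)
 moreover have "f1 (x, - d) = 0" for x using fF(1)[of "(x, - d)"] bot[of x] eta(2)[of x] by (simp add: cl)
 ultimately show ?thesis by simp
 qed

 have J_der: "((%z. J (fst z) (snd z)) has_derivative (%(s, t). f1 (x, y) * s + f2 (x, y) * t)) (at (x, y))" if z: "(x, y) \<in> ?O" for x y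
 proof -
 have y: "- d < y" "y < et x" using z by (auto simp: mem_fluid)
 have "open {t. y < et t}" by (intro open_Collect_less continuous_intros eta(1))
 then obtain e where e: "0 < e" "cball x e \<subseteq> {t. y < et t}" using y open_contains_cball by blast
 have sub: "y < et t" if "abs (t - x) <= e" for t using that e(2) by (auto simp: cball_def dist_real_def abs_minus_commute)
 have "((%t. J (x - e) y + integral {x - e..t} (%x. f1 (x, y))) has_real_derivative f1 (x, y)) (at x)"
 using integral_less_continuous_derivative[OF line(2), of "x - e" x y] e(1) by (auto intro!: derivative_eq_intros)
 hence "((%t. J t y) has_real_derivative f1 (x, y)) (at x)"
 proof (rule has_field_derivative_transform_within_open[where S = "{x - e<..<x + e}"])
 fix t assume t: "t \<in> {x - e<..<x + e}"
 show "J (x - e) y + integral {x - e..t} (%x. f1 (x, y)) = J t y"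
 using Jx_diff[of "x - e" t y] sub t y(1) by (auto simp: abs_le_iff)
 qed (use e in auto)
 hence fx: "((%t. J t y) has_derivative (%s. f1 (x, y) * s)) (at x within UNIV)" by (simp add: has_field_derivative_def)
 have "((%(x, y). J x y) has_derivative (%(s, t). f1 (x, y) * s + blinfun_apply (blinfun_mult_right (f2 (x, y))) t)) (at (x, y) within UNIV \<times> {- d<..})"
 proof (rule has_derivative_partialsI[where f = J and X = UNIV and Y = "{- d<..}" and fy = "%x y. blinfun_mult_right (f2 (x, y))" and fx = "%s. f1 (x, y) * s", OF fx])
 show "((%y. J x y) has_derivative blinfun_apply (blinfun_mult_right (f2 (x, y)))) (at y within {- d<..})"
 if "y \<in> {- d<..}" for x y
 using Jy[of y x] that by (auto simp: has_field_derivative_def blinfun_mult_right.rep_eq intro: has_derivative_at_withinI)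
 have "cts UNIV (%z. blinfun_mult_right (f2 z))"
 by (intro bounded_linear.continuous_on[OF bounded_linear_blinfun_mult_right] fc)
 hence "continuous (at (x, y)) (%z. blinfun_mult_right (f2 z))" by (simp add: continuous_on_eq_continuous_at)
 thus "continuous (at (x, y) within UNIV \<times> {- d<..}) (%(x, y). blinfun_mult_right (f2 (x, y)))"
 by (auto simp: case_prod_beta' intro: continuous_at_imp_continuous_at_within)
 qed (use y in auto)
 moreover have "at (x, y) within UNIV \<times> {- d<..} = at (x, y)"
 by (rule at_within_open) (use y in "auto intro: open_Times")
 ultimately show ?thesis by (simp add: case_prod_beta' blinfun_mult_right.rep_eq)
 qed

 \<comment> \<open>The surface does not belong to the open domain: \<open>J\<close> is
   differentiated along the curves lowered by \<open>c\<close>, and \<open>c\<close> tends to zero.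
   The condition on the surface makes the limit of the integrand vanish.\<close>
 have top_const: "J b (et b) = J a (et a)" if ab: "a <= b" for a b
 proof -
 obtain x0 where x0: "x0 \<in> {a..b}" "\<forall>x\<in>{a..b}. et x0 <= et x"
 using continuous_attains_inf[OF compact_Icc _ continuous_on_subset[OF eta(1)], of a b] ab by auto
 \<comment> \<open>Lowering by less than the smallest depth over the interval keeps the whole curve
   above the bottom.\<close>
 define e where "e = et x0 + d"
 have e: "0 < e" "e <= et x + d" if "x \<in> {a..b}" for x using eta(2)[of x0] x0(2) that by (auto simp: e_def)
 have e0: "0 < e" using e(1)[of a] ab by simp
 let ?k = "%x c. f1 (x, et x - c) + f2 (x, et x - c) * et' x"
 let ?g = "%c. (J b (et b - c) - J a (et a - c)) - integral {a..b} (%x. ?k x c)"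
 have "?g 0 = 0"
 proof (rule vanish[OF _ _ e0])
 have "cts {0..e} (%c. J x (et x - c))" if "x \<in> {a..b}" for x
 by (rule Jcomp) (use e(2)[OF that] in "auto intro!: continuous_intros")
 from this[of a] this[of b] have Jab: "cts {0..e} (%c. J a (et a - c))" "cts {0..e} (%c. J b (et b - c))"
 using ab by auto
 have eta_snd: "cts X (%z. et (snd z))" "cts X (%z. et' (snd z))" for X :: "(real \<times> real) set"
 by (rule continuous_on_compose2[OF eta(1)]; auto intro!: continuous_intros) (rule continuous_on_compose2[OF eta(4)]; auto intro!: continuous_intros)
 have k1: "cts X (%z. f1 (snd z, et (snd z) - fst z))" for X
 by (rule continuous_on_compose2[OF fc(1)[of UNIV]]) (intro continuous_intros eta_snd, simp)
 have k2: "cts X (%z. f2 (snd z, et (snd z) - fst z))" for X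
 by (rule continuous_on_compose2[OF fc(2)[of UNIV]]) (intro continuous_intros eta_snd, simp)
 have "cts ({0..e} \<times> cbox a b) (%(c, x). ?k x c)" unfolding case_prod_beta'
 by (intro continuous_on_add continuous_on_mult k1 k2 eta_snd(2))
 hence "cts {0..e} (%c. integral (cbox a b) (%x. ?k x c))" by (rule integral_continuous_on_param)
 thus "cts {0..e} ?g" by (intro continuous_on_diff[OF continuous_on_diff[OF Jab(2,1)]]) simp
 fix c assume c: "0 < c" "c < e"
 have "integral {a..b} (%x. ?k x c) = J b (et b - c) - J a (et a - c)"
 proof (rule FTC_real[OF ab])
 fix x assume x: "x \<in> {a..b}"
 have O: "(x, et x - c) \<in> ?O" using e(2)[OF x] c by (auto simp: mem_fluid)
 have "((%x. (x, et x - c)) has_derivative (%s. (s, et' x * s))) (at x)"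
 by (rule has_derivative_eq_rhs[OF has_derivative_Pair[OF has_derivative_ident has_derivative_diff[OF eta(3)[unfolded has_field_derivative_def] has_derivative_const]]]) simp
 from has_derivative_compose[OF this J_der[OF O]]
 have "((%x. J x (et x - c)) has_derivative (%s. f1 (x, et x - c) * s + f2 (x, et x - c) * (et' x * s))) (at x)" by simp
 thus "((%x. J x (et x - c)) has_real_derivative ?k x c) (at x)"
 unfolding has_field_derivative_def by (rule has_derivative_eq_rhs) (simp add: fun_eq_iff algebra_simps)
 qed
 thus "?g c = 0" by simp
 qed
 moreover have "?k x 0 = 0" for x using top[of x] fF[of "(x, et x)"] eta(2)[of x] by (simp add: cl)
 ultimately show ?thesis by simp
 qed
 have top0: "J x (et x) = J 0 (et 0)" for x
 proof (cases "x <= 0")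
 case True
 from top_const[OF this] show ?thesis by (rule sym)
 next
 case False
 hence "0 <= x" by simp
 from top_const[OF this] show ?thesis .
 qed
 define ps where "ps z = J (fst z) (snd z) - J 0 (et 0)" for z
 have c: "cts (closure ?O) ps" unfolding ps_def[abs_def]
 by (rule continuous_on_diff[OF continuous_on_subset[OF Jc] continuous_on_const]) (auto simp: cl)
 have der: "(ps has_derivative (%(s, t). F1 z * s + F2 z * t)) (at z)" if z: "z \<in> ?O" for z
 proof -
 obtain x y where xy: "z = (x, y)" by (rule prod.exhaust)
 have e: "f1 (x, y) = F1 z" "f2 (x, y) = F2 z" unfolding xy by (rule fF[OF O_cl[OF z[unfolded xy]]])+
 note D = J_der[OF z[unfolded xy], unfolded e, folded xy]
 show ?thesis unfolding ps_def[abs_def]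
 by (rule has_derivative_eq_rhs[OF has_derivative_diff[OF D has_derivative_const]]) (simp add: fun_eq_iff)
 qed
 have top': "ps (x, et x) = 0" for x unfolding ps_def fst_conv snd_conv top0[of x] by simp
 have bot': "ps (x, - d) = - J 0 (et 0)" for x by (simp add: ps_def) (simp add: J_def)
 show ?thesis
 by (rule exI[of _ ps], rule exI[of _ "- J 0 (et 0)"], intro conjI ballI allI c der top' bot')
qed

text \<open>With zero horizontal weak derivative, the box integrals of horizontal differences
  vanish. Differentiation in the upper limit gives equality of the continuous values on interior
  lines, and continuity extends it to the closed strip. The one-variable derivative is recovered
  from the vertical weak derivative.\<close>

lemma profile_of_W1r:
 fixes f :: "real \<times> real => real"
 assumes p0: "p0 < 0" and l: "0 < l" and r: "1 <= r" and f: "cts (closure (strip p0)) f"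
 and W: "W1r r (strip p0) (cell l (strip p0)) f f1 f2" and z: "AE w in Leb. w \<in> strip p0 --> f1 w = 0"
 shows "\<exists>k k'. cts {p0..0} k & (\<forall>w\<in>closure (strip p0). f w = k (snd w)) & wder {p0<..<0} 1 k k' & Lr r {p0<..<0} k' &
 (AE w in Leb. w \<in> strip p0 --> f2 w = k' (snd w))"
proof -
 note cl = closure_strip[OF p0]
 have f0: "wder (strip p0) ex f (%w. 0)"
 proof (rule has_weak_deriv_cong_AE[OF _ _ z])
 show "wder (strip p0) ex f f1" using W by (simp add: W1r_def)
 qed simp
 have fS: "cts (strip p0) f" using W by (simp add: W1r_def)
 have open_eq: "f (b, y) - f (a, y) = 0" if ab: "a <= b" and y: "y \<in> {p0<..<0}" for a b y
 proof -
 \<comment> \<open>Midpoints, chosen so that \<open>p0 < c < y < e < 0\<close> holds and the boxes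
   between these levels lie in the strip.\<close>
 define c e where "c = (p0 + y) / 2" and "e = y / 2"
 have ce: "p0 < c" "c < y" "y < e" "e < 0" using y by (auto simp: c_def e_def)
 let ?k = "%y. f (b, y) - f (a, y)"
 have kc: "cts {c..e} ?k"
 by (intro continuous_intros continuous_on_compose2[OF fS]) (use ce in "auto simp: strip_def")
 have I: "integral {c..t} ?k = 0" if "t \<in> {c<..<e}" for t
 proof -
 have "cbox (a, c) (b, t) \<subseteq> strip p0" using ce that by (auto simp: strip_def mem_box Basis_prod_real)
 from weak_deriv_box(1)[OF open_strip fS ab _ this f0] that show ?thesis by simp
 qed
 have "((%t. integral {c..t} ?k) has_real_derivative ?k y) (at y within {c..e})"
 by (rule integral_has_real_derivative[OF kc]) (use ce in auto)
 hence "((%t. integral {c..t} ?k) has_real_derivative ?k y) (at y)" using ce by (simp add: at_within_Icc_at)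
 hence "((%t. 0) has_real_derivative ?k y) (at y)"
 by (rule has_field_derivative_transform_within_open[where S = "{c<..<e}"]) (use ce I in auto)
 from DERIV_unique[OF this DERIV_const] show ?thesis by simp
 qed
 have lc: "cts {p0..0} (%y. f (x, y))" for x
 by (rule continuous_on_compose2[OF f]) (auto intro!: continuous_intros simp: cl)
 have diff0: "f (b, y) - f (a, y) = 0" if "a <= b" "y \<in> {p0..0}" for a b y
 proof (rule continuous_constant_on_closure[of "{p0<..<0}" "%y. f (b, y) - f (a, y)"])
 show "cts (closure {p0<..<0}) (%y. f (b, y) - f (a, y))" using p0 by (simp add: continuous_on_diff lc)
 show "y \<in> closure {p0<..<0}" using p0 that by simp
 qed (rule open_eq[OF that(1)])
 define k where "k y = f (0, y)" for y
 have k: "f w = k (snd w)" if "w \<in> closure (strip p0)" for w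
 using diff0[of "fst w" 0 "snd w"] diff0[of 0 "fst w" "snd w"] that by (cases "fst w <= 0") (auto simp: k_def cl)
 have kc: "cts {p0..0} k" unfolding k_def by (rule lc)
 have "wder (strip p0) ey (%w. k (snd w)) f2"
 proof (rule has_weak_deriv_cong_AE)
 show "wder (strip p0) ey f f2" using W by (simp add: W1r_def)
 show "AE w in Leb. w \<in> strip p0 --> f w = k (snd w)"
 by (rule AE_I2, rule impI, rule k, rule subsetD[OF closure_subset])
 qed simp
 note kw = this
 have kc': "cts {p0<..<0} k" by (rule continuous_on_subset[OF kc]) auto
 obtain k' where k': "k' \<in> borel_measurable borel" "wder {p0<..<0} 1 k k'" "AE w in Leb. w \<in> strip p0 --> f2 w = k' (snd w)"
 using weak_deriv_of_snd[OF kc' kw[unfolded strip_def], folded strip_def] by blast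
 have "Lr r (cell l (strip p0)) (%w. k' (snd w))"
 proof (rule Lr_cong_AE)
 show "Lr r (cell l (strip p0)) f2" using W by (simp add: W1r_def)
 show "AE w in Leb. w \<in> cell l (strip p0) --> f2 w = k' (snd w)"
 using k'(3) by eventually_elim (auto simp: cell_def)
 qed (rule open_cell[OF open_strip])
 from Lr_snd_iff(2)[OF l r k'(1) this] have "Lr r {p0<..<0} k'" .
 note L = this
 show ?thesis by (rule exI[of _ k], rule exI[of _ k'], intro conjI ballI kc k k'(2,3) L)
qed

text \<open>Serves to compare two stream functions, or one with its translate, which agree on the
  surface and have the same vertical derivative.\<close>

lemma vertical_eq:
 fixes f g :: "real => real"
 assumes c: "cts {a..b} f" "cts {a..b} g"
 and d: "!!y. a < y ==> y < b ==> (f has_real_derivative k y) (at y)" "!!y. a < y ==> y < b ==> (g has_real_derivative k y) (at y)"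
 and b: "f b = g b" and ab: "a < b" and y: "y \<in> {a..b}"
 shows "f y = g y"
proof -
 have c': "cts {a..b} (%y. f y - g y)" by (intro continuous_intros c)
 have d': "((%y. f y - g y) has_real_derivative 0) (at y)" if "a < y" "y < b" for y
 using DERIV_diff[OF d(1)[OF that] d(2)[OF that]] by simp
 have "f y - g y = f a - g a" if "y \<in> {a..b}" for y
 by (rule DERIV_isconst2[OF ab c' d']) (use that in auto)
 from this[OF y] this[of b] ab b show ?thesis by simp
qed

section \<open>From the velocity to the stream function\<close>

lemma holder_bounded: "holder al S f ==> \<exists>B. \<forall>z\<in>closure S. abs (f z) <= B"
 by (auto simp: holder_def bounded_iff)

lemma per_W1_holder_W1r:
 assumes "per_W1_holder l r al (fluid d et) f" "cts UNIV et" "1 <= r"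
 shows "W1r r (fluid d et) (cell l (fluid d et)) f (wd (fluid d et) ex f) (wd (fluid d et) ey f)"
proof -
 let ?O = "fluid d et"
 have h: "holder al ?O f" and s: "sobolev 1 r ?O (cell l ?O) f" using assms(1) by (auto simp: per_W1_holder_def)
 obtain B where B: "\<forall>z\<in>closure ?O. abs (f z) <= B" using holder_bounded[OF h] by blast
 have oO: "open ?O" by (rule open_fluid[OF assms(2)])
 have sub: "cell l ?O \<subseteq> ?O" by (auto simp: cell_def)
 have c: "cts ?O f" using h closure_subset by (auto simp: holder_def intro: continuous_on_subset)
 have bd: "abs (f z) <= B" if "z \<in> cell l ?O" for z using B sub that closure_subset by blast
 have "\<exists>f1 f2. W1r r ?O (cell l ?O) f f1 f2"
 by (rule iffD1[OF sobolev1_iff_W1r[OF oO open_cell[OF oO] sub bounded_cell_fluid[OF assms(2)] assms(3) c bd] s])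
 thus ?thesis using W1r_wd(1) by blast
qed

lemma W1r_sqrt:
 assumes W: "W1r r S C rh rh1 rh2" and c: "0 < c" "!!z. z \<in> S ==> c <= rh z"
 shows "W1r r S C (%z. sqrt (rh z)) (%z. inverse (sqrt (rh z)) / 2 * rh1 z) (%z. inverse (sqrt (rh z)) / 2 * rh2 z)"
proof (rule W1r_compose[OF W, where V = "{c / 2<..}" and F = sqrt and F' = "%t. inverse (sqrt t) / 2" and M = "inverse (sqrt c)"])
 show "rh z \<in> {c / 2<..}" if "z \<in> S" for z using c(2)[OF that] c(1) by auto
 show "(sqrt has_real_derivative inverse (sqrt t) / 2) (at t)" if "t \<in> {c / 2<..}" for t
 using that c(1) by (intro DERIV_real_sqrt) auto
 show "cts {c / 2<..} (%t. inverse (sqrt t) / 2)" using c(1) by (auto intro!: continuous_intros)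
 fix z assume "z \<in> C"
 hence z: "c <= rh z" using W c(2)[of z] unfolding W1r_def by blast
 have "inverse (sqrt (rh z)) <= inverse (sqrt c)" by (rule le_imp_inverse_le) (use z c(1) in auto)
 moreover have "0 <= inverse (sqrt (rh z))" using z c(1) by simp
 moreover have "abs (x / 2) <= y" if "x <= y" "0 <= x" for x y :: real using that by linarith
 ultimately show "abs (inverse (sqrt (rh z)) / 2) <= inverse (sqrt c)" by blast
qed auto

text \<open>\<open>s\<close> is the square root of the density, and the left side of the conclusion
  is the Laplacian of the stream function. Eliminating \<open>P2\<close> between the vertical
  derivative of the energy and the second momentum equation leaves the common factor
  \<open>s * U\<close>, which is nonzero; division by it gives \<open>be\<close>.\<close>

lemma stream_identity:
 fixes s :: real
 assumes s: "0 < s" "s\<^sup>2 = rh" and U: "U ~= 0"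
 and r: "rh1 = - (- (s * v)) * R'" "rh2 = - (s * U) * R'"
 and E: "- (s * U) * - be = P2 + rh * (U * U2 + v * v2) + rh2 * ((U\<^sup>2 + v\<^sup>2) / 2) + g * (rh + y * rh2)"
 and eu: "rh * U * v1 + rh * v * v2 = - P2 - g * rh"
 shows "- (v * (inverse s / 2 * rh1) + s * v1) + (U * (inverse s / 2 * rh2) + s * U2) = g * y * R' + be"
proof -
 define A where "A = (U\<^sup>2 + v\<^sup>2) / 2"
 have "rh * (U * U2 + v * v2) = rh * U * U2 + (- P2 - g * rh - rh * U * v1)" using eu by (simp add: algebra_simps)
 hence "s * U * be = rh * U * U2 - rh * U * v1 + rh2 * A + g * (y * rh2)" using E[folded A_def] by (simp add: algebra_simps)
 also have "... = s * U * (s * (U2 - v1) - R' * (A + g * y))" unfolding s(2)[symmetric] r by (simp add: algebra_simps power2_eq_square)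
 finally have be: "be = s * (U2 - v1) - R' * (A + g * y)" using s(1) U by simp
 have k: "inverse s / 2 * rh1 = v * R' / 2" "inverse s / 2 * rh2 = - (U * R') / 2" unfolding r using s(1) by (simp_all add: field_simps)
 show ?thesis unfolding k be A_def by (simp add: field_simps power2_eq_square)
qed

context hodo
begin

text \<open>By assumption the gradient of \<open>f\<close> is parallel to that of \<open>ps\<close>.
  In strip coordinates this combination is, up to the factor \<open>psy\<close>, the horizontal
  derivative, so \<open>f\<close> depends on the level alone. It is applied to the density and to
  the Bernoulli energy.\<close>

lemma transport_profile:
 assumes l: "0 < l" and r: "1 <= r" and W: "W1r r OM (cell l OM) f f1 f2" and c: "cts (closure OM) f"
 and tr: "AE z in Leb. z \<in> OM --> psy z * f1 z = psx z * f2 z"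
 shows "\<exists>k k'. cts {p0..0} k & (\<forall>z\<in>closure OM. f z = k (- ps z)) & wder {p0<..<0} 1 k k' & Lr r {p0<..<0} k' &
 (AE z in Leb. z \<in> OM --> f1 z = - psx z * k' (- ps z) & f2 z = - psy z * k' (- ps z))"
proof -
 have fG: "cts (closure S) (%w. f (G w))"
 by (rule continuous_on_compose2[OF c G_cont]) (auto intro: G_cl)
 have "AE w in Leb. w \<in> S --> f1 (G w) + hq w * f2 (G w) = 0"
 using AE_to_strip[OF tr]
 proof eventually_elim
 case (elim w)
 show ?case
 proof
 assume w: "w \<in> S"
 have py: "psy (G w) ~= 0" using psy_le[OF G_cl[OF S_cl[OF w]]] M by auto
 have "psy (G w) * (f1 (G w) + hq w * f2 (G w)) = psy (G w) * f1 (G w) - psx (G w) * f2 (G w)"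
 unfolding h_via_psi(1)[OF S_cl[OF w]] using py by (simp add: field_simps)
 thus "f1 (G w) + hq w * f2 (G w) = 0" using elim w py by simp
 qed
 qed
 from profile_of_W1r[OF p0 l r fG W1r_to_strip[OF W] this]
 obtain k k' where k: "cts {p0..0} k" "\<forall>w\<in>closure S. f (G w) = k (snd w)" "wder {p0<..<0} 1 k k'" "Lr r {p0<..<0} k'"
 by blast
 have fk: "f z = k (- ps z)" if "z \<in> closure OM" for z
 using bspec[OF k(2) H_cl[OF that]] GH[OF that] by (simp add: H_def)
 have "W1r r OM (cell l OM) (%z. k (- ps z)) f1 f2" by (rule W1r_cong[OF W]) (simp add: fk O_cl)
 from W1r_unique[OF this W1r_profile[OF l r k(1,3,4)]] show ?thesis using k fk by blast
qed

text \<open>\<open>R\<close> is the profile of the density and \<open>- be\<close> the derivative of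
  the profile of the energy; the vertical derivative of the energy then gives the interior equation.
  Periodicity of \<open>ps\<close> is not part of its construction: it follows from the period of
  its vertical derivative and from its zero value on the surface.\<close>

lemma stream_of_velocity:
 assumes pos: "0 < g" "0 < rh0" "0 < \<sigma>" and l: "0 < l" and r: "1 <= r" and al: "al = (r - 1) / r"
 and vc: "velocity_class d l r al U v P rh et" and vp: "velocity_problem g d \<sigma> rh0 l U v P rh et"
 and px: "!!z. z \<in> closure OM ==> psx z = - (sqrt (rh z) * v z)" and py: "!!z. z \<in> closure OM ==> psy z = sqrt (rh z) * U z"
 and hxy: "holder al OM psx" "holder al OM psy"
 shows "\<exists>R be. velocity_to_stream g d U v P rh et p0 R be ps & stream_class d l r al p0 R be ps et & stream_problem g d \<sigma> rh0 l p0 R be ps et"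
proof -
 let ?wx = "wd OM ex" and ?wy = "wd OM ey"
 have per: "per_W2 l r et" and pU: "per_W1_holder l r al OM U" and pv: "per_W1_holder l r al OM v"
 and pP: "per_W1_holder l r al OM P" and prh: "per_W1_holder l r al OM rh" using vc by (auto simp: velocity_class_def)
 note vp = vp[unfolded velocity_problem_def Let_def]
 have eta_per: "et (x + l) = et x" for x using per by (simp add: per_W2_def)
 note WU = per_W1_holder_W1r[OF pU eta(1) r] note Wv = per_W1_holder_W1r[OF pv eta(1) r]
 note WP = per_W1_holder_W1r[OF pP eta(1) r] note Wrh = per_W1_holder_W1r[OF prh eta(1) r]
 have hU: "holder al OM U" and hv: "holder al OM v" and hP: "holder al OM P" and hrh: "holder al OM rh"
 using pU pv pP prh by (auto simp: per_W1_holder_def)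
 have rh_ge: "rh0 <= rh z" if "z \<in> closure OM" for z using vp that by blast
 have sq: "0 < sqrt (rh z)" "(sqrt (rh z))\<^sup>2 = rh z" if "z \<in> closure OM" for z using rh_ge[OF that] pos(2) by auto
 have U0: "U z ~= 0" if "z \<in> closure OM" for z using psy_le[OF that] py[OF that] M by auto
 have cell_cl: "z \<in> closure OM" if "z \<in> cell l OM" for z using that cO_sub(1) O_cl by blast
 have bd: "\<exists>B. \<forall>z\<in>cell l OM. abs (f z) <= B" if "holder al OM f" for f using holder_bounded[OF that] cell_cl by blast
 define q where "q z = 1 / 2 * (U z * U z) + 1 / 2 * (v z * v z)" for z
 have hq: "holder al OM q" unfolding q_def[abs_def] by (intro holder_lin holder_mult hU hv)
 obtain BU where BU: "\<forall>z\<in>cell l OM. abs (U z) <= BU" using bd[OF hU] by blast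
 obtain Bv where Bv: "\<forall>z\<in>cell l OM. abs (v z) <= Bv" using bd[OF hv] by blast
 obtain Brh where Brh: "\<forall>z\<in>cell l OM. abs (rh z) <= Brh" using bd[OF hrh] by blast
 obtain Bq where Bq: "\<forall>z\<in>cell l OM. abs (q z) <= Bq" using bd[OF hq] by blast
 obtain Be where Be: "!!x. abs (et x) <= Be" by (rule periodic_bounded[OF eta(1) eta_per l]) (rule that)
 have al01: "0 <= al" "al <= 1" using r by (auto simp: al divide_simps)
 have hsnd: "holder al OM snd" by (rule holder_snd_fluid[OF al01 Be])
 obtain Bs where Bs: "\<forall>z\<in>cell l OM. abs (snd z) <= Bs" using bd[OF hsnd] by blast
 have hsq: "holder al OM (%z. sqrt (rh z))"
 by (rule holder_lipschitz_compose[OF hrh, where X = "{rh0..}" and L = "1 / sqrt rh0"])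
 (use sqrt_lipschitz[OF pos(2)] rh_ge in auto)
 obtain Bsq where Bsq: "\<forall>z\<in>cell l OM. abs (sqrt (rh z)) <= Bsq" using bd[OF hsq] by blast
 define en where "en = energy g U v P rh"
 have en: "en z = 1 * (1 * P z + 1 * (rh z * q z)) + g * (rh z * snd z)" for z
 by (simp add: en_def energy_def q_def power2_eq_square algebra_simps)
 have cen: "cts (closure OM) en"
 unfolding en[abs_def] using hP hrh hq by (intro continuous_intros) (auto simp: holder_def)
 have Ws: "W1r r OM (cell l OM) (%z. sqrt (rh z)) (%z. inverse (sqrt (rh z)) / 2 * ?wx rh z) (%z. inverse (sqrt (rh z)) / 2 * ?wy rh z)"
 by (rule W1r_sqrt[OF Wrh pos(2)]) (rule rh_ge[OF O_cl])
 have Wpy: "W1r r OM (cell l OM) psy (%z. U z * (inverse (sqrt (rh z)) / 2 * ?wx rh z) + sqrt (rh z) * ?wx U z)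
 (%z. U z * (inverse (sqrt (rh z)) / 2 * ?wy rh z) + sqrt (rh z) * ?wy U z)"
 by (rule W1r_cong[OF W1r_mult[OF Ws WU]]) (use BU Bsq py O_cl in auto)
 have Wsv: "W1r r OM (cell l OM) (%z. sqrt (rh z) * v z) (%z. v z * (inverse (sqrt (rh z)) / 2 * ?wx rh z) + sqrt (rh z) * ?wx v z)
 (%z. v z * (inverse (sqrt (rh z)) / 2 * ?wy rh z) + sqrt (rh z) * ?wy v z)"
 by (rule W1r_mult[OF Ws Wv]) (use Bv Bsq in auto)
 note Wpx = W1r_cong[OF W1r_lin[OF Wsv Wsv, of "- 1" 0], of psx]
 have Wpx: "W1r r OM (cell l OM) psx (%z. - 1 * (v z * (inverse (sqrt (rh z)) / 2 * ?wx rh z) + sqrt (rh z) * ?wx v z) + 0 * (v z * (inverse (sqrt (rh z)) / 2 * ?wx rh z) + sqrt (rh z) * ?wx v z))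
 (%z. - 1 * (v z * (inverse (sqrt (rh z)) / 2 * ?wy rh z) + sqrt (rh z) * ?wy v z) + 0 * (v z * (inverse (sqrt (rh z)) / 2 * ?wy rh z) + sqrt (rh z) * ?wy v z))"
 by (rule Wpx) (simp add: px O_cl)
 have Wq: "W1r r OM (cell l OM) q (%z. 1 / 2 * (U z * ?wx U z + U z * ?wx U z) + 1 / 2 * (v z * ?wx v z + v z * ?wx v z))
 (%z. 1 / 2 * (U z * ?wy U z + U z * ?wy U z) + 1 / 2 * (v z * ?wy v z + v z * ?wy v z))"
 unfolding q_def[abs_def] by (intro W1r_lin W1r_mult[OF WU WU, of BU BU] W1r_mult[OF Wv Wv, of Bv Bv]) (use BU Bv in auto)
 define e where "e b z = 1 * (1 * wd OM b P z + 1 * (q z * wd OM b rh z + rh z * (1 / 2 * (U z * wd OM b U z + U z * wd OM b U z) + 1 / 2 * (v z * wd OM b v z + v z * wd OM b v z))))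
 + g * (snd z * wd OM b rh z + rh z * snd b)" for b z
 have We: "W1r r OM (cell l OM) en (e ex) (e ey)"
 unfolding en[abs_def] e_def[abs_def] snd_conv
 by (intro W1r_lin WP W1r_mult[OF Wrh Wq, of Brh Bq] W1r_mult[OF Wrh W1r_snd_fluid[OF r], of Brh Bs]) (use Brh Bq Bs in auto)
 have e: "e b z = wd OM b P z + rh z * (U z * wd OM b U z + v z * wd OM b v z) + wd OM b rh z * (((U z)\<^sup>2 + (v z)\<^sup>2) / 2) + g * (rh z * snd b + snd z * wd OM b rh z)" for b z
 unfolding e_def q_def by (simp add: field_simps power2_eq_square)
 have eul: "AE z in Leb. z \<in> OM -->
 rh z * U z * ?wx U z + rh z * v z * ?wy U z = - ?wx P z &
 rh z * U z * ?wx v z + rh z * v z * ?wy v z = - ?wy P z - g * rh z &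
 U z * ?wx rh z + v z * ?wy rh z = 0 & ?wx U z + ?wy v z = 0"
 using vp unfolding AE_lebesgue_on_open_iff[OF oO] by blast
 have "AE z in Leb. z \<in> OM --> psy z * ?wx rh z = psx z * ?wy rh z"
 using eul
 proof eventually_elim
 case (elim z)
 show ?case
 proof
 assume z: "z \<in> OM"
 have "U z * ?wx rh z = - v z * ?wy rh z" using elim z by (simp add: eq_neg_iff_add_eq_0)
 thus "psy z * ?wx rh z = psx z * ?wy rh z" unfolding px[OF O_cl[OF z]] py[OF O_cl[OF z]] by (simp add: mult.assoc)
 qed
 qed
 from transport_profile[OF l r Wrh _ this] hrh
 obtain R R1 where R: "cts {p0..0} R" "\<forall>z\<in>closure OM. rh z = R (- ps z)" "wder {p0<..<0} 1 R R1" "Lr r {p0<..<0} R1"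
 unfolding holder_def by blast
 have "AE z in Leb. z \<in> OM --> psy z * e ex z = psx z * e ey z"
 using eul
 proof eventually_elim
 case (elim z)
 show ?case
 proof
 assume z: "z \<in> OM"
 have A: "rh z * U z * ?wx U z + rh z * v z * ?wy U z = - ?wx P z" "rh z * U z * ?wx v z + rh z * v z * ?wy v z = - ?wy P z - g * rh z"
 "U z * ?wx rh z + v z * ?wy rh z = 0" using elim z by auto
 \<comment> \<open>The derivative of the energy along the flow is the sum of the momentum equations
   weighted by the velocity components, plus a multiple of the density equation.\<close>
 have "U z * e ex z + v z * e ey z = U z * (?wx P z + (rh z * U z * ?wx U z + rh z * v z * ?wy U z)) + v z * (?wy P z + g * rh z + (rh z * U z * ?wx v z + rh z * v z * ?wy v z))
 + (U z * ?wx rh z + v z * ?wy rh z) * (((U z)\<^sup>2 + (v z)\<^sup>2) / 2 + g * snd z)"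
 unfolding e by (simp add: algebra_simps add_divide_distrib)
 hence "U z * e ex z = - v z * e ey z" unfolding A by simp
 thus "psy z * e ex z = psx z * e ey z" unfolding px[OF O_cl[OF z]] py[OF O_cl[OF z]] by (simp add: mult.assoc)
 qed
 qed
 from transport_profile[OF l r We cen this]
 obtain E E1 where E: "cts {p0..0} E" "\<forall>z\<in>closure OM. en z = E (- ps z)" "wder {p0<..<0} 1 E E1" "Lr r {p0<..<0} E1"
 and eE: "AE z in Leb. z \<in> OM --> e ex z = - psx z * E1 (- ps z) & e ey z = - psy z * E1 (- ps z)" by blast
 define be where "be p = - E1 p" for p
 have Lbe: "Lr r {p0<..<0} be" using Lr_mult_bounded[OF _ E(4) r, of "%p. - 1" 1] by (simp add: be_def[abs_def])
 have dc: "data_class r p0 R be"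
 proof -
 have "bounded (R ` {p0..0})" by (intro compact_imp_bounded compact_continuous_image R) auto
 then obtain BR where BR: "!!p. p \<in> {p0..0} ==> abs (R p) <= BR" unfolding bounded_iff by (metis image_eqI real_norm_def)
 have c: "cts {p0<..<0} R" by (rule continuous_on_subset[OF R(1)]) auto
 have "Lr r {p0<..<0} R" by (rule Lr_bounded_continuous[OF _ _ c _ r, of BR]) (use BR in auto)
 moreover have "loc_int {p0<..<0} R1" using R(3) by (simp add: has_weak_deriv_def)
 ultimately show ?thesis unfolding data_class_def One_nat_def sobolev.simps
 using R Lbe locally_integrable_continuous[OF c] by auto
 qed
 define R' where "R' = wd {p0<..<0} 1 R"
 note dR = data_class_wd[OF dc, folded R'_def]
 have "W1r r OM (cell l OM) rh (%z. - psx z * R' (- ps z)) (%z. - psy z * R' (- ps z))"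
 by (rule W1r_cong[OF W1r_profile[OF l r R(1) dR]]) (simp add: R(2) O_cl)
 note rhR = W1r_unique[OF Wrh this]
 have lap: "AE z in Leb. z \<in> OM --> wd OM ex (pd ex ps) z + wd OM ey (pd ey ps) z = g * snd z * R' (- ps z) + be (- ps z)"
 using eul eE rhR W1r_wd(2)[OF iffD1[OF W1r_psi_pd(1) Wpx]] W1r_wd(2)[OF iffD1[OF W1r_psi_pd(2) Wpy]]
 proof eventually_elim
 case (elim z)
 show ?case
 proof
 assume z: "z \<in> OM"
 note z' = O_cl[OF z]
 note f = elim[rule_format, OF z]
 have r12: "?wx rh z = - (- (sqrt (rh z) * v z)) * R' (- ps z)" "?wy rh z = - (sqrt (rh z) * U z) * R' (- ps z)"
 using f px[OF z'] py[OF z'] by simp_all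
 have E2: "- (sqrt (rh z) * U z) * - be (- ps z) = ?wy P z + rh z * (U z * ?wy U z + v z * ?wy v z) + ?wy rh z * (((U z)\<^sup>2 + (v z)\<^sup>2) / 2) + g * (rh z + snd z * ?wy rh z)"
 using f py[OF z'] e[of ey z] by (simp add: be_def)
 have eu: "rh z * U z * ?wx v z + rh z * v z * ?wy v z = - ?wy P z - g * rh z" using f by blast
 from stream_identity[OF sq[OF z'] U0[OF z'] r12 E2 eu]
 show "wd OM ex (pd ex ps) z + wd OM ey (pd ey ps) z = g * snd z * R' (- ps z) + be (- ps z)"
 using f by simp
 qed
 qed
 have grad: "(psx z)\<^sup>2 + (psy z)\<^sup>2 = 2 * (E (- ps z) - P z - g * rh z * snd z)" if z: "z \<in> closure OM" for z
 proof -
 have "(psx z)\<^sup>2 + (psy z)\<^sup>2 = (sqrt (rh z))\<^sup>2 * ((U z)\<^sup>2 + (v z)\<^sup>2)" unfolding px[OF z] py[OF z] by (simp add: power_mult_distrib algebra_simps)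
 moreover have "E (- ps z) = P z + rh z * (((U z)\<^sup>2 + (v z)\<^sup>2) / 2) + g * rh z * snd z" using E(2) z by (simp add: en_def energy_def)
 ultimately show ?thesis unfolding sq(2)[OF z] by (simp add: field_simps)
 qed
 have R0: "rh (x, et x) = R 0" for x using R(2) top_cl by (simp add: psi_top)
 have R_ge: "rh0 <= R p" if "p \<in> {p0..0}" for p
 proof -
 have w: "(0, p) \<in> closure S" using that by (simp add: clS)
 have "- ps (G (0, p)) = p" using arg_cong[OF HG[OF w], of snd] by (simp add: H_def)
 thus ?thesis using rh_ge[OF G_cl[OF w]] R(2) G_cl[OF w] by simp
 qed
 \<comment> \<open>On the surface the energy has the constant value \<open>E 0\<close>, so the
   capillary law becomes the surface condition with the constant \<open>2 * E 0\<close>. That this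
   constant is the prescribed mean follows from the zero mean of \<open>et\<close>.\<close>
 have AEs: "AE x in Leb. (psx (x, et x))\<^sup>2 + (psy (x, et x))\<^sup>2 - 2 * \<sigma> * deriv2 et x / (1 + (deriv et x)\<^sup>2) powr (3/2) + 2 * (g * R 0) * et x = 2 * E 0"
 proof -
 have "AE x in Leb. P (x, et x) = - (\<sigma> * deriv2 et x / (1 + (deriv et x)\<^sup>2) powr (3/2))" using vp by blast
 thus ?thesis
 proof eventually_elim
 case (elim x)
 have "2 * \<sigma> * deriv2 et x / (1 + (deriv et x)\<^sup>2) powr (3/2) = 2 * (\<sigma> * deriv2 et x / (1 + (deriv et x)\<^sup>2) powr (3/2))" by simp
 moreover have "... = - 2 * P (x, et x)" unfolding elim by simp
 ultimately have "2 * \<sigma> * deriv2 et x / (1 + (deriv et x)\<^sup>2) powr (3/2) = - 2 * P (x, et x)" by (rule trans)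
 thus ?case using grad[OF top_cl[of x]] by (simp add: R0 psi_top algebra_simps)
 qed
 qed
 have sg: "surface_grad_sq d ps et = (%x. (psx (x, et x))\<^sup>2 + (psy (x, et x))\<^sup>2)" by (rule ext) (rule surface_grad_psx)
 have "0 < R 0" using R_ge[of 0] p0 pos(2) by auto
 moreover have "integral {0..l} et = 0" using vp by blast
 ultimately have "integral {0..l} (surface_grad_sq d ps et) = l * (2 * E 0)"
 using mean_eta_zero[OF l per pos(3) _ AEs] pos(1) by (simp add: sg)
 hence Q: "(1 / l) * integral {0..l} (surface_grad_sq d ps et) = 2 * E 0" using l by simp
 have AEs': "AE x in Leb. surface_grad_sq d ps et x - 2 * \<sigma> * deriv2 et x / (1 + (deriv et x)\<^sup>2) powr (3/2) + 2 * g * R 0 * et x = 2 * E 0"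
 using AEs by eventually_elim (simp add: surface_grad_psx mult.assoc)
 have sup: "(SUP z\<in>OM. pd ey ps z) < 0"
 proof -
 have "OM ~= {}" using G_S[of "(0, p0 / 2)"] p0 by (auto simp: memS)
 moreover have "pd ey ps z <= - (1 / M)" if "z \<in> OM" for z using psy_le[OF O_cl[OF that]] pd_psi(2)[OF that] by simp
 ultimately have "(SUP z\<in>OM. pd ey ps z) <= - (1 / M)" by (intro cSUP_least) auto
 also have "... < 0" using M by simp
 finally show ?thesis .
 qed
 have sp: "stream_problem g d \<sigma> rh0 l p0 R be ps et" unfolding stream_problem_def Let_def Q AE_lebesgue_on_open_iff[OF oO] R'_def[symmetric]
 by (intro conjI lap AEs' sup allI psi_top psi_bot ballI R_ge)

 have psi_per: "periodic_on l (closure OM) ps" unfolding periodic_on_def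
 proof (clarify)
 fix x y assume xy: "(x, y) \<in> closure OM"
 have cl': "(x', t) \<in> closure OM" if "et x' = et x" "t \<in> {- d..et x}" for x' t using that by (auto simp: clO)
 have line: "cts {- d..et x} (%t. ps (x', t))" if "et x' = et x" for x'
 by (rule continuous_on_compose2[OF psi_cont]) (use cl'[OF that] in "auto intro!: continuous_intros")
 have der: "((%t. ps (x', t)) has_real_derivative psy (x', t)) (at t)" if "et x' = et x" "- d < t" "t < et x" for x' t
 proof -
 have O: "(x', t) \<in> OM" using that by (auto simp: mem_fluid)
 have "ps differentiable (at (x', t))" using psi_der[OF O] by (auto simp: differentiable_def)
 from C1_on_lines(2)[OF this] show ?thesis by (simp add: pd_psi[OF O])
 qed
 have pyp: "psy (x + l, t) = psy (x, t)" if "t \<in> {- d..et x}" for t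
 proof -
 have "rh (x + l, t) = rh (x, t)" "U (x + l, t) = U (x, t)"
 using pU prh cl'[OF refl that] by (auto simp: per_W1_holder_def periodic_on_def)
 thus ?thesis using py[OF cl'[OF refl that]] py[OF cl'[OF eta_per that]] by simp
 qed
 show "ps (x + l, y) = ps (x, y)"
 proof (rule vertical_eq[OF line[OF eta_per] line[OF refl] _ der[OF refl]])
 show "((%t. ps (x + l, t)) has_real_derivative psy (x, t)) (at t)" if "- d < t" "t < et x" for t
 using der[OF eta_per that] pyp[of t] that by simp
 show "ps (x + l, et x) = ps (x, et x)" using psi_top[of x] psi_top[of "x + l"] by (simp add: eta_per)
 qed (use eta(2)[of x] xy in "auto simp: clO")
 qed
 have sc: "stream_class d l r al p0 R be ps et" unfolding stream_class_def
 by (intro conjI allI per eta(2) dc class_psiI[OF r hxy psi_per Wpx Wpy])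

 have vs: "velocity_to_stream g d U v P rh et p0 R be ps" unfolding velocity_to_stream_def
 proof (intro conjI)
 show "\<forall>z\<in>OM. (ps has_derivative (%(a, b). - sqrt (rh z) * v z * a + sqrt (rh z) * U z * b)) (at z)"
 using psi_der px py O_cl by (auto simp: case_prod_beta')
 show "\<forall>(q, p)\<in>closure S. (rh \<circ> inv_hodograph d et ps) (q, p) = R p"
 proof (clarify)
 fix q p assume w: "(q, p) \<in> closure S"
 show "(rh \<circ> inv_hodograph d et ps) (q, p) = R p"
 using inv_hodograph[OF w] HG[OF w] bspec[OF R(2) G_cl[OF w]] by (simp add: H_def)
 qed
 show "wder S ey (energy g U v P rh \<circ> inv_hodograph d et ps) (%(q, p). - be p)"
 proof (rule has_weak_deriv_cong_AE)
 show "wder S ey (%z. E (snd z)) (%z. E1 (snd z))" unfolding strip_def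
 by (rule weak_deriv_snd(1)[OF open_greaterThanLessThan continuous_on_subset[OF E(1)] E(3)]) auto
 have "E (snd w) = (energy g U v P rh \<circ> inv_hodograph d et ps) w" if "w \<in> S" for w
 proof -
 have w: "w \<in> closure S" using that by (rule S_cl)
 have "- ps (G w) = snd w" using arg_cong[OF HG[OF w], of snd] by (simp add: H_def)
 thus ?thesis using inv_hodograph[OF w] bspec[OF E(2) G_cl[OF w]] by (simp add: en_def)
 qed
 thus "AE z in Leb. z \<in> S --> E (snd z) = (energy g U v P rh \<circ> inv_hodograph d et ps) z" by simp
 qed (auto simp: be_def)
 qed (use psi_cont psi_top psi_bot bij in auto)
 show ?thesis using vs sc sp by blast
qed

end

text \<open>Two candidates have the same vertical derivative and vanish on the surface, so they
  coincide; hence so do the bottom value, the inverse hodograph map and the density profile.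
  \<open>be\<close> is prescribed only as a weak derivative and is therefore determined almost
  everywhere, by uniqueness for the continuous energy.\<close>

lemma velocity_to_stream_unique:
 assumes eta: "cts UNIV et" "!!x. - d < et x" and p0: "p0 < 0"
 and A: "velocity_to_stream g d U v P rh et p0 R be ps" and B: "velocity_to_stream g d U v P rh et p1 R1 be1 ps1"
 and c: "cts (strip p0) (energy g U v P rh \<circ> inv_hodograph d et ps)"
 shows "p1 = p0 & (\<forall>z\<in>closure (fluid d et). ps1 z = ps z) & (\<forall>p\<in>{p0..0}. R1 p = R p) & (AE p in lebesgue_on {p0<..<0}. be1 p = be p)"
proof -
 let ?O = "fluid d et"
 note cl = closure_fluid[OF eta]
 have line: "cts {- d..et x} (%t. f (x, t))" if "cts (closure ?O) f" for f :: "real \<times> real => real" and x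
 by (rule continuous_on_compose2[OF that]) (auto intro!: continuous_intros simp: cl)
 have der: "((%t. f (x, t)) has_real_derivative sqrt (rh (x, t)) * U (x, t)) (at t)"
 if "\<forall>z\<in>?O. (f has_derivative (%(a, b). - sqrt (rh z) * v z * a + sqrt (rh z) * U z * b)) (at z)" "- d < t" "t < et x" for f x t
 proof -
 have D: "(f has_derivative (%(a, b). - sqrt (rh (x, t)) * v (x, t) * a + sqrt (rh (x, t)) * U (x, t) * b)) (at (x, t))"
 using that by (auto simp: mem_fluid)
 have "f differentiable (at (x, t))" using D by (auto simp: differentiable_def)
 from C1_on_lines(2)[OF this] show ?thesis using pd_eqI[OF D, of ey] by simp
 qed
 have a: "cts (closure ?O) ps" "\<forall>z\<in>?O. (ps has_derivative (%(a, b). - sqrt (rh z) * v z * a + sqrt (rh z) * U z * b)) (at z)" "\<forall>x. ps (x, et x) = 0" "\<forall>x. p0 = - ps (x, - d)"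
 "\<forall>(q, p)\<in>closure (strip p0). (rh \<circ> inv_hodograph d et ps) (q, p) = R p" "wder (strip p0) ey (energy g U v P rh \<circ> inv_hodograph d et ps) (%(q, p). - be p)"
 using A unfolding velocity_to_stream_def by blast+
 have b: "cts (closure ?O) ps1" "\<forall>z\<in>?O. (ps1 has_derivative (%(a, b). - sqrt (rh z) * v z * a + sqrt (rh z) * U z * b)) (at z)" "\<forall>x. ps1 (x, et x) = 0" "\<forall>x. p1 = - ps1 (x, - d)"
 "\<forall>(q, p)\<in>closure (strip p1). (rh \<circ> inv_hodograph d et ps1) (q, p) = R1 p" "wder (strip p1) ey (energy g U v P rh \<circ> inv_hodograph d et ps1) (%(q, p). - be1 p)"
 using B unfolding velocity_to_stream_def by blast+
 have eq: "ps1 z = ps z" if "z \<in> closure ?O" for z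
 proof -
 obtain x y where z: "z = (x, y)" by (cases z)
 show ?thesis unfolding z
 by (rule vertical_eq[OF line[OF b(1)] line[OF a(1)] der[OF b(2)] der[OF a(2)]])
 (use a(3) b(3) eta(2)[of x] that z in "auto simp: cl")
 qed
 have "ps1 (0, - d) = ps (0, - d)" by (rule eq) (use eta(2)[of 0] in "simp add: cl")
 hence p1: "p1 = p0" using a(4)[rule_format, of 0] b(4)[rule_format, of 0] by simp
 \<comment> \<open>\<open>inv_into\<close> is defined by choice from the preimages in the closure;
   these sets of preimages coincide for both maps.\<close>
 have inv: "inv_hodograph d et ps1 = inv_hodograph d et ps"
 proof
 fix w
 have "z \<in> closure ?O & hodograph ps1 z = w \<longleftrightarrow> z \<in> closure ?O & hodograph ps z = w" for z using eq[of z] by (auto simp: hodograph_def)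
 thus "inv_hodograph d et ps1 w = inv_hodograph d et ps w" unfolding inv_into_def by presburger
 qed
 have "R1 p = R p" if "p \<in> {p0..0}" for p
 using bspec[OF a(5), of "(0, p)"] bspec[OF b(5), of "(0, p)"] that by (simp add: p1 inv closure_strip[OF p0])
 moreover have "AE p in lebesgue_on {p0<..<0}. be1 p = be p"
 proof -
 have "AE z in Leb. z \<in> strip p0 --> (%(q, p). - be1 p) z = (%(q, p). - be p) z"
 by (rule has_weak_deriv_unique[OF open_strip c _ b(6)[unfolded p1 inv] a(6)]) (simp add: ex_ey_Basis)
 hence "AE z in Leb. z \<in> (UNIV :: real set) \<times> {p0<..<0} --> be1 (snd z) = be (snd z)"
 by (simp add: strip_def case_prod_beta')
 thus ?thesis unfolding AE_lebesgue_on_open_iff[OF open_greaterThanLessThan] by (rule iffD1[OF AE_snd_iff[OF open_greaterThanLessThan, where P = "%p. be1 p = be p"]])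
 qed
 ultimately show ?thesis using p1 eq by blast
qed

text \<open>The level \<open>p0\<close> is known to be negative only after the stream function has
  been built: its vertical derivative is at most \<open>sqrt rh0\<close> times the negative supremum
  of \<open>U\<close>, so it decreases strictly from bottom to surface. The same bound lets the
  inverse shear be formed.\<close>

theorem velocity_to_stream_formulation:
 assumes pos: "0 < g" "0 < rh0" "0 < \<sigma>" and l: "0 < l" and r: "1 <= r" and al: "al = (r - 1) / r"
 and vc: "velocity_class d l r al U v P rh et" and vp: "velocity_problem g d \<sigma> rh0 l U v P rh et"
 shows "\<exists>p0 R be ps. p0 < 0 & velocity_to_stream g d U v P rh et p0 R be ps &
 stream_class d l r al p0 R be ps et & stream_problem g d \<sigma> rh0 l p0 R be ps et &
 (\<forall>p1 R1 be1 ps1. velocity_to_stream g d U v P rh et p1 R1 be1 ps1 -->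
 p1 = p0 & (\<forall>z\<in>closure (fluid d et). ps1 z = ps z) & (\<forall>p\<in>{p0..0}. R1 p = R p) & (AE p in lebesgue_on {p0<..<0}. be1 p = be p))"
proof -
 let ?O = "fluid d et"
 have per: "per_W2 l r et" and eta2: "!!x. - d < et x" and pU: "per_W1_holder l r al ?O U" and pv: "per_W1_holder l r al ?O v"
 and pP: "per_W1_holder l r al ?O P" and prh: "per_W1_holder l r al ?O rh" using vc by (auto simp: velocity_class_def)
 have eta1: "cts UNIV et" using per by (simp add: per_W2_def)
 note eta = eta1 eta2
 note cl = closure_fluid[OF eta]
 have oO: "open ?O" by (rule open_fluid[OF eta1])
 have O_cl: "z \<in> closure ?O" if "z \<in> ?O" for z using that closure_subset by blast
 note vp' = vp[unfolded velocity_problem_def Let_def]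
 note WU = per_W1_holder_W1r[OF pU eta1 r] note Wv = per_W1_holder_W1r[OF pv eta1 r] note Wrh = per_W1_holder_W1r[OF prh eta1 r]
 have hU: "holder al ?O U" and hv: "holder al ?O v" and hP: "holder al ?O P" and hrh: "holder al ?O rh"
 using pU pv pP prh by (auto simp: per_W1_holder_def)
 have rh_ge: "rh0 <= rh z" if "z \<in> closure ?O" for z using vp' that by blast
 have hsq: "holder al ?O (%z. sqrt (rh z))"
 by (rule holder_lipschitz_compose[OF hrh, where X = "{rh0..}" and L = "1 / sqrt rh0"])
 (use sqrt_lipschitz[OF pos(2)] rh_ge in auto)
 define F1 F2 where "F1 z = - 1 * (sqrt (rh z) * v z) + 0 * (sqrt (rh z) * v z)" and "F2 z = sqrt (rh z) * U z" for z
 have hF1: "holder al ?O F1" unfolding F1_def[abs_def] by (intro holder_lin holder_mult hsq hv)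
 have hF2: "holder al ?O F2" unfolding F2_def[abs_def] by (intro holder_mult hsq hU)
 obtain B1 where B1: "\<forall>z\<in>closure ?O. abs (F1 z) <= B1" using holder_bounded[OF hF1] by blast
 obtain B2 where B2: "\<forall>z\<in>closure ?O. abs (F2 z) <= B2" using holder_bounded[OF hF2] by blast
 have B2': "abs (F2 z) <= B2" if "z \<in> closure ?O" for z using B2 that by blast
 obtain BU where BU: "\<forall>z\<in>closure ?O. abs (U z) <= BU" using holder_bounded[OF hU] by blast
 obtain Bv where Bv: "\<forall>z\<in>closure ?O. abs (v z) <= Bv" using holder_bounded[OF hv] by blast
 obtain Bs where Bs: "\<forall>z\<in>closure ?O. abs (sqrt (rh z)) <= Bs" using holder_bounded[OF hsq] by blast
 have cell_cl: "z \<in> closure ?O" if "z \<in> cell l ?O" for z using that O_cl by (auto simp: cell_def)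
 let ?k = "%z. inverse (sqrt (rh z)) / 2"
 have Ws: "W1r r ?O (cell l ?O) (%z. sqrt (rh z)) (%z. ?k z * wd ?O ex rh z) (%z. ?k z * wd ?O ey rh z)"
 by (rule W1r_sqrt[OF Wrh pos(2)]) (rule rh_ge[OF O_cl])
 have WF2: "W1r r ?O (cell l ?O) F2 (%z. U z * (?k z * wd ?O ex rh z) + sqrt (rh z) * wd ?O ex U z) (%z. U z * (?k z * wd ?O ey rh z) + sqrt (rh z) * wd ?O ey U z)"
 unfolding F2_def[abs_def] by (rule W1r_mult[OF Ws WU]) (use Bs BU cell_cl in auto)
 have Wsv: "W1r r ?O (cell l ?O) (%z. sqrt (rh z) * v z) (%z. v z * (?k z * wd ?O ex rh z) + sqrt (rh z) * wd ?O ex v z) (%z. v z * (?k z * wd ?O ey rh z) + sqrt (rh z) * wd ?O ey v z)"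
 by (rule W1r_mult[OF Ws Wv]) (use Bs Bv cell_cl in auto)
 note WF1 = W1r_lin[OF Wsv Wsv, of "- 1" 0, folded F1_def]
 \<comment> \<open>Incompressibility times the square root of the density plus the density equation
   times the derivative of that root: the field with components \<open>F1\<close> and
   \<open>F2\<close> is curl free almost everywhere.\<close>
 have curl: "AE z in Leb. z \<in> ?O -->
 - 1 * (v z * (?k z * wd ?O ey rh z) + sqrt (rh z) * wd ?O ey v z) + 0 * (v z * (?k z * wd ?O ey rh z) + sqrt (rh z) * wd ?O ey v z)
 = U z * (?k z * wd ?O ex rh z) + sqrt (rh z) * wd ?O ex U z"
 proof -
 have "AE z in Leb. z \<in> ?O --> U z * wd ?O ex rh z + v z * wd ?O ey rh z = 0 & wd ?O ex U z + wd ?O ey v z = 0"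
 using vp' unfolding AE_lebesgue_on_open_iff[OF oO] by (elim conjE) (erule AE_mp, simp)
 thus ?thesis
 proof eventually_elim
 case (elim z)
 show ?case
 proof
 assume "z \<in> ?O"
 hence e: "U z * wd ?O ex rh z + v z * wd ?O ey rh z = 0" "wd ?O ex U z + wd ?O ey v z = 0" using elim by auto
 have "?k z * (U z * wd ?O ex rh z + v z * wd ?O ey rh z) + sqrt (rh z) * (wd ?O ex U z + wd ?O ey v z) = 0" unfolding e by simp
 thus "- 1 * (v z * (?k z * wd ?O ey rh z) + sqrt (rh z) * wd ?O ey v z) + 0 * (v z * (?k z * wd ?O ey rh z) + sqrt (rh z) * wd ?O ey v z)
 = U z * (?k z * wd ?O ex rh z) + sqrt (rh z) * wd ?O ex U z"
 by (simp add: distrib_left mult_ac)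
 qed
 qed
 qed
 have F1c: "cts (closure ?O) F1" and F2c: "cts (closure ?O) F2" using hF1 hF2 by (auto simp: holder_def)
 have w1: "wder ?O ey F1 (%z. - 1 * (v z * (?k z * wd ?O ey rh z) + sqrt (rh z) * wd ?O ey v z) + 0 * (v z * (?k z * wd ?O ey rh z) + sqrt (rh z) * wd ?O ey v z))"
 using WF1 by (simp add: W1r_def)
 have w2: "wder ?O ex F2 (%z. U z * (?k z * wd ?O ex rh z) + sqrt (rh z) * wd ?O ex U z)" using WF2 by (simp add: W1r_def)
 have bot: "F1 (x, - d) = 0" for x using vp' by (simp add: F1_def)
 have top: "F1 (x, et x) + F2 (x, et x) * deriv et x = 0" for x using vp' by (simp add: F1_def F2_def)
 obtain ps c where ps: "cts (closure ?O) ps" "\<forall>z\<in>?O. (ps has_derivative (%(s, t). F1 z * s + F2 z * t)) (at z)" "\<forall>x. ps (x, et x) = 0" "\<forall>x. ps (x, - d) = c"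
 using stream_function_exists[OF eta per_W2_C1(1,2)[OF per] F1c F2c B2' w1 w2 curl bot top] by blast
 define u where "u = (SUP z\<in>?O. U z)"
 have u: "u < 0" using vp' by (simp add: u_def)
 have U_le: "U z <= u" if "z \<in> ?O" for z unfolding u_def
 by (rule cSUP_upper[OF that]) (use BU O_cl in "auto intro!: bdd_aboveI[of _ BU] simp: abs_le_iff")
 have F2_le: "F2 z <= - (sqrt rh0 * - u)" if "z \<in> ?O" for z
 proof -
 have "sqrt rh0 * - u <= sqrt (rh z) * - U z"
 by (rule mult_mono) (use rh_ge[OF O_cl[OF that]] U_le[OF that] u pos(2) in auto)
 thus ?thesis by (simp add: F2_def)
 qed
 have cpos: "0 < sqrt rh0 * - u" by (rule mult_pos_pos) (use u pos(2) in auto)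
 have "ps (0, et 0) < ps (0, - d)"
 proof (rule DERIV_neg_imp_decreasing_open[OF eta2])
 fix t assume t: "- d < t" "t < et 0"
 hence O: "(0, t) \<in> ?O" by (simp add: mem_fluid)
 have D: "(ps has_derivative (%(s, t'). F1 (0, t) * s + F2 (0, t) * t')) (at (0, t))" using ps(2) O by blast
 have "ps differentiable (at (0, t))" using D by (auto simp: differentiable_def)
 from C1_on_lines(2)[OF this] have "((%t. ps (0, t)) has_real_derivative F2 (0, t)) (at t)" using pd_eqI[OF D, of ey] by simp
 moreover have "F2 (0, t) < 0" using F2_le[OF O] cpos by linarith
 ultimately show "\<exists>D. ((%t. ps (0, t)) has_real_derivative D) (at t) & D < 0" by blast
 next
 show "cts {- d..et 0} (%t. ps (0, t))"
 by (rule continuous_on_compose2[OF ps(1)]) (auto intro!: continuous_intros simp: cl)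
 qed
 hence c: "0 < c" using ps(3,4) by simp
 define p0 where "p0 = - c"
 have p0: "p0 < 0" using c by (simp add: p0_def)
 have "\<exists>h hq hp m M. hodo d p0 m M et ps h hq hp"
 proof (rule hodo_of_psi[OF p0 eta ps(1) _ _ _ F1c _ F2c _ cpos F2_le, where B = "max B1 B2"])
 show "ps (x, et x) = 0" "ps (x, - d) = - p0" for x using ps(3,4) by (auto simp: p0_def)
 show "(ps has_derivative (%(s, t). F1 z * s + F2 z * t)) (at z)" if "z \<in> ?O" for z using ps(2) that by blast
 show "abs (F1 z) <= max B1 B2" "abs (F2 z) <= max B1 B2" if "z \<in> closure ?O" for z
 using B1 B2 that by (simp_all add: max.coboundedI1 max.coboundedI2)
 qed
 then obtain h hq hp m M where hd: "hodo d p0 m M et ps h hq hp" by blast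
 then interpret hodo d p0 m M et ps h hq hp .
 have pxy: "psx z = F1 z & psy z = F2 z" if z: "z \<in> OM" for z
 proof -
 have D: "(ps has_derivative (%(s, t). F1 z * s + F2 z * t)) (at z)" using ps(2) z by blast
 show ?thesis using pd_eqI[OF D, of ex] pd_eqI[OF D, of ey] pd_psi[OF z] by simp
 qed
 have px: "psx z - F1 z = 0" and py: "psy z - F2 z = 0" if z: "z \<in> closure OM" for z
 by (rule continuous_constant_on_closure[of OM "%z. psx z - F1 z"]; (intro continuous_on_diff psx_cont F1c z | simp add: pxy))
 (rule continuous_constant_on_closure[of OM "%z. psy z - F2 z"]; (intro continuous_on_diff psy_cont F2c z | simp add: pxy))
 have px': "psx z = - (sqrt (rh z) * v z)" and py': "psy z = sqrt (rh z) * U z" if "z \<in> closure OM" for z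
 using px[OF that] py[OF that] by (simp_all add: F1_def F2_def)
 have hpx: "holder al OM psx" by (rule holder_cong[OF hF1]) (use px in simp)
 have hpy: "holder al OM psy" by (rule holder_cong[OF hF2]) (use py in simp)
 obtain R be where R: "velocity_to_stream g d U v P rh et p0 R be ps" "stream_class d l r al p0 R be ps et" "stream_problem g d \<sigma> rh0 l p0 R be ps et"
 using stream_of_velocity[OF pos l r al vc vp px' py' hpx hpy] by blast
 have "cts S (%w. energy g U v P rh (G w))"
 proof (rule continuous_on_compose2[OF _ continuous_on_subset[OF G_cont clS_open(1)]])
 show "cts (closure OM) (energy g U v P rh)" unfolding energy_def[abs_def]
 using hU hv hP hrh by (intro continuous_intros) (auto simp: holder_def)
 show "G ` S \<subseteq> closure OM" using G_cl S_cl by blast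
 qed
 hence "cts S (energy g U v P rh \<circ> inv_hodograph d et ps)"
 by (rule continuous_on_eq) (simp add: inv_hodograph S_cl)
 note uq = velocity_to_stream_unique[OF eta p0 R(1) _ this]
 show ?thesis
 by (rule exI[of _ p0], rule exI[of _ R], rule exI[of _ be], rule exI[of _ ps]) (intro conjI[OF p0] conjI[OF R(1)] conjI[OF R(2)] conjI[OF R(3)] allI impI, rule uq)
qed

theorem theorem2p1:
  fixes g d \<rho>0 \<sigma> l r \<alpha> :: real
  assumes "0 < g" and "0 < d" and "0 < \<rho>0" and "0 < \<sigma>" and "0 < l"
    and "1 \<le> r" and "\<alpha> = (r - 1) / r"
  shows
    "(\<forall>U v P \<rho> \<eta>.
        velocity_class d l r \<alpha> U v P \<rho> \<eta> \<and> velocity_problem g d \<sigma> \<rho>0 l U v P \<rho> \<eta> \<longrightarrow>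
        (\<exists>p0 R \<beta> \<psi>.
           p0 < 0 \<and> velocity_to_stream g d U v P \<rho> \<eta> p0 R \<beta> \<psi> \<and>
           stream_class d l r \<alpha> p0 R \<beta> \<psi> \<eta> \<and> stream_problem g d \<sigma> \<rho>0 l p0 R \<beta> \<psi> \<eta> \<and>
           (\<forall>p1 R1 \<beta>1 \<psi>1.
              velocity_to_stream g d U v P \<rho> \<eta> p1 R1 \<beta>1 \<psi>1 \<longrightarrow>
              p1 = p0 \<and> (\<forall>z\<in>closure (fluid d \<eta>). \<psi>1 z = \<psi> z) \<and> (\<forall>p\<in>{p0..0}. R1 p = R p) \<and>
              (AE p in lebesgue_on {p0<..<0}. \<beta>1 p = \<beta> p))))
     \<and>
     (\<forall>p0 R \<beta> \<psi> \<eta>.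
        p0 < 0 \<and> stream_class d l r \<alpha> p0 R \<beta> \<psi> \<eta> \<and> stream_problem g d \<sigma> \<rho>0 l p0 R \<beta> \<psi> \<eta> \<longrightarrow>
        (\<exists>h. stream_to_height d p0 \<psi> \<eta> h \<and>
             height_class l r \<alpha> p0 R \<beta> h \<and> height_problem g d \<sigma> \<rho>0 l p0 R \<beta> h \<and>
             (\<forall>h1. stream_to_height d p0 \<psi> \<eta> h1 \<longrightarrow> (\<forall>w\<in>closure (strip p0). h1 w = h w))))
     \<and>
     (\<forall>p0 R \<beta> h.
        p0 < 0 \<and> height_class l r \<alpha> p0 R \<beta> h \<and> height_problem g d \<sigma> \<rho>0 l p0 R \<beta> h \<longrightarrow>
        (\<exists>U v P \<rho> \<eta> \<psi>.
           velocity_class d l r \<alpha> U v P \<rho> \<eta> \<and> velocity_problem g d \<sigma> \<rho>0 l U v P \<rho> \<eta> \<and>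
           velocity_to_stream g d U v P \<rho> \<eta> p0 R \<beta> \<psi> \<and>
           stream_class d l r \<alpha> p0 R \<beta> \<psi> \<eta> \<and> stream_problem g d \<sigma> \<rho>0 l p0 R \<beta> \<psi> \<eta> \<and>
           stream_to_height d p0 \<psi> \<eta> h))"
proof (intro conjI allI impI; elim conjE)
 fix U v P \<rho> \<eta>
 assume "velocity_class d l r \<alpha> U v P \<rho> \<eta>" "velocity_problem g d \<sigma> \<rho>0 l U v P \<rho> \<eta>"
 from velocity_to_stream_formulation[OF assms(1,3,4,5,6,7) this]
 show "\<exists>p0 R \<beta> \<psi>. p0 < 0 \<and> velocity_to_stream g d U v P \<rho> \<eta> p0 R \<beta> \<psi> \<and>
   stream_class d l r \<alpha> p0 R \<beta> \<psi> \<eta> \<and> stream_problem g d \<sigma> \<rho>0 l p0 R \<beta> \<psi> \<eta> \<and>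
   (\<forall>p1 R1 \<beta>1 \<psi>1. velocity_to_stream g d U v P \<rho> \<eta> p1 R1 \<beta>1 \<psi>1 -->
    p1 = p0 \<and> (\<forall>z\<in>closure (fluid d \<eta>). \<psi>1 z = \<psi> z) \<and> (\<forall>p\<in>{p0..0}. R1 p = R p) \<and> (AE p in lebesgue_on {p0<..<0}. \<beta>1 p = \<beta> p))" .
next
 fix p0 R \<beta> \<psi> \<eta>
 assume "p0 < 0" "stream_class d l r \<alpha> p0 R \<beta> \<psi> \<eta>" "stream_problem g d \<sigma> \<rho>0 l p0 R \<beta> \<psi> \<eta>"
 from stream_to_height_formulation[OF assms(5,6,7) this]
 show "\<exists>h. stream_to_height d p0 \<psi> \<eta> h \<and> height_class l r \<alpha> p0 R \<beta> h \<and> height_problem g d \<sigma> \<rho>0 l p0 R \<beta> h \<and>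
  (\<forall>h1. stream_to_height d p0 \<psi> \<eta> h1 --> (\<forall>w\<in>closure (strip p0). h1 w = h w))" .
next
 fix p0 R \<beta> h
 assume "p0 < 0" "height_class l r \<alpha> p0 R \<beta> h" "height_problem g d \<sigma> \<rho>0 l p0 R \<beta> h"
 from height_to_velocity_formulation[OF assms(1,3,4,5,6,7) this]
 show "\<exists>U v P \<rho> \<eta> \<psi>. velocity_class d l r \<alpha> U v P \<rho> \<eta> \<and> velocity_problem g d \<sigma> \<rho>0 l U v P \<rho> \<eta> \<and>
  velocity_to_stream g d U v P \<rho> \<eta> p0 R \<beta> \<psi> \<and> stream_class d l r \<alpha> p0 R \<beta> \<psi> \<eta> \<and>
  stream_problem g d \<sigma> \<rho>0 l p0 R \<beta> \<psi> \<eta> \<and> stream_to_height d p0 \<psi> \<eta> h" .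
qed

end
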